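(* Let $n\ge 2$, let $k,l$ be real numbers, and let $K$ be a compactly supported function on $\mathbb{R}^n=\mathbb{R}^{n-1}\times\mathbb{R}$, smooth away from the origin, with $K(x)=E_k(x)H_l(x)$ for small $x\neq 0$, where $E_k$ is homogeneous of degree $-k$ in the isotropic sense and $H_l$ is homogeneous of degree $-l$ in the non-isotropic sense, both smooth away from the origin. (A) Assume $k+l=n+1$, $l>2$, and that $K_h(x)=E_k(x',0)H_l(x',x_n)$ has mean value zero on the unit sphere $|x|_h=1$. Then for each $0<\alpha<1$ there is a constant $C$ such that $$\|T^h(f)\|_{{\rm Lip}^\alpha_h}\le C\|f\|_{{\rm Lip}^\alpha_h}\quad\text{for all } f\in{\rm Lip}^\alpha_h,$$ and for each $\alpha=(\alpha_1,\alpha_2)$ with $0<\alpha_1,\alpha_2<1$ there is a constant $C$ such that $$\|T^h(f)\|_{{\rm Lip}^\alpha_{\rm com}}\le C\|f\|_{{\rm Lip}^\alpha_{\rm com}}\quad\text{for all } f\in{\rm Lip}^\alpha_{\rm com}.$$ (B) Assume instead $k+\frac12l=n$, $l<2$, and that $K_e(x)=E_k(x',x_n)H_l(0,x_n)$ has mean value zero on the unit sphere $|x|_e=1$. Then for each $0<\alpha<1$ there is a constant $C$ such that $$\|T^e(f)\|_{{\rm Lip}^\alpha_e}\le C\|f\|_{{\rm Lip}^\alpha_e}\quad\text{for all } f\in{\rm Lip}^\alpha_e,$$ and for each $\alpha=(\alpha_1,\alpha_2)$ with $0<\alpha_1,\alpha_2<1$ there is a constant $C$ such that $$\|T^e(f)\|_{{\rm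 Lip}^\alpha_{\rm com}}\le C\|f\|_{{\rm Lip}^\alpha_{\rm com}}\quad\text{for all } f\in{\rm Lip}^\alpha_{\rm com}.$$
   Context: Write $x=(x',x_n)\in\mathbb{R}^{n-1}\times\mathbb{R}$. The isotropic dilations are $\delta_e(x',x_n)=(\delta x',\delta x_n)$ and the non-isotropic ones are $\delta_h(x',x_n)=(\delta x',\delta^2x_n)$, $\delta>0$. Put $|x|_e=(|x'|^2+|x_n|^2)^{1/2}$ and $|x|_h=(|x'|^2+|x_n|)^{1/2}$. $E_k$ homogeneous of degree $-k$ in the isotropic sense means $\delta^kE_k(\delta_e x)=E_k(x)$; $H_l$ homogeneous of degree $-l$ in the non-isotropic sense means $\delta^lH_l(\delta_hx)=H_l(x)$. "For small $x$" means for $0<|x|_e<r_0$ for some $r_0>0$. Mean value zero on $|x|_h=1$ (resp. $|x|_e=1$) is with respect to the measure on that sphere coming from polar coordinates for the corresponding dilations ($dx=r^{n}\,dr\,d\sigma_h$, resp. $dx=r^{n-1}\,dr\,d\sigma_e$); in case (A) it is equivalent to $\int_{a<|x|_h<b}K_h(x)\,dx=0$ for all $0<a<b$, and in case (B) to $\int_{a<|x|_e<b}K_e(x)\,dx=0$ for all $0<a<b$. In case (A), $T^h$ is the $L^2(\mathbb{R}^n)$-bounded operator $T^h(f)=\lim_{\varepsilon\to0^+}T^h_\varepsilon f$ (limit in $L^2$), $T^h_\varepsilon f(x)=\int_{|y|_h\ge\varepsilon}K(y)f(x-y)\,dy$. In case (B), $T^e(f)=\lim_{\varepsilon\to0^+}T^e_\varepsilon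 f$ (limit in $L^2$), $T^e_\varepsilon f(x)=\int_{|y|_e\ge\varepsilon}K(y)f(x-y)\,dy$. Lipschitz spaces: let $\Delta_uf(x)=f(x-u)-f(x)$. For $0<\alpha<1$, ${\rm Lip}^\alpha_e$ (resp. ${\rm Lip}^\alpha_h$) is the space of continuous $f$ on $\mathbb{R}^n$ with $\|f\|_{{\rm Lip}^\alpha_e}=\sup_{u\ne0}\|\Delta_uf\|_\infty/|u|_e^\alpha<\infty$ (resp. $\|f\|_{{\rm Lip}^\alpha_h}=\sup_{v\ne0}\|\Delta_vf\|_\infty/|v|_h^\alpha<\infty$). For $\alpha=(\alpha_1,\alpha_2)$, $0<\alpha_1,\alpha_2<1$, ${\rm Lip}^\alpha_{\rm com}$ is the space of continuous $f$ on $\mathbb{R}^n$ with $$\|f\|_{{\rm Lip}^\alpha_{\rm com}}=\sup_{u,v\neq0}\frac{\|\Delta_u\Delta_vf\|_\infty}{|u|_e^{\alpha_1}|v|_h^{\alpha_2}}<\infty.$$ Elements of these spaces are regarded modulo polynomials, as elements of $\mathcal S'/\mathcal P$. The operators are extended from $L^2\cap{\rm Lip}$ to ${\rm Lip}$ (where ${\rm Lip}$ is any one of the three spaces) as follows: each $f\in{\rm Lip}$ is the limit in the distribution sense of a sequence $f_m\in L^2\cap{\rm Lip}$ with $\|f_m\|_{\rm Lip}\le C\|f\|_{\rm Lip}$ ($C$ independent of $f$ and $m$), and $T(f):=\lim_{m\to\infty}T(f_m)$ in the distribution sense. *)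

theory Defs
  imports "HOL-Analysis.Analysis"
begin

section \<open>Dilations, homogeneous norms and polar measures\<close>

text \<open>The space \<open>\<real>\<^sup>n = \<real>\<^sup>n\<^sup>-\<^sup>1 \<times> \<real>\<close> is the product type \<^typ>\<open>(real ^ 'm) \<times> real\<close>, so that
  \<open>n = CARD('m) + 1 \<ge> 2\<close>. The isotropic length \<open>|x|\<^sub>e\<close> is the library norm of this type
  (see \<open>norm_Pair\<close>).\<close>

type_synonym 'm pt = "(real ^ 'm) \<times> real"

definition dil_e :: "real \<Rightarrow> 'm::finite pt \<Rightarrow> 'm pt" where
  "dil_e \<delta> x = (\<delta> *\<^sub>R fst x, \<delta> * snd x)"

definition dil_h :: "real \<Rightarrow> 'm::finite pt \<Rightarrow> 'm pt" where
  "dil_h \<delta> x = (\<delta> *\<^sub>R fst x, \<delta>\<^sup>2 * snd x)"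

definition norm_h :: "'m::finite pt \<Rightarrow> real" where
  "norm_h x = sqrt ((norm (fst x))\<^sup>2 + \<bar>snd x\<bar>)"

text \<open>Homogeneity is only required away from the origin; the value at the origin is irrelevant
  throughout.\<close>

definition homogeneous ::
  "(real \<Rightarrow> 'm::finite pt \<Rightarrow> 'm pt) \<Rightarrow> real \<Rightarrow> ('m pt \<Rightarrow> complex) \<Rightarrow> bool" where
  "homogeneous dil k E \<longleftrightarrow>
     (\<forall>\<delta>>0. \<forall>x. x \<noteq> 0 \<longrightarrow> (\<delta> powr k) *\<^sub>R E (dil \<delta> x) = E x)"

text \<open>Let the dilations \<open>dil\<close> scale volume by \<open>\<delta>\<^sup>Q\<close> and let \<open>\<rho>\<close> be a length with
  \<open>\<rho> (dil \<delta> x) = \<delta> * \<rho> x\<close>. The polar coordinate formula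
  \<open>dx = r\<^sup>Q\<^sup>-\<^sup>1 dr d\<sigma>\<close> determines \<open>\<sigma>\<close> on the unit sphere \<open>\<rho> = 1\<close>: the cone over \<open>A\<close> inside the unit
  ball has volume \<open>\<sigma>(A) * (\<integral> r\<^sup>Q\<^sup>-\<^sup>1 dr over 0 < r < 1) = \<sigma>(A) / Q\<close>. Hence \<open>\<sigma>\<close> is \<open>Q\<close> times the
  image of Lebesgue measure on the punctured unit ball under \<open>x \<mapsto> dil (1 / \<rho> x) x\<close>; it is
  regarded as a measure on the whole space, carried by the sphere.\<close>

definition polar_measure ::
  "(real \<Rightarrow> 'm::finite pt \<Rightarrow> 'm pt) \<Rightarrow> ('m pt \<Rightarrow> real) \<Rightarrow> real \<Rightarrow> 'm pt measure" where
  "polar_measure dil \<rho> Q =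
     scale_measure (ennreal Q)
       (distr (restrict_space lborel {x. 0 < \<rho> x \<and> \<rho> x < 1}) borel (\<lambda>x. dil (1 / \<rho> x) x))"

definition sphere_measure_e :: "'m::finite pt measure" where
  "sphere_measure_e = polar_measure dil_e norm (real CARD('m) + 1)"

definition sphere_measure_h :: "'m::finite pt measure" where
  "sphere_measure_h = polar_measure dil_h norm_h (real CARD('m) + 2)"

definition mean_zero :: "'v measure \<Rightarrow> ('v \<Rightarrow> complex) \<Rightarrow> bool" where
  "mean_zero \<sigma> f \<longleftrightarrow> has_bochner_integral \<sigma> f 0"


section \<open>Smooth functions, test functions, convergence modulo polynomials\<close>

primrec iter_deriv ::
  "'v::euclidean_space list \<Rightarrow> ('v \<Rightarrow> complex) \<Rightarrow> 'v \<Rightarrow> complex" where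
  "iter_deriv [] f = f"
| "iter_deriv (v # vs) f = (\<lambda>x. frechet_derivative (iter_deriv vs f) (at x) v)"

text \<open>Meant for open \<open>S\<close>. Continuity of all derivatives follows from their differentiability.\<close>

definition smooth_on :: "'v::euclidean_space set \<Rightarrow> ('v \<Rightarrow> complex) \<Rightarrow> bool" where
  "smooth_on S f \<longleftrightarrow> (\<forall>vs. \<forall>x\<in>S. iter_deriv vs f differentiable (at x))"

definition schwartz :: "('v::euclidean_space \<Rightarrow> complex) set" where
  "schwartz = {\<phi>. smooth_on UNIV \<phi> \<and>
     (\<forall>vs N. \<exists>B. \<forall>x. (1 + norm x) ^ N * norm (iter_deriv vs \<phi> x) \<le> B)}"

text \<open>\<open>\<S>'/\<P>\<close> is the dual of the space of Schwartz functions all of whose moments vanish.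
  Accordingly, convergence in the distribution sense modulo polynomials is convergence of the
  pairings with these test functions.\<close>

definition schwartz0 :: "('v::euclidean_space \<Rightarrow> complex) set" where
  "schwartz0 = {\<phi> \<in> schwartz.
     \<forall>p. real_polynomial_function p \<longrightarrow> (LINT x|lborel. p x *\<^sub>R \<phi> x) = 0}"

definition lim_mod_poly ::
  "(nat \<Rightarrow> 'v::euclidean_space \<Rightarrow> complex) \<Rightarrow> ('v \<Rightarrow> complex) \<Rightarrow> bool" where
  "lim_mod_poly fs g \<longleftrightarrow>
     (\<forall>\<phi>\<in>schwartz0.
        (\<lambda>m. LINT x|lborel. fs m x * \<phi> x) \<longlonglongrightarrow> (LINT x|lborel. g x * \<phi> x))"


section \<open>Singular integrals on \<open>L\<^sup>2\<close>\<close>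

definition L2 :: "('v::euclidean_space \<Rightarrow> complex) set" where
  "L2 = {f \<in> borel_measurable lborel. (\<integral>\<^sup>+x. ennreal ((norm (f x))\<^sup>2) \<partial>lborel) < \<infinity>}"

definition trunc_op ::
  "('v::euclidean_space \<Rightarrow> real) \<Rightarrow> ('v \<Rightarrow> complex) \<Rightarrow> real \<Rightarrow> ('v \<Rightarrow> complex) \<Rightarrow> 'v \<Rightarrow> complex" where
  "trunc_op \<rho> K \<epsilon> f x = (LINT y:{y. \<rho> y \<ge> \<epsilon>}|lborel. K y * f (x - y))"

text \<open>The limit in \<open>L\<^sup>2\<close> is unique up to a null set; \<open>pv_op\<close> picks a representative. If the
  limit did not exist, nothing could be proved about the value.\<close>

definition pv_limit ::
  "('v::euclidean_space \<Rightarrow> real) \<Rightarrow> ('v \<Rightarrow> complex) \<Rightarrow> ('v \<Rightarrow> complex) \<Rightarrow> ('v \<Rightarrow> complex) \<Rightarrow> bool" where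
  "pv_limit \<rho> K f g \<longleftrightarrow> g \<in> L2 \<and>
     ((\<lambda>\<epsilon>. \<integral>\<^sup>+x. ennreal ((norm (trunc_op \<rho> K \<epsilon> f x - g x))\<^sup>2) \<partial>lborel) \<longlongrightarrow> 0) (at_right 0)"

definition pv_op ::
  "('v::euclidean_space \<Rightarrow> real) \<Rightarrow> ('v \<Rightarrow> complex) \<Rightarrow> ('v \<Rightarrow> complex) \<Rightarrow> 'v \<Rightarrow> complex" where
  "pv_op \<rho> K f = (SOME g. pv_limit \<rho> K f g)"


section \<open>Lipschitz spaces\<close>

definition diff_op :: "'v::euclidean_space \<Rightarrow> ('v \<Rightarrow> complex) \<Rightarrow> 'v \<Rightarrow> complex" where
  "diff_op u f = (\<lambda>x. f (x - u) - f x)"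

text \<open>All functions concerned are continuous, so the \<open>L\<^sup>\<infinity>\<close> norm is the supremum.\<close>

definition sup_norm :: "('v \<Rightarrow> complex) \<Rightarrow> ennreal" where
  "sup_norm f = (SUP x. ennreal (norm (f x)))"

definition lip_norm_e :: "real \<Rightarrow> ('m::finite pt \<Rightarrow> complex) \<Rightarrow> ennreal" where
  "lip_norm_e \<alpha> f = (SUP u\<in>-{0}. sup_norm (diff_op u f) / ennreal (norm u powr \<alpha>))"

definition lip_norm_h :: "real \<Rightarrow> ('m::finite pt \<Rightarrow> complex) \<Rightarrow> ennreal" where
  "lip_norm_h \<alpha> f = (SUP v\<in>-{0}. sup_norm (diff_op v f) / ennreal (norm_h v powr \<alpha>))"

definition lip_norm_com :: "real \<Rightarrow> real \<Rightarrow> ('m::finite pt \<Rightarrow> complex) \<Rightarrow> ennreal" where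
  "lip_norm_com \<alpha>1 \<alpha>2 f =
     (SUP u\<in>-{0}. SUP v\<in>-{0}.
        sup_norm (diff_op u (diff_op v f)) / ennreal (norm u powr \<alpha>1 * norm_h v powr \<alpha>2))"

text \<open>In the following, \<open>N\<close> is one of the three seminorms above.\<close>

definition lip_space ::
  "(('v::euclidean_space \<Rightarrow> complex) \<Rightarrow> ennreal) \<Rightarrow> ('v \<Rightarrow> complex) set" where
  "lip_space N = {f. continuous_on UNIV f \<and> N f < \<infinity>}"

definition lip_approx ::
  "(('v::euclidean_space \<Rightarrow> complex) \<Rightarrow> ennreal) \<Rightarrow> real \<Rightarrow> ('v \<Rightarrow> complex) \<Rightarrow>
     (nat \<Rightarrow> 'v \<Rightarrow> complex) \<Rightarrow> bool" where
  "lip_approx N B f fs \<longleftrightarrow>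
     (\<forall>m. fs m \<in> L2 \<inter> lip_space N \<and> N (fs m) \<le> ennreal B * N f) \<and> lim_mod_poly fs f"

text \<open>The function \<open>g\<close> represents the class of \<open>T f\<close> modulo polynomials: an admissible
  approximating sequence exists (with the constant \<open>B\<close>), and \<open>T\<close> maps every admissible sequence,
  with whatever constant, to a sequence tending to \<open>g\<close>.\<close>

definition lip_extension ::
  "(('v::euclidean_space \<Rightarrow> complex) \<Rightarrow> ennreal) \<Rightarrow> (('v \<Rightarrow> complex) \<Rightarrow> 'v \<Rightarrow> complex) \<Rightarrow>
     real \<Rightarrow> ('v \<Rightarrow> complex) \<Rightarrow> ('v \<Rightarrow> complex) \<Rightarrow> bool" where
  "lip_extension N T B f g \<longleftrightarrow>
     (\<exists>fs. lip_approx N B f fs) \<and>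
     (\<forall>B' fs. lip_approx N B' f fs \<longrightarrow> lim_mod_poly (\<lambda>m. T (fs m)) g)"

text \<open>The extension of \<open>T\<close> is well defined on the whole Lipschitz space, with one constant \<open>B\<close> in
  the approximation for all \<open>f\<close>, and it is bounded there with constant \<open>C\<close>.\<close>

definition bounded_on_lip ::
  "(('v::euclidean_space \<Rightarrow> complex) \<Rightarrow> ennreal) \<Rightarrow> (('v \<Rightarrow> complex) \<Rightarrow> 'v \<Rightarrow> complex) \<Rightarrow> bool" where
  "bounded_on_lip N T \<longleftrightarrow>
     (\<exists>B C :: real. \<forall>f\<in>lip_space N. \<exists>g\<in>lip_space N.
        lip_extension N T B f g \<and> N g \<le> ennreal C * N f)"

end

theory Submission
  imports Defs
begin

text \<open>In both cases \<open>K\<close> is singular with respect to one family of dilations only, with length \<open>\<rho>\<close>.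
  Replacing the factor that is homogeneous for the other family by its values on a coordinate
  subspace gives the homogeneous mean-zero kernel \<open>K\<^sub>h\<close> (resp. \<open>K\<^sub>e\<close>) near the origin; the conditions
  \<open>l > 2\<close> (resp. \<open>l < 2\<close>) say that the singularity of the frozen factor is integrable across the
  complementary directions, so the error is integrable. It follows that \<open>K\<close> satisfies size and
  cancellation conditions and that \<open>\<integral> |K(y - u) - K(y)| dy\<close> over \<open>r \<le> \<rho>(y) < 2r\<close> is at most
  \<open>A (\<rho>(u) / r)\<^sup>\<gamma>\<close> for \<open>2 \<rho>(u) \<le> r\<close>. Nothing else about \<open>K\<close> is used.

  For Hoelder functions the operator is \<open>T f(x) = \<integral> K(y) (f(x - y) - f(x)) dy + c f(x)\<close>. It is bounded
  for small exponents by splitting the integral, and for all exponents below 1 because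
  \<open>\<Delta>\<^sub>u f\<close> has a smaller exponent with a small constant and \<open>T\<close> commutes with \<open>\<Delta>\<^sub>u\<close>. The same commutation
  gives the composite spaces: \<open>\<Delta>\<^sub>u f\<close> is Hoelder for \<open>\<rho>\<close>, with constant controlled by the other length of
  \<open>u\<close>. The truncated operators are uniformly bounded on \<open>L\<^sup>2\<close> by the Lax-Krein argument, so the
  principal value exists; it agrees with this formula, and the limits modulo polynomials follow by
  moving \<open>T\<close> to the test function, where vanishing moments are preserved. An approximating sequence in a composite space is obtained from a tent
  convolution: the high-frequency part is bounded and can be cut off, and the low-frequency part is
  nearly additive, hence close to an affine function.\<close>

section \<open>Translations, reflections and dyadic decompositions\<close>

text \<open>On an annulus of \<rho> the kernel has no uniform pointwise bound of the homogeneous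
  size: near the subspace where the other factor is singular it can be much larger. So every
  condition on the kernel is an integral over annuli. Such conditions yield a Hoelder bound for
  small exponents directly, and the remaining estimates are drawn from it, including the one on L2,
  where the Lax-Krein argument replaces Fourier transforms and almost orthogonality. Cases (A) and
  (B) exchange the roles of the two lengths, which is why lengths are abstract. An admissible
  sequence for the extension converges only against test functions with vanishing moments, so
  independence of the sequence has to come from duality. In a composite space two more obstacles
  arise: functions may grow, and the seminorm sees only second differences, so that a plain cut-off
  of f creates terms with f and with its first differences that nothing controls. Subtracting local
  averages twice makes these terms bounded.\<close>

abbreviation l1_on :: "'v::euclidean_space set \<Rightarrow> ('v \<Rightarrow> complex) \<Rightarrow> ennreal" where
  "l1_on S f \<equiv> \<integral>\<^sup>+x\<in>S. ennreal (norm (f x)) \<partial>lborel"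

lemma distr_lborel_diff:
  fixes a :: "'v::euclidean_space"
  shows "distr lborel borel (\<lambda>y. a - y) = lborel" by (subst (2) lborel_affine[of "-1" a], auto simp: density_1)

lemma distr_lborel_shift:
  fixes a :: "'v::euclidean_space"
  shows "distr lborel borel (\<lambda>y. y - a) = lborel"
proof -
  have "(\<lambda>y. y - a) = (+) (- a)" by auto
  then show ?thesis using lborel_distr_plus[of "- a"] by simp
qed

lemma nn_integral_lborel_diff:
  fixes a :: "'v::euclidean_space"
  assumes [measurable]: "f \<in> borel_measurable borel"
  shows "(\<integral>\<^sup>+y. f (a - y) \<partial>lborel) = (\<integral>\<^sup>+y. f y \<partial>lborel)" by (subst (2) distr_lborel_diff[of a, symmetric], subst nn_integral_distr) auto

lemma nn_integral_lborel_shift: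
  fixes a :: "'v::euclidean_space"
  assumes [measurable]: "f \<in> borel_measurable borel"
  shows "(\<integral>\<^sup>+y. f (y - a) \<partial>lborel) = (\<integral>\<^sup>+y. f y \<partial>lborel)" by (subst (2) distr_lborel_shift[of a, symmetric], subst nn_integral_distr) auto

lemma integrable_lborel_diff:
  fixes a :: "'v::euclidean_space" and f :: "'v \<Rightarrow> 'b::{banach, second_countable_topology}"
  assumes f: "integrable lborel f"
  shows "integrable lborel (\<lambda>y. f (a - y))"
  using f by (subst (asm) distr_lborel_diff[of a, symmetric], subst (asm) integrable_distr_eq) auto

lemma integrable_lborel_shift:
  fixes a :: "'v::euclidean_space" and f :: "'v \<Rightarrow> 'b::{banach, second_countable_topology}"
  assumes f: "integrable lborel f"
  shows "integrable lborel (\<lambda>y. f (y - a))"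
  using f by (subst (asm) distr_lborel_shift[of a, symmetric], subst (asm) integrable_distr_eq) auto

lemma integral_lborel_diff:
  fixes a :: "'v::euclidean_space" and f :: "'v \<Rightarrow> 'b::{banach, second_countable_topology}"
  assumes [measurable]: "f \<in> borel_measurable borel"
  shows "(LINT y|lborel. f (a - y)) = (LINT y|lborel. f y)" by (subst (2) distr_lborel_diff[of a, symmetric], subst integral_distr) auto

lemma integral_lborel_shift:
  fixes a :: "'v::euclidean_space" and f :: "'v \<Rightarrow> 'b::{banach, second_countable_topology}"
  assumes [measurable]: "f \<in> borel_measurable borel"
  shows "(LINT y|lborel. f (y - a)) = (LINT y|lborel. f y)" by (subst (2) distr_lborel_shift[of a, symmetric], subst integral_distr) auto

lemma integrable_bounded_nn:
  fixes f :: "'a \<Rightarrow> 'b::{banach, second_countable_topology}"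
  assumes "f \<in> borel_measurable M" and "(\<integral>\<^sup>+x. ennreal (norm (f x)) \<partial>M) \<le> ennreal B"
  shows "integrable M f" using assms by (simp add: integrable_iff_bounded le_less_trans)

lemma norm_integral_bounded_nn:
  fixes f :: "'a \<Rightarrow> 'b::{banach, second_countable_topology}"
  assumes "(\<integral>\<^sup>+x. ennreal (norm (f x)) \<partial>M) \<le> ennreal B" and "0 \<le> B"
  shows "norm (\<integral>x. f x \<partial>M) \<le> B"
proof (cases "integrable M f")
  case True
  then have "ennreal (norm (\<integral>x. f x \<partial>M)) \<le> ennreal B" by (rule order_trans[OF integral_norm_bound_ennreal assms(1)])
  with assms(2) show ?thesis by simp
next
  case False
  with assms(2) show ?thesis by (simp add: not_integrable_integral_eq)
qed

lemma suminf_geometric_le: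
  assumes "\<And>j. a j \<le> ennreal (C * q ^ j)" and "0 \<le> C" and "0 \<le> q" and "q < 1"
  shows "(\<Sum>j. a j) \<le> ennreal (C / (1 - q))"
proof -
  have s: "(\<lambda>j. C * q ^ j) sums (C * (1 / (1 - q)))" using assms by (intro sums_mult geometric_sums) auto
  have "(\<Sum>j. a j) \<le> (\<Sum>j. ennreal (C * q ^ j))" using assms(1) by (intro suminf_le) auto
  also have "... = ennreal (\<Sum>j. C * q ^ j)" using assms s by (intro suminf_ennreal2) (auto simp: sums_iff)
  also have "... = ennreal (C / (1 - q))" using s by (simp add: sums_iff)
  finally show ?thesis .
qed

lemma nn_integral_countable_cover:
  fixes f :: "'a \<Rightarrow> ennreal"
  assumes [measurable]: "f \<in> borel_measurable M" "\<And>j::nat. B j \<in> sets M" and "A \<subseteq> (\<Union>j. B j)"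
  shows "(\<integral>\<^sup>+x\<in>A. f x \<partial>M) \<le> (\<Sum>j. \<integral>\<^sup>+x\<in>B j. f x \<partial>M)"
proof -
  have "(\<integral>\<^sup>+x\<in>A. f x \<partial>M) \<le> (\<integral>\<^sup>+x. (\<Sum>j. f x * indicator (B j) x) \<partial>M)"
  proof (rule nn_integral_mono)
    fix x
    show "f x * indicator A x \<le> (\<Sum>j. f x * indicator (B j) x)"
    proof (cases "x \<in> A")
      case True
      then obtain j where "x \<in> B j" using assms(3) by auto
      then have "f x * indicator A x \<le> (\<Sum>j\<in>{j}. f x * indicator (B j) x)" using True by simp
      also have "... \<le> (\<Sum>j. f x * indicator (B j) x)" by (intro sum_le_suminf) auto
      finally show ?thesis .
    qed simp
  qed
  also have "... = (\<Sum>j. \<integral>\<^sup>+x\<in>B j. f x \<partial>M)" by (intro nn_integral_suminf) auto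
  finally show ?thesis .
qed

lemma set_nn_integral_le_const:
  assumes "A \<in> sets M" "\<And>x. x \<in> A \<Longrightarrow> f x \<le> c"
  shows "(\<integral>\<^sup>+x\<in>A. f x \<partial>M) \<le> c * emeasure M A"
proof -
  have "(\<integral>\<^sup>+x\<in>A. f x \<partial>M) \<le> (\<integral>\<^sup>+x. c * indicator A x \<partial>M)" using assms(2) by (intro nn_integral_mono) (auto simp: indicator_def)
  then show ?thesis using assms(1) by (simp add: nn_integral_cmult_indicator)
qed

lemma emeasure_norm_less:
  assumes "0 \<le> r"
  shows "emeasure lborel {x::'v::euclidean_space. norm x < r} = ennreal (r ^ DIM('v) * measure lborel (ball (0::'v) 1))"
proof -
  have "{x::'v. norm x < r} = ball 0 r" by auto
  moreover have "emeasure lborel (ball (0::'v) r) = ennreal (measure lborel (ball (0::'v) r))"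
    using emeasure_lborel_ball_finite[of "0::'v" r] by (intro emeasure_eq_ennreal_measure) simp
  ultimately show ?thesis using content_ball_conv_unit_ball[of r "0::'v"] assms by simp
qed

lemma one_div_2_powr_less: "0 < b \<Longrightarrow> 1 / 2 powr b < (1::real)" by (simp add: divide_less_eq)

lemma power_powr_commute: "0 \<le> x \<Longrightarrow> (x ^ j) powr b = (x powr b) ^ (j::nat)" for x :: real by (induction j) (auto simp: powr_mult)

lemma dyadic_above:
  fixes s t :: real
  assumes "0 < s" "s \<le> t"
  obtains j :: nat where "2 ^ j * s \<le> t" "t < 2 * (2 ^ j * s)"
proof -
  have "\<exists>n::nat. t / s < 2 ^ n" using real_arch_pow[of 2 "t / s"] by simp
  define n where "n = (LEAST n::nat. t / s < 2 ^ n)"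
  have n: "t / s < 2 ^ n" unfolding n_def by (rule LeastI_ex) fact
  have "n \<noteq> 0" using n assms by (auto intro!: gr0I simp: divide_less_eq)
  then obtain j where j: "n = Suc j" by (cases n) auto
  have "\<not> t / s < 2 ^ j" using not_less_Least[of j "\<lambda>n. t / s < 2 ^ n"] j n_def by auto
  with n j assms show ?thesis by (intro that[of j]) (auto simp: field_simps)
qed

lemma dyadic_below:
  fixes s t :: real
  assumes "0 < t" "t < s"
  obtains j :: nat where "s / 2 ^ Suc j \<le> t" "t < 2 * (s / 2 ^ Suc j)"
proof -
  have "\<exists>n::nat. s / t \<le> 2 ^ n" using real_arch_pow[of 2 "s / t"] by (auto intro: less_imp_le)
  define n where "n = (LEAST n::nat. s / t \<le> 2 ^ n)"
  have n: "s / t \<le> 2 ^ n" unfolding n_def by (rule LeastI_ex) fact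
  have "n \<noteq> 0" using n assms by (auto intro!: gr0I simp: divide_le_eq)
  then obtain j where j: "n = Suc j" by (cases n) auto
  have "\<not> s / t \<le> 2 ^ j" using not_less_Least[of j "\<lambda>n. s / t \<le> 2 ^ n"] j n_def by auto
  with n j assms show ?thesis by (intro that[of j]) (auto simp: field_simps)
qed


section \<open>Length functions\<close>

text \<open>Shared by the isotropic and the non-isotropic length, so dilations are absent here. The
  comparisons \<open>norm_le\<close> and \<open>le_norm\<close> with the Euclidean norm make
  \<rho>-balls compact and turn powers of \<rho> into polynomial growth; the square in
  \<open>norm_le\<close> is forced by the last coordinate in \<open>norm_h\<close>. The axiom
  \<open>star\<close> lets the mean value inequality run along segments inside
  \<rho>-annuli.\<close>

locale length_function =
  fixes \<rho> :: "'v::euclidean_space \<Rightarrow> real"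
  assumes continuous: "continuous_on UNIV \<rho>"
    and eq_0_iff: "\<rho> x = 0 \<longleftrightarrow> x = 0"
    and minus: "\<rho> (- x) = \<rho> x"
    and triangle: "\<rho> (x + y) \<le> \<rho> x + \<rho> y"
    and norm_le: "norm x \<le> \<rho> x + (\<rho> x)\<^sup>2"
    and le_norm: "\<rho> x \<le> 1 + norm x"
    and star: "0 \<le> t \<Longrightarrow> t \<le> 1 \<Longrightarrow> \<rho> (t *\<^sub>R x) \<le> \<rho> x"
begin

lemma nonneg [simp]: "0 \<le> \<rho> x" using triangle[of x "- x"] eq_0_iff[of 0] by (simp add: minus)

lemma zero [simp]: "\<rho> 0 = 0" by (simp add: eq_0_iff)

lemma pos_iff: "0 < \<rho> x \<longleftrightarrow> x \<noteq> 0" using eq_0_iff[of x] nonneg[of x] by linarith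

lemma measurable [measurable]: "\<rho> \<in> borel_measurable borel" using continuous by (rule borel_measurable_continuous_onI)

lemma triangle_diff: "\<rho> (x - y) \<le> \<rho> x + \<rho> y" using triangle[of x "- y"] by (simp add: minus)

lemma diff_ge: "\<rho> x - \<rho> y \<le> \<rho> (x - y)" using triangle[of "x - y" y] by simp

lemma compact_cball: "compact {y. \<rho> y \<le> s}"
proof -
  have "closed {y. \<rho> y \<le> s}" using continuous by (intro closed_Collect_le) auto
  moreover have "bounded {y. \<rho> y \<le> s}"
  proof (rule boundedI)
    fix y assume "y \<in> {y. \<rho> y \<le> s}"
    then have "\<rho> y \<le> s" by simp
    then have "\<rho> y + (\<rho> y)\<^sup>2 \<le> s + s\<^sup>2" by (intro add_mono power_mono) auto
    with norm_le[of y] show "norm y \<le> s + s\<^sup>2" by linarith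
  qed
  ultimately show ?thesis by (simp add: compact_eq_bounded_closed)
qed

lemma bounded_on_cball:
  fixes f :: "'v \<Rightarrow> complex"
  assumes "continuous_on UNIV f"
  obtains B where "0 \<le> B" "\<And>y. \<rho> y \<le> s \<Longrightarrow> norm (f y) \<le> B"
proof -
  have "compact (f ` {y. \<rho> y \<le> s})" using compact_cball assms by (intro compact_continuous_image) (auto intro: continuous_on_subset)
  then obtain B where "\<forall>z\<in>f ` {y. \<rho> y \<le> s}. norm z \<le> B" using compact_imp_bounded bounded_iff by metis
  then show ?thesis by (intro that[of "max 0 B"]) force+
qed

lemma bounded_translates:
  fixes f :: "'v \<Rightarrow> complex"
  assumes "continuous_on UNIV f"
  obtains B where "0 \<le> B" "\<And>y. \<rho> y \<le> s \<Longrightarrow> norm (f (x - y)) \<le> B"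
proof -
  have "continuous_on UNIV (\<lambda>y. f (x - y))" by (intro continuous_on_compose2[OF assms] continuous_intros) auto
  then show ?thesis using bounded_on_cball that by blast
qed

lemma scale_pow: "\<rho> ((2 ^ j) *\<^sub>R u) \<le> 2 ^ j * \<rho> u"
proof (induction j)
  case (Suc j)
  have "(2 ^ Suc j) *\<^sub>R u = (2 ^ j) *\<^sub>R u + (2 ^ j) *\<^sub>R u" by (simp add: scaleR_2 flip: scaleR_scaleR)
  then have "\<rho> ((2 ^ Suc j) *\<^sub>R u) \<le> \<rho> ((2 ^ j) *\<^sub>R u) + \<rho> ((2 ^ j) *\<^sub>R u)" by (metis triangle)
  with Suc show ?case by simp
qed simp

lemma emeasure_ball_finite: "emeasure lborel {y. \<rho> y < s} < \<infinity>"
proof -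
  have "emeasure lborel {y. \<rho> y < s} \<le> emeasure lborel {y. \<rho> y \<le> s}" by (intro emeasure_mono) auto
  also have "... < \<infinity>" using compact_cball by (rule emeasure_compact_finite)
  finally show ?thesis .
qed

text \<open>The annular bound is phrased with the outer radius 2r, so the outermost annulus, with 2r
  = s, contributes at most \<open>B * s powr \<gamma>\<close> and the others follow the geometric
  series of ratio \<open>1 / 2 powr \<gamma>\<close>.\<close>

lemma nn_integral_dyadic_below:
  assumes [measurable]: "f \<in> borel_measurable borel" and s: "0 < s" and \<gamma>: "0 < \<gamma>" and B: "0 \<le> B"
    and ann: "\<And>r. 0 < r \<Longrightarrow> 2 * r \<le> s \<Longrightarrow>
      (\<integral>\<^sup>+y\<in>{y. r \<le> \<rho> y \<and> \<rho> y < 2 * r}. f y \<partial>lborel) \<le> ennreal (B * (2 * r) powr \<gamma>)"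
  shows "(\<integral>\<^sup>+y\<in>{y. 0 < \<rho> y \<and> \<rho> y < s}. f y \<partial>lborel) \<le> ennreal (B * s powr \<gamma> / (1 - 1 / 2 powr \<gamma>))"
proof -
  let ?S = "\<lambda>j. {y. s / 2 ^ Suc j \<le> \<rho> y \<and> \<rho> y < 2 * (s / 2 ^ Suc j)}"
  have "(\<integral>\<^sup>+y\<in>{y. 0 < \<rho> y \<and> \<rho> y < s}. f y \<partial>lborel) \<le> (\<Sum>j. \<integral>\<^sup>+y\<in>?S j. f y \<partial>lborel)"
  proof (rule nn_integral_countable_cover)
    show "{y. 0 < \<rho> y \<and> \<rho> y < s} \<subseteq> (\<Union>j. ?S j)" using dyadic_below[of "\<rho> _" s] by blast
  qed simp_all
  also have "... \<le> ennreal (B * s powr \<gamma> / (1 - 1 / 2 powr \<gamma>))"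
  proof (rule suminf_geometric_le)
    fix j :: nat
    have "(\<integral>\<^sup>+y\<in>?S j. f y \<partial>lborel) \<le> ennreal (B * (2 * (s / 2 ^ Suc j)) powr \<gamma>)"
      using s one_le_power[of "2 :: real" j] by (intro ann) (auto simp: divide_le_eq)
    also have "B * (2 * (s / 2 ^ Suc j)) powr \<gamma> = B * s powr \<gamma> * (1 / 2 powr \<gamma>) ^ j"
      using s by (simp add: powr_divide power_powr_commute power_one_over)
    finally show "(\<integral>\<^sup>+y\<in>?S j. f y \<partial>lborel) \<le> ennreal (B * s powr \<gamma> * (1 / 2 powr \<gamma>) ^ j)" .
  qed (use B one_div_2_powr_less[OF \<gamma>] in auto)
  finally show ?thesis .
qed

lemma nn_integral_dyadic_above:
  assumes [measurable]: "f \<in> borel_measurable borel" and s: "0 < s" and \<gamma>: "0 < \<gamma>" and B: "0 \<le> B"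
    and ann: "\<And>r. s \<le> r \<Longrightarrow>
      (\<integral>\<^sup>+y\<in>{y. r \<le> \<rho> y \<and> \<rho> y < 2 * r}. f y \<partial>lborel) \<le> ennreal (B * r powr (- \<gamma>))"
  shows "(\<integral>\<^sup>+y\<in>{y. s \<le> \<rho> y}. f y \<partial>lborel) \<le> ennreal (B * s powr (- \<gamma>) / (1 - 1 / 2 powr \<gamma>))"
proof -
  let ?S = "\<lambda>j. {y. 2 ^ j * s \<le> \<rho> y \<and> \<rho> y < 2 * (2 ^ j * s)}"
  have "(\<integral>\<^sup>+y\<in>{y. s \<le> \<rho> y}. f y \<partial>lborel) \<le> (\<Sum>j. \<integral>\<^sup>+y\<in>?S j. f y \<partial>lborel)"
  proof (rule nn_integral_countable_cover)
    show "{y. s \<le> \<rho> y} \<subseteq> (\<Union>j. ?S j)" using dyadic_above[OF s, of "\<rho> _"] by blast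
  qed simp_all
  also have "... \<le> ennreal (B * s powr (- \<gamma>) / (1 - 1 / 2 powr \<gamma>))"
  proof (rule suminf_geometric_le)
    fix j :: nat
    have "1 * s \<le> 2 ^ j * s" using s by (intro mult_right_mono one_le_power) auto
    then have "(\<integral>\<^sup>+y\<in>?S j. f y \<partial>lborel) \<le> ennreal (B * (2 ^ j * s) powr (- \<gamma>))" by (intro ann) simp
    also have "B * (2 ^ j * s) powr (- \<gamma>) = B * s powr (- \<gamma>) * (1 / 2 powr \<gamma>) ^ j"
      using s by (simp add: powr_mult power_powr_commute powr_minus power_one_over inverse_eq_divide)
    finally show "(\<integral>\<^sup>+y\<in>?S j. f y \<partial>lborel) \<le> ennreal (B * s powr (- \<gamma>) * (1 / 2 powr \<gamma>) ^ j)" .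
  qed (use B one_div_2_powr_less[OF \<gamma>] in auto)
  finally show ?thesis .
qed

end


section \<open>Singular integral operators on Hoelder functions\<close>

text \<open>Meant with \<open>c\<close> the limit of the integrals of \<open>K\<close> over \<rho> y
  \<ge> r as r tends to 0; it is then the principal value, with f(x) subtracted to make the integral
  absolutely convergent. For \<open>K\<close> of compact support it also makes sense for growing
  \<open>f\<close>, and it represents the extended operator throughout.\<close>

definition cz_op ::
  "('v::euclidean_space \<Rightarrow> complex) \<Rightarrow> complex \<Rightarrow> ('v \<Rightarrow> complex) \<Rightarrow> 'v \<Rightarrow> complex" where
  "cz_op K c f x = (LINT y|lborel. K y * (f (x - y) - f x)) + c * f x"

definition truncated ::
  "('v::euclidean_space \<Rightarrow> real) \<Rightarrow> ('v \<Rightarrow> complex) \<Rightarrow> real \<Rightarrow> 'v \<Rightarrow> complex" where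
  "truncated \<rho> K r = (\<lambda>y. if r \<le> \<rho> y then K y else 0)"

definition conv ::
  "('v::euclidean_space \<Rightarrow> complex) \<Rightarrow> ('v \<Rightarrow> complex) \<Rightarrow> 'v \<Rightarrow> complex" where
  "conv k f x = (LINT y|lborel. k y * f (x - y))"

lemma trunc_op_eq_conv: "trunc_op \<rho> K e f = conv (truncated \<rho> K e) f"
  unfolding trunc_op_def conv_def truncated_def set_lebesgue_integral_def
  by (intro ext Bochner_Integration.integral_cong) (auto simp: indicator_def)

text \<open>The summands are the shares in \<open>cz_op_hoelder_small\<close>. The first is the
  region \<rho> y < \<rho> u, with the constant 2 of \<open>diff_op u f\<close>. The last is the
  dyadic sum over \<rho> y \<ge> 2 \<rho> u, convergent since b < \<delta>. The 8 is 6 from the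
  three annuli at the scale \<rho> u where the truncation jumps, and 1 each from the truncated
  integral and from \<open>c\<close>.\<close>

definition lip_factor :: "real \<Rightarrow> real \<Rightarrow> real" where
  "lip_factor b \<delta> = 2 / (1 - 1 / 2 powr b) + 8 + 4 / (1 - 1 / 2 powr (\<delta> - b))"

lemma lip_factor_ge: "0 < b \<Longrightarrow> b < \<delta> \<Longrightarrow> 8 \<le> lip_factor b \<delta>"
proof -
  assume "0 < b" "b < \<delta>"
  then have "0 < 2 / (1 - 1 / 2 powr b)" "0 < 4 / (1 - 1 / 2 powr (\<delta> - b))"
    using one_div_2_powr_less[of b] one_div_2_powr_less[of "\<delta> - b"] by simp_all
  then show ?thesis unfolding lip_factor_def by linarith
qed

text \<open>Calderon-Zygmund conditions in integrated form. \<open>regular\<close> is asked only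
  where both \<open>y\<close> and \<open>y - u\<close> stay away from the origin, and its exponent
  \<delta> limits the Hoelder exponents that can be treated directly. \<open>tendsto\<close> is
  listed besides \<open>cancellation\<close> because bounded truncated integrals need not
  converge.\<close>

locale cz_kernel = length_function \<rho> for \<rho> :: "'v::euclidean_space \<Rightarrow> real" +
  fixes K :: "'v \<Rightarrow> complex" and A R \<delta> :: real and c :: complex
  assumes K_measurable [measurable]: "K \<in> borel_measurable borel"
    and A_nonneg: "0 \<le> A" and R_pos: "0 < R" and delta: "0 < \<delta>" "\<delta> \<le> 1"
    and support: "R \<le> \<rho> y \<Longrightarrow> K y = 0"
    and size: "0 < r \<Longrightarrow> l1_on {y. r \<le> \<rho> y \<and> \<rho> y < 2 * r} K \<le> ennreal A"
    and cancellation: "0 < r \<Longrightarrow> norm (LINT y|lborel. truncated \<rho> K r y) \<le> A"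
    and tendsto: "((\<lambda>r. LINT y|lborel. truncated \<rho> K r y) \<longlongrightarrow> c) (at_right 0)"
    and regular: "0 < r \<Longrightarrow> 2 * \<rho> u \<le> r \<Longrightarrow>
      l1_on {y. r \<le> \<rho> y \<and> \<rho> y < 2 * r} (\<lambda>y. K (y - u) - K y)
        \<le> ennreal (A * (\<rho> u / r) powr \<delta>)"
begin

lemma norm_c_le: "norm c \<le> A"
proof (rule tendsto_upperbound)
  show "((\<lambda>r. norm (LINT y|lborel. truncated \<rho> K r y)) \<longlongrightarrow> norm c) (at_right 0)" using tendsto by (rule tendsto_norm)
  show "\<forall>\<^sub>F r in at_right 0. norm (LINT y|lborel. truncated \<rho> K r y) \<le> A"
    using cancellation by (auto simp: eventually_at_right_field intro!: exI[of _ 1])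
qed simp

text \<open>The condition \<open>size\<close> gives the same bound on every annulus, so the integral
  of |K| alone may diverge logarithmically; any positive power of \<rho> restores a geometric
  series.\<close>

lemma power_integral:
  assumes b: "0 < b" and s: "0 < s"
  shows "(\<integral>\<^sup>+y\<in>{y. \<rho> y < s}. ennreal (norm (K y) * \<rho> y powr b) \<partial>lborel) \<le> ennreal (A * s powr b / (1 - 1 / 2 powr b))"
proof -
  let ?f = "\<lambda>y. ennreal (norm (K y) * \<rho> y powr b)"
  have "(\<integral>\<^sup>+y\<in>{y. \<rho> y < s}. ?f y \<partial>lborel) = (\<integral>\<^sup>+y\<in>{y. 0 < \<rho> y \<and> \<rho> y < s}. ?f y \<partial>lborel)"
    by (intro nn_integral_cong) (auto simp: indicator_def pos_iff)
  also have "... \<le> ennreal (A * s powr b / (1 - 1 / 2 powr b))"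
  proof (rule nn_integral_dyadic_below[OF _ s b A_nonneg])
    fix r :: real assume r: "0 < r"
    let ?D = "{y. r \<le> \<rho> y \<and> \<rho> y < 2 * r}"
    have "(\<integral>\<^sup>+y\<in>?D. ?f y \<partial>lborel) \<le> (\<integral>\<^sup>+y. ennreal ((2 * r) powr b) * (ennreal (norm (K y)) * indicator ?D y) \<partial>lborel)"
      using b by (intro nn_integral_mono)
        (auto simp: indicator_def ennreal_mult'[symmetric] mult.commute intro!: ennreal_leI mult_left_mono powr_mono2)
    also have "... = ennreal ((2 * r) powr b) * l1_on ?D K" by (intro nn_integral_cmult) measurable
    also have "... \<le> ennreal ((2 * r) powr b) * ennreal A" using size[OF r] by (intro mult_left_mono) auto
    also have "... = ennreal (A * (2 * r) powr b)" using A_nonneg by (simp add: mult.commute flip: ennreal_mult)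
    finally show "(\<integral>\<^sup>+y\<in>?D. ?f y \<partial>lborel) \<le> ennreal (A * (2 * r) powr b)" .
  qed measurable
  finally show ?thesis .
qed

lemma nn_integral_K_Hoelder:
  assumes b: "0 < b" and s: "0 < s" and L: "0 \<le> L" and [measurable]: "g \<in> borel_measurable borel"
    and g: "\<And>y. \<rho> y < s \<Longrightarrow> norm (g y :: complex) \<le> L * \<rho> y powr b"
  shows "l1_on {y. \<rho> y < s} (\<lambda>y. K y * g y) \<le> ennreal (L * A * s powr b / (1 - 1 / 2 powr b))"
proof -
  have "l1_on {y. \<rho> y < s} (\<lambda>y. K y * g y) \<le> (\<integral>\<^sup>+y. ennreal L * (ennreal (norm (K y) * \<rho> y powr b) * indicator {y. \<rho> y < s} y) \<partial>lborel)"
  proof (rule nn_integral_mono)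
    fix y
    show "ennreal (norm (K y * g y)) * indicator {y. \<rho> y < s} y
      \<le> ennreal L * (ennreal (norm (K y) * \<rho> y powr b) * indicator {y. \<rho> y < s} y)"
      using mult_left_mono[OF g[of y], of "norm (K y)"] L
      by (auto simp: indicator_def norm_mult ennreal_mult'[symmetric] mult_ac intro!: ennreal_leI)
  qed
  also have "... = ennreal L * (\<integral>\<^sup>+y\<in>{y. \<rho> y < s}. ennreal (norm (K y) * \<rho> y powr b) \<partial>lborel)" by (intro nn_integral_cmult) measurable
  also have "... \<le> ennreal L * ennreal (A * s powr b / (1 - 1 / 2 powr b))" using power_integral[OF b s] by (intro mult_left_mono) auto
  also have "... = ennreal (L * A * s powr b / (1 - 1 / 2 powr b))" using L by (simp add: ennreal_mult'[symmetric] mult.assoc)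
  finally show ?thesis .
qed

lemma
  assumes b: "0 < b" and L: "0 \<le> L" and [measurable]: "g \<in> borel_measurable borel"
    and g: "\<And>y. \<rho> y < R \<Longrightarrow> norm (g y :: complex) \<le> L * \<rho> y powr b"
  shows integrable_K_Hoelder: "integrable lborel (\<lambda>y. K y * g y)"
    and norm_integral_K_Hoelder:
      "norm (LINT y|lborel. K y * g y) \<le> L * A * R powr b / (1 - 1 / 2 powr b)"
proof -
  have "(\<integral>\<^sup>+y. ennreal (norm (K y * g y)) \<partial>lborel) = l1_on {y. \<rho> y < R} (\<lambda>y. K y * g y)"
    using support by (intro nn_integral_cong) (auto simp: indicator_def not_less)
  then have *: "(\<integral>\<^sup>+y. ennreal (norm (K y * g y)) \<partial>lborel) \<le> ennreal (L * A * R powr b / (1 - 1 / 2 powr b))"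
    using nn_integral_K_Hoelder[OF b R_pos L _ g] by simp
  show "integrable lborel (\<lambda>y. K y * g y)" using * by (intro integrable_bounded_nn) measurable
  show "norm (LINT y|lborel. K y * g y) \<le> L * A * R powr b / (1 - 1 / 2 powr b)"
    using * L A_nonneg one_div_2_powr_less[OF b] by (intro norm_integral_bounded_nn) auto
qed

lemma truncated_measurable [measurable]: "truncated \<rho> K r \<in> borel_measurable borel" unfolding truncated_def by measurable

lemma truncated_support: "R \<le> \<rho> y \<Longrightarrow> truncated \<rho> K r y = 0" by (simp add: truncated_def support)

lemma integrable_truncated:
  assumes r: "0 < r" shows "integrable lborel (truncated \<rho> K r)"
proof -
  let ?g = "\<lambda>y. if r \<le> \<rho> y then 1 else 0 :: complex"
  \<comment> \<open>The indicator of \<rho> y \<ge> r is at most \<rho> y / r, hence counts as a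
    Hoelder factor of exponent 1 with constant 1 / r.\<close>
  have "integrable lborel (\<lambda>y. K y * ?g y)" using r by (intro integrable_K_Hoelder[of 1 "1 / r"]) auto
  also have "(\<lambda>y. K y * ?g y) = truncated \<rho> K r" by (auto simp: truncated_def)
  finally show ?thesis .
qed

end

context length_function begin

lemma integrable_conv:
  fixes f :: "'v \<Rightarrow> complex"
  assumes k: "integrable lborel k" "\<And>y. R \<le> \<rho> y \<Longrightarrow> k y = 0" and f: "continuous_on UNIV f"
  shows "integrable lborel (\<lambda>y. k y * f (x - y))"
proof -
  obtain B where B: "0 \<le> B" "\<And>y. \<rho> y \<le> R \<Longrightarrow> norm (f (x - y)) \<le> B" using bounded_translates[OF f] by metis
  have [measurable]: "f \<in> borel_measurable borel" "k \<in> borel_measurable borel" using f k by (auto intro: borel_measurable_continuous_onI)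
  show ?thesis
  proof (rule Bochner_Integration.integrable_bound)
    show "integrable lborel (\<lambda>y. B * norm (k y))" using k by auto
    have "norm (k y * f (x - y)) \<le> norm (B * norm (k y))" for y
      using B k(2)[of y] mult_right_mono[of "norm (f (x - y))" B "norm (k y)"] by (cases "\<rho> y \<le> R") (auto simp: norm_mult mult.commute)
    then show "AE y in lborel. norm (k y * f (x - y)) \<le> norm (B * norm (k y))" by simp
  qed measurable
qed

end

section \<open>Hoelder classes and Marchaud's inequality\<close>

context length_function begin

definition hoelder :: "real \<Rightarrow> real \<Rightarrow> ('v \<Rightarrow> complex) \<Rightarrow> bool" where
  "hoelder b L f \<longleftrightarrow> (\<forall>x u. norm (f (x - u) - f x) \<le> L * \<rho> u powr b)"

lemma hoelderD: "hoelder b L f \<Longrightarrow> norm (f (x - u) - f x) \<le> L * \<rho> u powr b" by (simp add: hoelder_def)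

lemma hoelder_nonneg: assumes "hoelder \<beta> L f" shows "0 \<le> L"
proof -
  obtain b :: 'v where "b \<in> Basis" using nonempty_Basis by blast
  then have b: "0 < \<rho> b" using nonzero_Basis by (simp add: pos_iff)
  have "0 \<le> L * \<rho> b powr \<beta>" using hoelderD[OF assms, of 0 b] norm_ge_zero order_trans by blast
  with b show ?thesis by (simp add: zero_le_mult_iff)
qed

lemma hoelder_continuous:
  assumes "hoelder b L f" "0 < b" shows "continuous_on UNIV f"
proof -
  have "isCont f x" for x
  proof -
    have "isCont \<rho> 0" using continuous by (simp add: continuous_on_eq_continuous_at)
    then have "((\<lambda>h. \<rho> h) \<longlongrightarrow> 0) (at 0)" by (simp add: isCont_def)
    then have "((\<lambda>h. L * \<rho> h powr b) \<longlongrightarrow> 0) (at 0)" using assms(2) by (intro tendsto_eq_intros) auto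
    moreover have "norm (f (x + h) - f x) \<le> L * \<rho> h powr b" for h using hoelderD[OF assms(1), of x "- h"] by (simp add: minus)
    ultimately have "((\<lambda>h. f (x + h) - f x) \<longlongrightarrow> 0) (at 0)" by (intro Lim_null_comparison[of "\<lambda>h. f (x + h) - f x"]) auto
    then show ?thesis by (simp add: isCont_iff LIM_zero_iff)
  qed
  then show ?thesis by (simp add: continuous_at_imp_continuous_on)
qed

text \<open>The second difference is at most 2L times \<open>\<rho> u powr a\<close> and, by
  commuting the differences, at most 2L times \<open>\<rho> v powr a\<close>. The smaller of these
  powers is at most \<open>\<rho> u powr (a - b) * \<rho> v powr b\<close>, which trades exponent in
  \<open>v\<close> for a power of \<rho> u in the constant.\<close>

lemma hoelder_diff_op:
  assumes f: "hoelder a L f" and b: "0 \<le> b" "b \<le> a"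
  shows "hoelder b (2 * L * \<rho> u powr (a - b)) (diff_op u f)" unfolding hoelder_def
proof (intro allI)
  fix x v
  have L: "0 \<le> L" using hoelder_nonneg[OF f] .
  let ?n = "norm (diff_op u f (x - v) - diff_op u f x)"
  have 1: "?n \<le> 2 * L * \<rho> u powr a" using hoelderD[OF f, of "x - v" u] hoelderD[OF f, of x u]
      norm_triangle_ineq4[of "f (x - v - u) - f (x - v)" "f (x - u) - f x"] by (simp add: diff_op_def)
  have "f (x - v - u) - f (x - v) - (f (x - u) - f x) = (f (x - u - v) - f (x - u)) - (f (x - v) - f x)"
  proof -
    have "x - v - u = x - u - v" by (simp add: algebra_simps)
    from arg_cong[OF this, of f] show ?thesis by simp
  qed
  then have "?n = norm ((f (x - u - v) - f (x - u)) - (f (x - v) - f x))" by (simp only: diff_op_def)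
  then have 2: "?n \<le> 2 * L * \<rho> v powr a" using hoelderD[OF f, of "x - u" v] hoelderD[OF f, of x v]
      norm_triangle_ineq4[of "f (x - u - v) - f (x - u)" "f (x - v) - f x"] by linarith
  show "?n \<le> 2 * L * \<rho> u powr (a - b) * \<rho> v powr b"
  proof (cases "\<rho> u \<le> \<rho> v")
    case True
    have "\<rho> u powr a = \<rho> u powr (a - b) * \<rho> u powr b" by (simp flip: powr_add)
    also have "... \<le> \<rho> u powr (a - b) * \<rho> v powr b" using True b by (intro mult_left_mono powr_mono2) auto
    finally have "2 * L * \<rho> u powr a \<le> 2 * L * (\<rho> u powr (a - b) * \<rho> v powr b)" using L by (intro mult_left_mono) auto
    with 1 show ?thesis by (simp add: mult.assoc)
  next
    case False
    have "\<rho> v powr a = \<rho> v powr (a - b) * \<rho> v powr b" by (simp flip: powr_add)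
    also have "... \<le> \<rho> u powr (a - b) * \<rho> v powr b" using False b by (intro mult_right_mono powr_mono2) auto
    finally have "2 * L * \<rho> v powr a \<le> 2 * L * (\<rho> u powr (a - b) * \<rho> v powr b)" using L by (intro mult_left_mono) auto
    with 2 show ?thesis by (simp add: mult.assoc)
  qed
qed

text \<open>A form of Marchaud's inequality: \<open>\<Delta>\<^sub>u g = (\<Delta>\<^sub>2\<^sub>u g - \<Delta>\<^sub>u \<Delta>\<^sub>u g) / 2\<close> is iterated.\<close>

lemma marchaud:
  assumes D: "0 \<le> D" and a: "0 < a" "a < 1"
    and second: "\<And>x u. norm (diff_op u (diff_op u g) x) \<le> D * \<rho> u powr a"
    and growth: "\<And>x u. (\<lambda>j. norm (g (x - (2 ^ j) *\<^sub>R u) - g x) / 2 ^ j) \<longlonglongrightarrow> 0"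
  shows "hoelder a (D / (1 - 2 powr (a - 1))) g" unfolding hoelder_def
proof (intro allI)
  fix x u
  define q :: real where "q = 2 powr (a - 1)"
  have q: "0 < q" "q < 1" using a powr_less_mono[of "a - 1" 0 2] by (auto simp: q_def)
  let ?d = "\<lambda>j. norm (g (x - (2 ^ j) *\<^sub>R u) - g x)"
  have step: "?d j \<le> ?d (Suc j) / 2 + D * \<rho> u powr a * (2 powr a) ^ j" for j
  proof -
    let ?v = "(2 ^ j) *\<^sub>R u"
    have "x - (2 ^ Suc j) *\<^sub>R u = x - ?v - ?v"
    proof -
      have "(2 ^ Suc j) *\<^sub>R u = ?v + ?v" by (simp add: scaleR_2 flip: scaleR_scaleR)
      then show ?thesis by (simp only: diff_diff_eq)
    qed
    then have "2 * (g (x - ?v) - g x) = (g (x - (2 ^ Suc j) *\<^sub>R u) - g x) - diff_op ?v (diff_op ?v g) x"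
      unfolding diff_op_def by (simp only:) simp
    then have "2 * ?d j \<le> ?d (Suc j) + norm (diff_op ?v (diff_op ?v g) x)" using norm_triangle_ineq4 by (metis norm_mult norm_numeral)
    moreover have "norm (diff_op ?v (diff_op ?v g) x) \<le> D * \<rho> u powr a * (2 powr a) ^ j"
    proof -
      have "\<rho> ?v powr a \<le> (2 ^ j * \<rho> u) powr a" using scale_pow a by (intro powr_mono2) auto
      also have "... = \<rho> u powr a * (2 powr a) ^ j" by (simp add: powr_mult power_powr_commute)
      finally have "D * \<rho> ?v powr a \<le> D * (\<rho> u powr a * (2 powr a) ^ j)" using D by (rule mult_left_mono)
      with second[of ?v x] show ?thesis by (simp add: mult.assoc)
    qed
    moreover have "0 \<le> D * \<rho> u powr a * (2 powr a) ^ j" using D by simp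
    ultimately show ?thesis by linarith
  qed
  have q_pow: "(2 powr a) ^ j / 2 ^ j = q ^ j" for j by (simp add: q_def powr_diff power_divide)
  have *: "?d 0 \<le> ?d j / 2 ^ j + D * \<rho> u powr a * (\<Sum>i<j. q ^ i)" for j
  proof (induction j)
    case (Suc j)
    have "?d j / 2 ^ j \<le> (?d (Suc j) / 2 + D * \<rho> u powr a * (2 powr a) ^ j) / 2 ^ j" using step[of j] by (intro divide_right_mono) auto
    also have "... = ?d (Suc j) / 2 ^ Suc j + D * \<rho> u powr a * q ^ j" by (simp add: add_divide_distrib q_pow[symmetric])
    finally show ?case using Suc by (simp add: algebra_simps)
  qed simp
  have sums: "(\<lambda>j. \<Sum>i<j. q ^ i) \<longlonglongrightarrow> 1 / (1 - q)" using geometric_sums[of q] q by (simp add: sums_def)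
  \<comment> \<open>As j tends to infinity, \<open>growth\<close> removes the boundary term; the
    series converges because \<open>2 powr (a - 1)\<close> is below 1, which is where a < 1
    enters.\<close>
  have "?d 0 \<le> 0 + D * \<rho> u powr a * (1 / (1 - q))"
    by (rule tendsto_lowerbound[OF tendsto_add[OF growth[of x u] tendsto_mult[OF tendsto_const sums]]]) (use * in auto)
  then show "norm (g (x - u) - g x) \<le> D / (1 - 2 powr (a - 1)) * \<rho> u powr a" by (simp add: q_def)
qed

end

lemma cz_op_translate: "cz_op K c (\<lambda>x. f (x - u)) x = cz_op K c f (x - u)" by (simp add: cz_op_def algebra_simps)

lemma cz_op_sub:
  assumes "integrable lborel (\<lambda>y. K y * (f (x - y) - f x))"
    and "integrable lborel (\<lambda>y. K y * (g (x - y) - g x))"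
  shows "cz_op K c (\<lambda>x. f x - g x) x = cz_op K c f x - cz_op K c g x"
proof -
  have "(LINT y|lborel. K y * (f (x - y) - g (x - y) - (f x - g x))) = (LINT y|lborel. K y * (f (x - y) - f x) - K y * (g (x - y) - g x))"
    by (intro Bochner_Integration.integral_cong) (auto simp: algebra_simps)
  also have "... = (LINT y|lborel. K y * (f (x - y) - f x)) - (LINT y|lborel. K y * (g (x - y) - g x))"
    using assms by (rule Bochner_Integration.integral_diff)
  finally show ?thesis by (simp add: cz_op_def algebra_simps)
qed

lemma cz_op_diff_op:
  assumes "\<And>x. integrable lborel (\<lambda>y. K y * (f (x - y) - f x))"
  shows "cz_op K c (diff_op u f) = diff_op u (cz_op K c f)"
proof
  fix x
  have "integrable lborel (\<lambda>y. K y * (f (x - y - u) - f (x - u)))" using assms[of "x - u"] by (simp add: algebra_simps)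
  then show "cz_op K c (diff_op u f) x = diff_op u (cz_op K c f) x"
    using cz_op_sub[of K "\<lambda>x. f (x - u)" x f c] assms[of x] by (simp add: diff_op_def cz_op_translate)
qed

section \<open>Hoelder estimates for the singular integral operator\<close>

context cz_kernel begin

text \<open>On the annulus of radius r the weight costs at most \<open>(2 * r) powr b\<close> and
  \<open>regular\<close> gains \<open>(s / r) powr \<delta>\<close>, so the annuli sum because b <
  \<delta>. Starting at 2s ensures 2 \<rho> u \<le> r throughout.\<close>

lemma far_regular:
  assumes b: "0 < b" "b < \<delta>" and s: "0 < s" "\<rho> u \<le> s"
  shows "(\<integral>\<^sup>+y\<in>{y. 2 * s \<le> \<rho> y}. ennreal (norm (K (y - u) - K y) * \<rho> y powr b) \<partial>lborel)
    \<le> ennreal (4 * A * s powr b / (1 - 1 / 2 powr (\<delta> - b)))"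
proof -
  let ?f = "\<lambda>y. ennreal (norm (K (y - u) - K y) * \<rho> y powr b)"
  let ?\<gamma> = "\<delta> - b"
  have "(\<integral>\<^sup>+y\<in>{y. 2 * s \<le> \<rho> y}. ?f y \<partial>lborel) \<le> ennreal (2 * A * s powr \<delta> * (2 * s) powr (- ?\<gamma>) / (1 - 1 / 2 powr ?\<gamma>))"
  proof (rule nn_integral_dyadic_above)
    fix r assume "2 * s \<le> r"
    then have r: "0 < r" "2 * \<rho> u \<le> r" using s by auto
    let ?D = "{y. r \<le> \<rho> y \<and> \<rho> y < 2 * r}"
    have "(\<integral>\<^sup>+y\<in>?D. ?f y \<partial>lborel) \<le> (\<integral>\<^sup>+y. ennreal ((2 * r) powr b) * (ennreal (norm (K (y - u) - K y)) * indicator ?D y) \<partial>lborel)"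
      using b by (intro nn_integral_mono)
        (auto simp: indicator_def ennreal_mult'[symmetric] mult.commute intro!: ennreal_leI mult_right_mono powr_mono2)
    also have "... = ennreal ((2 * r) powr b) * l1_on ?D (\<lambda>y. K (y - u) - K y)" by (intro nn_integral_cmult) measurable
    also have "... \<le> ennreal ((2 * r) powr b) * ennreal (A * (\<rho> u / r) powr \<delta>)" using regular[OF r] by (intro mult_left_mono) auto
    also have "... = ennreal ((2 * r) powr b * (A * (\<rho> u / r) powr \<delta>))" by (simp add: ennreal_mult')
    also have "... \<le> ennreal (2 powr 1 * r powr b * (A * (s powr \<delta> * r powr (- \<delta>))))"
    proof (intro ennreal_leI mult_mono mult_left_mono)
      show "(2 * r) powr b \<le> 2 powr 1 * r powr b"
        using b delta by (simp add: powr_mult mult_right_mono powr_mono[of b 1 "2 :: real", simplified])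
      have "(\<rho> u / r) powr \<delta> \<le> (s / r) powr \<delta>" using s r delta by (intro powr_mono2 divide_right_mono) auto
      then show "(\<rho> u / r) powr \<delta> \<le> s powr \<delta> * r powr (- \<delta>)" by (simp add: powr_divide powr_minus_divide)
    qed (use A_nonneg in auto)
    also have "2 powr 1 * r powr b * (A * (s powr \<delta> * r powr (- \<delta>))) = 2 * A * s powr \<delta> * r powr (- ?\<gamma>)"
      by (simp add: minus_diff_eq powr_diff powr_minus_divide)
    finally show "(\<integral>\<^sup>+y\<in>?D. ?f y \<partial>lborel) \<le> ennreal (2 * A * s powr \<delta> * r powr (- ?\<gamma>))" .
  qed (use s b A_nonneg in auto)
  also have "... \<le> ennreal (4 * A * s powr b / (1 - 1 / 2 powr ?\<gamma>))"
  proof (intro ennreal_leI divide_right_mono)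
    have "(2 * s) powr (- ?\<gamma>) \<le> s powr (- ?\<gamma>)" using s b by (intro powr_mono2') auto
    then have "2 * A * s powr \<delta> * (2 * s) powr (- ?\<gamma>) \<le> 2 * A * s powr \<delta> * s powr (- ?\<gamma>)" using A_nonneg by (intro mult_left_mono) auto
    also have "... \<le> 4 * A * s powr b" using A_nonneg s by (simp add: mult.assoc flip: powr_add)
    finally show "2 * A * s powr \<delta> * (2 * s) powr (- ?\<gamma>) \<le> 4 * A * s powr b" .
  qed (use b in \<open>auto intro: ge_one_powr_ge_zero\<close>)
  finally show ?thesis .
qed

text \<open>Truncating at s = \<rho> u creates a jump, but for \<rho> y \<ge> 2s both
  \<open>y\<close> and \<open>y - u\<close> lie beyond it and \<open>far_regular\<close> applies.
  For \<rho> y < 2s the two terms are estimated separately by \<open>size\<close>: where the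
  truncated kernel is nonzero, \<open>y\<close> lies in one annulus, while \<rho> (y - u) < 3s
  requires two. With \<open>2 powr b\<close> at most 2 these three annuli give the 6.\<close>

lemma truncated_regular:
  assumes b: "0 < b" "b < \<delta>" and s: "0 < s" "\<rho> u = s"
  shows "(\<integral>\<^sup>+y. ennreal (norm (truncated \<rho> K s (y - u) - truncated \<rho> K s y) * \<rho> y powr b) \<partial>lborel)
    \<le> ennreal ((6 + 4 / (1 - 1 / 2 powr (\<delta> - b))) * A * s powr b)"
proof -
  let ?k = "truncated \<rho> K s"
  let ?D = "\<lambda>r. {y. r \<le> \<rho> y \<and> \<rho> y < 2 * r}"
  let ?g = "\<lambda>r y. ennreal (norm (K y)) * indicator (?D r) y"
  let ?h = "\<lambda>y. ennreal (norm (K (y - u) - K y) * \<rho> y powr b) * indicator {y. 2 * s \<le> \<rho> y} y"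
  let ?c = "ennreal ((2 * s) powr b)"
  have pt: "ennreal (norm (?k (y - u) - ?k y) * \<rho> y powr b) \<le> ?h y + (?c * ?g s y + (?c * ?g s (y - u) + ?c * ?g (2 * s) (y - u)))" for y
  proof (cases "2 * s \<le> \<rho> y")
    case True
    then have "s \<le> \<rho> (y - u)" using diff_ge[of y u] s by linarith
    with True s show ?thesis by (auto simp: truncated_def)
  next
    case False
    then have y: "\<rho> y powr b \<le> (2 * s) powr b" using b by (intro powr_mono2) auto
    have "norm (?k (y - u) - ?k y) * \<rho> y powr b \<le> (norm (?k (y - u)) + norm (?k y)) * (2 * s) powr b"
      using y by (intro mult_mono norm_triangle_ineq4) auto
    then have "ennreal (norm (?k (y - u) - ?k y) * \<rho> y powr b) \<le> ?c * ennreal (norm (?k y)) + ?c * ennreal (norm (?k (y - u)))"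
      by (simp add: ennreal_mult'[symmetric] ennreal_plus[symmetric] algebra_simps del: ennreal_plus)
    moreover have "ennreal (norm (?k y)) \<le> ?g s y" using False by (auto simp: truncated_def indicator_def)
    moreover have "ennreal (norm (?k (y - u))) \<le> ?g s (y - u) + ?g (2 * s) (y - u)"
      using False triangle_diff[of y u] s by (auto simp: truncated_def indicator_def)
    ultimately have "ennreal (norm (?k (y - u) - ?k y) * \<rho> y powr b) \<le> ?c * ?g s y + ?c * (?g s (y - u) + ?g (2 * s) (y - u))"
      by (meson add_mono mult_left_mono order_trans zero_le)
    then show ?thesis by (simp add: distrib_left add_increasing)
  qed
  have cg: "(\<integral>\<^sup>+y. ?c * ?g r y \<partial>lborel) \<le> ?c * ennreal A" if "0 < r" for r
    using size[OF that] by (subst nn_integral_cmult) (auto intro!: mult_left_mono)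
  have cgu: "(\<integral>\<^sup>+y. ?c * ?g r (y - u) \<partial>lborel) \<le> ?c * ennreal A" if "0 < r" for r
    using cg[OF that] by (subst nn_integral_lborel_shift[of "\<lambda>y. ?c * ?g r y" u]) auto
  have "(\<integral>\<^sup>+y. ennreal (norm (?k (y - u) - ?k y) * \<rho> y powr b) \<partial>lborel)
      \<le> (\<integral>\<^sup>+y. ?h y + (?c * ?g s y + (?c * ?g s (y - u) + ?c * ?g (2 * s) (y - u))) \<partial>lborel)" using pt by (intro nn_integral_mono)
  also have "... = (\<integral>\<^sup>+y. ?h y \<partial>lborel) + ((\<integral>\<^sup>+y. ?c * ?g s y \<partial>lborel)
      + ((\<integral>\<^sup>+y. ?c * ?g s (y - u) \<partial>lborel) + (\<integral>\<^sup>+y. ?c * ?g (2 * s) (y - u) \<partial>lborel)))" by (simp add: nn_integral_add)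
  also have "... \<le> ennreal (4 * A * s powr b / (1 - 1 / 2 powr (\<delta> - b))) + (?c * ennreal A + (?c * ennreal A + ?c * ennreal A))"
    using s b by (intro add_mono far_regular cg cgu) auto
  also have "... = ennreal (4 * A * s powr b / (1 - 1 / 2 powr (\<delta> - b)) + 3 * ((2 * s) powr b * A))"
  proof -
    have "0 \<le> 4 * A * s powr b / (1 - 1 / 2 powr (\<delta> - b))" "0 \<le> (2 * s) powr b * A"
      using A_nonneg b
      by (auto intro!: divide_nonneg_pos mult_nonneg_nonneg simp only: diff_gt_0_iff_gt one_div_2_powr_less zero_le_numeral powr_ge_zero)
    moreover have "ennreal X + (ennreal Y + (ennreal Y + ennreal Y)) = ennreal (X + 3 * Y)"
      if "0 \<le> X" "0 \<le> Y" for X Y :: real using that by (simp flip: ennreal_plus)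
    ultimately show ?thesis by (simp only: ennreal_mult'[symmetric] powr_ge_zero)
  qed
  also have "... \<le> ennreal ((6 + 4 / (1 - 1 / 2 powr (\<delta> - b))) * A * s powr b)"
  proof (rule ennreal_leI)
    have "2 powr b \<le> (2::real) powr 1" using b delta by (intro powr_mono) auto
    then have "(2 * s) powr b \<le> 2 * s powr b" using s by (simp add: powr_mult)
    then have "(2 * s) powr b * A \<le> 2 * s powr b * A" using A_nonneg by (rule mult_right_mono)
    then show "4 * A * s powr b / (1 - 1 / 2 powr (\<delta> - b)) + 3 * ((2 * s) powr b * A) \<le> (6 + 4 / (1 - 1 / 2 powr (\<delta> - b))) * A * s powr b"
      by (simp add: algebra_simps)
  qed
  finally show ?thesis .
qed

lemma hoelder_integrable:
  assumes "hoelder b L f" "0 < b"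
  shows "integrable lborel (\<lambda>y. K y * (f (x - y) - f x))"
proof -
  have [measurable]: "f \<in> borel_measurable borel" using hoelder_continuous[OF assms] by (rule borel_measurable_continuous_onI)
  show ?thesis using assms hoelderD[OF assms(1)] hoelder_nonneg[OF assms(1)] by (intro integrable_K_Hoelder[of b L]) auto
qed

text \<open>Not scale invariant: the compact support of \<open>K\<close> makes T f - c f bounded on
  the whole space, although \<open>f\<close> itself need not be. This provides the growth condition
  of \<open>marchaud\<close> and the supremum bound on test functions.\<close>

lemma norm_cz_op_sub_le:
  assumes "hoelder b L f" "0 < b"
  shows "norm (cz_op K c f x - c * f x) \<le> L * A * R powr b / (1 - 1 / 2 powr b)"
proof -
  have [measurable]: "f \<in> borel_measurable borel" using hoelder_continuous[OF assms] by (rule borel_measurable_continuous_onI)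
  show ?thesis
    using assms hoelderD[OF assms(1)] hoelder_nonneg[OF assms(1)] by (simp add: cz_op_def) (intro norm_integral_K_Hoelder[of b L]; simp)
qed

text \<open>With g = \<open>diff_op u f\<close> and s = \<rho> u, the integral for T g(x) is split
  at \<rho> y = s. Near the origin the Hoelder bound of g in the variable y beats the singularity.
  Beyond s only the size of g, of order s^b, is small: \<open>cancellation\<close> handles the term
  with g(x), and in the term with g(x - y) the difference is moved from \<open>f\<close> to the
  kernel, so that regularity can be used.\<close>

lemma cz_op_hoelder_small:
  assumes b: "0 < b" "b < \<delta>" and f: "hoelder b L f"
  shows "hoelder b (lip_factor b \<delta> * A * L) (cz_op K c f)" unfolding hoelder_def
proof (intro allI)
  fix x u
  have L: "0 \<le> L" using f by (rule hoelder_nonneg)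
  have f_cont: "continuous_on UNIV f" using f b(1) by (rule hoelder_continuous)
  then have [measurable]: "f \<in> borel_measurable borel" by (rule borel_measurable_continuous_onI)
  show "norm (cz_op K c f (x - u) - cz_op K c f x) \<le> lip_factor b \<delta> * A * L * \<rho> u powr b"
  proof (cases "u = 0")
    case False
    define s where "s = \<rho> u"
    have s: "0 < s" using False by (simp add: s_def pos_iff)
    let ?k = "truncated \<rho> K s"
    let ?n = "\<lambda>y. if \<rho> y < s then K y else 0"
    define g where "g = diff_op u f"
    have g_le: "norm (g z) \<le> L * s powr b" for z using hoelderD[OF f] by (simp add: g_def diff_op_def s_def)
    have g_cont: "continuous_on UNIV g" unfolding g_def diff_op_def by (intro continuous_intros continuous_on_compose2[OF f_cont]) auto
    then have [measurable]: "g \<in> borel_measurable borel" by (rule borel_measurable_continuous_onI)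
    have "hoelder b (2 * L * \<rho> u powr (b - b)) g" unfolding g_def using b by (intro hoelder_diff_op[OF f]) auto
    then have g_h: "hoelder b (2 * L) g" using False by (simp add: eq_0_iff)
    have "diff_op u (cz_op K c f) x = cz_op K c g x" unfolding g_def using cz_op_diff_op[OF hoelder_integrable[OF f b(1)]] by simp
    then have op_eq: "cz_op K c f (x - u) - cz_op K c f x = (LINT y|lborel. K y * (g (x - y) - g x)) + c * g x"
      by (simp add: diff_op_def cz_op_def)
    have kint: "integrable lborel ?k" using integrable_truncated[OF s] .
    have kg: "integrable lborel (\<lambda>y. ?k y * g (x - y))" by (rule integrable_conv[OF kint truncated_support g_cont])
    have kf1: "integrable lborel (\<lambda>y. ?k y * f (x - u - y))" by (rule integrable_conv[OF kint truncated_support f_cont])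
    have kf2: "integrable lborel (\<lambda>y. ?k y * f (x - y))" by (rule integrable_conv[OF kint truncated_support f_cont])
    have near_le: "(\<integral>\<^sup>+y. ennreal (norm (?n y * (g (x - y) - g x))) \<partial>lborel) \<le> ennreal (2 * L * A * s powr b / (1 - 1 / 2 powr b))"
    proof -
      have "(\<integral>\<^sup>+y. ennreal (norm (?n y * (g (x - y) - g x))) \<partial>lborel) = l1_on {y. \<rho> y < s} (\<lambda>y. K y * (g (x - y) - g x))"
        by (intro nn_integral_cong) (auto simp: indicator_def)
      also have "... \<le> ennreal (2 * L * A * s powr b / (1 - 1 / 2 powr b))"
        using L hoelderD[OF g_h] by (intro nn_integral_K_Hoelder[OF b(1) s]) auto
      finally show ?thesis .
    qed
    have nint: "integrable lborel (\<lambda>y. ?n y * (g (x - y) - g x))" using near_le by (rule integrable_bounded_nn[rotated]) measurable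
    have near: "norm (LINT y|lborel. ?n y * (g (x - y) - g x)) \<le> 2 * L * A * s powr b / (1 - 1 / 2 powr b)"
      using near_le L A_nonneg one_div_2_powr_less[OF b(1)] by (intro norm_integral_bounded_nn) auto
    have "(LINT y|lborel. K y * (g (x - y) - g x)) = (LINT y|lborel. ?n y * (g (x - y) - g x) + (?k y * g (x - y) - ?k y * g x))"
      by (intro Bochner_Integration.integral_cong) (auto simp: truncated_def algebra_simps)
    also have "... = (LINT y|lborel. ?n y * (g (x - y) - g x)) + ((LINT y|lborel. ?k y * g (x - y)) - (LINT y|lborel. ?k y) * g x)"
      using nint kg kint by simp
    finally have split: "(LINT y|lborel. K y * (g (x - y) - g x)) = (LINT y|lborel. ?n y * (g (x - y) - g x))
        + ((LINT y|lborel. ?k y * g (x - y)) - (LINT y|lborel. ?k y) * g x)" .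
    have ku: "integrable lborel (\<lambda>y. ?k (y - u))" using kint by (rule integrable_lborel_shift)
    have "(\<lambda>y. ?k (y - u) * f (x - y)) = (\<lambda>y. (\<lambda>z. ?k z * f (x - u - z)) (y - u))" by (auto simp: algebra_simps)
    then have kuf: "integrable lborel (\<lambda>y. ?k (y - u) * f (x - y))"
        and kuf_eq: "(LINT y|lborel. ?k (y - u) * f (x - y)) = (LINT y|lborel. ?k y * f (x - u - y))"
      using integrable_lborel_shift[OF kf1, of u] integral_lborel_shift[of "\<lambda>z. ?k z * f (x - u - z)" u] by simp_all
    have "(LINT y|lborel. ?k y * g (x - y)) = (LINT y|lborel. ?k y * f (x - u - y) - ?k y * f (x - y))"
      by (intro Bochner_Integration.integral_cong) (auto simp: g_def diff_op_def algebra_simps)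
    also have "... = (LINT y|lborel. ?k (y - u) * f (x - y)) - (LINT y|lborel. ?k y * f (x - y))" using kf1 kf2 by (simp add: kuf_eq)
    \<comment> \<open>By translation invariance the two kernel integrals agree, so f(x) may be
      subtracted; the factor f(x - y) - f(x) is then controlled by the weight in
      \<open>truncated_regular\<close>.\<close>
    also have "... = (LINT y|lborel. ?k (y - u) * f (x - y)) - (LINT y|lborel. ?k y * f (x - y))
        - ((LINT y|lborel. ?k (y - u)) - (LINT y|lborel. ?k y)) * f x" by (simp add: integral_lborel_shift)
    also have "... = (LINT y|lborel. ?k (y - u) * f (x - y) - ?k y * f (x - y) - (?k (y - u) - ?k y) * f x)" using kuf kf2 ku kint by simp
    also have "... = (LINT y|lborel. (?k (y - u) - ?k y) * (f (x - y) - f x))"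
      by (intro Bochner_Integration.integral_cong) (auto simp: algebra_simps)
    finally have far_eq: "(LINT y|lborel. ?k y * g (x - y)) = (LINT y|lborel. (?k (y - u) - ?k y) * (f (x - y) - f x))" .
    have "(\<integral>\<^sup>+y. ennreal (norm ((?k (y - u) - ?k y) * (f (x - y) - f x))) \<partial>lborel)
        \<le> (\<integral>\<^sup>+y. ennreal L * ennreal (norm (?k (y - u) - ?k y) * \<rho> y powr b) \<partial>lborel)"
    proof (rule nn_integral_mono)
      fix y
      show "ennreal (norm ((?k (y - u) - ?k y) * (f (x - y) - f x))) \<le> ennreal L * ennreal (norm (?k (y - u) - ?k y) * \<rho> y powr b)"
        using mult_left_mono[OF hoelderD[OF f, of x y], of "norm (?k (y - u) - ?k y)"] L
        by (simp add: norm_mult ennreal_mult'[symmetric] mult_ac)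
    qed
    also have "... = ennreal L * (\<integral>\<^sup>+y. ennreal (norm (?k (y - u) - ?k y) * \<rho> y powr b) \<partial>lborel)" by (intro nn_integral_cmult) measurable
    also have "... \<le> ennreal L * ennreal ((6 + 4 / (1 - 1 / 2 powr (\<delta> - b))) * A * s powr b)"
      using truncated_regular[OF b s s_def[symmetric]] by (intro mult_left_mono) auto
    also have "... = ennreal (L * ((6 + 4 / (1 - 1 / 2 powr (\<delta> - b))) * A * s powr b))" using L by (simp add: ennreal_mult')
    finally have *: "(\<integral>\<^sup>+y. ennreal (norm ((?k (y - u) - ?k y) * (f (x - y) - f x))) \<partial>lborel)
        \<le> ennreal (L * ((6 + 4 / (1 - 1 / 2 powr (\<delta> - b))) * A * s powr b))" .
    have far: "norm (LINT y|lborel. ?k y * g (x - y)) \<le> L * ((6 + 4 / (1 - 1 / 2 powr (\<delta> - b))) * A * s powr b)"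
    proof -
      have "0 \<le> 4 / (1 - 1 / 2 powr (\<delta> - b))"
        using b by (intro divide_nonneg_pos) (simp_all only: diff_gt_0_iff_gt one_div_2_powr_less zero_le_numeral)
      then have "0 \<le> L * ((6 + 4 / (1 - 1 / 2 powr (\<delta> - b))) * A * s powr b)"
        using L A_nonneg by (intro mult_nonneg_nonneg add_nonneg_nonneg) auto
      with * show ?thesis unfolding far_eq by (intro norm_integral_bounded_nn)
    qed
    have "norm ((LINT y|lborel. ?k y) * g x) \<le> A * (L * s powr b)"
      unfolding norm_mult using cancellation[OF s] g_le A_nonneg by (intro mult_mono) auto
    moreover have "norm (c * g x) \<le> A * (L * s powr b)" unfolding norm_mult using norm_c_le g_le A_nonneg by (intro mult_mono) auto
    ultimately have "norm (cz_op K c f (x - u) - cz_op K c f x) \<le> 2 * L * A * s powr b / (1 - 1 / 2 powr b)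
          + (L * ((6 + 4 / (1 - 1 / 2 powr (\<delta> - b))) * A * s powr b) + A * (L * s powr b)) + A * (L * s powr b)"
      unfolding op_eq split using near far by (intro norm_triangle_le add_mono norm_triangle_le_diff) auto
    also have "... = lip_factor b \<delta> * A * L * \<rho> u powr b" by (simp add: lip_factor_def s_def algebra_simps)
    finally show ?thesis .
  qed simp
qed

lemma cz_op_hoelder:
  assumes a: "0 < a" "a < 1"
  obtains C where "0 \<le> C" "\<And>L f. hoelder a L f \<Longrightarrow> hoelder a (C * L) (cz_op K c f)"
proof -
  \<comment> \<open>It has to lie below \<delta> for \<open>cz_op_hoelder_small\<close> and not
    above \<open>a\<close> for \<open>hoelder_diff_op\<close>; halving the minimum achieves
    both.\<close>
  define \<beta> where "\<beta> = min a \<delta> / 2"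
  have \<beta>: "0 < \<beta>" "\<beta> < \<delta>" "\<beta> < a" using a delta by (auto simp: \<beta>_def)
  define C0 where "C0 = lip_factor \<beta> \<delta> * A * 2"
  have C0: "0 \<le> C0" using lip_factor_ge[OF \<beta>(1,2)] A_nonneg by (simp add: C0_def)
  have q: "2 powr (a - 1) < (1::real)" using a powr_less_mono[of "a - 1" 0 2] by auto
  have "hoelder a (C0 / (1 - 2 powr (a - 1)) * L) (cz_op K c f)" if f: "hoelder a L f" for L f
  proof -
    have L: "0 \<le> L" using f by (rule hoelder_nonneg)
    define T where "T = cz_op K c f"
    have comm: "cz_op K c (diff_op u f) = diff_op u T" for u unfolding T_def using cz_op_diff_op[OF hoelder_integrable[OF f a(1)]] .
    have second: "norm (diff_op u (diff_op u T) x) \<le> C0 * L * \<rho> u powr a" for x u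
    proof -
      have "hoelder \<beta> (2 * L * \<rho> u powr (a - \<beta>)) (diff_op u f)" using f \<beta> by (intro hoelder_diff_op) auto
      from cz_op_hoelder_small[OF \<beta>(1,2) this]
      have "hoelder \<beta> (C0 * L * \<rho> u powr (a - \<beta>)) (diff_op u T)" by (simp add: comm C0_def mult_ac)
      from hoelderD[OF this, of x u]
      have "norm (diff_op u (diff_op u T) x) \<le> C0 * L * (\<rho> u powr (a - \<beta>) * \<rho> u powr \<beta>)" by (simp add: diff_op_def mult_ac)
      then show ?thesis by (simp flip: powr_add)
    qed
    define B where "B = L * A * R powr a / (1 - 1 / 2 powr a)"
    \<comment> \<open>T f - c f is bounded by \<open>B\<close>, and c f has increments of order
      \<rho> to the power a < 1, so the increments of T f over 2^j u are o(2^j).\<close>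
    have growth: "(\<lambda>j. norm (T (x - (2 ^ j) *\<^sub>R u) - T x) / 2 ^ j) \<longlonglongrightarrow> 0" for x u
    proof (rule Lim_null_comparison)
      let ?b = "\<lambda>j. (2 * B + A * L * (2 ^ j * \<rho> u) powr a) / 2 ^ j"
      have "norm (T (x - v) - T x) \<le> 2 * B + A * L * \<rho> v powr a" for v
      proof -
        have "T (x - v) - T x = (T (x - v) - c * f (x - v)) - (T x - c * f x) + c * (f (x - v) - f x)" by (simp add: algebra_simps)
        also have "norm ... \<le> B + B + A * (L * \<rho> v powr a)"
        proof -
          have "norm (T y - c * f y) \<le> B" for y using norm_cz_op_sub_le[OF f a(1)] by (simp add: T_def B_def)
          moreover have "norm (c * (f (x - v) - f x)) \<le> A * (L * \<rho> v powr a)"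
            unfolding norm_mult using A_nonneg norm_c_le hoelderD[OF f, of x v] by (intro mult_mono) auto
          ultimately show ?thesis using norm_triangle_ineq norm_triangle_ineq4 by (smt (verit))
        qed
        finally show ?thesis by simp
      qed
      moreover have "A * L * \<rho> ((2 ^ j) *\<^sub>R u) powr a \<le> A * L * (2 ^ j * \<rho> u) powr a" for j
        using scale_pow[of j u] a L A_nonneg by (intro mult_left_mono powr_mono2) auto
      ultimately have "norm (T (x - (2 ^ j) *\<^sub>R u) - T x) \<le> 2 * B + A * L * (2 ^ j * \<rho> u) powr a" for j by (meson add_left_mono order_trans)
      then show "\<forall>\<^sub>F j in sequentially. norm (norm (T (x - (2 ^ j) *\<^sub>R u) - T x) / 2 ^ j) \<le> ?b j" by (simp add: divide_right_mono)
      have "?b = (\<lambda>j. 2 * B * (1 / 2) ^ j + A * L * \<rho> u powr a * (2 powr (a - 1)) ^ j)"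
        by (auto simp: add_divide_distrib powr_mult power_powr_commute powr_diff power_divide mult_ac)
      also have "... \<longlonglongrightarrow> 0" using q by (intro tendsto_add_zero tendsto_mult_right_zero LIMSEQ_realpow_zero) auto
      finally show "?b \<longlonglongrightarrow> 0" .
    qed
    show ?thesis using marchaud[of "C0 * L" a T] second growth a C0 L by (simp add: T_def)
  qed
  moreover have "0 \<le> C0 / (1 - 2 powr (a - 1))" using C0 q by simp
  ultimately show ?thesis using that by blast
qed

end

section \<open>Boundedness on \<open>L\<^sup>2\<close>\<close>

definition l2_sq :: "('v::euclidean_space \<Rightarrow> complex) \<Rightarrow> ennreal" where
  "l2_sq f = (\<integral>\<^sup>+x. ennreal ((norm (f x))\<^sup>2) \<partial>lborel)"

definition l2_prod :: "('v::euclidean_space \<Rightarrow> complex) \<Rightarrow> ('v \<Rightarrow> complex) \<Rightarrow> complex" where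
  "l2_prod f g = (LINT x|lborel. f x * cnj (g x))"

definition adjoint_kernel :: "('v::euclidean_space \<Rightarrow> complex) \<Rightarrow> 'v \<Rightarrow> complex" where
  "adjoint_kernel k y = cnj (k (- y))"

lemma L2_iff: "f \<in> L2 \<longleftrightarrow> f \<in> borel_measurable borel \<and> l2_sq f < \<infinity>" by (simp add: L2_def l2_sq_def)

lemma l2_sq_mono:
  assumes "\<And>x. norm (f x) \<le> norm (g x)" shows "l2_sq f \<le> l2_sq g"
  unfolding l2_sq_def using assms by (intro nn_integral_mono ennreal_leI power_mono) auto

lemma norm_add_sq_le: "(norm (a + b))\<^sup>2 \<le> 2 * (norm a)\<^sup>2 + 2 * (norm b)\<^sup>2"
  for a b :: "'a::real_normed_vector"
proof -
  have "(norm (a + b))\<^sup>2 \<le> (norm a + norm b)\<^sup>2" by (intro power_mono norm_triangle_ineq) auto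
  also have "... \<le> 2 * (norm a)\<^sup>2 + 2 * (norm b)\<^sup>2" using zero_le_power2[of "norm a - norm b"] by (simp add: power2_eq_square algebra_simps)
  finally show ?thesis .
qed

lemma l2_sq_add:
  assumes [measurable]: "f \<in> borel_measurable borel" "g \<in> borel_measurable borel"
  shows "l2_sq (\<lambda>x. f x + g x) \<le> 2 * l2_sq f + 2 * l2_sq g"
proof -
  have "l2_sq (\<lambda>x. f x + g x) \<le> (\<integral>\<^sup>+x. 2 * ennreal ((norm (f x))\<^sup>2) + 2 * ennreal ((norm (g x))\<^sup>2) \<partial>lborel)" unfolding l2_sq_def
  proof (rule nn_integral_mono)
    fix x
    have "ennreal ((norm (f x + g x))\<^sup>2) \<le> ennreal (2 * (norm (f x))\<^sup>2 + 2 * (norm (g x))\<^sup>2)" by (rule ennreal_leI[OF norm_add_sq_le])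
    also have "... = 2 * ennreal ((norm (f x))\<^sup>2) + 2 * ennreal ((norm (g x))\<^sup>2)" by (simp add: ennreal_mult')
    finally show "ennreal ((norm (f x + g x))\<^sup>2) \<le> 2 * ennreal ((norm (f x))\<^sup>2) + 2 * ennreal ((norm (g x))\<^sup>2)" .
  qed
  also have "... = 2 * l2_sq f + 2 * l2_sq g" unfolding l2_sq_def by (simp add: nn_integral_add nn_integral_cmult)
  finally show ?thesis .
qed

lemma l2_sq_uminus: "l2_sq (\<lambda>x. - f x) = l2_sq f" by (simp add: l2_sq_def)

lemma l2_sq_diff:
  assumes [measurable]: "f \<in> borel_measurable borel" "g \<in> borel_measurable borel"
  shows "l2_sq (\<lambda>x. f x - g x) \<le> 2 * l2_sq f + 2 * l2_sq g" using l2_sq_add[of f "\<lambda>x. - g x"] by (simp add: l2_sq_uminus)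

lemma borel_measurable_cnj [measurable]:
  assumes "f \<in> borel_measurable M" shows "(\<lambda>x. cnj (f x)) \<in> borel_measurable M"
  using assms by (rule measurable_compose) (intro borel_measurable_continuous_onI continuous_intros)

lemma conv_measurable [measurable]:
  assumes [measurable]: "k \<in> borel_measurable borel" "f \<in> borel_measurable borel"
  shows "conv k f \<in> borel_measurable borel" unfolding conv_def[abs_def] by measurable

lemma ennreal_norm_integral_le:
  fixes f :: "'a \<Rightarrow> 'b::{banach, second_countable_topology}"
  shows "ennreal (norm (\<integral>x. f x \<partial>M)) \<le> (\<integral>\<^sup>+x. ennreal (norm (f x)) \<partial>M)"
  by (cases "integrable M f") (auto intro: integral_norm_bound_ennreal simp: not_integrable_integral_eq)

text \<open>Cauchy-Schwarz against the measure |k(y)| dy, by splitting |k| into two square roots,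
  followed by Tonelli and translation invariance.\<close>

lemma young_l2:
  assumes [measurable]: "k \<in> borel_measurable borel" "f \<in> borel_measurable borel"
  shows "l2_sq (conv k f) \<le> (\<integral>\<^sup>+y. ennreal (norm (k y)) \<partial>lborel)\<^sup>2 * l2_sq f"
proof -
  let ?I = "\<integral>\<^sup>+y. ennreal (norm (k y)) \<partial>lborel"
  have pt: "ennreal ((norm (conv k f x))\<^sup>2) \<le> ?I * (\<integral>\<^sup>+y. ennreal (norm (k y) * (norm (f (x - y)))\<^sup>2) \<partial>lborel)" for x
  proof -
    let ?a = "\<lambda>y. ennreal (sqrt (norm (k y)))"
    let ?b = "\<lambda>y. ennreal (sqrt (norm (k y)) * norm (f (x - y)))"
    have "ennreal ((norm (conv k f x))\<^sup>2) = (ennreal (norm (conv k f x)))\<^sup>2" by (simp add: ennreal_power)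
    also have "... \<le> (\<integral>\<^sup>+y. ennreal (norm (k y * f (x - y))) \<partial>lborel)\<^sup>2"
      unfolding conv_def by (intro power_mono ennreal_norm_integral_le) auto
    also have "... = (\<integral>\<^sup>+y. ?a y * ?b y \<partial>lborel)\<^sup>2" by (simp add: ennreal_mult'[symmetric] norm_mult flip: mult.assoc)
    also have "... \<le> (\<integral>\<^sup>+y. (?a y)\<^sup>2 \<partial>lborel) * (\<integral>\<^sup>+y. (?b y)\<^sup>2 \<partial>lborel)" by (intro Cauchy_Schwarz_nn_integral) measurable
    also have "... = ?I * (\<integral>\<^sup>+y. ennreal (norm (k y) * (norm (f (x - y)))\<^sup>2) \<partial>lborel)" by (simp add: ennreal_power power_mult_distrib)
    finally show ?thesis .
  qed
  have "l2_sq (conv k f) \<le> (\<integral>\<^sup>+x. ?I * (\<integral>\<^sup>+y. ennreal (norm (k y) * (norm (f (x - y)))\<^sup>2) \<partial>lborel) \<partial>lborel)"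
    unfolding l2_sq_def by (intro nn_integral_mono pt)
  also have "... = ?I * (\<integral>\<^sup>+x. \<integral>\<^sup>+y. ennreal (norm (k y) * (norm (f (x - y)))\<^sup>2) \<partial>lborel \<partial>lborel)" by (intro nn_integral_cmult) measurable
  also have "(\<integral>\<^sup>+x. \<integral>\<^sup>+y. ennreal (norm (k y) * (norm (f (x - y)))\<^sup>2) \<partial>lborel \<partial>lborel)
      = (\<integral>\<^sup>+y. \<integral>\<^sup>+x. ennreal (norm (k y) * (norm (f (x - y)))\<^sup>2) \<partial>lborel \<partial>lborel)" by (rule lborel_pair.Fubini') measurable
  also have "... = (\<integral>\<^sup>+y. ennreal (norm (k y)) * l2_sq f \<partial>lborel)"
  proof (rule nn_integral_cong)
    fix y
    have "(\<integral>\<^sup>+x. ennreal (norm (k y) * (norm (f (x - y)))\<^sup>2) \<partial>lborel) = (\<integral>\<^sup>+x. ennreal (norm (k y) * (norm (f x))\<^sup>2) \<partial>lborel)"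
      by (rule nn_integral_lborel_shift[of "\<lambda>x. ennreal (norm (k y) * (norm (f x))\<^sup>2)"]) measurable
    then show "(\<integral>\<^sup>+x. ennreal (norm (k y) * (norm (f (x - y)))\<^sup>2) \<partial>lborel) = ennreal (norm (k y)) * l2_sq f"
      by (simp add: l2_sq_def ennreal_mult' nn_integral_cmult)
  qed
  also have "... = ?I * l2_sq f" by (rule nn_integral_multc) measurable
  finally show ?thesis by (simp add: power2_eq_square mult.assoc)
qed

lemma l2_prod_le:
  assumes [measurable]: "f \<in> borel_measurable borel" "g \<in> borel_measurable borel"
  shows "(ennreal (norm (l2_prod f g)))\<^sup>2 \<le> l2_sq f * l2_sq g"
proof -
  have "(ennreal (norm (l2_prod f g)))\<^sup>2 \<le> (\<integral>\<^sup>+x. ennreal (norm (f x * cnj (g x))) \<partial>lborel)\<^sup>2"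
    unfolding l2_prod_def by (intro power_mono ennreal_norm_integral_le) auto
  also have "... = (\<integral>\<^sup>+x. ennreal (norm (f x)) * ennreal (norm (g x)) \<partial>lborel)\<^sup>2" by (simp add: norm_mult ennreal_mult')
  also have "... \<le> (\<integral>\<^sup>+x. (ennreal (norm (f x)))\<^sup>2 \<partial>lborel) * (\<integral>\<^sup>+x. (ennreal (norm (g x)))\<^sup>2 \<partial>lborel)"
    by (intro Cauchy_Schwarz_nn_integral) measurable
  also have "... = l2_sq f * l2_sq g" by (simp add: l2_sq_def ennreal_power)
  finally show ?thesis .
qed

lemma l2_prod_self:
  assumes [measurable]: "f \<in> borel_measurable borel" and f: "l2_sq f < \<infinity>"
  shows "l2_sq f = ennreal (norm (l2_prod f f))"
proof -
  have "integrable lborel (\<lambda>x. (norm (f x))\<^sup>2)" using f by (intro integrableI_bounded) (auto simp: l2_sq_def)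
  then have "l2_sq f = ennreal (LINT x|lborel. (norm (f x))\<^sup>2)" unfolding l2_sq_def by (rule nn_integral_eq_integral) auto
  also have "l2_prod f f = of_real (LINT x|lborel. (norm (f x))\<^sup>2)"
  proof -
    have "(\<lambda>x. f x * cnj (f x)) = (\<lambda>x. complex_of_real ((norm (f x))\<^sup>2))" using complex_norm_square by auto
    then show ?thesis unfolding l2_prod_def by (simp only: integral_complex_of_real)
  qed
  then have "(LINT x|lborel. (norm (f x))\<^sup>2) = norm (l2_prod f f)" by simp
  finally show ?thesis .
qed

text \<open>A majorant of product form fits the applications: decay in one variable, an integrable
  kernel, possibly weighted, in the other.\<close>

lemma integral_swap:
  fixes h :: "'v::euclidean_space \<Rightarrow> 'w::euclidean_space \<Rightarrow> complex"
  assumes h [measurable]: "case_prod h \<in> borel_measurable (lborel \<Otimes>\<^sub>M lborel)"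
    and a: "integrable lborel a" and b: "integrable lborel b"
    and le: "\<And>x y. norm (h x y) \<le> a x * (b y :: real)"
  shows "(LINT x|lborel. LINT y|lborel. h x y) = (LINT y|lborel. LINT x|lborel. h x y)"
proof -
  have "integrable lborel (\<lambda>x. \<bar>a x\<bar> * (LINT y|lborel. \<bar>b y\<bar>))" using a by simp
  then have "integrable (lborel \<Otimes>\<^sub>M lborel) (\<lambda>(x, y). a x * b y)"
    using a b borel_measurable_integrable[OF a] borel_measurable_integrable[OF b]
    by (intro lborel_pair.Fubini_integrable) (simp_all add: abs_mult)
  then have "integrable (lborel \<Otimes>\<^sub>M lborel) (case_prod h)"
    by (rule Bochner_Integration.integrable_bound) (auto intro!: AE_I2 order_trans[OF le])
  then show ?thesis by (rule lborel_pair.Fubini_integral[symmetric])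
qed

text \<open>With N = 2^n the hypothesis reads q^N \<le> V N^d for arbitrarily large N; as q^N = exp
  (N ln q), this contradicts the growth of the exponential.\<close>

lemma power_over_exp_contra:
  fixes q V :: real
  assumes q: "1 < q" and le: "\<And>n::nat. q ^ (2 ^ n) \<le> V * (2 ^ n) ^ d"
  shows False
proof -
  define c where "c = ln q"
  have c: "0 < c" using q by (simp add: c_def)
  have lim: "((\<lambda>x::real. x ^ d / exp x) \<longlongrightarrow> 0) at_top" by (rule tendsto_power_div_exp_0)
  have top: "filterlim (\<lambda>n::nat. c * 2 ^ n) at_top sequentially" using c by (intro filterlim_tendsto_pos_mult_at_top[OF tendsto_const]
      filterlim_at_infinity_imp_filterlim_at_top filterlim_realpow_sequentially_gt1[of 2]) auto
  have "(\<lambda>n::nat. V / c ^ d * ((c * 2 ^ n) ^ d / exp (c * 2 ^ n))) \<longlonglongrightarrow> V / c ^ d * 0"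
    by (intro tendsto_mult tendsto_const filterlim_compose[OF lim top])
  then have "\<forall>\<^sub>F n in sequentially. V / c ^ d * ((c * 2 ^ n) ^ d / exp (c * 2 ^ n)) < 1" by (intro order_tendstoD(2)[of _ 0]) auto
  then obtain n where n: "V / c ^ d * ((c * 2 ^ n) ^ d / exp (c * 2 ^ n)) < 1" by (auto simp: eventually_sequentially)
  have "exp (c * 2 ^ n) = q ^ (2 ^ n)" using q by (simp add: c_def exp_of_nat2_mult[of "ln q" "2 ^ n", simplified])
  then show False using n le[of n] q c by (simp add: power_mult_distrib divide_simps)
qed

text \<open>Meant for b n = |S^(2^n) f|^2 and a = |f|^2 with norms in L2. Iterating
  \<open>sq\<close> gives (b 0 / a)^(2^n) \<le> b n / a; in the 2^n-th root the factors V and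
  (2^n)^d disappear and only the exponential rate \<open>D\<close> survives.\<close>

lemma lax_sequence:
  fixes b :: "nat \<Rightarrow> real"
  assumes nonneg: "\<And>n. 0 \<le> b n" "0 \<le> a" and D: "0 < D"
    and sq: "\<And>n. (b n)\<^sup>2 \<le> a * b (Suc n)"
    and le: "\<And>n. b n \<le> V * (2 ^ n) ^ d * D ^ (2 ^ n)"
  shows "b 0 \<le> D * a"
proof (cases "a = 0")
  case True
  with sq[of 0] show ?thesis by simp
next
  case False
  with nonneg have a: "0 < a" by simp
  have pow: "(b 0 / a) ^ (2 ^ n) \<le> b n / a" for n
  proof (induction n)
    case (Suc n)
    have "(b 0 / a) ^ (2 ^ Suc n) = ((b 0 / a) ^ (2 ^ n))\<^sup>2" by (simp add: mult.commute flip: power_mult)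
    also have "... \<le> (b n / a)\<^sup>2" using Suc nonneg by (intro power_mono) auto
    also have "... \<le> b (Suc n) / a" using sq[of n] a by (simp add: field_simps power2_eq_square)
    finally show ?case .
  qed simp
  show ?thesis
  proof (rule ccontr)
    assume "\<not> b 0 \<le> D * a"
    then have q: "1 < b 0 / a / D" using a D by (simp add: field_simps)
    have "(b 0 / a / D) ^ (2 ^ n) \<le> V / a * (2 ^ n) ^ d" for n :: nat
    proof -
      have "(b 0 / a / D) ^ (2 ^ n) \<le> (b n / a) / D ^ (2 ^ n)"
      proof -
        have "(b 0 / a / D) ^ (2 ^ n) = (b 0 / a) ^ (2 ^ n) / D ^ (2 ^ n)" by (rule power_divide)
        also have "... \<le> (b n / a) / D ^ (2 ^ n)" using pow[of n] D by (intro divide_right_mono) auto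
        finally show ?thesis .
      qed
      also have "... \<le> (V * (2 ^ n) ^ d * D ^ (2 ^ n) / a) / D ^ (2 ^ n)" using le[of n] a D by (intro divide_right_mono) auto
      also have "... = V / a * (2 ^ n) ^ d" using D by simp
      finally show ?thesis .
    qed
    from power_over_exp_contra[OF q this] show False .
  qed
qed

section \<open>Compactly supported Hoelder functions as test class for the bound on L2\<close>

context length_function begin

text \<open>One constant serves both the Hoelder seminorm and the supremum, so that an operator acts
  on the class by a single factor and an enlarged support radius; this makes powers of the operator
  easy to follow.\<close>

definition test_class :: "real \<Rightarrow> real \<Rightarrow> real \<Rightarrow> ('v \<Rightarrow> complex) \<Rightarrow> bool" where
  "test_class b Q r f \<longleftrightarrow> hoelder b Q f \<and> (\<forall>x. norm (f x) \<le> Q) \<and> (\<forall>x. r \<le> \<rho> x \<longrightarrow> f x = 0)"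

lemma l2_sq_bounded_support:
  assumes "\<And>x. norm (f x) \<le> Q" "\<And>x. r \<le> \<rho> x \<Longrightarrow> f x = 0"
  shows "l2_sq f \<le> ennreal (Q\<^sup>2) * emeasure lborel {x. \<rho> x < r}"
proof -
  have "l2_sq f \<le> (\<integral>\<^sup>+x. ennreal (Q\<^sup>2) * indicator {x. \<rho> x < r} x \<partial>lborel)"
    unfolding l2_sq_def by (intro nn_integral_mono) (use assms in \<open>auto simp: indicator_def not_less intro!: ennreal_leI power_mono\<close>)
  also have "... = ennreal (Q\<^sup>2) * emeasure lborel {x. \<rho> x < r}" by (subst nn_integral_cmult_indicator) auto
  finally show ?thesis .
qed

lemma test_classD:
  assumes "test_class b Q r f"
  shows "hoelder b Q f" "norm (f x) \<le> Q" "r \<le> \<rho> x \<Longrightarrow> f x = 0" using assms by (auto simp: test_class_def)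

lemma test_class_measurable:
  "test_class b Q r f \<Longrightarrow> 0 < b \<Longrightarrow> f \<in> borel_measurable borel" using hoelder_continuous test_classD(1) borel_measurable_continuous_onI by blast

lemma test_class_l2:
  assumes "test_class b Q r f" shows "l2_sq f < \<infinity>"
proof -
  have "l2_sq f \<le> ennreal (Q\<^sup>2) * emeasure lborel {x. \<rho> x < r}" using test_classD(2,3)[OF assms] by (rule l2_sq_bounded_support)
  also have "... < \<infinity>" using emeasure_ball_finite by (simp add: ennreal_mult_less_top)
  finally show ?thesis .
qed

lemma test_class_integrable:
  assumes "test_class b Q r f" "0 < b" shows "integrable lborel f"
proof (rule Bochner_Integration.integrable_bound)
  show "integrable lborel (\<lambda>x. Q * indicator {x. \<rho> x < r} x)"
    using emeasure_ball_finite by (intro integrable_mult_right integrable_real_indicator) auto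
  show "f \<in> borel_measurable lborel" using test_class_measurable[OF assms] by simp
  have "norm (f x) \<le> norm (Q * indicator {x. \<rho> x < r} x)" for x using test_classD(2,3)[OF assms(1), of x] by (cases "\<rho> x < r") auto
  then show "AE x in lborel. norm (f x) \<le> norm (Q * indicator {x. \<rho> x < r} x)" by simp
qed

text \<open>Since \<open>norm_le\<close> is quadratic, the \<rho>-ball of radius N t sits in a
  Euclidean ball of radius N^2 (1 + t + t^2). Hence its volume grows only polynomially in N, as
  \<open>lax_sequence\<close> demands.\<close>

lemma volume_ball_le:
  assumes "1 \<le> N" "0 \<le> t"
  shows "emeasure lborel {x. \<rho> x < N * t} \<le> ennreal (measure lborel (ball (0::'v) 1) * (1 + t + t\<^sup>2) ^ DIM('v) * N ^ (2 * DIM('v)))"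
proof -
  let ?s = "N\<^sup>2 * (1 + t + t\<^sup>2)"
  have "{x. \<rho> x < N * t} \<subseteq> ball 0 ?s"
  proof
    fix x assume "x \<in> {x. \<rho> x < N * t}"
    then have x: "\<rho> x < N * t" by simp
    have "norm x \<le> \<rho> x + (\<rho> x)\<^sup>2" by (rule norm_le)
    also have "... \<le> N * t + (N * t)\<^sup>2" using x by (intro add_mono power_mono) auto
    also have "... < ?s"
    proof -
      have "1 \<le> N\<^sup>2" using assms by simp
      moreover have "N * t \<le> N\<^sup>2 * t" using assms by (intro mult_right_mono) (auto simp: power2_eq_square mult_le_cancel_left1)
      ultimately show ?thesis by (simp add: power_mult_distrib algebra_simps)
    qed
    finally show "x \<in> ball 0 ?s" by simp
  qed
  then have "emeasure lborel {x. \<rho> x < N * t} \<le> emeasure lborel {x::'v. norm x < ?s}" by (intro emeasure_mono) auto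
  also have "... = ennreal (?s ^ DIM('v) * measure lborel (ball (0::'v) 1))" using assms by (intro emeasure_norm_less) simp
  finally show ?thesis by (simp add: power_mult_distrib mult_ac flip: power_mult)
qed

end

lemma adjoint_conv:
  fixes k :: "'v::euclidean_space \<Rightarrow> complex"
  assumes k: "integrable lborel k" and f: "integrable lborel f" "\<And>x. norm (f x) \<le> B"
    and g: "integrable lborel g" "\<And>x. norm (g x) \<le> B'"
  shows "l2_prod (conv k f) g = l2_prod f (conv (adjoint_kernel k) g)"
proof -
  have [measurable]: "k \<in> borel_measurable borel" "g \<in> borel_measurable borel" "f \<in> borel_measurable borel"
    using k g f borel_measurable_integrable by fastforce+
  have "l2_prod (conv k f) g = (LINT x|lborel. LINT y|lborel. k y * f (x - y) * cnj (g x))" by (simp add: l2_prod_def conv_def)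
  also have "... = (LINT y|lborel. LINT x|lborel. k y * f (x - y) * cnj (g x))"
  proof (rule integral_swap)
    have "(\<lambda>x. cnj (g x)) \<in> borel_measurable borel" by measurable
    then have [measurable]: "(\<lambda>x. cnj (g (fst x))) \<in> borel_measurable ((borel :: 'v measure) \<Otimes>\<^sub>M (borel :: 'v measure))"
      by (rule measurable_compose[OF measurable_fst])
    show "case_prod (\<lambda>x y. k y * f (x - y) * cnj (g x)) \<in> borel_measurable (lborel \<Otimes>\<^sub>M lborel)" by (simp add: case_prod_beta')
    show "integrable lborel (\<lambda>x. B * norm (g x))" using g by simp
    show "integrable lborel (\<lambda>y. norm (k y))" using k by simp
    show "norm (k y * f (x - y) * cnj (g x)) \<le> B * norm (g x) * norm (k y)" for x y
      using mult_right_mono[OF f(2)[of "x - y"], of "norm (g x) * norm (k y)"] by (simp add: norm_mult mult_ac)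
  qed
  also have "... = (LINT y|lborel. LINT z|lborel. k y * f z * cnj (g (z + y)))"
  proof (rule Bochner_Integration.integral_cong)
    fix y
    show "(LINT x|lborel. k y * f (x - y) * cnj (g x)) = (LINT z|lborel. k y * f z * cnj (g (z + y)))"
      using integral_lborel_shift[of "\<lambda>z. k y * f z * cnj (g (z + y))" y] by simp
  qed simp
  also have "... = (LINT y|lborel. LINT z|lborel. k (- y) * f z * cnj (g (z - y)))"
    using integral_lborel_diff[of "\<lambda>y. LINT z|lborel. k y * f z * cnj (g (z + y))" 0] by simp
  also have "... = (LINT z|lborel. LINT y|lborel. k (- y) * f z * cnj (g (z - y)))"
  proof (rule integral_swap[symmetric])
    have [measurable]: "(\<lambda>x. f (fst x)) \<in> borel_measurable ((borel :: 'v measure) \<Otimes>\<^sub>M (borel :: 'v measure))" by measurable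
    show "case_prod (\<lambda>z y. k (- y) * f z * cnj (g (z - y))) \<in> borel_measurable (lborel \<Otimes>\<^sub>M lborel)" by (simp add: case_prod_beta')
    show "integrable lborel (\<lambda>x. B' * norm (f x))" using f by simp
    show "integrable lborel (\<lambda>y. norm (k (- y)))" using integrable_lborel_diff[OF k, of 0] by simp
    show "norm (k (- y) * f z * cnj (g (z - y))) \<le> B' * norm (f z) * norm (k (- y))" for z y
      using mult_right_mono[OF g(2)[of "z - y"], of "norm (f z) * norm (k (- y))"] by (simp add: norm_mult mult_ac)
  qed
  also have "... = l2_prod f (conv (adjoint_kernel k) g)"
  proof -
    have "cnj (LINT y|lborel. cnj (k (- y)) * g (x - y)) = (LINT y|lborel. k (- y) * cnj (g (x - y)))" for x
      by (subst Bochner_Integration.integral_cnj[symmetric]) simp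
    then show ?thesis by (simp add: l2_prod_def conv_def adjoint_kernel_def mult_ac)
  qed
  finally show ?thesis .
qed


section \<open>The operator and its adjoint on the test class\<close>

context cz_kernel begin

text \<open>The second summand bounds the Hoelder seminorm; together with the third it bounds the
  supremum, the contribution |c| \<le> A being absorbed because \<open>lip_factor\<close> is at
  least 8. The leading 1 keeps the constant positive when A = 0.\<close>

definition op_bound :: "real \<Rightarrow> real" where
  "op_bound b = 1 + lip_factor b \<delta> * A + A * R powr b / (1 - 1 / 2 powr b)"

lemma op_bound_ge_1:
  assumes b: "0 < b" "b < \<delta>"
  shows "1 \<le> op_bound b"
  using lip_factor_ge[OF b] A_nonneg one_div_2_powr_less[OF b(1)] unfolding op_bound_def by (simp add: add_nonneg_nonneg)

text \<open>Because \<open>K\<close> vanishes beyond \<open>R\<close>, the support radius grows only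
  additively, by \<open>R\<close> per application, while the constant grows geometrically.\<close>

lemma cz_op_test_class:
  assumes b: "0 < b" "b < \<delta>" and f: "test_class b Q r f"
  shows "test_class b (op_bound b * Q) (r + R) (cz_op K c f)"
proof -
  have h: "hoelder b Q f" using f by (rule test_classD)
  have Q: "0 \<le> Q" using h by (rule hoelder_nonneg)
  have p: "0 \<le> A * R powr b / (1 - 1 / 2 powr b)" using A_nonneg one_div_2_powr_less[OF b(1)] by simp
  have l: "8 * A \<le> lip_factor b \<delta> * A" using A_nonneg lip_factor_ge[OF b] by (rule mult_right_mono[rotated])
  have "hoelder b (op_bound b * Q) (cz_op K c f)" unfolding hoelder_def
  proof (intro allI)
    fix x u
    have "lip_factor b \<delta> * A * Q * \<rho> u powr b \<le> op_bound b * Q * \<rho> u powr b" using p Q by (intro mult_right_mono) (auto simp: op_bound_def)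
    with hoelderD[OF cz_op_hoelder_small[OF b h], of x u]
    show "norm (cz_op K c f (x - u) - cz_op K c f x) \<le> op_bound b * Q * \<rho> u powr b" by linarith
  qed
  moreover have "norm (cz_op K c f x) \<le> op_bound b * Q" for x
  proof -
    have "norm (c * f x) \<le> A * Q" unfolding norm_mult using norm_c_le A_nonneg test_classD(2)[OF f] by (intro mult_mono) auto
    then have "norm (cz_op K c f x) \<le> Q * A * R powr b / (1 - 1 / 2 powr b) + A * Q"
      using norm_cz_op_sub_le[OF h b(1), of x] norm_triangle_sub[of "cz_op K c f x" "c * f x"] by linarith
    also have "... = (A * R powr b / (1 - 1 / 2 powr b) + A) * Q" by (simp add: algebra_simps)
    also have "... \<le> op_bound b * Q" using Q l A_nonneg by (intro mult_right_mono) (auto simp: op_bound_def)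
    finally show ?thesis .
  qed
  moreover have "cz_op K c f x = 0" if x: "r + R \<le> \<rho> x" for x
  proof -
    have fx: "f x = 0" using x R_pos by (intro test_classD(3)[OF f]) linarith
    have "K y * (f (x - y) - f x) = 0" for y
    proof (cases "R \<le> \<rho> y")
      case False
      then have "r \<le> \<rho> (x - y)" using diff_ge[of x y] x by linarith
      then show ?thesis using fx test_classD(3)[OF f] by simp
    qed (simp add: support)
    then have "(\<lambda>y. K y * (f (x - y) - f x)) = (\<lambda>_. 0)" by (rule ext)
    then show ?thesis unfolding cz_op_def by (simp only:) (simp add: fx)
  qed
  ultimately show ?thesis by (simp add: test_class_def)
qed

lemma conv_eq_cz_op:
  assumes K: "integrable lborel K" "c = (LINT y|lborel. K y)" and f: "continuous_on UNIV f"
  shows "conv K f = cz_op K c f"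
proof
  fix x
  have "integrable lborel (\<lambda>y. K y * f (x - y))" using K(1) support f by (rule integrable_conv)
  then show "conv K f x = cz_op K c f x" using K by (simp add: conv_def cz_op_def right_diff_distrib)
qed

text \<open>The reflection of y preserves every condition as \<rho> is even, \<open>regular\<close>
  being used at -u; conjugation affects only \<open>c\<close>.\<close>

lemma adjoint_cz_kernel: "cz_kernel \<rho> (adjoint_kernel K) A R \<delta> (cnj c)"
proof unfold_locales
  have tr: "truncated \<rho> (adjoint_kernel K) r = (\<lambda>y. cnj (truncated \<rho> K r (0 - y)))" for r
    by (auto simp: truncated_def adjoint_kernel_def minus)
  have tr_int: "(LINT y|lborel. truncated \<rho> (adjoint_kernel K) r y) = cnj (LINT y|lborel. truncated \<rho> K r y)" for r
    unfolding tr Bochner_Integration.integral_cnj by (subst integral_lborel_diff) auto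
  show "adjoint_kernel K \<in> borel_measurable borel" unfolding adjoint_kernel_def by measurable
  show "R \<le> \<rho> y \<Longrightarrow> adjoint_kernel K y = 0" for y using support by (simp add: adjoint_kernel_def minus)
  show "l1_on {y. r \<le> \<rho> y \<and> \<rho> y < 2 * r} (\<lambda>y. adjoint_kernel K y) \<le> ennreal A"
    if "0 < r" for r using size[OF that] nn_integral_lborel_diff[of
      "\<lambda>y. ennreal (norm (K y)) * indicator {y. r \<le> \<rho> y \<and> \<rho> y < 2 * r} y" 0] by (simp add: adjoint_kernel_def minus indicator_def)
  show "norm (LINT y|lborel. truncated \<rho> (adjoint_kernel K) r y) \<le> A" if "0 < r" for r using cancellation[OF that] by (simp add: tr_int)
  show "((\<lambda>r. LINT y|lborel. truncated \<rho> (adjoint_kernel K) r y) \<longlongrightarrow> cnj c) (at_right 0)" unfolding tr_int using tendsto by (rule tendsto_cnj)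
  show "l1_on {y. r \<le> \<rho> y \<and> \<rho> y < 2 * r} (\<lambda>y. adjoint_kernel K (y - u) - adjoint_kernel K y)
        \<le> ennreal (A * (\<rho> u / r) powr \<delta>)" if "0 < r" "2 * \<rho> u \<le> r" for r u
  proof -
    have "norm (adjoint_kernel K (y - u) - adjoint_kernel K y) = norm (K (0 - y - (- u)) - K (0 - y))" for y
      by (simp add: adjoint_kernel_def flip: complex_cnj_diff)
    then show ?thesis using regular[of r "- u"] that nn_integral_lborel_diff[of
        "\<lambda>y. ennreal (norm (K (y - (- u)) - K y)) * indicator {y. r \<le> \<rho> y \<and> \<rho> y < 2 * r} y" 0] by (simp add: minus indicator_def)
  qed
qed (use A_nonneg R_pos delta in auto)


end

context cz_kernel begin

text \<open>The argument of Lax and Krein: for the self-adjoint \<open>S = T\<^sup>* T\<close> one has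
  \<open>\<parallel>S\<^sup>m f\<parallel>\<^sup>2 \<le> \<parallel>f\<parallel> \<parallel>S\<^sup>2\<^sup>m f\<parallel>\<close>, so the \<open>L\<^sup>2\<close> growth of the iterates is
  governed by their growth in the Hoelder norm; the supports only contribute a polynomial factor.\<close>

lemma l2_bound_integrable:
  assumes \<beta>: "0 < \<beta>" "\<beta> < \<delta>" and K: "integrable lborel K" "c = (LINT y|lborel. K y)"
    and f: "test_class \<beta> Q r f" and r: "0 \<le> r"
  shows "l2_sq (conv K f) \<le> ennreal ((op_bound \<beta>)\<^sup>2) * l2_sq f"
proof -
  interpret adj: cz_kernel \<rho> "adjoint_kernel K" A R \<delta> "cnj c" by (rule adjoint_cz_kernel)
  define M where "M = op_bound \<beta>"
  have M: "1 \<le> M" unfolding M_def using \<beta> by (rule op_bound_ge_1)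
  have adj_M: "adj.op_bound \<beta> = M" by (simp add: M_def op_bound_def adj.op_bound_def)
  have K': "integrable lborel (adjoint_kernel K)" "cnj c = (LINT y|lborel. adjoint_kernel K y)"
  proof -
    show "integrable lborel (adjoint_kernel K)" using integrable_lborel_diff[OF K(1), of 0] by (simp add: adjoint_kernel_def[abs_def])
    show "cnj c = (LINT y|lborel. adjoint_kernel K y)" using integral_lborel_diff[of K 0] by (simp add: adjoint_kernel_def[abs_def] K(2))
  qed
  have tc: "test_class \<beta> (M * Q) (r + R) (conv K g)" if "test_class \<beta> Q r g" for Q r g
    using cz_op_test_class[OF \<beta> that] conv_eq_cz_op[OF K] hoelder_continuous[OF test_classD(1)[OF that] \<beta>(1)] by (simp add: M_def)
  have tc': "test_class \<beta> (M * Q) (r + R) (conv (adjoint_kernel K) g)" if "test_class \<beta> Q r g" for Q r g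
    using adj.cz_op_test_class[OF \<beta> that] adj.conv_eq_cz_op[OF K'] hoelder_continuous[OF test_classD(1)[OF that] \<beta>(1)] by (simp add: adj_M)
  define S where "S = (\<lambda>g. conv (adjoint_kernel K) (conv K g))"
  have S: "test_class \<beta> (M\<^sup>2 * Q) (r + 2 * R) (S g)" if "test_class \<beta> Q r g" for Q r g
    using tc'[OF tc[OF that]] by (simp add: S_def power2_eq_square mult.assoc algebra_simps)
  have Sm: "test_class \<beta> ((M\<^sup>2) ^ m * Q) (r + real m * (2 * R)) ((S ^^ m) g)" if "test_class \<beta> Q r g" for Q r g m
  proof (induction m)
    case (Suc m)
    show ?case using S[OF Suc] by (simp add: algebra_simps)
  qed (use that in simp)
  note meas = test_class_measurable[OF _ \<beta>(1)] and int = test_class_integrable[OF _ \<beta>(1)]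
  have adj1: "l2_prod (conv K g) h = l2_prod g (conv (adjoint_kernel K) h)"
    if "test_class \<beta> Q r g" "test_class \<beta> Q' r' h" for Q r g Q' r' h
    using that by (intro adjoint_conv[OF K(1) int _ int]) (auto intro: test_classD)
  have adj2: "l2_prod (conv (adjoint_kernel K) g) h = l2_prod g (conv K h)"
    if "test_class \<beta> Q r g" "test_class \<beta> Q' r' h" for Q r g Q' r' h
  proof -
    have "l2_prod (conv (adjoint_kernel K) g) h = l2_prod g (conv (adjoint_kernel (adjoint_kernel K)) h)"
      using that by (intro adjoint_conv[OF K'(1) int _ int]) (auto intro: test_classD)
    then show ?thesis by (simp add: adjoint_kernel_def[abs_def])
  qed
  have sym1: "l2_prod (S g) h = l2_prod g (S h)"
    if "test_class \<beta> Q r g" "test_class \<beta> Q' r' h" for Q r g Q' r' h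
    unfolding S_def using adj2[OF tc[OF that(1)] that(2)] adj1[OF that(1) tc[OF that(2)]] by simp
  have sym: "l2_prod ((S ^^ m) g) h = l2_prod g ((S ^^ m) h)"
    if "test_class \<beta> Q r g" "test_class \<beta> Q' r' h" for Q r g Q' r' h m using that(2)
  proof (induction m arbitrary: Q' r' h)
    case (Suc m)
    have "l2_prod ((S ^^ Suc m) g) h = l2_prod ((S ^^ m) g) (S h)" using sym1[OF Sm[OF that(1)] Suc.prems] by simp
    also have "... = l2_prod g ((S ^^ m) (S h))" using Suc.IH[OF S[OF Suc.prems]] .
    finally show ?case by (simp add: funpow_swap1)
  qed simp
  define a where "a = (\<lambda>m. l2_sq ((S ^^ m) f))"
  have a_fin: "a m < \<infinity>" for m unfolding a_def using Sm[OF f] by (rule test_class_l2)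
  have a_sq: "(a m)\<^sup>2 \<le> a 0 * a (2 * m)" for m
  proof -
    have "a m = ennreal (norm (l2_prod ((S ^^ m) f) ((S ^^ m) f)))"
      unfolding a_def using a_fin[of m] meas[OF Sm[OF f]] by (intro l2_prod_self) (auto simp: a_def)
    also have "l2_prod ((S ^^ m) f) ((S ^^ m) f) = l2_prod f ((S ^^ (2 * m)) f)" using sym[OF f Sm[OF f]] by (simp add: mult_2 funpow_add)
    finally show ?thesis using l2_prod_le[OF meas[OF f] meas[OF Sm[OF f]]] by (simp add: a_def)
  qed
  define b where "b = (\<lambda>n. enn2real (a (2 ^ n)))"
  \<comment> \<open>After 2^n applications of \<open>S\<close> the support radius is r + 2^n (2R),
    at most 2^n (r + 2R), which makes \<open>volume_ball_le\<close> applicable with N = 2^n.\<close>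
  define V where "V = Q\<^sup>2 * (measure lborel (ball (0::'v) 1) * (1 + (r + 2 * R) + (r + 2 * R)\<^sup>2) ^ DIM('v))"
  have b_a: "a (2 ^ n) = ennreal (b n)" for n using a_fin[of "2 ^ n"] by (simp add: b_def)
  have a0: "a 0 = ennreal (enn2real (a 0))" using a_fin[of 0] by simp
  \<comment> \<open>One application of \<open>S\<close> multiplies the supremum bound by M^2, hence
    the bound of the squared L2 norm by M^4.\<close>
  have "b 0 \<le> M ^ 4 * enn2real (a 0)"
  proof (rule lax_sequence)
    show "(b n)\<^sup>2 \<le> enn2real (a 0) * b (Suc n)" for n
    proof -
      have "ennreal ((b n)\<^sup>2) \<le> ennreal (enn2real (a 0) * b (Suc n))"
      proof -
        have "(ennreal (b n))\<^sup>2 \<le> ennreal (enn2real (a 0)) * ennreal (b (Suc n))"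
          unfolding b_a[symmetric] a0[symmetric] using a_sq[of "2 ^ n"] by simp
        then show ?thesis by (simp only: ennreal_power[symmetric] ennreal_mult' enn2real_nonneg b_def)
      qed
      then show ?thesis by (simp add: b_def)
    qed
    show "b n \<le> V * (2 ^ n) ^ (2 * DIM('v)) * (M ^ 4) ^ (2 ^ n)" for n
    proof -
      let ?N = "2 ^ n :: real"
      have N: "1 \<le> ?N" by simp
      have "a (2 ^ n) \<le> ennreal (((M\<^sup>2) ^ 2 ^ n * Q)\<^sup>2) * emeasure lborel {x. \<rho> x < r + ?N * (2 * R)}"
        unfolding a_def using Sm[OF f, of "2 ^ n"] by (intro l2_sq_bounded_support) (auto dest: test_classD)
      also have "emeasure lborel {x. \<rho> x < r + ?N * (2 * R)} \<le> emeasure lborel {x. \<rho> x < ?N * (r + 2 * R)}"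
        using r mult_right_mono[OF N r] by (intro emeasure_mono) (auto simp: algebra_simps)
      also have "... \<le> ennreal (measure lborel (ball (0::'v) 1) * (1 + (r + 2 * R) + (r + 2 * R)\<^sup>2) ^ DIM('v) * ?N ^ (2 * DIM('v)))"
        using r R_pos N by (intro volume_ball_le) auto
      finally have "a (2 ^ n) \<le> ennreal (((M\<^sup>2) ^ 2 ^ n * Q)\<^sup>2 * (measure lborel (ball (0::'v) 1)
          * (1 + (r + 2 * R) + (r + 2 * R)\<^sup>2) ^ DIM('v) * ?N ^ (2 * DIM('v))))" by (simp add: ennreal_mult' mult_left_mono)
      also have "((M\<^sup>2) ^ 2 ^ n * Q)\<^sup>2 * (measure lborel (ball (0::'v) 1)
          * (1 + (r + 2 * R) + (r + 2 * R)\<^sup>2) ^ DIM('v) * ?N ^ (2 * DIM('v)))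
          = V * ?N ^ (2 * DIM('v)) * (M ^ 4) ^ (2 ^ n)"
      proof -
        have "((M\<^sup>2) ^ k)\<^sup>2 = (M ^ 4) ^ k" for k
        proof -
          have "((M\<^sup>2) ^ k)\<^sup>2 = ((M\<^sup>2)\<^sup>2) ^ k" by (metis power_mult mult.commute)
          then show ?thesis by simp
        qed
        then show ?thesis unfolding V_def power_mult_distrib by (simp only: mult_ac)
      qed
      finally have "ennreal (b n) \<le> ennreal (V * ?N ^ (2 * DIM('v)) * (M ^ 4) ^ (2 ^ n))" by (simp add: b_a)
      moreover have "0 \<le> V * ?N ^ (2 * DIM('v)) * (M ^ 4) ^ (2 ^ n)"
        unfolding V_def using r R_pos M hoelder_nonneg[OF test_classD(1)[OF f]] by (intro mult_nonneg_nonneg zero_le_power add_nonneg_nonneg) auto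
      ultimately show ?thesis by (simp add: b_def)
    qed
  qed (use M in \<open>auto simp: b_def\<close>)
  then have "ennreal (b 0) \<le> ennreal (M ^ 4) * a 0" by (subst a0) (simp add: ennreal_mult'[symmetric] M)
  then have a1: "l2_sq (S f) \<le> ennreal (M ^ 4) * l2_sq f" using b_a[of 0] by (simp add: a_def)
  \<comment> \<open>|K f|^2 = <f, S f> \<le> |f| |S f| \<le> M^2 |f|^2: the bound for
    \<open>S\<close> is turned back into one for the convolution with \<open>K\<close>.\<close>
  define p where "p = norm (l2_prod f (S f))"
  have "l2_sq (conv K f) = ennreal (norm (l2_prod (conv K f) (conv K f)))"
    using meas[OF tc[OF f]] test_class_l2[OF tc[OF f]] by (intro l2_prod_self) auto
  also have "l2_prod (conv K f) (conv K f) = l2_prod f (S f)" using adj1[OF f tc[OF f]] by (simp add: S_def)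
  finally have *: "l2_sq (conv K f) = ennreal p" by (simp add: p_def)
  have "(ennreal p)\<^sup>2 \<le> l2_sq f * (ennreal (M ^ 4) * l2_sq f)"
    unfolding p_def by (rule order_trans[OF l2_prod_le[OF meas[OF f] meas[OF S[OF f]]] mult_left_mono[OF a1]]) simp
  moreover have l0: "l2_sq f = ennreal (enn2real (a 0))" using a0 by (simp add: a_def)
  moreover have "ennreal (enn2real (a 0)) * (ennreal (M ^ 4) * ennreal (enn2real (a 0))) = ennreal ((M\<^sup>2 * enn2real (a 0))\<^sup>2)"
  proof -
    have "(M\<^sup>2 * enn2real (a 0))\<^sup>2 = enn2real (a 0) * (M ^ 4 * enn2real (a 0))"
      by (simp add: power_mult_distrib power2_eq_square[of "enn2real (a 0)"])
    then show ?thesis using M by (simp only: ennreal_mult'[symmetric] ennreal_mult''[symmetric] enn2real_nonneg)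
  qed
  moreover have "(ennreal p)\<^sup>2 = ennreal (p\<^sup>2)" by (simp add: p_def ennreal_power)
  ultimately have "ennreal (p\<^sup>2) \<le> ennreal ((M\<^sup>2 * enn2real (a 0))\<^sup>2)" by metis
  then have "p\<^sup>2 \<le> (M\<^sup>2 * enn2real (a 0))\<^sup>2" by simp
  then have "p \<le> M\<^sup>2 * enn2real (a 0)" by (rule power2_le_imp_le) simp
  then have "ennreal p \<le> ennreal (M\<^sup>2) * ennreal (enn2real (a 0))" by (simp add: ennreal_mult'[symmetric])
  then show ?thesis unfolding * M_def[symmetric] l0[symmetric] .
qed


text \<open>The Lax-Krein bound needs an integrable kernel satisfying the kernel conditions
  uniformly in e. A sharp truncation would jump and endanger \<open>regular\<close> at the radius e;
  a cut-off piecewise linear in \<rho>, rising from 0 at e to 1 at 2e, keeps it.\<close>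

definition smooth_truncated :: "real \<Rightarrow> 'v \<Rightarrow> complex" where
  "smooth_truncated e y = of_real (min 1 (max 0 (\<rho> y / e - 1))) * K y"

lemma smooth_truncated_measurable [measurable]: "smooth_truncated e \<in> borel_measurable borel"
  unfolding smooth_truncated_def[abs_def] by measurable

lemma smooth_truncated_le: "norm (smooth_truncated e y) \<le> norm (K y)" by (simp add: smooth_truncated_def norm_mult mult_left_le_one_le)

lemma smooth_truncated_eq_0: "0 < e \<Longrightarrow> \<rho> y \<le> e \<Longrightarrow> smooth_truncated e y = 0" by (simp add: smooth_truncated_def)

lemma smooth_truncated_eq: "0 < e \<Longrightarrow> 2 * e \<le> \<rho> y \<Longrightarrow> smooth_truncated e y = K y"
  by (simp add: smooth_truncated_def min_def max_def field_simps)

text \<open>The cut-off is 1/e-Lipschitz for \<rho> and equals 1 beyond 2e. It can differ at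
  \<open>y\<close> and \<open>y - u\<close> only if \<rho> y < 2e + \<rho> u, and then r < 4e, so
  that \<rho> u / e \<le> 4 \<rho> u / r.\<close>

lemma smooth_truncated_diff:
  assumes e: "0 < e" and u: "2 * \<rho> u \<le> r" and y: "r \<le> \<rho> y"
  shows "norm (smooth_truncated e (y - u) - smooth_truncated e y) \<le> norm (K (y - u) - K y) + 4 * (\<rho> u / r) * norm (K y)"
proof -
  let ?\<eta> = "\<lambda>y. min 1 (max 0 (\<rho> y / e - 1))"
  have "smooth_truncated e (y - u) - smooth_truncated e y = of_real (?\<eta> (y - u)) * (K (y - u) - K y) + of_real (?\<eta> (y - u) - ?\<eta> y) * K y"
    by (simp add: smooth_truncated_def algebra_simps)
  moreover have "norm (of_real (?\<eta> (y - u)) * (K (y - u) - K y)) \<le> norm (K (y - u) - K y)" by (simp add: norm_mult mult_left_le_one_le)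
  moreover have "norm (of_real (?\<eta> (y - u) - ?\<eta> y) * K y) \<le> 4 * (\<rho> u / r) * norm (K y)" unfolding norm_mult norm_of_real
  proof (rule mult_right_mono)
    have r: "0 \<le> r" using u nonneg[of u] by linarith
    show "\<bar>?\<eta> (y - u) - ?\<eta> y\<bar> \<le> 4 * (\<rho> u / r)"
    proof (cases "2 * e + \<rho> u \<le> \<rho> y")
      case True
      then have "2 * e \<le> \<rho> (y - u)" "2 * e \<le> \<rho> y" using diff_ge[of y u] nonneg[of u] by linarith+
      then have "?\<eta> (y - u) = 1" "?\<eta> y = 1" using e by (auto simp: min_def max_def field_simps)
      then show ?thesis using r by simp
    next
      case False
      then have r4: "r < 4 * e" using u y by linarith
      have "\<bar>\<rho> (y - u) - \<rho> y\<bar> \<le> \<rho> u" using diff_ge[of y u] triangle_diff[of y u] by linarith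
      then have "\<bar>\<rho> (y - u) / e - \<rho> y / e\<bar> \<le> \<rho> u / e" using e by (simp add: divide_right_mono flip: diff_divide_distrib)
      then have *: "\<bar>?\<eta> (y - u) - ?\<eta> y\<bar> \<le> \<rho> u / e" by linarith
      show ?thesis
      proof (cases "r = 0")
        case True
        then show ?thesis using * u nonneg[of u] by simp
      next
        case False
        with r have "0 < r" by simp
        then have "\<rho> u / e \<le> 4 * (\<rho> u / r)" using e r4 mult_left_mono[of r "4 * e" "\<rho> u"] by (simp add: field_simps)
        with * show ?thesis by linarith
      qed
    qed
  qed simp
  ultimately show ?thesis by (smt (verit) norm_triangle_ineq)
qed

lemma integrable_smooth_truncated: assumes "0 < e" shows "integrable lborel (smooth_truncated e)"
proof (rule Bochner_Integration.integrable_bound)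
  show "integrable lborel (truncated \<rho> K e)" using assms by (rule integrable_truncated)
  have "norm (smooth_truncated e y) \<le> norm (truncated \<rho> K e y)" for y
    using smooth_truncated_le smooth_truncated_eq_0[OF assms, of y] by (simp add: truncated_def)
  then show "AE y in lborel. norm (smooth_truncated e y) \<le> norm (truncated \<rho> K e y)" by simp
qed simp

text \<open>The factor 5 comes from \<open>regular\<close>: 1 from \<open>K\<close> itself and 4
  from \<open>smooth_truncated_diff\<close>, where \<rho> u / r \<le> 1 is at most its own power of
  exponent \<delta>. The same constant is ample for size and cancellation.\<close>

lemma cz_kernel_smooth_truncated:
  assumes e: "0 < e"
  shows "cz_kernel \<rho> (smooth_truncated e) (5 * A) R \<delta> (LINT y|lborel. smooth_truncated e y)"
proof unfold_locales
  let ?k = "smooth_truncated e"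
  note int = integrable_smooth_truncated[OF e]
  show "R \<le> \<rho> y \<Longrightarrow> ?k y = 0" for y by (simp add: smooth_truncated_def support)
  show "l1_on {y. r \<le> \<rho> y \<and> \<rho> y < 2 * r} ?k \<le> ennreal (5 * A)" if "0 < r" for r
  proof -
    have "l1_on {y. r \<le> \<rho> y \<and> \<rho> y < 2 * r} ?k \<le> l1_on {y. r \<le> \<rho> y \<and> \<rho> y < 2 * r} K"
      using smooth_truncated_le by (intro nn_integral_mono mult_right_mono ennreal_leI) auto
    also have "... \<le> ennreal A" using size[OF that] .
    also have "... \<le> ennreal (5 * A)" using A_nonneg by (intro ennreal_leI) auto
    finally show ?thesis .
  qed
  show "norm (LINT y|lborel. truncated \<rho> ?k r y) \<le> 5 * A" if r: "0 < r" for r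
  proof -
    \<comment> \<open>Compared with the sharp truncation at max r (2e), the kernel differs only on e
      \<le> \<rho> y < 2e, whose mass \<open>size\<close> controls.\<close>
    let ?d = "\<lambda>y. truncated \<rho> ?k r y - truncated \<rho> K (max r (2 * e)) y"
    have m: "0 < max r (2 * e)" using r by simp
    have i1: "integrable lborel (truncated \<rho> ?k r)" using int by (rule Bochner_Integration.integrable_bound) (auto simp: truncated_def)
    have "(\<integral>\<^sup>+y. ennreal (norm (?d y)) \<partial>lborel) \<le> l1_on {y. e \<le> \<rho> y \<and> \<rho> y < 2 * e} K"
    proof (rule nn_integral_mono)
      fix y
      show "ennreal (norm (?d y)) \<le> ennreal (norm (K y)) * indicator {y. e \<le> \<rho> y \<and> \<rho> y < 2 * e} y"
        using smooth_truncated_le[of e y] smooth_truncated_eq[OF e, of y] smooth_truncated_eq_0[OF e, of y]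
        by (auto simp: truncated_def indicator_def intro!: ennreal_leI)
    qed
    also have "... \<le> ennreal A" using size[OF e] .
    finally have "norm (LINT y|lborel. ?d y) \<le> A" using A_nonneg by (rule norm_integral_bounded_nn)
    also have "(LINT y|lborel. ?d y) = (LINT y|lborel. truncated \<rho> ?k r y) - (LINT y|lborel. truncated \<rho> K (max r (2 * e)) y)"
      using i1 integrable_truncated[OF m] by simp
    finally show ?thesis using cancellation[OF m] A_nonneg norm_triangle_sub by (smt (verit))
  qed
  show "((\<lambda>r. LINT y|lborel. truncated \<rho> ?k r y) \<longlongrightarrow> (LINT y|lborel. ?k y)) (at_right 0)"
  proof (rule tendsto_eventually)
    have "truncated \<rho> ?k r = ?k" if "0 < r" "r < e" for r using smooth_truncated_eq_0[OF e] that by (auto simp: truncated_def)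
    then show "\<forall>\<^sub>F r in at_right 0. (LINT y|lborel. truncated \<rho> ?k r y) = (LINT y|lborel. ?k y)"
      using e by (auto simp: eventually_at_right_field intro!: exI[of _ e])
  qed
  show "l1_on {y. r \<le> \<rho> y \<and> \<rho> y < 2 * r} (\<lambda>y. ?k (y - u) - ?k y) \<le> ennreal (5 * A * (\<rho> u / r) powr \<delta>)" if r: "0 < r" "2 * \<rho> u \<le> r" for r u
  proof -
    let ?D = "{y. r \<le> \<rho> y \<and> \<rho> y < 2 * r}"
    have "l1_on ?D (\<lambda>y. ?k (y - u) - ?k y) \<le> (\<integral>\<^sup>+y. ennreal (norm (K (y - u) - K y)) * indicator ?D y
            + ennreal (4 * (\<rho> u / r)) * (ennreal (norm (K y)) * indicator ?D y) \<partial>lborel)"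
    proof (rule nn_integral_mono)
      fix y
      show "ennreal (norm (?k (y - u) - ?k y)) * indicator ?D y \<le> ennreal (norm (K (y - u) - K y)) * indicator ?D y
            + ennreal (4 * (\<rho> u / r)) * (ennreal (norm (K y)) * indicator ?D y)"
        using smooth_truncated_diff[OF e r(2), of y] r
        by (auto simp: indicator_def ennreal_mult''[symmetric] simp flip: ennreal_plus intro!: ennreal_leI)
    qed
    also have "... = l1_on ?D (\<lambda>y. K (y - u) - K y) + ennreal (4 * (\<rho> u / r)) * l1_on ?D K"
      by (subst nn_integral_add) (auto intro!: arg_cong2[of _ _ _ _ plus] nn_integral_cmult)
    also have "... \<le> ennreal (A * (\<rho> u / r) powr \<delta>) + ennreal (4 * (\<rho> u / r)) * ennreal A"
      using regular[OF r] size[OF r(1)] by (intro add_mono mult_left_mono) auto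
    also have "... = ennreal (A * (\<rho> u / r) powr \<delta> + 4 * (\<rho> u / r) * A)"
      using A_nonneg r by (simp add: ennreal_mult''[symmetric] flip: ennreal_plus)
    also have "... \<le> ennreal (5 * A * (\<rho> u / r) powr \<delta>)"
    proof (rule ennreal_leI)
      have "\<rho> u / r \<le> 1" using r nonneg[of u] by (simp add: divide_le_eq)
      then have "(\<rho> u / r) powr 1 \<le> (\<rho> u / r) powr \<delta>" using r delta by (intro powr_mono') auto
      then have "\<rho> u / r \<le> (\<rho> u / r) powr \<delta>" using r by simp
      then have "\<rho> u / r * A \<le> (\<rho> u / r) powr \<delta> * A" using A_nonneg by (rule mult_right_mono)
      then have "A * (\<rho> u / r) powr \<delta> + 4 * (\<rho> u / r * A) \<le> A * (\<rho> u / r) powr \<delta> + 4 * ((\<rho> u / r) powr \<delta> * A)" by linarith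
      also have "... = 5 * A * (\<rho> u / r) powr \<delta>" by algebra
      finally show "A * (\<rho> u / r) powr \<delta> + 4 * (\<rho> u / r) * A \<le> 5 * A * (\<rho> u / r) powr \<delta>" by (simp only: mult.assoc)
    qed
    finally show ?thesis .
  qed
qed (use A_nonneg R_pos delta in auto)

text \<open>Sharp and smooth truncation differ by a kernel of mass at most \<open>A\<close> carried
  by one annulus, so Young's inequality passes the uniform bound from the smooth truncation to the
  sharp one.\<close>

lemma l2_bound_truncated:
  assumes b: "0 < b" "b < \<delta>"
  obtains C :: real where "0 \<le> C"
    "\<And>e Q r f. 0 < e \<Longrightarrow> 0 \<le> r \<Longrightarrow> test_class b Q r f \<Longrightarrow>
      l2_sq (conv (truncated \<rho> K e) f) \<le> ennreal C * l2_sq f"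
proof -
  define M where "M = cz_kernel.op_bound (5 * A) R \<delta> b"
  have "l2_sq (conv (truncated \<rho> K e) f) \<le> ennreal (2 * M\<^sup>2 + 2 * A\<^sup>2) * l2_sq f"
    if e: "0 < e" and r: "0 \<le> r" and f: "test_class b Q r f" for e r Q f
  proof -
    let ?k = "smooth_truncated e" and ?d = "\<lambda>y. truncated \<rho> K e y - smooth_truncated e y"
    interpret s: cz_kernel \<rho> ?k "5 * A" R \<delta> "LINT y|lborel. ?k y" using e by (rule cz_kernel_smooth_truncated)
    have f_cont: "continuous_on UNIV f" using hoelder_continuous[OF test_classD(1)[OF f] b(1)] .
    have [measurable]: "f \<in> borel_measurable borel" using test_class_measurable[OF f b(1)] .
    have 1: "l2_sq (conv ?k f) \<le> ennreal (M\<^sup>2) * l2_sq f"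
      unfolding M_def using s.l2_bound_integrable[OF b integrable_smooth_truncated[OF e] refl f r] .
    have "(\<integral>\<^sup>+y. ennreal (norm (?d y)) \<partial>lborel) \<le> l1_on {y. e \<le> \<rho> y \<and> \<rho> y < 2 * e} K"
    proof (rule nn_integral_mono)
      fix y
      have "K y - smooth_truncated e y = of_real (1 - min 1 (max 0 (\<rho> y / e - 1))) * K y" by (simp add: smooth_truncated_def algebra_simps)
      then have "norm (K y - smooth_truncated e y) = \<bar>1 - min 1 (max 0 (\<rho> y / e - 1))\<bar> * norm (K y)" by (simp only: norm_mult norm_of_real)
      also have "... \<le> 1 * norm (K y)" by (rule mult_right_mono) auto
      finally show "ennreal (norm (?d y)) \<le> ennreal (norm (K y)) * indicator {y. e \<le> \<rho> y \<and> \<rho> y < 2 * e} y"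
        using smooth_truncated_eq[OF e, of y] smooth_truncated_eq_0[OF e, of y]
        by (auto simp: truncated_def indicator_def intro!: ennreal_leI)
    qed
    also have "... \<le> ennreal A" using size[OF e] .
    finally have "l2_sq (conv ?d f) \<le> (ennreal A)\<^sup>2 * l2_sq f" by (intro order_trans[OF young_l2] mult_right_mono power_mono) auto
    then have 2: "l2_sq (conv ?d f) \<le> ennreal (A\<^sup>2) * l2_sq f" using A_nonneg by (simp add: ennreal_power)
    have "conv (truncated \<rho> K e) f x = conv ?k f x + conv ?d f x" for x
    proof -
      have "integrable lborel (\<lambda>y. truncated \<rho> K e y * f (x - y))"
        by (rule integrable_conv[OF integrable_truncated[OF e] truncated_support f_cont])
      moreover have "integrable lborel (\<lambda>y. ?k y * f (x - y))"
        by (rule integrable_conv[OF integrable_smooth_truncated[OF e] s.support f_cont])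
      ultimately show ?thesis by (simp add: conv_def left_diff_distrib)
    qed
    then have "l2_sq (conv (truncated \<rho> K e) f) = l2_sq (\<lambda>x. conv ?k f x + conv ?d f x)" by presburger
    also have "... \<le> 2 * l2_sq (conv ?k f) + 2 * l2_sq (conv ?d f)" by (intro l2_sq_add) measurable
    also have "... \<le> 2 * (ennreal (M\<^sup>2) * l2_sq f) + 2 * (ennreal (A\<^sup>2) * l2_sq f)" using 1 2 by (intro add_mono mult_left_mono) auto
    also have "... = ennreal (2 * M\<^sup>2 + 2 * A\<^sup>2) * l2_sq f" by (simp add: ennreal_mult' distrib_right mult.assoc)
    finally show ?thesis .
  qed
  moreover have "0 \<le> 2 * M\<^sup>2 + 2 * A\<^sup>2" by simp
  ultimately show ?thesis using that by blast
qed

end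

section \<open>Local Hoelder regularity and cut-offs\<close>

context length_function begin

text \<open>Common ground of the Hoelder and the composite spaces. A kernel of compact support sees
  \<open>f\<close> only near x, so constants that depend on the region suffice for pointwise
  convergence of the truncated integrals, and cutting off leads to the test class.\<close>

definition local_hoelder :: "real \<Rightarrow> ('v \<Rightarrow> complex) \<Rightarrow> bool" where
  "local_hoelder b f \<longleftrightarrow> continuous_on UNIV f \<and>
    (\<forall>s. \<exists>L. \<forall>x u. \<rho> x \<le> s \<longrightarrow> \<rho> u \<le> s \<longrightarrow> norm (f (x - u) - f x) \<le> L * \<rho> u powr b)"

lemma local_hoelderD:
  assumes "local_hoelder b f"
  obtains L where "0 \<le> L" "\<And>x u. \<rho> x \<le> s \<Longrightarrow> \<rho> u \<le> s \<Longrightarrow> norm (f (x - u) - f x) \<le> L * \<rho> u powr b"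
proof -
  obtain L where L: "\<And>x u. \<rho> x \<le> s \<Longrightarrow> \<rho> u \<le> s \<Longrightarrow> norm (f (x - u) - f x) \<le> L * \<rho> u powr b" using assms unfolding local_hoelder_def by meson
  have "norm (f (x - u) - f x) \<le> \<bar>L\<bar> * \<rho> u powr b" if "\<rho> x \<le> s" "\<rho> u \<le> s" for x u
    by (rule order_trans[OF L[OF that]]) (intro mult_right_mono, auto)
  then show ?thesis using that[of "\<bar>L\<bar>"] by simp
qed

lemma local_hoelder_mono:
  assumes f: "local_hoelder b f" and b: "0 < b'" "b' \<le> b"
  shows "local_hoelder b' f" unfolding local_hoelder_def
proof (intro conjI allI)
  show "continuous_on UNIV f" using f by (simp add: local_hoelder_def)
  fix s
  obtain L where L: "0 \<le> L" "\<And>x u. \<rho> x \<le> s \<Longrightarrow> \<rho> u \<le> s \<Longrightarrow> norm (f (x - u) - f x) \<le> L * \<rho> u powr b" using local_hoelderD[OF f] by metis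
  have "norm (f (x - u) - f x) \<le> L * s powr (b - b') * \<rho> u powr b'" if "\<rho> x \<le> s" "\<rho> u \<le> s" for x u
  proof -
    have "\<rho> u powr b = \<rho> u powr (b - b') * \<rho> u powr b'" by (simp flip: powr_add)
    also have "... \<le> s powr (b - b') * \<rho> u powr b'" using that b by (intro mult_right_mono powr_mono2) auto
    finally have "L * \<rho> u powr b \<le> L * (s powr (b - b') * \<rho> u powr b')" using L(1) by (rule mult_left_mono)
    with L(2)[OF that] show ?thesis by (simp add: mult.assoc)
  qed
  then show "\<exists>L. \<forall>x u. \<rho> x \<le> s \<longrightarrow> \<rho> u \<le> s \<longrightarrow> norm (f (x - u) - f x) \<le> L * \<rho> u powr b'" by blast
qed

definition cutoff :: "real \<Rightarrow> 'v \<Rightarrow> real" where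
  "cutoff s x = min 1 (max 0 (2 - \<rho> x / s))"

lemma cutoff_bounds: "0 \<le> cutoff s x" "cutoff s x \<le> 1" by (auto simp: cutoff_def)

lemma cutoff_eq_1: "0 < s \<Longrightarrow> \<rho> x \<le> s \<Longrightarrow> cutoff s x = 1" by (auto simp: cutoff_def min_def max_def field_simps)

lemma cutoff_eq_0: "0 < s \<Longrightarrow> 2 * s \<le> \<rho> x \<Longrightarrow> cutoff s x = 0" by (auto simp: cutoff_def min_def max_def field_simps)

lemma cutoff_diff: "0 < s \<Longrightarrow> \<bar>cutoff s (x - u) - cutoff s x\<bar> \<le> \<rho> u / s"
proof -
  assume s: "0 < s"
  have "\<bar>\<rho> (x - u) - \<rho> x\<bar> \<le> \<rho> u" using diff_ge[of x u] triangle_diff[of x u] by linarith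
  then have "\<bar>\<rho> (x - u) / s - \<rho> x / s\<bar> \<le> \<rho> u / s" using s by (simp add: divide_right_mono flip: diff_divide_distrib)
  then show ?thesis unfolding cutoff_def by linarith
qed

lemma cutoff_test_class:
  assumes f: "local_hoelder b f" and b: "0 < b" "b \<le> 1" and s: "0 < s"
  obtains Q where "test_class b Q (2 * s) (\<lambda>x. of_real (cutoff s x) * f x)"
proof -
  let ?g = "\<lambda>x. of_real (cutoff s x) * f x"
  have cont: "continuous_on UNIV f" using f by (simp add: local_hoelder_def)
  \<comment> \<open>The radius 6s: the cut-off vanishes for \<rho> \<ge> 2s, so if \<rho> u \<le> 4s
    and \<rho> x > 6s then it vanishes at both \<open>x\<close> and \<open>x - u\<close>.\<close>
  obtain B where B: "0 \<le> B" "\<And>y. \<rho> y \<le> 6 * s \<Longrightarrow> norm (f y) \<le> B" using bounded_on_cball[OF cont] by metis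
  obtain L where L: "0 \<le> L"
    "\<And>x u. \<rho> x \<le> 6 * s \<Longrightarrow> \<rho> u \<le> 6 * s \<Longrightarrow> norm (f (x - u) - f x) \<le> L * \<rho> u powr b" using local_hoelderD[OF f] by metis
  \<comment> \<open>\<open>D\<close> serves twice: \<open>D * \<rho> u powr b\<close> dominates B
    \<rho> u / s for \<rho> u \<le> 4s, and for larger u it is at least
    \<open>D * (4 * s) powr b\<close>, which is 4B and exceeds the trivial bound 2B.\<close>
  define D where "D = 4 * B / (4 * s) powr b"
  have D: "0 \<le> D" using B by (simp add: D_def)
  define Q where "Q = B + L + D"
  have bound: "norm (?g x) \<le> B" for x
  proof (cases "\<rho> x \<le> 6 * s")
    case True
    have "norm (?g x) \<le> 1 * B" unfolding norm_mult using B True cutoff_bounds[of s x] by (intro mult_mono) auto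
    then show ?thesis by simp
  next
    case False
    then have "cutoff s x = 0" using s by (intro cutoff_eq_0) auto
    then show ?thesis using B by simp
  qed
  have h: "norm (?g (x - u) - ?g x) \<le> (L + D) * \<rho> u powr b" for x u
  proof (cases "\<rho> u \<le> 4 * s")
    case u: True
    show ?thesis
    proof (cases "\<rho> x \<le> 6 * s")
      case True
      have "\<rho> u / s \<le> 4 * (\<rho> u / (4 * s)) powr b"
      proof -
        have "(\<rho> u / (4 * s)) powr 1 \<le> (\<rho> u / (4 * s)) powr b" using u s b by (intro powr_mono') auto
        then show ?thesis using s by simp
      qed
      then have "B * (\<rho> u / s) \<le> B * (4 * (\<rho> u / (4 * s)) powr b)" using B(1) by (rule mult_left_mono)
      then have D1: "\<rho> u / s * B \<le> D * \<rho> u powr b" using s by (simp add: D_def powr_divide mult_ac)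
      have "?g (x - u) - ?g x = of_real (cutoff s (x - u)) * (f (x - u) - f x) + of_real (cutoff s (x - u) - cutoff s x) * f x"
        by (simp add: algebra_simps)
      also have "norm ... \<le> 1 * (L * \<rho> u powr b) + \<rho> u / s * B"
      proof (intro norm_triangle_le add_mono)
        show "norm (of_real (cutoff s (x - u)) * (f (x - u) - f x)) \<le> 1 * (L * \<rho> u powr b)"
          unfolding norm_mult using L True u s cutoff_bounds[of s "x - u"] by (intro mult_mono) auto
        show "norm (of_real (cutoff s (x - u) - cutoff s x) * f x) \<le> \<rho> u / s * B"
          unfolding norm_mult norm_of_real using cutoff_diff[OF s] B True s by (intro mult_mono) auto
      qed
      finally show ?thesis using D1 by (simp add: distrib_right)
    next
      case False
      then have "2 * s \<le> \<rho> (x - u)" "2 * s \<le> \<rho> x" using diff_ge[of x u] u s by linarith+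
      then have "cutoff s (x - u) = 0" "cutoff s x = 0" using s by (auto intro: cutoff_eq_0)
      then show ?thesis using L D by simp
    qed
  next
    case False
    have "norm (?g (x - u) - ?g x) \<le> 2 * B" using norm_triangle_ineq4[of "?g (x - u)" "?g x"] bound[of x] bound[of "x - u"] by linarith
    also have "2 * B \<le> D * (4 * s) powr b" using s B by (simp add: D_def)
    also have "... \<le> D * \<rho> u powr b" using False s b D by (intro mult_left_mono powr_mono2) auto
    also have "... \<le> (L + D) * \<rho> u powr b" using L by (intro mult_right_mono) auto
    finally show ?thesis .
  qed
  have "hoelder b Q ?g" unfolding hoelder_def
  proof (intro allI)
    fix x u
    have "(L + D) * \<rho> u powr b \<le> Q * \<rho> u powr b" using B by (intro mult_right_mono) (auto simp: Q_def)
    with h[of x u] show "norm (?g (x - u) - ?g x) \<le> Q * \<rho> u powr b" by linarith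
  qed
  moreover have "norm (?g x) \<le> Q" for x using bound[of x] L D by (simp add: Q_def)
  moreover have "2 * s \<le> \<rho> x \<Longrightarrow> ?g x = 0" for x using s cutoff_eq_0 by simp
  ultimately have "test_class b Q (2 * s) ?g" unfolding test_class_def by blast
  then show ?thesis by (rule that)
qed

lemma test_class_diff:
  assumes f: "test_class b Q r f" and g: "test_class b Q' r' g"
  shows "test_class b (Q + Q') (max r r') (\<lambda>x. f x - g x)" unfolding test_class_def hoelder_def
proof (intro conjI allI impI)
  fix x u
  have "f (x - u) - g (x - u) - (f x - g x) = (f (x - u) - f x) - (g (x - u) - g x)" by simp
  also have "norm ... \<le> Q * \<rho> u powr b + Q' * \<rho> u powr b"
    using hoelderD[OF test_classD(1)[OF f], of x u] hoelderD[OF test_classD(1)[OF g], of x u]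
      norm_triangle_ineq4[of "f (x - u) - f x" "g (x - u) - g x"] by linarith
  finally show "norm (f (x - u) - g (x - u) - (f x - g x)) \<le> (Q + Q') * \<rho> u powr b" by (simp add: distrib_right)
next
  fix x show "norm (f x - g x) \<le> Q + Q'"
    using test_classD(2)[OF f, of x] test_classD(2)[OF g, of x] by (intro norm_triangle_le_diff add_mono)
next
  fix x assume "max r r' \<le> \<rho> x"
  then show "f x - g x = 0" using test_classD(3)[OF f, of x] test_classD(3)[OF g, of x] by simp
qed

end

lemma ennreal_tendsto_0I:
  fixes F :: "'a \<Rightarrow> ennreal"
  assumes "\<And>e::real. 0 < e \<Longrightarrow> eventually (\<lambda>x. F x \<le> ennreal e) G"
  shows "(F \<longlongrightarrow> 0) G"
proof (rule order_tendstoI)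
  fix a :: ennreal assume "0 < a"
  then obtain b where b: "0 < b" "b < a" using dense by blast
  then obtain e where e: "b = ennreal e" "0 < e" by (cases b) (auto simp: top_unique)
  show "eventually (\<lambda>x. F x < a) G" using assms[OF e(2)] by (rule eventually_mono) (use b(2) e in auto)
qed simp

section \<open>Convergence of the truncated integrals to the operator\<close>

context cz_kernel begin

text \<open>The difference consists of the part of the absolutely convergent integral over \<rho> y
  < e and of f(x) times the deviation of the truncated integral of \<open>K\<close> from
  \<open>c\<close>. An explicit bound is kept because it is used pointwise and also uniformly in
  x.\<close>

lemma conv_truncated_sub_cz_op:
  assumes b: "0 < b" and L: "0 \<le> L" and f: "continuous_on UNIV f"
    and h: "\<And>y. \<rho> y < R \<Longrightarrow> norm (f (x - y) - f x) \<le> L * \<rho> y powr b"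
    and e: "0 < e" "e \<le> R"
  shows "norm (conv (truncated \<rho> K e) f x - cz_op K c f x)
    \<le> L * A * e powr b / (1 - 1 / 2 powr b) + norm ((LINT y|lborel. truncated \<rho> K e y) - c) * norm (f x)"
proof -
  have [measurable]: "f \<in> borel_measurable borel" using f by (rule borel_measurable_continuous_onI)
  let ?k = "truncated \<rho> K e" and ?n = "\<lambda>y. if \<rho> y < e then K y else 0"
  have kint: "integrable lborel ?k" using e(1) by (rule integrable_truncated)
  have kf: "integrable lborel (\<lambda>y. ?k y * f (x - y))" by (rule integrable_conv[OF kint truncated_support f])
  have "(\<integral>\<^sup>+y. ennreal (norm (?n y * (f (x - y) - f x))) \<partial>lborel) = l1_on {y. \<rho> y < e} (\<lambda>y. K y * (f (x - y) - f x))"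
    by (intro nn_integral_cong) (auto simp: indicator_def)
  also have "... \<le> ennreal (L * A * e powr b / (1 - 1 / 2 powr b))" using h e by (intro nn_integral_K_Hoelder[OF b e(1) L]) auto
  finally have n: "(\<integral>\<^sup>+y. ennreal (norm (?n y * (f (x - y) - f x))) \<partial>lborel) \<le> ennreal (L * A * e powr b / (1 - 1 / 2 powr b))" .
  have nint: "integrable lborel (\<lambda>y. ?n y * (f (x - y) - f x))" using n by (rule integrable_bounded_nn[rotated]) measurable
  have n_le: "norm (LINT y|lborel. ?n y * (f (x - y) - f x)) \<le> L * A * e powr b / (1 - 1 / 2 powr b)"
    using n L A_nonneg one_div_2_powr_less[OF b] by (intro norm_integral_bounded_nn) auto
  have "(LINT y|lborel. K y * (f (x - y) - f x)) = (LINT y|lborel. ?n y * (f (x - y) - f x) + (?k y * f (x - y) - ?k y * f x))"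
    by (intro Bochner_Integration.integral_cong) (auto simp: truncated_def algebra_simps)
  also have "... = (LINT y|lborel. ?n y * (f (x - y) - f x)) + (conv ?k f x - (LINT y|lborel. ?k y) * f x)"
    unfolding conv_def using nint kf kint by simp
  finally have "conv ?k f x - cz_op K c f x = - (LINT y|lborel. ?n y * (f (x - y) - f x)) + ((LINT y|lborel. ?k y) - c) * f x"
    by (simp add: cz_op_def algebra_simps)
  moreover have "norm (((LINT y|lborel. ?k y) - c) * f x) = norm ((LINT y|lborel. ?k y) - c) * norm (f x)" by (rule norm_mult)
  ultimately show ?thesis
    using n_le norm_triangle_ineq[of "- (LINT y|lborel. ?n y * (f (x - y) - f x))" "((LINT y|lborel. ?k y) - c) * f x"] by simp
qed

lemma error_tendsto_0:
  assumes "0 < b"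
  shows "((\<lambda>e. L * A * e powr b / (1 - 1 / 2 powr b) + norm ((LINT y|lborel. truncated \<rho> K e y) - c) * M) \<longlongrightarrow> 0) (at_right 0)"
proof -
  have "((\<lambda>e::real. e powr b) \<longlongrightarrow> 0) (at_right 0)"
    using assms by (intro tendsto_zero_powrI[of _ _ _ b] tendsto_ident_at tendsto_const)
      (auto simp: eventually_at_right_field intro!: exI[of _ 1])
  moreover have "((\<lambda>e. norm ((LINT y|lborel. truncated \<rho> K e y) - c)) \<longlongrightarrow> 0) (at_right 0)"
    using tendsto by (simp add: tendsto_norm_zero_iff LIM_zero_iff)
  ultimately have "((\<lambda>e. L * A * e powr b * (1 / (1 - 1 / 2 powr b)) + norm ((LINT y|lborel. truncated \<rho> K e y) - c) * M) \<longlongrightarrow> 0) (at_right 0)"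
    by (intro tendsto_add_zero tendsto_mult_left_zero tendsto_mult_right_zero)
  then show ?thesis by simp
qed

lemma conv_truncated_tendsto:
  assumes f: "local_hoelder b f" and b: "0 < b"
  shows "((\<lambda>e. conv (truncated \<rho> K e) f x) \<longlongrightarrow> cz_op K c f x) (at_right 0)"
proof -
  have cont: "continuous_on UNIV f" using f by (simp add: local_hoelder_def)
  obtain L where L: "0 \<le> L" "\<And>z u. \<rho> z \<le> max R (\<rho> x) \<Longrightarrow> \<rho> u \<le> max R (\<rho> x) \<Longrightarrow>
      norm (f (z - u) - f z) \<le> L * \<rho> u powr b" using local_hoelderD[OF f] by metis
  have "((\<lambda>e. conv (truncated \<rho> K e) f x - cz_op K c f x) \<longlongrightarrow> 0) (at_right 0)"
  proof (rule Lim_null_comparison[OF _ error_tendsto_0[OF b, of L "norm (f x)"]])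
    show "\<forall>\<^sub>F e in at_right 0. norm (conv (truncated \<rho> K e) f x - cz_op K c f x)
      \<le> L * A * e powr b / (1 - 1 / 2 powr b) + norm ((LINT y|lborel. truncated \<rho> K e y) - c) * norm (f x)"
      unfolding eventually_at_right_field
    proof (intro exI conjI allI impI)
      fix e assume "0 < e" "e < R"
      then show "norm (conv (truncated \<rho> K e) f x - cz_op K c f x)
        \<le> L * A * e powr b / (1 - 1 / 2 powr b) + norm ((LINT y|lborel. truncated \<rho> K e y) - c) * norm (f x)"
        using L by (intro conv_truncated_sub_cz_op[OF b L(1) cont]) auto
    qed (rule R_pos)
  qed
  then show ?thesis by (simp add: LIM_zero_iff)
qed

lemma inverse_Suc_at_right: "filterlim (\<lambda>n. 1 / real (Suc n)) (at_right 0) sequentially"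
  unfolding filterlim_at using LIMSEQ_inverse_real_of_nat by (simp add: inverse_eq_divide)

lemma cz_op_measurable:
  assumes f: "local_hoelder b f" and b: "0 < b"
  shows "cz_op K c f \<in> borel_measurable borel"
proof (rule borel_measurable_LIMSEQ_metric)
  have [measurable]: "f \<in> borel_measurable borel" using f by (intro borel_measurable_continuous_onI) (simp add: local_hoelder_def)
  show "conv (truncated \<rho> K (1 / real (Suc n))) f \<in> borel_measurable borel" for n by measurable
  show "(\<lambda>n. conv (truncated \<rho> K (1 / real (Suc n))) f x) \<longlonglongrightarrow> cz_op K c f x" for x
    using filterlim_compose[OF conv_truncated_tendsto[OF f b] inverse_Suc_at_right] .
qed

text \<open>For a test function the pointwise error is uniform in x and lives in the fixed ball of
  radius r + R, so uniform convergence gives convergence in L2.\<close>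

lemma l2_truncation_error_tendsto:
  assumes b: "0 < b" "b < \<delta>" and g: "test_class b Q r g" and r: "0 \<le> r"
  shows "((\<lambda>e. l2_sq (\<lambda>x. conv (truncated \<rho> K e) g x - cz_op K c g x)) \<longlongrightarrow> 0) (at_right 0)"
proof -
  let ?w = "\<lambda>e. Q * A * e powr b / (1 - 1 / 2 powr b) + norm ((LINT y|lborel. truncated \<rho> K e y) - c) * Q"
  define m where "m = measure lborel {x. \<rho> x < r + R}"
  have m: "emeasure lborel {x. \<rho> x < r + R} = ennreal m"
    unfolding m_def using emeasure_ball_finite[of "r + R"] by (intro emeasure_eq_ennreal_measure) auto
  have Q: "0 \<le> Q" using hoelder_nonneg[OF test_classD(1)[OF g]] .
  have le: "l2_sq (\<lambda>x. conv (truncated \<rho> K e) g x - cz_op K c g x) \<le> ennreal ((?w e)\<^sup>2 * m)"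
    if e: "0 < e" "e < R" for e
  proof -
    have 1: "norm (conv (truncated \<rho> K e) g x - cz_op K c g x) \<le> ?w e" for x
    proof -
      have "norm (conv (truncated \<rho> K e) g x - cz_op K c g x)
          \<le> Q * A * e powr b / (1 - 1 / 2 powr b) + norm ((LINT y|lborel. truncated \<rho> K e y) - c) * norm (g x)"
        using e hoelderD[OF test_classD(1)[OF g]] hoelder_continuous[OF test_classD(1)[OF g] b(1)]
        by (intro conv_truncated_sub_cz_op[OF b(1) Q]) auto
      also have "... \<le> ?w e" using test_classD(2)[OF g] by (intro add_left_mono mult_left_mono) auto
      finally show ?thesis .
    qed
    have 2: "conv (truncated \<rho> K e) g x - cz_op K c g x = 0" if x: "r + R \<le> \<rho> x" for x
    proof -
      have "truncated \<rho> K e y * g (x - y) = 0" for y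
      proof (cases "R \<le> \<rho> y")
        case False
        then have "r \<le> \<rho> (x - y)" using diff_ge[of x y] x by linarith
        then show ?thesis using test_classD(3)[OF g] by simp
      qed (simp add: truncated_support)
      then have "conv (truncated \<rho> K e) g x = 0" by (simp only: conv_def) simp
      moreover have "cz_op K c g x = 0" using test_classD(3)[OF cz_op_test_class[OF b g] x] .
      ultimately show ?thesis by simp
    qed
    have "l2_sq (\<lambda>x. conv (truncated \<rho> K e) g x - cz_op K c g x) \<le> ennreal ((?w e)\<^sup>2) * emeasure lborel {x. \<rho> x < r + R}"
      using 1 2 by (rule l2_sq_bounded_support)
    then show ?thesis unfolding m ennreal_mult'[OF zero_le_power2] .
  qed
  have "((\<lambda>e. (?w e)\<^sup>2 * m) \<longlongrightarrow> 0\<^sup>2 * m) (at_right 0)" by (intro tendsto_mult tendsto_power tendsto_const error_tendsto_0[OF b(1)])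
  then have "((\<lambda>e. ennreal ((?w e)\<^sup>2 * m)) \<longlongrightarrow> 0) (at_right 0)" using tendsto_ennrealI[of "\<lambda>e. (?w e)\<^sup>2 * m" "0\<^sup>2 * m"] by simp
  then show ?thesis by (rule tendsto_sandwich[OF _ _ tendsto_const, rotated 2]) (use le R_pos in \<open>auto simp: eventually_at_right_field\<close>)
qed


end

lemma l2_sq_limit_le:
  assumes "\<And>n. F n \<in> borel_measurable borel" and lim: "\<And>x. (\<lambda>n. F n x) \<longlonglongrightarrow> G x" and le: "\<And>n. l2_sq (F n) \<le> B"
  shows "l2_sq G \<le> B"
proof -
  have [measurable]: "F n \<in> borel_measurable borel" for n by fact
  have "ennreal ((norm (G x))\<^sup>2) = liminf (\<lambda>n. ennreal ((norm (F n x))\<^sup>2))" for x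
    by (rule lim_imp_Liminf[symmetric]) (auto intro!: tendsto_ennrealI tendsto_power tendsto_norm lim)
  then have "l2_sq G = (\<integral>\<^sup>+x. liminf (\<lambda>n. ennreal ((norm (F n x))\<^sup>2)) \<partial>lborel)" by (simp add: l2_sq_def)
  also have "... \<le> liminf (\<lambda>n. l2_sq (F n))" unfolding l2_sq_def by (rule nn_integral_liminf) measurable
  also have "... \<le> liminf (\<lambda>n. B)" using le by (intro Liminf_mono) auto
  also have "... = B" by (simp add: Liminf_const)
  finally show ?thesis .
qed

lemma (in length_function) l2_tail_tendsto:
  assumes f: "f \<in> L2"
  shows "(\<lambda>n. l2_sq (\<lambda>x. if real n \<le> \<rho> x then f x else 0)) \<longlonglongrightarrow> 0"
proof -
  have [measurable]: "f \<in> borel_measurable borel" using f by (simp add: L2_iff)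
  have "(\<lambda>n. \<integral>\<^sup>+x. ennreal ((norm (if real n \<le> \<rho> x then f x else 0))\<^sup>2) \<partial>lborel)
      \<longlonglongrightarrow> (\<integral>\<^sup>+x. 0 \<partial>(lborel :: 'v measure))"
  proof (rule nn_integral_dominated_convergence)
    show "(\<integral>\<^sup>+x. ennreal ((norm (f x))\<^sup>2) \<partial>lborel) < \<infinity>" using f by (simp add: L2_iff l2_sq_def)
    have "(\<lambda>n. ennreal ((norm (if real n \<le> \<rho> x then f x else 0))\<^sup>2)) \<longlonglongrightarrow> 0" for x
    proof (rule tendsto_eventually)
      obtain N :: nat where N: "\<rho> x < real N" using reals_Archimedean2 by blast
      have "\<forall>n\<ge>N. ennreal ((norm (if real n \<le> \<rho> x then f x else 0))\<^sup>2) = 0" using N by auto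
      then show "\<forall>\<^sub>F n in sequentially. ennreal ((norm (if real n \<le> \<rho> x then f x else 0))\<^sup>2) = 0" unfolding eventually_sequentially by blast
    qed
    then show "AE x in lborel. (\<lambda>n. ennreal ((norm (if real n \<le> \<rho> x then f x else 0))\<^sup>2)) \<longlonglongrightarrow> 0" by simp
  qed (auto simp: intro!: AE_I2)
  then show ?thesis by (simp add: l2_sq_def)
qed

lemma (in length_function) test_class_local_hoelder:
  assumes "test_class b Q r f" "0 < b" shows "local_hoelder b f"
  using hoelderD[OF test_classD(1)[OF assms(1)]] hoelder_continuous[OF test_classD(1)[OF assms(1)] assms(2)]
  unfolding local_hoelder_def by blast

lemma pv_limit_unique:
  assumes [measurable]: "K \<in> borel_measurable borel" "f \<in> borel_measurable borel"
    and g: "pv_limit \<rho> K f g" and g': "pv_limit \<rho> K f g'" and [measurable]: "\<rho> \<in> borel_measurable borel"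
  shows "AE x in lborel. g x = g' x"
proof -
  have [measurable]: "g \<in> borel_measurable borel" "g' \<in> borel_measurable borel" using g g' by (simp_all add: pv_limit_def L2_iff)
  have [measurable]: "trunc_op \<rho> K e f \<in> borel_measurable borel" for e
  proof -
    have "truncated \<rho> K e \<in> borel_measurable borel" unfolding truncated_def by measurable
    then show ?thesis unfolding trunc_op_eq_conv by measurable
  qed
  let ?F = "\<lambda>g e. l2_sq (\<lambda>x. trunc_op \<rho> K e f x - g x)"
  have "(?F g \<longlongrightarrow> 0) (at_right 0)" "(?F g' \<longlongrightarrow> 0) (at_right 0)" using g g' by (simp_all add: pv_limit_def l2_sq_def)
  then have "((\<lambda>e. 2 * ?F g' e + 2 * ?F g e) \<longlongrightarrow> 2 * 0 + 2 * 0) (at_right 0)" by (intro tendsto_add ennreal_tendsto_cmult) auto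
  then have lim: "((\<lambda>e. 2 * ?F g' e + 2 * ?F g e) \<longlongrightarrow> 0) (at_right 0)" by simp
  have le: "l2_sq (\<lambda>x. g x - g' x) \<le> 2 * ?F g' e + 2 * ?F g e" for e
    using l2_sq_diff[of "\<lambda>x. trunc_op \<rho> K e f x - g' x" "\<lambda>x. trunc_op \<rho> K e f x - g x"] by simp
  have "l2_sq (\<lambda>x. g x - g' x) \<le> 0" using tendsto_lowerbound[OF lim always_eventually] le by simp
  then have "l2_sq (\<lambda>x. g x - g' x) = 0" by simp
  then have "AE x in lborel. ennreal ((norm (g x - g' x))\<^sup>2) = 0" unfolding l2_sq_def by (subst (asm) nn_integral_0_iff_AE) auto
  then show ?thesis by eventually_elim auto
qed

section \<open>Existence of the principal value in L2\<close>

context cz_kernel begin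

lemma l2_sq_conv_truncated_finite:
  assumes e: "0 < e" and f: "f \<in> L2"
  shows "l2_sq (conv (truncated \<rho> K e) f) < \<infinity>"
proof -
  have [measurable]: "f \<in> borel_measurable borel" using f by (simp add: L2_iff)
  have "(\<integral>\<^sup>+y. ennreal (norm (truncated \<rho> K e y)) \<partial>lborel) < \<infinity>" using integrable_truncated[OF e] by (simp add: integrable_iff_bounded)
  then show ?thesis
    using young_l2[of "truncated \<rho> K e" f] f by (auto simp: L2_iff ennreal_mult_less_top power_less_top_ennreal intro: le_less_trans)
qed

text \<open>The cut-offs \<open>g n\<close> of \<open>f\<close> are test functions, for which the
  limit is already known. The uniform bound is available on test functions only, hence for f - g n
  it is obtained by Fatou: the test functions \<open>h N\<close> converge to f - g n, and
  simultaneously a second truncation at 1/(N + 1) turns the truncated operator into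
  \<open>cz_op\<close>. The resulting bound involves only the L2 tail of \<open>f\<close> and is
  uniform in the truncation radius.\<close>

theorem pv_limit_cz_op:
  assumes f: "f \<in> L2" and fh: "local_hoelder \<beta>0 f" and \<beta>0: "0 < \<beta>0"
  shows "pv_limit \<rho> K f (cz_op K c f)"
proof -
  define \<beta> where "\<beta> = min \<beta>0 \<delta> / 2"
  have \<beta>: "0 < \<beta>" "\<beta> < \<delta>" "\<beta> \<le> \<beta>0" "\<beta> \<le> 1" using \<beta>0 delta by (auto simp: \<beta>_def)
  have lh: "local_hoelder \<beta> f" using local_hoelder_mono[OF fh \<beta>(1,3)] .
  have cont: "continuous_on UNIV f" using lh by (simp add: local_hoelder_def)
  have [measurable]: "f \<in> borel_measurable borel" using f by (simp add: L2_iff)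
  have [measurable]: "cz_op K c f \<in> borel_measurable borel" using cz_op_measurable[OF lh \<beta>(1)] .
  obtain C where C: "0 \<le> C" and C_bound: "\<And>\<epsilon> Q r f. 0 < \<epsilon> \<Longrightarrow> 0 \<le> r \<Longrightarrow> test_class \<beta> Q r f \<Longrightarrow>
      l2_sq (conv (truncated \<rho> K \<epsilon>) f) \<le> ennreal C * l2_sq f" using l2_bound_truncated[OF \<beta>(1,2)] by metis
  define tail where "tail = (\<lambda>n. l2_sq (\<lambda>x. if real n \<le> \<rho> x then f x else 0))"
  define g where "g = (\<lambda>n x. of_real (cutoff (real n) x) * f x)"
  have g_class: "\<exists>Q. test_class \<beta> Q (2 * real n) (g n)" if "0 < n" for n :: nat
    using cutoff_test_class[OF lh \<beta>(1,4), of "real n"] that unfolding g_def by auto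
  let ?T = "cz_op K c" and ?k = "truncated \<rho> K"
  have tail_bound: "l2_sq (\<lambda>x. (conv (?k \<epsilon>) f x - conv (?k \<epsilon>) (g n) x) - (?T f x - ?T (g n) x))
      \<le> 4 * ennreal C * tail n" if \<epsilon>: "0 < \<epsilon>" and n: "0 < n" for \<epsilon> n
  proof (rule l2_sq_limit_le)
    define h where "h = (\<lambda>N x. g (N + n) x - g n x)"
    have h_class: "\<exists>Q r. 0 \<le> r \<and> test_class \<beta> Q r (h N)" for N
    proof -
      obtain Q Q' where "test_class \<beta> Q (2 * real (N + n)) (g (N + n))" "test_class \<beta> Q' (2 * real n) (g n)"
        using g_class[of "N + n"] g_class[OF n] n by auto
      from test_class_diff[OF this] show ?thesis unfolding h_def
        by (intro exI[of _ "Q + Q'"] exI[of _ "max (2 * real (N + n)) (2 * real n)"]) auto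
    qed
    have h_meas [measurable]: "h N \<in> borel_measurable borel" for N using h_class[of N] test_class_measurable \<beta>(1) by blast
    let ?F = "\<lambda>N x. conv (?k \<epsilon>) (h N) x - conv (?k (1 / real (Suc N))) (h N) x"
    show "?F N \<in> borel_measurable borel" for N by measurable
    have h_le: "l2_sq (h N) \<le> tail n" for N unfolding tail_def
    proof (rule l2_sq_mono)
      fix x
      have "h N x = of_real (cutoff (real (N + n)) x - cutoff (real n) x) * f x" by (simp add: h_def g_def algebra_simps)
      then have eq: "norm (h N x) = \<bar>cutoff (real (N + n)) x - cutoff (real n) x\<bar> * norm (f x)" by (simp only: norm_mult norm_of_real)
      show "norm (h N x) \<le> norm (if real n \<le> \<rho> x then f x else 0)"
      proof (cases "real n \<le> \<rho> x")
        case True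
        have "\<bar>cutoff (real (N + n)) x - cutoff (real n) x\<bar> \<le> 1"
          using cutoff_bounds[of "real (N + n)" x] cutoff_bounds[of "real n" x] by linarith
        then have "norm (h N x) \<le> 1 * norm (f x)" unfolding eq by (rule mult_right_mono) simp
        with True show ?thesis by simp
      next
        case False
        then show ?thesis using n eq cutoff_eq_1[of "real n" x] cutoff_eq_1[of "real (N + n)" x] by simp
      qed
    qed
    show "l2_sq (?F N) \<le> 4 * ennreal C * tail n" for N
    proof -
      have b: "l2_sq (conv (?k \<epsilon>') (h N)) \<le> ennreal C * tail n" if "0 < \<epsilon>'" for \<epsilon>'
      proof -
        obtain Q r where "0 \<le> r" "test_class \<beta> Q r (h N)" using h_class by blast
        from C_bound[OF that this] show ?thesis using mult_left_mono[OF h_le[of N], of "ennreal C"] by (auto intro: order_trans)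
      qed
      have "l2_sq (?F N) \<le> 2 * l2_sq (conv (?k \<epsilon>) (h N)) + 2 * l2_sq (conv (?k (1 / real (Suc N))) (h N))" by (intro l2_sq_diff) measurable
      also have "... \<le> 2 * (ennreal C * tail n) + 2 * (ennreal C * tail n)" using \<epsilon> by (intro add_mono mult_left_mono b) auto
      also have "... = 4 * ennreal C * tail n" by (simp add: mult.assoc flip: distrib_right)
      finally show ?thesis .
    qed
    fix x
    obtain Q where Q: "test_class \<beta> Q (2 * real n) (g n)" using g_class[OF n] by blast
    have gn_cont: "continuous_on UNIV (g n)" using hoelder_continuous[OF test_classD(1)[OF Q] \<beta>(1)] .
    have conv_h: "conv (?k \<epsilon>') (h N) x = conv (?k \<epsilon>') f x - conv (?k \<epsilon>') (g n) x"
      if N: "\<rho> x + R \<le> real N" and \<epsilon>': "0 < \<epsilon>'" for N \<epsilon>'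
    proof -
      have "?k \<epsilon>' y * h N (x - y) = ?k \<epsilon>' y * f (x - y) - ?k \<epsilon>' y * g n (x - y)" for y
      proof (cases "R \<le> \<rho> y")
        case False
        then have "\<rho> (x - y) \<le> real (N + n)" using N triangle_diff[of x y] by simp
        then have "cutoff (real (N + n)) (x - y) = 1" using n by (intro cutoff_eq_1) auto
        then have "g (N + n) (x - y) = f (x - y)" by (simp add: g_def)
        then show ?thesis by (simp add: h_def right_diff_distrib)
      qed (simp add: truncated_support)
      moreover have "integrable lborel (\<lambda>y. ?k \<epsilon>' y * f (x - y))"
        by (rule integrable_conv[OF integrable_truncated[OF \<epsilon>'] truncated_support cont])
      moreover have "integrable lborel (\<lambda>y. ?k \<epsilon>' y * g n (x - y))"
        by (rule integrable_conv[OF integrable_truncated[OF \<epsilon>'] truncated_support gn_cont])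
      ultimately show ?thesis by (simp add: conv_def)
    qed
    \<comment> \<open>Once N \<ge> \<rho> x + R, the cut-off \<open>g (N + n)\<close> agrees with
      \<open>f\<close> at every point the kernel reaches from x, so \<open>h N\<close> may be
      replaced by f - g n.\<close>
    obtain N0 :: nat where N0: "\<rho> x + R \<le> real N0" using real_arch_simple by blast
    have ev: "\<forall>\<^sub>F N in sequentially. (conv (?k \<epsilon>) f x - conv (?k \<epsilon>) (g n) x)
        - (conv (?k (1 / real (Suc N))) f x - conv (?k (1 / real (Suc N))) (g n) x) = ?F N x" unfolding eventually_sequentially
    proof (intro exI allI impI)
      fix N assume "N0 \<le> N"
      then have "\<rho> x + R \<le> real N" using N0 by simp
      then show "(conv (?k \<epsilon>) f x - conv (?k \<epsilon>) (g n) x)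
        - (conv (?k (1 / real (Suc N))) f x - conv (?k (1 / real (Suc N))) (g n) x) = ?F N x"
        using conv_h[of N \<epsilon>] conv_h[of N "1 / real (Suc N)"] \<epsilon> by simp
    qed
    have "(\<lambda>N. (conv (?k \<epsilon>) f x - conv (?k \<epsilon>) (g n) x)
        - (conv (?k (1 / real (Suc N))) f x - conv (?k (1 / real (Suc N))) (g n) x))
      \<longlonglongrightarrow> (conv (?k \<epsilon>) f x - conv (?k \<epsilon>) (g n) x) - (?T f x - ?T (g n) x)"
      by (intro tendsto_diff tendsto_const filterlim_compose[OF conv_truncated_tendsto[OF lh \<beta>(1)] inverse_Suc_at_right]
        filterlim_compose[OF conv_truncated_tendsto[OF test_class_local_hoelder[OF Q \<beta>(1)] \<beta>(1)] inverse_Suc_at_right])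
    then show "(\<lambda>N. ?F N x) \<longlonglongrightarrow> (conv (?k \<epsilon>) f x - conv (?k \<epsilon>) (g n) x) - (?T f x - ?T (g n) x)" using ev by (rule Lim_transform_eventually)
  qed
  have lim: "((\<lambda>\<epsilon>. l2_sq (\<lambda>x. conv (?k \<epsilon>) f x - ?T f x)) \<longlongrightarrow> 0) (at_right 0)"
  proof (rule ennreal_tendsto_0I)
    fix e :: real assume e: "0 < e"
    \<comment> \<open>The tail enters with the factor 2 times 4C; the added 1 covers C = 0.\<close>
    define e' where "e' = e / (2 * (8 * C + 1))"
    have e': "0 < e'" "(8 * C) * e' \<le> e / 2" using e C by (auto simp: e'_def field_simps)
    have "\<forall>\<^sub>F n in sequentially. tail n < ennreal e'"
      using l2_tail_tendsto[OF f] e'(1) unfolding tail_def by (intro order_tendstoD(2)[of _ 0]) auto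
    then have "\<forall>\<^sub>F n in sequentially. tail n < ennreal e' \<and> 0 < n" using eventually_gt_at_top by (rule eventually_conj)
    then obtain n where n: "tail n < ennreal e'" "0 < n" using eventually_happens'[OF sequentially_bot] by blast
    obtain Q where Q: "test_class \<beta> Q (2 * real n) (g n)" using g_class[OF n(2)] by blast
    have [measurable]: "g n \<in> borel_measurable borel" using test_class_measurable[OF Q \<beta>(1)] .
    have [measurable]: "?T (g n) \<in> borel_measurable borel" using cz_op_measurable[OF test_class_local_hoelder[OF Q \<beta>(1)] \<beta>(1)] .
    have "\<forall>\<^sub>F \<epsilon> in at_right 0. l2_sq (\<lambda>x. conv (?k \<epsilon>) (g n) x - ?T (g n) x) < ennreal (e / 4)"
      using l2_truncation_error_tendsto[OF \<beta>(1,2) Q] e by (intro order_tendstoD(2)[of _ 0]) auto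
    then have "\<forall>\<^sub>F \<epsilon> in at_right 0. l2_sq (\<lambda>x. conv (?k \<epsilon>) (g n) x - ?T (g n) x) < ennreal (e / 4) \<and> 0 < \<epsilon>"
      using eventually_at_right_less by (rule eventually_conj)
    then show "\<forall>\<^sub>F \<epsilon> in at_right 0. l2_sq (\<lambda>x. conv (?k \<epsilon>) f x - ?T f x) \<le> ennreal e"
    proof (rule eventually_mono, elim conjE)
      fix \<epsilon> :: real
      let ?d = "\<lambda>x. conv (?k \<epsilon>) (g n) x - ?T (g n) x"
      let ?h = "\<lambda>x. (conv (?k \<epsilon>) f x - conv (?k \<epsilon>) (g n) x) - (?T f x - ?T (g n) x)"
      assume 1: "l2_sq ?d < ennreal (e / 4)" and 2: "0 < \<epsilon>"
      have "l2_sq (\<lambda>x. conv (?k \<epsilon>) f x - ?T f x) = l2_sq (\<lambda>x. ?d x + ?h x)" by (rule arg_cong[of _ _ l2_sq]) (auto simp: algebra_simps)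
      also have "... \<le> 2 * l2_sq ?d + 2 * l2_sq ?h" by (intro l2_sq_add) measurable
      also have "... \<le> 2 * ennreal (e / 4) + 2 * (4 * ennreal C * ennreal e')"
        using 1 n tail_bound[OF 2 n(2)] by (intro add_mono mult_left_mono order_trans[OF tail_bound[OF 2 n(2)]]) auto
      also have "... = ennreal (e / 2 + (8 * C) * e')"
      proof -
        have "2 * ennreal (e / 4) = ennreal (e / 2)" using e by (simp flip: ennreal_numeral ennreal_mult')
        moreover have "2 * (4 * ennreal C * ennreal e') = ennreal ((8 * C) * e')"
          using C e' by (simp add: mult.assoc flip: ennreal_numeral ennreal_mult')
        ultimately show ?thesis using e C e' by (simp add: ennreal_plus)
      qed
      also have "... \<le> ennreal e" using e' by (intro ennreal_leI) linarith
      finally show "l2_sq (\<lambda>x. conv (?k \<epsilon>) f x - ?T f x) \<le> ennreal e" .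
    qed
  qed
  have "\<forall>\<^sub>F \<epsilon> in at_right 0. l2_sq (\<lambda>x. conv (?k \<epsilon>) f x - ?T f x) < 1 \<and> 0 < \<epsilon>"
    using order_tendstoD(2)[OF lim, of 1] eventually_at_right_less by (intro eventually_conj) auto
  then obtain \<epsilon> :: real where \<epsilon>: "l2_sq (\<lambda>x. conv (?k \<epsilon>) f x - ?T f x) < 1" "0 < \<epsilon>"
    using eventually_happens'[OF trivial_limit_at_right_real] by blast
  \<comment> \<open>T f belongs to L2 because one truncated operator maps \<open>f\<close> into L2
    by Young's inequality and differs from T f by a function in L2.\<close>
  have "l2_sq (?T f) = l2_sq (\<lambda>x. conv (?k \<epsilon>) f x - (conv (?k \<epsilon>) f x - ?T f x))" by simp
  also have "... \<le> 2 * l2_sq (conv (?k \<epsilon>) f) + 2 * l2_sq (\<lambda>x. conv (?k \<epsilon>) f x - ?T f x)" by (intro l2_sq_diff) measurable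
  also have "... < \<infinity>"
    using l2_sq_conv_truncated_finite[OF \<epsilon>(2) f] \<epsilon>(1) order_less_trans[OF \<epsilon>(1), of top] by (auto simp: ennreal_mult_less_top)
  finally have "?T f \<in> L2" by (simp add: L2_iff)
  with lim show ?thesis by (simp add: pv_limit_def trunc_op_eq_conv l2_sq_def)
qed

text \<open>\<open>pv_op\<close> chooses a representative that is determined only up to a null set;
  \<open>cz_op\<close> is an explicit one to compute with.\<close>

theorem pv_op_eq_cz_op:
  assumes f: "f \<in> L2" "local_hoelder b f" "0 < b"
  shows "pv_op \<rho> K f \<in> borel_measurable borel" "AE x in lborel. pv_op \<rho> K f x = cz_op K c f x"
proof -
  have pv: "pv_limit \<rho> K f (pv_op \<rho> K f)" unfolding pv_op_def using someI[of "pv_limit \<rho> K f", OF pv_limit_cz_op[OF f]] by simp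
  then show "pv_op \<rho> K f \<in> borel_measurable borel" by (simp add: pv_limit_def L2_iff)
  show "AE x in lborel. pv_op \<rho> K f x = cz_op K c f x"
    using f by (intro pv_limit_unique[OF K_measurable _ pv pv_limit_cz_op[OF f]]) (auto simp: L2_iff)
qed

end

section \<open>Schwartz functions\<close>

declare iter_deriv.simps(2) [simp del]

lemma iter_deriv_append: "iter_deriv vs (iter_deriv ws f) = iter_deriv (vs @ ws) f" by (induction vs) (simp_all add: iter_deriv.simps(2))

lemma schwartz_iter_deriv: "\<phi> \<in> schwartz \<Longrightarrow> iter_deriv vs \<phi> \<in> schwartz"
  unfolding schwartz_def smooth_on_def by (auto simp: iter_deriv_append)

lemma schwartz_has_derivative:
  assumes "\<phi> \<in> schwartz"
  shows "(\<phi> has_derivative (\<lambda>v. iter_deriv [v] \<phi> x)) (at x)"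
proof -
  have "iter_deriv [] \<phi> differentiable (at x)" using assms unfolding schwartz_def smooth_on_def by blast
  then have "\<phi> differentiable (at x)" by simp
  then show ?thesis by (simp add: iter_deriv.simps(2) frechet_derivative_works[symmetric])
qed

lemma schwartz_continuous: "\<phi> \<in> schwartz \<Longrightarrow> continuous_on UNIV \<phi>"
  by (meson schwartz_has_derivative continuous_at_imp_continuous_on has_derivative_continuous)

lemma schwartz_measurable: "\<phi> \<in> schwartz \<Longrightarrow> \<phi> \<in> borel_measurable borel" by (intro borel_measurable_continuous_onI schwartz_continuous)

lemma schwartz_decay:
  assumes "\<phi> \<in> schwartz"
  obtains B where "0 \<le> B" "\<And>x. norm (\<phi> x) \<le> B / (1 + norm x) ^ N"
proof -
  obtain B where B: "\<And>x. (1 + norm x) ^ N * norm (iter_deriv [] \<phi> x) \<le> B" using assms unfolding schwartz_def by blast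
  have "0 \<le> B" using order_trans[OF _ B[of 0]] by simp
  moreover have "norm (\<phi> x) \<le> B / (1 + norm x) ^ N" for x
  proof -
    have "0 < (1 + norm x) ^ N" by (intro zero_less_power) (simp add: add_pos_nonneg)
    then show ?thesis using B[of x] by (simp add: pos_le_divide_eq mult.commute)
  qed
  ultimately show ?thesis by (rule that)
qed

text \<open>Mean value inequality on the segment from x - y to x: its points z satisfy |x| \<le> |z|
  + S, so decay of the derivatives at z is decay in x up to the factor (1 + S)^N.\<close>

lemma schwartz_increment:
  fixes \<phi> :: "'v::euclidean_space \<Rightarrow> complex"
  assumes \<phi>: "\<phi> \<in> schwartz" and S: "0 \<le> S"
  obtains B where "0 \<le> B" "\<And>x y. norm y \<le> S \<Longrightarrow> norm (\<phi> (x - y) - \<phi> x) \<le> B * norm y / (1 + norm x) ^ N"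
proof -
  have "\<exists>B. 0 \<le> B \<and> (\<forall>x. norm (iter_deriv [b] \<phi> x) \<le> B / (1 + norm x) ^ N)" for b
    using schwartz_decay[OF schwartz_iter_deriv[OF \<phi>]] by metis
  then obtain D where D: "\<And>b. 0 \<le> D b" "\<And>b x. norm (iter_deriv [b] \<phi> x) \<le> D b / (1 + norm x) ^ N" by metis
  define B where "B = (\<Sum>b\<in>Basis. D b) * (1 + S) ^ N"
  have "norm (\<phi> (x - y) - \<phi> x) \<le> B * norm y / (1 + norm x) ^ N" if y: "norm y \<le> S" for x y
  proof -
    have "norm (\<phi> (x - y) - \<phi> x) \<le> B / (1 + norm x) ^ N * norm ((x - y) - x)"
    proof (rule differentiable_bound[of "closed_segment (x - y) x" \<phi> "\<lambda>z v. iter_deriv [v] \<phi> z"])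
      fix z assume z: "z \<in> closed_segment (x - y) x"
      show "(\<phi> has_derivative (\<lambda>v. iter_deriv [v] \<phi> z)) (at z within closed_segment (x - y) x)"
        using schwartz_has_derivative[OF \<phi>] by (rule has_derivative_at_withinI)
      have "norm (z - x) \<le> norm ((x - y) - x)" using segment_bound(2)[OF z] by (simp add: norm_minus_commute)
      then have zx: "norm x \<le> norm z + S" using y norm_triangle_ineq2[of x z] by (simp add: norm_minus_commute)
      have "onorm (\<lambda>v. iter_deriv [v] \<phi> z) \<le> (\<Sum>b\<in>Basis. norm (iter_deriv [b] \<phi> z))"
        using schwartz_has_derivative[OF \<phi>] by (intro onorm_componentwise) (rule has_derivative_bounded_linear)
      also have "... \<le> (\<Sum>b\<in>Basis. D b / (1 + norm z) ^ N)" by (intro sum_mono D)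
      also have "... = (\<Sum>b\<in>Basis. D b) / (1 + norm z) ^ N" by (simp add: sum_divide_distrib)
      also have "... \<le> B / (1 + norm x) ^ N"
      proof -
        have "1 + norm x \<le> (1 + S) * (1 + norm z)"
        proof -
          have "(1 + S) * (1 + norm z) = 1 + S + norm z + S * norm z" by algebra
          then show ?thesis using zx mult_nonneg_nonneg[OF S norm_ge_zero[of z]] by linarith
        qed
        then have "(1 + norm x) ^ N \<le> (1 + S) ^ N * (1 + norm z) ^ N" unfolding power_mult_distrib[symmetric] by (intro power_mono) auto
        then have "(\<Sum>b\<in>Basis. D b) * (1 + norm x) ^ N \<le> (\<Sum>b\<in>Basis. D b) * ((1 + S) ^ N * (1 + norm z) ^ N)"
          using D(1) by (intro mult_left_mono sum_nonneg) auto
        moreover have "0 < (1 + norm x) ^ N" "0 < (1 + norm z) ^ N" by (intro zero_less_power, simp add: add_pos_nonneg)+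
        ultimately show ?thesis by (simp add: B_def field_simps)
      qed
      finally show "onorm (\<lambda>v. iter_deriv [v] \<phi> z) \<le> B / (1 + norm x) ^ N" .
    qed auto
    then show ?thesis by (simp add: norm_minus_commute)
  qed
  moreover have "0 \<le> B" unfolding B_def using D(1) S by (intro mult_nonneg_nonneg sum_nonneg) auto
  ultimately show ?thesis using that by blast
qed

lemma schwartz_lipschitz:
  fixes \<phi> :: "'v::euclidean_space \<Rightarrow> complex"
  assumes \<phi>: "\<phi> \<in> schwartz"
  obtains B where "0 \<le> B" "\<And>x y. norm (\<phi> x - \<phi> y) \<le> B * norm (x - y)"
proof -
  have "\<exists>B. 0 \<le> B \<and> (\<forall>x. norm (iter_deriv [b] \<phi> x) \<le> B / (1 + norm x) ^ 0)" for b
    using schwartz_decay[OF schwartz_iter_deriv[OF \<phi>]] by metis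
  then obtain D where D: "\<And>b. 0 \<le> D b" "\<And>b x. norm (iter_deriv [b] \<phi> x) \<le> D b" by simp metis
  have "norm (\<phi> x - \<phi> y) \<le> (\<Sum>b\<in>Basis. D b) * norm (x - y)" for x y
  proof (rule differentiable_bound[of UNIV \<phi> "\<lambda>z v. iter_deriv [v] \<phi> z"])
    fix z
    show "(\<phi> has_derivative (\<lambda>v. iter_deriv [v] \<phi> z)) (at z within UNIV)"
      using schwartz_has_derivative[OF \<phi>] by (rule has_derivative_at_withinI)
    have "onorm (\<lambda>v. iter_deriv [v] \<phi> z) \<le> (\<Sum>b\<in>Basis. norm (iter_deriv [b] \<phi> z))"
      using schwartz_has_derivative[OF \<phi>] by (intro onorm_componentwise) (rule has_derivative_bounded_linear)
    also have "... \<le> (\<Sum>b\<in>Basis. D b)" by (intro sum_mono D)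
    finally show "onorm (\<lambda>v. iter_deriv [v] \<phi> z) \<le> (\<Sum>b\<in>Basis. D b)" .
  qed auto
  moreover have "0 \<le> (\<Sum>b\<in>Basis. D b)" using D(1) by (intro sum_nonneg)
  ultimately show ?thesis using that by blast
qed

text \<open>The remainder of the first-order expansion of \<open>\<phi>(x - y) - \<phi>(x)\<close> in \<open>x\<close> is small in \<open>y\<close> as
  well as in \<open>h\<close>: both \<open>|h| |y|\<close> and \<open>|h|\<^sup>2\<close> bound it, hence so does the geometric mean.\<close>

lemma schwartz_increment_remainder:
  fixes \<phi> :: "'v::euclidean_space \<Rightarrow> complex"
  assumes \<phi>: "\<phi> \<in> schwartz"
  obtains C where "0 \<le> C" "\<And>x y h. norm ((\<phi> (x + h - y) - \<phi> (x + h)) - (\<phi> (x - y) - \<phi> x)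
      - (iter_deriv [h] \<phi> (x - y) - iter_deriv [h] \<phi> x)) \<le> C * sqrt (norm h * norm y) * norm h"
proof -
  have "\<exists>B. 0 \<le> B \<and> (\<forall>x y. norm (iter_deriv [b] \<phi> x - iter_deriv [b] \<phi> y) \<le> B * norm (x - y))" for b
    using schwartz_lipschitz[OF schwartz_iter_deriv[OF \<phi>]] by metis
  then obtain D where D: "\<And>b. 0 \<le> D b"
      "\<And>b x y. norm (iter_deriv [b] \<phi> x - iter_deriv [b] \<phi> y) \<le> D b * norm (x - y)" by metis
  define C where "C = (\<Sum>b\<in>Basis. 2 * D b)"
  have "norm ((\<phi> (x + h - y) - \<phi> (x + h)) - (\<phi> (x - y) - \<phi> x)
      - (iter_deriv [h] \<phi> (x - y) - iter_deriv [h] \<phi> x)) \<le> C * sqrt (norm h * norm y) * norm h" for x y h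
  proof -
    define G where "G = (\<lambda>w. (\<phi> (x + w - y) - \<phi> (x + w)) - (iter_deriv [w] \<phi> (x - y) - iter_deriv [w] \<phi> x))"
    define G' where "G' = (\<lambda>w v. (iter_deriv [v] \<phi> (x + w - y) - iter_deriv [v] \<phi> (x + w))
        - (iter_deriv [v] \<phi> (x - y) - iter_deriv [v] \<phi> x))"
    have bl: "bounded_linear (\<lambda>v. iter_deriv [v] \<phi> z)" for z using schwartz_has_derivative[OF \<phi>] by (rule has_derivative_bounded_linear)
    have der: "(G has_derivative G' w) (at w within T)" for w T
      unfolding G_def G'_def by (intro has_derivative_diff bounded_linear.has_derivative[OF bl] has_derivative_ident
        has_derivative_compose[OF _ schwartz_has_derivative[OF \<phi>], of "\<lambda>w. x + w - y" "\<lambda>v. v"]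
        has_derivative_compose[OF _ schwartz_has_derivative[OF \<phi>], of "\<lambda>w. x + w" "\<lambda>v. v"]) (auto intro!: derivative_eq_intros)
    have "norm (G h - G 0) \<le> C * sqrt (norm h * norm y) * norm (h - 0)"
    proof (rule differentiable_bound[of "closed_segment 0 h" G G'])
      fix w assume "w \<in> closed_segment 0 h"
      then have w: "norm w \<le> norm h" using segment_bound(1)[of w 0 h] by simp
      show "(G has_derivative G' w) (at w within closed_segment 0 h)" by (rule der)
      have "norm (G' w b) \<le> 2 * D b * sqrt (norm h * norm y)" for b
      proof -
        have 1: "norm (G' w b) \<le> 2 * D b * norm y" using D(2)[of b "x + w - y" "x + w"] D(2)[of b "x - y" x]
            norm_triangle_ineq4[of "iter_deriv [b] \<phi> (x + w - y) - iter_deriv [b] \<phi> (x + w)" "iter_deriv [b] \<phi> (x - y) - iter_deriv [b] \<phi> x"]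
          unfolding G'_def by simp
        have "G' w b = (iter_deriv [b] \<phi> (x + w - y) - iter_deriv [b] \<phi> (x - y))
            - (iter_deriv [b] \<phi> (x + w) - iter_deriv [b] \<phi> x)" by (simp add: G'_def)
        moreover have "norm (iter_deriv [b] \<phi> (x + w - y) - iter_deriv [b] \<phi> (x - y)) \<le> D b * norm w"
          using D(2)[of b "x + w - y" "x - y"] by simp
        moreover have "norm (iter_deriv [b] \<phi> (x + w) - iter_deriv [b] \<phi> x) \<le> D b * norm w" using D(2)[of b "x + w" x] by simp
        ultimately have "norm (G' w b) \<le> 2 * D b * norm w"
          using norm_triangle_ineq4[of "iter_deriv [b] \<phi> (x + w - y) - iter_deriv [b] \<phi> (x - y)" "iter_deriv [b] \<phi> (x + w) - iter_deriv [b] \<phi> x"]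
          by simp
        also have "... \<le> 2 * D b * norm h" using w D(1)[of b] by (intro mult_left_mono) auto
        finally have 2: "norm (G' w b) \<le> 2 * D b * norm h" .
        have "norm (G' w b) = sqrt (norm (G' w b) * norm (G' w b))" by simp
        also have "... \<le> sqrt ((2 * D b * norm h) * (2 * D b * norm y))" using 1 2 D(1)[of b] by (intro real_sqrt_le_mono mult_mono) auto
        also have "... = sqrt ((2 * D b)\<^sup>2 * (norm h * norm y))" by (simp add: power2_eq_square mult_ac)
        also have "... = 2 * D b * sqrt (norm h * norm y)" using D(1)[of b] by (simp add: real_sqrt_mult)
        finally show ?thesis .
      qed
      then have "(\<Sum>b\<in>Basis. norm (G' w b)) \<le> (\<Sum>b\<in>Basis. 2 * D b * sqrt (norm h * norm y))" by (intro sum_mono)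
      also have "... = C * sqrt (norm h * norm y)" by (simp add: C_def sum_distrib_right)
      finally show "onorm (G' w) \<le> C * sqrt (norm h * norm y)"
        using onorm_componentwise[OF has_derivative_bounded_linear[OF der[of w UNIV]]] by linarith
    qed auto
    moreover have "iter_deriv [0] \<phi> z = 0" for z using bl[of z] by (rule linear_simps(3))
    then have "G h - G 0 = (\<phi> (x + h - y) - \<phi> (x + h)) - (\<phi> (x - y) - \<phi> x)
      - (iter_deriv [h] \<phi> (x - y) - iter_deriv [h] \<phi> x)" unfolding G_def by (simp)
    ultimately show ?thesis by (simp)
  qed
  moreover have "0 \<le> C" unfolding C_def using D(1) by (intro sum_nonneg) auto
  ultimately show ?thesis using that by blast
qed

lemma (in length_function) norm_le_mult:
  assumes "\<rho> y \<le> R" shows "norm y \<le> (1 + R) * \<rho> y"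
  using norm_le[of y] mult_right_mono[OF assms nonneg[of y]] by (simp add: power2_eq_square algebra_simps)

section \<open>The operator on Schwartz functions\<close>

context cz_kernel begin

text \<open>Kernel of the transpose for the bilinear pairing with test functions; unlike for the
  adjoint nothing is conjugated, and \<open>c\<close> stays the same.\<close>

lemma reflected_cz_kernel: "cz_kernel \<rho> (\<lambda>y. K (- y)) A R \<delta> c"
proof unfold_locales
  have tr: "truncated \<rho> (\<lambda>y. K (- y)) r = (\<lambda>y. truncated \<rho> K r (0 - y))" for r by (auto simp: truncated_def minus)
  have tr_int: "(LINT y|lborel. truncated \<rho> (\<lambda>y. K (- y)) r y) = (LINT y|lborel. truncated \<rho> K r y)" for r
    unfolding tr by (rule integral_lborel_diff) measurable
  show "R \<le> \<rho> y \<Longrightarrow> K (- y) = 0" for y using support by (simp add: minus)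
  show "l1_on {y. r \<le> \<rho> y \<and> \<rho> y < 2 * r} (\<lambda>y. K (- y)) \<le> ennreal A"
    if "0 < r" for r using size[OF that] nn_integral_lborel_diff[of
      "\<lambda>y. ennreal (norm (K y)) * indicator {y. r \<le> \<rho> y \<and> \<rho> y < 2 * r} y" 0] by (simp add: minus indicator_def)
  show "norm (LINT y|lborel. truncated \<rho> (\<lambda>y. K (- y)) r y) \<le> A" if "0 < r" for r using cancellation[OF that] by (simp add: tr_int)
  show "((\<lambda>r. LINT y|lborel. truncated \<rho> (\<lambda>y. K (- y)) r y) \<longlongrightarrow> c) (at_right 0)" unfolding tr_int by (rule tendsto)
  show "l1_on {y. r \<le> \<rho> y \<and> \<rho> y < 2 * r} (\<lambda>y. K (- (y - u)) - K (- y)) \<le> ennreal (A * (\<rho> u / r) powr \<delta>)" if "0 < r" "2 * \<rho> u \<le> r" for r u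
    using regular[of r "- u"] that nn_integral_lborel_diff[of
        "\<lambda>y. ennreal (norm (K (y - (- u)) - K y)) * indicator {y. r \<le> \<rho> y \<and> \<rho> y < 2 * r} y" 0] by (simp add: minus indicator_def)
qed (use A_nonneg R_pos delta in auto)

lemma schwartz_K_integrable:
  assumes \<phi>: "\<phi> \<in> schwartz"
  shows "integrable lborel (\<lambda>y. K y * (\<phi> (x - y) - \<phi> x))"
proof -
  have [measurable]: "\<phi> \<in> borel_measurable borel" using \<phi> by (rule schwartz_measurable)
  obtain B where B: "0 \<le> B" "\<And>x y. norm (\<phi> x - \<phi> y) \<le> B * norm (x - y)" using schwartz_lipschitz[OF \<phi>] by metis
  show ?thesis
  proof (rule integrable_K_Hoelder[of 1 "B * (1 + R)"])
    fix y assume "\<rho> y < R"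
    then have "B * norm y \<le> B * ((1 + R) * \<rho> y)" using norm_le_mult[of y R] B(1) by (intro mult_left_mono) auto
    then show "norm (\<phi> (x - y) - \<phi> x) \<le> B * (1 + R) * \<rho> y powr 1" using B(2)[of "x - y" x] by (simp add: mult.assoc)
  qed (use B R_pos in auto)
qed

text \<open>Differentiation under the singular integral: the remainder must be o(|h|) and at the
  same time vanish at y = 0 to a positive order. The bound by
  \<open>sqrt (norm h * norm y) * norm h\<close> does both, as |y|^(1/2) is dominated by a multiple
  of \<rho> y to the power 1/2 on the support of \<open>K\<close>.\<close>

lemma cz_op_schwartz_derivative:
  assumes \<phi>: "\<phi> \<in> schwartz"
  shows "(cz_op K c \<phi> has_derivative (\<lambda>v. cz_op K c (iter_deriv [v] \<phi>) x)) (at x)"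
proof -
  let ?D = "\<lambda>v z. iter_deriv [v] \<phi> z"
  have bl: "bounded_linear (\<lambda>v. ?D v z)" for z using schwartz_has_derivative[OF \<phi>] by (rule has_derivative_bounded_linear)
  have int: "integrable lborel (\<lambda>y. K y * (?D v (x - y) - ?D v x))" for v by (rule schwartz_K_integrable[OF schwartz_iter_deriv[OF \<phi>]])
  have D_add: "?D (v + w) z = ?D v z + ?D w z" for v w z using bl[of z] by (rule linear_simps(1))
  have D_scale: "?D (r *\<^sub>R v) z = r *\<^sub>R ?D v z" for r v z using bl[of z] by (rule linear_simps(5))
  have "linear (\<lambda>v. cz_op K c (?D v) x)"
  proof (rule linearI)
    fix v w
    have "(LINT y|lborel. K y * (?D (v + w) (x - y) - ?D (v + w) x))
        = (LINT y|lborel. K y * (?D v (x - y) - ?D v x) + K y * (?D w (x - y) - ?D w x))"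
      by (intro Bochner_Integration.integral_cong) (simp_all add: D_add algebra_simps)
    also have "... = (LINT y|lborel. K y * (?D v (x - y) - ?D v x)) + (LINT y|lborel. K y * (?D w (x - y) - ?D w x))"
      by (rule Bochner_Integration.integral_add[OF int int])
    finally show "cz_op K c (?D (v + w)) x = cz_op K c (?D v) x + cz_op K c (?D w) x" by (simp add: cz_op_def D_add algebra_simps)
  next
    fix r v
    have "(LINT y|lborel. K y * (?D (r *\<^sub>R v) (x - y) - ?D (r *\<^sub>R v) x)) = (LINT y|lborel. r *\<^sub>R (K y * (?D v (x - y) - ?D v x)))"
      by (intro Bochner_Integration.integral_cong) (simp_all add: D_scale mult_scaleR_right scaleR_diff_right[symmetric])
    also have "... = r *\<^sub>R (LINT y|lborel. K y * (?D v (x - y) - ?D v x))" by (rule Bochner_Integration.integral_scaleR_right)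
    finally show "cz_op K c (?D (r *\<^sub>R v)) x = r *\<^sub>R cz_op K c (?D v) x" by (simp add: cz_op_def D_scale algebra_simps)
  qed
  then have lin: "bounded_linear (\<lambda>v. cz_op K c (?D v) x)" by (simp add: linear_conv_bounded_linear)
  obtain C where C: "0 \<le> C" "\<And>x y h. norm ((\<phi> (x + h - y) - \<phi> (x + h)) - (\<phi> (x - y) - \<phi> x)
      - (?D h (x - y) - ?D h x)) \<le> C * sqrt (norm h * norm y) * norm h" using schwartz_increment_remainder[OF \<phi>] by metis
  have [measurable]: "\<phi> \<in> borel_measurable borel" "?D h \<in> borel_measurable borel" for h
    using schwartz_measurable[OF \<phi>] schwartz_measurable[OF schwartz_iter_deriv[OF \<phi>]] by auto
  define M where "M = C * sqrt (1 + R) * A * R powr (1/2) / (1 - 1 / 2 powr (1/2))"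
  let ?e = "\<lambda>h. \<phi> (x + h) - \<phi> x - ?D h x"
  have le: "norm (cz_op K c \<phi> (x + h) - cz_op K c \<phi> x - cz_op K c (?D h) x) / norm h
      \<le> M * sqrt (norm h) + norm c * (norm (?e h) / norm h)" if h: "h \<noteq> 0" for h
  proof -
    let ?r = "\<lambda>y. (\<phi> (x + h - y) - \<phi> (x + h)) - (\<phi> (x - y) - \<phi> x) - (?D h (x - y) - ?D h x)"
    have eq: "cz_op K c \<phi> (x + h) - cz_op K c \<phi> x - cz_op K c (?D h) x = (LINT y|lborel. K y * ?r y) + c * ?e h"
    proof -
      have "(LINT y|lborel. K y * ?r y) = (LINT y|lborel. K y * (\<phi> (x + h - y) - \<phi> (x + h))
          - K y * (\<phi> (x - y) - \<phi> x) - K y * (?D h (x - y) - ?D h x))"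
        by (intro Bochner_Integration.integral_cong) (simp_all add: algebra_simps)
      also have "... = (LINT y|lborel. K y * (\<phi> (x + h - y) - \<phi> (x + h)))
          - (LINT y|lborel. K y * (\<phi> (x - y) - \<phi> x)) - (LINT y|lborel. K y * (?D h (x - y) - ?D h x))"
        by (simp add: Bochner_Integration.integral_diff[OF Bochner_Integration.integrable_diff[OF
          schwartz_K_integrable[OF \<phi>, of "x + h"] schwartz_K_integrable[OF \<phi>, of x]] int]
          Bochner_Integration.integral_diff[OF schwartz_K_integrable[OF \<phi>, of "x + h"] schwartz_K_integrable[OF \<phi>, of x]]
         )
      finally show ?thesis by (simp add: cz_op_def algebra_simps)
    qed
    have "norm (LINT y|lborel. K y * ?r y) \<le> (C * sqrt (1 + R) * sqrt (norm h) * norm h) * A * R powr (1/2) / (1 - 1 / 2 powr (1/2))"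
    proof (rule norm_integral_K_Hoelder)
      fix y assume y: "\<rho> y < R"
      have "sqrt (norm h * norm y) \<le> sqrt (norm h * ((1 + R) * \<rho> y))"
        using y norm_le_mult[of y R] by (intro real_sqrt_le_mono mult_left_mono) auto
      also have "... = sqrt (1 + R) * sqrt (norm h) * \<rho> y powr (1/2)" by (simp add: real_sqrt_mult powr_half_sqrt)
      finally have "C * sqrt (norm h * norm y) * norm h \<le> C * (sqrt (1 + R) * sqrt (norm h) * \<rho> y powr (1/2)) * norm h"
        using C(1) by (intro mult_right_mono mult_left_mono) auto
      with C(2)[of x h y] show "norm (?r y) \<le> C * sqrt (1 + R) * sqrt (norm h) * norm h * \<rho> y powr (1/2)" by (simp add: mult_ac)
    qed (use C R_pos in auto)
    then have "norm (LINT y|lborel. K y * ?r y) \<le> M * sqrt (norm h) * norm h" by (simp add: M_def mult_ac)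
    then have "norm (cz_op K c \<phi> (x + h) - cz_op K c \<phi> x - cz_op K c (?D h) x) \<le> M * sqrt (norm h) * norm h + norm c * norm (?e h)"
      unfolding eq by (intro norm_triangle_le add_mono) (simp_all only: norm_mult)
    then have "norm (cz_op K c \<phi> (x + h) - cz_op K c \<phi> x - cz_op K c (?D h) x) / norm h
        \<le> (M * sqrt (norm h) * norm h + norm c * norm (?e h)) / norm h" by (intro divide_right_mono) auto
    also have "... = M * sqrt (norm h) + norm c * (norm (?e h) / norm h)" using h by (simp add: add_divide_distrib)
    finally show ?thesis .
  qed
  have "((\<lambda>h. norm (?e h) / norm h) \<longlongrightarrow> 0) (at 0)" using schwartz_has_derivative[OF \<phi>, of x] unfolding has_derivative_at by simp
  then have "((\<lambda>h. M * sqrt (norm h) + norm c * (norm (?e h) / norm h)) \<longlongrightarrow> M * sqrt (norm (0::'v)) + norm c * 0) (at 0)"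
    by (intro tendsto_intros)
  then have lim: "((\<lambda>h. M * sqrt (norm h) + norm c * (norm (?e h) / norm h)) \<longlongrightarrow> 0) (at 0)" by simp
  have "((\<lambda>h. norm (cz_op K c \<phi> (x + h) - cz_op K c \<phi> x - cz_op K c (?D h) x) / norm h) \<longlongrightarrow> 0) (at 0)"
    by (rule Lim_null_comparison[OF _ lim]) (use le in \<open>auto simp: eventually_at_filter\<close>)
  with lin show ?thesis unfolding has_derivative_at by blast
qed

lemma iter_deriv_cz_op:
  assumes \<phi>: "\<phi> \<in> schwartz"
  shows "iter_deriv vs (cz_op K c \<phi>) = cz_op K c (iter_deriv vs \<phi>)"
proof (induction vs)
  case (Cons v vs)
  have "iter_deriv (v # vs) (cz_op K c \<phi>) x = cz_op K c (iter_deriv (v # vs) \<phi>) x" for x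
    using frechet_derivative_at[OF cz_op_schwartz_derivative[OF schwartz_iter_deriv[OF \<phi>, of vs], of x]]
    by (simp add: Cons iter_deriv.simps(2)) metis
  then show ?case by blast
qed simp

text \<open>Derivatives pass to \<phi> by \<open>iter_deriv_cz_op\<close>. Decay survives since
  \<open>K\<close> has compact support: the increments of \<phi> inside the integral decay in x to
  every order.\<close>

lemma cz_op_schwartz:
  assumes \<phi>: "\<phi> \<in> schwartz"
  shows "cz_op K c \<phi> \<in> schwartz" unfolding schwartz_def smooth_on_def mem_Collect_eq
proof (intro conjI allI ballI)
  fix vs x
  show "iter_deriv vs (cz_op K c \<phi>) differentiable at x"
    unfolding iter_deriv_cz_op[OF \<phi>] using cz_op_schwartz_derivative[OF schwartz_iter_deriv[OF \<phi>]] by (auto simp: differentiable_def)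
next
  fix vs N
  define \<psi> where "\<psi> = iter_deriv vs \<phi>"
  have \<psi>: "\<psi> \<in> schwartz" unfolding \<psi>_def using \<phi> by (rule schwartz_iter_deriv)
  have [measurable]: "\<psi> \<in> borel_measurable borel" using \<psi> by (rule schwartz_measurable)
  obtain B0 where B0: "0 \<le> B0" "\<And>x. norm (\<psi> x) \<le> B0 / (1 + norm x) ^ N" using schwartz_decay[OF \<psi>] by metis
  obtain B where B: "0 \<le> B" "\<And>x y. norm y \<le> (1 + R) * R \<Longrightarrow> norm (\<psi> (x - y) - \<psi> x) \<le> B * norm y / (1 + norm x) ^ N"
    using schwartz_increment[OF \<psi>, of "(1 + R) * R"] R_pos by (metis add_nonneg_nonneg less_imp_le mult_nonneg_nonneg zero_le_one)
  have "(1 + norm x) ^ N * norm (cz_op K c \<psi> x) \<le> B * (1 + R) * A * R powr 1 / (1 - 1 / 2 powr 1) + norm c * B0" for x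
  proof -
    have pos: "0 < (1 + norm x) ^ N" by (intro zero_less_power) (simp add: add_pos_nonneg)
    have "norm (LINT y|lborel. K y * (\<psi> (x - y) - \<psi> x)) \<le> (B * (1 + R) / (1 + norm x) ^ N) * A * R powr 1 / (1 - 1 / 2 powr 1)"
    proof (rule norm_integral_K_Hoelder)
      fix y assume y: "\<rho> y < R"
      have ny: "norm y \<le> (1 + R) * \<rho> y" using y by (intro norm_le_mult) auto
      also have "... \<le> (1 + R) * R" using y R_pos by (intro mult_left_mono) auto
      finally have "norm (\<psi> (x - y) - \<psi> x) \<le> B * norm y / (1 + norm x) ^ N" by (rule B(2))
      also have "... \<le> B * ((1 + R) * \<rho> y) / (1 + norm x) ^ N" using ny B(1) pos by (intro divide_right_mono mult_left_mono) auto
      finally show "norm (\<psi> (x - y) - \<psi> x) \<le> B * (1 + R) / (1 + norm x) ^ N * \<rho> y powr 1" by (simp add: mult.assoc)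
    qed (use B R_pos pos in auto)
    moreover have "norm (c * \<psi> x) \<le> norm c * (B0 / (1 + norm x) ^ N)" unfolding norm_mult using B0 by (intro mult_left_mono) auto
    ultimately have "norm (cz_op K c \<psi> x) \<le> (B * (1 + R) / (1 + norm x) ^ N) * A * R powr 1 / (1 - 1 / 2 powr 1) + norm c * (B0 / (1 + norm x) ^ N)"
      unfolding cz_op_def by (intro norm_triangle_le add_mono)
    then have "(1 + norm x) ^ N * norm (cz_op K c \<psi> x) \<le> (1 + norm x) ^ N * ((B * (1 + R) / (1 + norm x) ^ N) * A * R powr 1 / (1 - 1 / 2 powr 1) + norm c * (B0 / (1 + norm x) ^ N))"
      using pos by (intro mult_left_mono) auto
    also have "... = B * (1 + R) * A * R powr 1 / (1 - 1 / 2 powr 1) + norm c * B0"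
    proof -
      have "P * ((b / P) * a * q / d + e * (b' / P)) = b * a * q / d + e * b'" if "0 < P" for P b a q d e b' :: real
        using that by (simp add: distrib_left)
      from this[OF pos] show ?thesis .
    qed
    finally show ?thesis .
  qed
  then show "\<exists>B. \<forall>x. (1 + norm x) ^ N * norm (iter_deriv vs (cz_op K c \<phi>) x) \<le> B" unfolding iter_deriv_cz_op[OF \<phi>] \<psi>_def by blast
qed

end

section \<open>Integrals of functions of polynomial growth against Schwartz functions\<close>

interpretation norm_length: length_function "norm :: 'v::euclidean_space \<Rightarrow> real"
proof
  show "norm x \<le> norm x + (norm x)\<^sup>2" for x :: 'v by simp
  show "norm (t *\<^sub>R x) \<le> norm x" if "0 \<le> t" "t \<le> 1" for t and x :: 'v using that by (simp add: mult_left_le_one_le)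
qed (auto intro: continuous_intros norm_triangle_ineq)

lemma integrable_inverse_power:
  "integrable lborel (\<lambda>x::'v::euclidean_space. 1 / (1 + norm x) ^ (DIM('v) + 1))"
proof (rule integrable_bounded_nn)
  let ?d = "DIM('v)"
  let ?f = "\<lambda>x::'v. ennreal (1 / (1 + norm x) ^ (?d + 1))"
  define V where "V = measure lborel (ball (0::'v) 1)"
  have "(\<integral>\<^sup>+x\<in>{x::'v. norm x < 1}. ?f x \<partial>lborel) \<le> 1 * emeasure lborel {x::'v. norm x < 1}"
    by (intro set_nn_integral_le_const) (auto intro!: one_le_power simp: ennreal_le_1 divide_le_eq add_pos_nonneg simp del: power_Suc)
  also have "... = ennreal V" by (subst emeasure_norm_less) (simp_all add: V_def)
  finally have near: "(\<integral>\<^sup>+x\<in>{x::'v. norm x < 1}. ?f x \<partial>lborel) \<le> ennreal V" .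
  have far: "(\<integral>\<^sup>+x\<in>{x::'v. 1 \<le> norm x}. ?f x \<partial>lborel) \<le> ennreal (2 ^ ?d * V * 1 powr (- 1) / (1 - 1 / 2 powr 1))"
  proof (rule norm_length.nn_integral_dyadic_above)
    fix r :: real assume r: "1 \<le> r"
    let ?D = "{x::'v. r \<le> norm x \<and> norm x < 2 * r}"
    have "(\<integral>\<^sup>+x\<in>?D. ?f x \<partial>lborel) \<le> ennreal (1 / r ^ (?d + 1)) * emeasure lborel ?D"
      using r by (intro set_nn_integral_le_const ennreal_leI divide_left_mono power_mono mult_pos_pos zero_less_power) (auto simp: add_pos_nonneg)
    also have "... \<le> ennreal (1 / r ^ (?d + 1)) * emeasure lborel {x::'v. norm x < 2 * r}" by (intro mult_left_mono emeasure_mono) auto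
    also have "... = ennreal (1 / r ^ (?d + 1) * ((2 * r) ^ ?d * V))"
      unfolding V_def using r by (subst emeasure_norm_less) (simp, rule ennreal_mult'[symmetric], simp)
    also have "1 / r ^ (?d + 1) * ((2 * r) ^ ?d * V) = 2 ^ ?d * V * r powr (- 1)"
      using r by (simp add: power_mult_distrib powr_minus_divide)
    finally show "(\<integral>\<^sup>+x\<in>?D. ?f x \<partial>lborel) \<le> ennreal (2 ^ ?d * V * r powr (- 1))" .
  qed (auto simp: V_def)
  have "(\<integral>\<^sup>+x. ennreal (norm (1 / (1 + norm x) ^ (?d + 1))) \<partial>(lborel :: 'v measure))
      = (\<integral>\<^sup>+x. ?f x * indicator {x. norm x < 1} x + ?f x * indicator {x. 1 \<le> norm x} x \<partial>lborel)"
    by (intro nn_integral_cong) (auto simp: indicator_def)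
  also have "... = (\<integral>\<^sup>+x\<in>{x::'v. norm x < 1}. ?f x \<partial>lborel) + (\<integral>\<^sup>+x\<in>{x::'v. 1 \<le> norm x}. ?f x \<partial>lborel)" by (rule nn_integral_add) auto
  also have "... \<le> ennreal V + ennreal (2 ^ ?d * V * 1 powr (- 1) / (1 - 1 / 2 powr 1))" by (intro add_mono near far)
  also have "... = ennreal (V + 2 ^ ?d * V * 2)" by (simp add: V_def flip: ennreal_plus)
  finally show "(\<integral>\<^sup>+x. ennreal (norm (1 / (1 + norm x) ^ (?d + 1))) \<partial>(lborel :: 'v measure)) \<le> ennreal (V + 2 ^ ?d * V * 2)" .
qed measurable

definition poly_bounded :: "('v::real_normed_vector \<Rightarrow> 'b::real_normed_vector) \<Rightarrow> bool" where
  "poly_bounded f \<longleftrightarrow> (\<exists>C N. \<forall>x. norm (f x) \<le> C * (1 + norm x) ^ N)"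

lemma poly_boundedE:
  assumes "poly_bounded f"
  obtains C N where "0 \<le> C" "\<And>x. norm (f x) \<le> C * (1 + norm x) ^ N"
proof -
  obtain C N where C: "\<And>x. norm (f x) \<le> C * (1 + norm x) ^ N" using assms unfolding poly_bounded_def by blast
  have "0 \<le> C" using order_trans[OF norm_ge_zero C[of 0]] by simp
  then show ?thesis using C that by blast
qed

lemma one_add_norm_pos: "0 < 1 + norm x" by (simp add: add_pos_nonneg)

lemma poly_bounded_shift:
  assumes "poly_bounded f" shows "poly_bounded (\<lambda>x. f (x + y))"
proof -
  obtain C N where C: "0 \<le> C" "\<And>x. norm (f x) \<le> C * (1 + norm x) ^ N" using poly_boundedE[OF assms] by metis
  have "norm (f (x + y)) \<le> C * (1 + norm y) ^ N * (1 + norm x) ^ N" for x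
  proof -
    have "(1 + norm (x + y)) ^ N \<le> ((1 + norm y) * (1 + norm x)) ^ N"
    proof (rule power_mono)
      have "(1 + norm y) * (1 + norm x) = 1 + norm x + norm y + norm y * norm x" by algebra
      then show "1 + norm (x + y) \<le> (1 + norm y) * (1 + norm x)"
        using norm_triangle_ineq[of x y] mult_nonneg_nonneg[OF norm_ge_zero[of y] norm_ge_zero[of x]] by linarith
    qed simp
    then have "C * (1 + norm (x + y)) ^ N \<le> C * ((1 + norm y) * (1 + norm x)) ^ N" using C(1) by (rule mult_left_mono)
    with C(2)[of "x + y"] show ?thesis by (simp add: power_mult_distrib mult.assoc)
  qed
  then show ?thesis unfolding poly_bounded_def by blast
qed

lemma poly_bounded_add:
  assumes "poly_bounded f" "poly_bounded g" shows "poly_bounded (\<lambda>x. f x + g x)"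
proof -
  obtain C N where C: "0 \<le> C" "\<And>x. norm (f x) \<le> C * (1 + norm x) ^ N" using poly_boundedE[OF assms(1)] by metis
  obtain D M where D: "0 \<le> D" "\<And>x. norm (g x) \<le> D * (1 + norm x) ^ M" using poly_boundedE[OF assms(2)] by metis
  have "norm (f x + g x) \<le> (C + D) * (1 + norm x) ^ (N + M)" for x
  proof -
    have "C * (1 + norm x) ^ N \<le> C * (1 + norm x) ^ (N + M)" "D * (1 + norm x) ^ M \<le> D * (1 + norm x) ^ (N + M)"
      using C D by (auto intro!: mult_left_mono power_increasing)
    with C(2)[of x] D(2)[of x] have "norm (f x) + norm (g x) \<le> (C + D) * (1 + norm x) ^ (N + M)" by (simp add: distrib_right)
    then show ?thesis by (rule norm_triangle_le)
  qed
  then show ?thesis unfolding poly_bounded_def by blast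
qed

lemma poly_bounded_real_polynomial:
  assumes "real_polynomial_function p" shows "poly_bounded p" using assms
proof (induction rule: real_polynomial_function.induct)
  case (linear f)
  obtain B where B: "0 \<le> B" "\<And>x. norm (f x) \<le> norm x * B" using bounded_linear.nonneg_bounded[OF linear] by blast
  have "norm (f x) \<le> B * (1 + norm x) ^ 1" for x using B(2)[of x] B(1) by (simp add: algebra_simps)
  then show ?case unfolding poly_bounded_def by blast
next
  case (const c)
  have "norm c \<le> norm c * (1 + norm x) ^ 0" for x :: 'a by simp
  then show ?case unfolding poly_bounded_def by blast
next
  case (add f g)
  then show ?case by (intro poly_bounded_add)
next
  case (mult f g)
  obtain C N where C: "0 \<le> C" "\<And>x. norm (f x) \<le> C * (1 + norm x) ^ N" using poly_boundedE[OF mult.IH(1)] by metis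
  obtain D M where D: "0 \<le> D" "\<And>x. norm (g x) \<le> D * (1 + norm x) ^ M" using poly_boundedE[OF mult.IH(2)] by metis
  have "norm (f x * g x) \<le> (C * D) * (1 + norm x) ^ (N + M)" for x
  proof -
    have "norm (f x * g x) \<le> (C * (1 + norm x) ^ N) * (D * (1 + norm x) ^ M)" unfolding norm_mult using C D by (intro mult_mono) auto
    then show ?thesis by (simp add: power_add mult_ac)
  qed
  then show ?case unfolding poly_bounded_def by blast
qed

lemma schwartz_dominating:
  fixes f :: "'v::euclidean_space \<Rightarrow> complex"
  assumes \<phi>: "\<phi> \<in> schwartz" and C: "0 \<le> C"
  obtains D where "0 \<le> D" "\<And>x. C * (1 + norm x) ^ N * norm (\<phi> x) \<le> D / (1 + norm x) ^ (DIM('v) + 1)"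
proof -
  obtain B where B: "0 \<le> B" "\<And>x. norm (\<phi> x) \<le> B / (1 + norm x) ^ (N + (DIM('v) + 1))" using schwartz_decay[OF \<phi>] by metis
  have "C * (1 + norm x) ^ N * norm (\<phi> x) \<le> C * B / (1 + norm x) ^ (DIM('v) + 1)" for x
  proof -
    have "C * (1 + norm x) ^ N * norm (\<phi> x) \<le> C * (1 + norm x) ^ N * (B / (1 + norm x) ^ (N + (DIM('v) + 1)))"
      using B C by (intro mult_left_mono) auto
    also have "... = C * B / (1 + norm x) ^ (DIM('v) + 1)"
      using one_add_norm_pos[of x] unfolding power_add[of _ N] by (simp add: divide_simps)
    finally show ?thesis .
  qed
  then show ?thesis using that[of "C * B"] B C by simp
qed

lemma integrable_poly_schwartz:
  fixes f :: "'v::euclidean_space \<Rightarrow> complex"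
  assumes f: "poly_bounded f" "f \<in> borel_measurable borel" and \<phi>: "\<phi> \<in> schwartz"
  shows "integrable lborel (\<lambda>x. f x * \<phi> x)"
proof -
  have [measurable]: "f \<in> borel_measurable borel" "\<phi> \<in> borel_measurable borel" using f schwartz_measurable[OF \<phi>] by auto
  obtain C N where C: "0 \<le> C" "\<And>x. norm (f x) \<le> C * (1 + norm x) ^ N" using poly_boundedE[OF f(1)] by metis
  obtain D where D: "0 \<le> D" "\<And>x. C * (1 + norm x) ^ N * norm (\<phi> x) \<le> D / (1 + norm x) ^ (DIM('v) + 1)"
    using schwartz_dominating[OF \<phi> C(1)] by metis
  show ?thesis
  proof (rule Bochner_Integration.integrable_bound)
    show "integrable lborel (\<lambda>x::'v. D * (1 / (1 + norm x) ^ (DIM('v) + 1)))" by (intro integrable_mult_right integrable_inverse_power)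
    have "norm (f x * \<phi> x) \<le> norm (D * (1 / (1 + norm x) ^ (DIM('v) + 1)))" for x
    proof -
      have "norm (f x * \<phi> x) \<le> C * (1 + norm x) ^ N * norm (\<phi> x)" unfolding norm_mult using C by (intro mult_right_mono) auto
      with D(2)[of x] show ?thesis by (simp add: D(1) abs_of_nonneg)
    qed
    then show "AE x in lborel. norm (f x * \<phi> x) \<le> norm (D * (1 / (1 + norm x) ^ (DIM('v) + 1)))" by simp
  qed measurable
qed

lemma schwartz_shift:
  assumes "\<phi> \<in> schwartz" shows "poly_bounded f \<Longrightarrow> f \<in> borel_measurable borel \<Longrightarrow>
    integrable lborel (\<lambda>x. f x * \<phi> (x - y))"
    "poly_bounded f \<Longrightarrow> f \<in> borel_measurable borel \<Longrightarrow>
    (LINT x|lborel. f x * \<phi> (x - y)) = (LINT x|lborel. f (x + y) * \<phi> x)"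
proof -
  assume f: "poly_bounded f" "f \<in> borel_measurable borel"
  then have [measurable]: "f \<in> borel_measurable borel" "\<phi> \<in> borel_measurable borel" using schwartz_measurable[OF assms] by auto
  have "integrable lborel (\<lambda>x. f (x + y) * \<phi> x)" using poly_bounded_shift[OF f(1)] assms by (intro integrable_poly_schwartz) auto
  from integrable_lborel_shift[OF this, of y] show "integrable lborel (\<lambda>x. f x * \<phi> (x - y))" by simp
  show "(LINT x|lborel. f x * \<phi> (x - y)) = (LINT x|lborel. f (x + y) * \<phi> x)" using integral_lborel_shift[of "\<lambda>x. f (x + y) * \<phi> x" y] by simp
qed

text \<open>What members of the Hoelder and of the composite spaces share: polynomial growth, also
  of the local Hoelder constant, for increments within the range \<open>R\<close> of the kernel.
  Against a Schwartz function such growth is harmless, so T f can be paired with it.\<close>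

definition (in length_function) tame :: "real \<Rightarrow> real \<Rightarrow> ('v \<Rightarrow> complex) \<Rightarrow> bool" where
  "tame R b f \<longleftrightarrow> continuous_on UNIV f \<and> poly_bounded f \<and>
    (\<exists>C N. \<forall>x u. \<rho> u \<le> R \<longrightarrow> norm (f (x - u) - f x) \<le> C * (1 + norm x) ^ N * \<rho> u powr b)"

section \<open>Transposition of the operator and limits modulo polynomials\<close>

context cz_kernel begin

lemma integrable_K_power:
  assumes "0 < b" shows "integrable lborel (\<lambda>y. norm (K y) * \<rho> y powr b)"
proof -
  have "integrable lborel (\<lambda>y. K y * of_real (\<rho> y powr b))" using assms by (intro integrable_K_Hoelder[of b 1]) auto
  then have "integrable lborel (\<lambda>y. norm (K y * of_real (\<rho> y powr b)))" by (rule integrable_norm)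
  then show ?thesis by (simp add: norm_mult)
qed

text \<open>Fubini is legitimate because the increment of \<phi> supplies both one power of \<rho> y
  against the singularity and the decay in x against the growth of \<open>f\<close>.\<close>

lemma cz_op_schwartz_pairing:
  assumes f: "poly_bounded f" "f \<in> borel_measurable borel" and \<phi>: "\<phi> \<in> schwartz"
  shows "(LINT x|lborel. f x * cz_op K c \<phi> x)
    = (LINT y|lborel. K y * (LINT x|lborel. f x * (\<phi> (x - y) - \<phi> x))) + c * (LINT x|lborel. f x * \<phi> x)"
proof -
  have [measurable]: "f \<in> borel_measurable borel" "\<phi> \<in> borel_measurable borel" using f schwartz_measurable[OF \<phi>] by auto
  obtain C N where C: "0 \<le> C" "\<And>x. norm (f x) \<le> C * (1 + norm x) ^ N" using poly_boundedE[OF f(1)] by metis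
  obtain B where B: "0 \<le> B" "\<And>x y. norm y \<le> (1 + R) * R \<Longrightarrow> norm (\<phi> (x - y) - \<phi> x) \<le> B * norm y / (1 + norm x) ^ (N + (DIM('v) + 1))"
    using schwartz_increment[OF \<phi>, of "(1 + R) * R"] R_pos by (metis add_nonneg_nonneg less_imp_le mult_nonneg_nonneg zero_le_one)
  have swap: "(LINT x|lborel. LINT y|lborel. f x * (K y * (\<phi> (x - y) - \<phi> x)))
      = (LINT y|lborel. LINT x|lborel. f x * (K y * (\<phi> (x - y) - \<phi> x)))"
  proof (rule integral_swap)
    have m1: "(\<lambda>z. f (fst z)) \<in> borel_measurable ((borel :: 'v measure) \<Otimes>\<^sub>M (borel :: 'v measure))"
      by (rule measurable_compose[OF measurable_fst]) fact
    have m2: "(\<lambda>z. \<phi> (fst z)) \<in> borel_measurable ((borel :: 'v measure) \<Otimes>\<^sub>M (borel :: 'v measure))"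
      by (rule measurable_compose[OF measurable_fst]) fact
    note [measurable] = m1 m2
    show "case_prod (\<lambda>x y. f x * (K y * (\<phi> (x - y) - \<phi> x))) \<in> borel_measurable (lborel \<Otimes>\<^sub>M lborel)" by (simp add: case_prod_beta')
    show "integrable lborel (\<lambda>x::'v. (C * B * (1 + R)) * (1 / (1 + norm x) ^ (DIM('v) + 1)))"
      by (intro integrable_mult_right integrable_inverse_power)
    show "integrable lborel (\<lambda>y. norm (K y) * \<rho> y powr 1)" by (rule integrable_K_power) simp
    fix x y
    show "norm (f x * (K y * (\<phi> (x - y) - \<phi> x))) \<le> (C * B * (1 + R)) * (1 / (1 + norm x) ^ (DIM('v) + 1)) * (norm (K y) * \<rho> y powr 1)"
    proof (cases "\<rho> y < R")
      case True
      have ny: "norm y \<le> (1 + R) * \<rho> y" using True by (intro norm_le_mult) auto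
      also have "... \<le> (1 + R) * R" using True R_pos by (intro mult_left_mono) auto
      finally have "norm (\<phi> (x - y) - \<phi> x) \<le> B * norm y / (1 + norm x) ^ (N + (DIM('v) + 1))" by (rule B(2))
      also have "... \<le> B * ((1 + R) * \<rho> y) / (1 + norm x) ^ (N + (DIM('v) + 1))"
        using ny B(1) by (intro divide_right_mono mult_left_mono) auto
      finally have "norm (f x) * (norm (K y) * norm (\<phi> (x - y) - \<phi> x))
          \<le> (C * (1 + norm x) ^ N) * (norm (K y) * (B * ((1 + R) * \<rho> y) / (1 + norm x) ^ (N + (DIM('v) + 1))))"
        using C by (intro mult_mono mult_left_mono) auto
      also have "... = (C * B * (1 + R)) * (1 / (1 + norm x) ^ (DIM('v) + 1)) * (norm (K y) * \<rho> y powr 1)"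
        using one_add_norm_pos[of x] unfolding power_add[of _ N] by (simp add: divide_simps)
      finally show ?thesis by (simp add: norm_mult)
    next
      case False
      then show ?thesis by (simp add: support not_less)
    qed
  qed
  have fphi: "integrable lborel (\<lambda>x. f x * \<phi> x)" using f \<phi> by (rule integrable_poly_schwartz)
  have fT: "integrable lborel (\<lambda>x. f x * cz_op K c \<phi> x)" using f cz_op_schwartz[OF \<phi>] by (rule integrable_poly_schwartz)
  have eq: "f x * (LINT y|lborel. K y * (\<phi> (x - y) - \<phi> x)) = f x * cz_op K c \<phi> x - c * (f x * \<phi> x)" for x
    by (simp add: cz_op_def algebra_simps)
  have "(LINT x|lborel. LINT y|lborel. f x * (K y * (\<phi> (x - y) - \<phi> x))) = (LINT x|lborel. f x * cz_op K c \<phi> x - c * (f x * \<phi> x))"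
    by (simp add: eq)
  also have "... = (LINT x|lborel. f x * cz_op K c \<phi> x) - c * (LINT x|lborel. f x * \<phi> x)" using fphi fT by simp
  finally have e: "(LINT x|lborel. LINT y|lborel. f x * (K y * (\<phi> (x - y) - \<phi> x)))
      = (LINT x|lborel. f x * cz_op K c \<phi> x) - c * (LINT x|lborel. f x * \<phi> x)" .
  have "(LINT x|lborel. f x * cz_op K c \<phi> x)
      = (LINT y|lborel. LINT x|lborel. f x * (K y * (\<phi> (x - y) - \<phi> x))) + c * (LINT x|lborel. f x * \<phi> x)"
    unfolding swap[symmetric] e by simp
  also have "(\<lambda>y. LINT x|lborel. f x * (K y * (\<phi> (x - y) - \<phi> x))) = (\<lambda>y. K y * (LINT x|lborel. f x * (\<phi> (x - y) - \<phi> x)))"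
    by (simp add: mult.left_commute[of _ "K _"])
  finally show ?thesis .
qed

text \<open>By \<open>cz_op_schwartz_pairing\<close> with a polynomial p in place of
  \<open>f\<close>, it is enough that p is orthogonal to every translate of \<phi>; translating
  back, p(x + y) is again a polynomial in x.\<close>

lemma cz_op_schwartz0:
  assumes "\<phi> \<in> schwartz0" shows "cz_op K c \<phi> \<in> schwartz0" unfolding schwartz0_def mem_Collect_eq
proof (intro conjI allI impI)
  have \<phi>: "\<phi> \<in> schwartz" using assms by (simp add: schwartz0_def)
  have zero: "(LINT x|lborel. of_real (p x) * \<phi> x) = 0" if "real_polynomial_function p" for p
    using assms that by (simp add: schwartz0_def scaleR_conv_of_real)
  show "cz_op K c \<phi> \<in> schwartz" using \<phi> by (rule cz_op_schwartz)
  fix p :: "'v \<Rightarrow> real" assume p: "real_polynomial_function p"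
  have meas: "(\<lambda>x. complex_of_real (p x)) \<in> borel_measurable borel"
  proof -
    have "isCont p x" for x using p by (rule continuous_real_polymonial_function)
    then show ?thesis by (intro borel_measurable_continuous_onI continuous_intros continuous_at_imp_continuous_on) auto
  qed
  have "poly_bounded p" using p by (rule poly_bounded_real_polynomial)
  then have pb: "poly_bounded (\<lambda>x. complex_of_real (p x))" by (simp add: poly_bounded_def)
  have "(LINT x|lborel. of_real (p x) * (\<phi> (x - y) - \<phi> x)) = 0" for y
  proof -
    have "real_polynomial_function (p \<circ> (\<lambda>x. x + y))" using p by (intro real_polynomial_function_compose polynomial_function_add) auto
    then have "(LINT x|lborel. of_real (p (x + y)) * \<phi> x) = 0" using zero[of "p \<circ> (\<lambda>x. x + y)"] by simp
    then show ?thesis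
      using schwartz_shift[OF \<phi> pb meas, of y] integrable_poly_schwartz[OF pb meas \<phi>] zero[OF p] by (simp add: right_diff_distrib)
  qed
  then show "(LINT x|lborel. p x *\<^sub>R cz_op K c \<phi> x) = 0"
    using cz_op_schwartz_pairing[OF pb meas \<phi>] zero[OF p] by (simp add: scaleR_conv_of_real)
qed

lemma tame_local_hoelder:
  assumes f: "tame R b f" and b: "0 < b" shows "local_hoelder b f" unfolding local_hoelder_def
proof (intro conjI allI)
  show cont: "continuous_on UNIV f" using f by (simp add: tame_def)
  fix s
  obtain C N where C: "\<And>x u. \<rho> u \<le> R \<Longrightarrow> norm (f (x - u) - f x) \<le> C * (1 + norm x) ^ N * \<rho> u powr b" using f unfolding tame_def by blast
  obtain B where B: "0 \<le> B" "\<And>y. \<rho> y \<le> 2 * s \<Longrightarrow> norm (f y) \<le> B" using bounded_on_cball[OF cont] by metis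
  define L where "L = \<bar>C\<bar> * (1 + (s + s\<^sup>2)) ^ N + 2 * B / R powr b"
  have "norm (f (x - u) - f x) \<le> L * \<rho> u powr b" if x: "\<rho> x \<le> s" and u: "\<rho> u \<le> s" for x u
  proof (cases "\<rho> u \<le> R")
    case True
    have "norm x \<le> s + s\<^sup>2" using norm_le[of x] x power_mono[OF x nonneg, of 2] by linarith
    then have "C * (1 + norm x) ^ N \<le> \<bar>C\<bar> * (1 + (s + s\<^sup>2)) ^ N" by (intro mult_mono power_mono) auto
    also have "... \<le> L" using B by (simp add: L_def)
    finally have "C * (1 + norm x) ^ N * \<rho> u powr b \<le> L * \<rho> u powr b" by (intro mult_right_mono) auto
    with C[OF True, of x] show ?thesis by linarith
  next
    case False
    have s0: "0 \<le> s" using x nonneg[of x] by linarith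
    have "\<rho> (x - u) \<le> 2 * s" "\<rho> x \<le> 2 * s" using triangle_diff[of x u] x u s0 by linarith+
    then have "norm (f (x - u) - f x) \<le> 2 * B" using B(2)[of x] B(2)[of "x - u"] norm_triangle_ineq4[of "f (x - u)" "f x"] by linarith
    also have "... = 2 * B / R powr b * R powr b" using R_pos by simp
    also have "... \<le> 2 * B / R powr b * \<rho> u powr b" using False B R_pos b by (intro mult_left_mono powr_mono2) auto
    also have "... \<le> L * \<rho> u powr b" using s0 by (intro mult_right_mono) (auto simp: L_def)
    finally show ?thesis .
  qed
  then show "\<exists>L. \<forall>x u. \<rho> x \<le> s \<longrightarrow> \<rho> u \<le> s \<longrightarrow> norm (f (x - u) - f x) \<le> L * \<rho> u powr b" by blast
qed

lemma tame_integrable: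
  assumes f: "tame R b f" and b: "0 < b"
  shows "integrable lborel (\<lambda>y. K y * (f (x - y) - f x))"
proof -
  obtain C N where C: "\<And>x u. \<rho> u \<le> R \<Longrightarrow> norm (f (x - u) - f x) \<le> C * (1 + norm x) ^ N * \<rho> u powr b" using f unfolding tame_def by blast
  have [measurable]: "f \<in> borel_measurable borel" using f by (intro borel_measurable_continuous_onI) (simp add: tame_def)
  show ?thesis
  proof (rule integrable_K_Hoelder[OF b, of "\<bar>C * (1 + norm x) ^ N\<bar>"])
    show "norm (f (x - y) - f x) \<le> \<bar>C * (1 + norm x) ^ N\<bar> * \<rho> y powr b" if "\<rho> y < R" for y
      by (rule order_trans[OF C]) (use that in \<open>auto intro!: mult_right_mono\<close>)
  qed auto
qed

text \<open>Fubini, now with the increment on \<open>f\<close>. In the inner integral a translation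
  moves it to \<phi>, with y reflected, and what results is the pairing formula for the reflected
  kernel.\<close>

lemma cz_op_tame_pairing:
  assumes f: "tame R b f" and b: "0 < b" and \<phi>: "\<phi> \<in> schwartz"
  shows "(LINT x|lborel. cz_op K c f x * \<phi> x) = (LINT x|lborel. f x * cz_op (\<lambda>y. K (- y)) c \<phi> x)"
proof -
  interpret r: cz_kernel \<rho> "\<lambda>y. K (- y)" A R \<delta> c by (rule reflected_cz_kernel)
  have pb: "poly_bounded f" and cont: "continuous_on UNIV f" using f by (simp_all add: tame_def)
  have fm: "f \<in> borel_measurable borel" using cont by (rule borel_measurable_continuous_onI)
  have [measurable]: "f \<in> borel_measurable borel" "\<phi> \<in> borel_measurable borel" using fm schwartz_measurable[OF \<phi>] by auto
  obtain C0 N where C0: "\<And>x u. \<rho> u \<le> R \<Longrightarrow> norm (f (x - u) - f x) \<le> C0 * (1 + norm x) ^ N * \<rho> u powr b" using f unfolding tame_def by blast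
  define C where "C = \<bar>C0\<bar>"
  have C: "0 \<le> C" "\<And>x u. \<rho> u \<le> R \<Longrightarrow> norm (f (x - u) - f x) \<le> C * (1 + norm x) ^ N * \<rho> u powr b"
    by (auto simp: C_def intro!: order_trans[OF C0] mult_right_mono)
  obtain D where D: "0 \<le> D" "\<And>x. C * (1 + norm x) ^ N * norm (\<phi> x) \<le> D / (1 + norm x) ^ (DIM('v) + 1)"
    using schwartz_dominating[OF \<phi> C(1)] by metis
  have bound: "norm (K y * ((f (x - y) - f x) * \<phi> x)) \<le> D * (1 / (1 + norm x) ^ (DIM('v) + 1)) * (norm (K y) * \<rho> y powr b)" for x y
  proof (cases "\<rho> y < R")
    case True
    have "norm (K y) * (norm (f (x - y) - f x) * norm (\<phi> x)) \<le> norm (K y) * ((C * (1 + norm x) ^ N * \<rho> y powr b) * norm (\<phi> x))"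
      using C(2)[of y x] True by (intro mult_left_mono mult_right_mono) auto
    also have "... = (C * (1 + norm x) ^ N * norm (\<phi> x)) * (norm (K y) * \<rho> y powr b)" by (simp add: mult_ac)
    also have "... \<le> D / (1 + norm x) ^ (DIM('v) + 1) * (norm (K y) * \<rho> y powr b)" using D(2)[of x] by (intro mult_right_mono) auto
    finally show ?thesis by (simp add: norm_mult)
  next
    case False
    then show ?thesis by (simp add: support not_less)
  qed
  have Tf_pb: "poly_bounded (cz_op K c f)"
  proof -
    have "norm (cz_op K c f x - c * f x) \<le> (C * A * R powr b / (1 - 1 / 2 powr b)) * (1 + norm x) ^ N" for x
    proof -
      have "norm (LINT y|lborel. K y * (f (x - y) - f x)) \<le> (C * (1 + norm x) ^ N) * A * R powr b / (1 - 1 / 2 powr b)"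
        using C one_add_norm_pos[of x] by (intro norm_integral_K_Hoelder[OF b]) auto
      then show ?thesis by (simp add: cz_op_def mult_ac)
    qed
    then have "poly_bounded (\<lambda>x. cz_op K c f x - c * f x)" unfolding poly_bounded_def by blast
    moreover have "poly_bounded (\<lambda>x. c * f x)"
    proof -
      obtain C1 M where C1: "0 \<le> C1" "\<And>x. norm (f x) \<le> C1 * (1 + norm x) ^ M" using poly_boundedE[OF pb] by metis
      have "norm (c * f x) \<le> (norm c * C1) * (1 + norm x) ^ M" for x unfolding norm_mult mult.assoc using C1 by (intro mult_left_mono) auto
      then show ?thesis unfolding poly_bounded_def by blast
    qed
    ultimately have "poly_bounded (\<lambda>x. (cz_op K c f x - c * f x) + c * f x)" by (rule poly_bounded_add)
    then show ?thesis by simp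
  qed
  have fphi: "integrable lborel (\<lambda>x. f x * \<phi> x)" using pb fm \<phi> by (rule integrable_poly_schwartz)
  have Tfphi: "integrable lborel (\<lambda>x. cz_op K c f x * \<phi> x)"
    using Tf_pb cz_op_measurable[OF tame_local_hoelder[OF f b] b] \<phi> by (rule integrable_poly_schwartz)
  have swap: "(LINT x|lborel. LINT y|lborel. K y * ((f (x - y) - f x) * \<phi> x))
      = (LINT y|lborel. LINT x|lborel. K y * ((f (x - y) - f x) * \<phi> x))"
  proof (rule integral_swap)
    have m1: "(\<lambda>z. f (fst z)) \<in> borel_measurable ((borel :: 'v measure) \<Otimes>\<^sub>M (borel :: 'v measure))"
      by (rule measurable_compose[OF measurable_fst]) fact
    have m2: "(\<lambda>z. \<phi> (fst z)) \<in> borel_measurable ((borel :: 'v measure) \<Otimes>\<^sub>M (borel :: 'v measure))"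
      by (rule measurable_compose[OF measurable_fst]) fact
    note [measurable] = m1 m2
    show "case_prod (\<lambda>x y. K y * ((f (x - y) - f x) * \<phi> x)) \<in> borel_measurable (lborel \<Otimes>\<^sub>M lborel)" by (simp add: case_prod_beta')
    show "integrable lborel (\<lambda>x::'v. D * (1 / (1 + norm x) ^ (DIM('v) + 1)))" by (intro integrable_mult_right integrable_inverse_power)
    show "integrable lborel (\<lambda>y. norm (K y) * \<rho> y powr b)" using b by (rule integrable_K_power)
  qed (rule bound)
  have inner: "(LINT x|lborel. (f (x - y) - f x) * \<phi> x) = (LINT x|lborel. f x * (\<phi> (x + y) - \<phi> x))" for y
  proof -
    have "integrable lborel (\<lambda>x. f (x + (- y)) * \<phi> x)"
      using poly_bounded_shift[OF pb, of "- y"] \<phi> by (intro integrable_poly_schwartz) simp_all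
    then show ?thesis using schwartz_shift[OF \<phi> pb fm, of "- y"] fphi by (simp add: left_diff_distrib right_diff_distrib)
  qed
  have "(LINT x|lborel. cz_op K c f x * \<phi> x) - c * (LINT x|lborel. f x * \<phi> x) = (LINT x|lborel. cz_op K c f x * \<phi> x - c * (f x * \<phi> x))"
    using fphi Tfphi by simp
  also have "... = (LINT x|lborel. LINT y|lborel. K y * ((f (x - y) - f x) * \<phi> x))"
  proof (intro Bochner_Integration.integral_cong refl)
    fix x
    have "cz_op K c f x * \<phi> x - c * (f x * \<phi> x) = (LINT y|lborel. K y * (f (x - y) - f x)) * \<phi> x"
      by (simp add: cz_op_def distrib_right mult.assoc)
    also have "... = (LINT y|lborel. K y * (f (x - y) - f x) * \<phi> x)" by simp
    finally show "cz_op K c f x * \<phi> x - c * (f x * \<phi> x) = (LINT y|lborel. K y * ((f (x - y) - f x) * \<phi> x))" by (simp only: mult.assoc)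
  qed
  also have "... = (LINT y|lborel. K y * (LINT x|lborel. f x * (\<phi> (x + y) - \<phi> x)))" by (simp add: swap inner)
  also have "... = (LINT y|lborel. K (- y) * (LINT x|lborel. f x * (\<phi> (x - y) - \<phi> x)))"
    using integral_lborel_diff[of "\<lambda>y. K y * (LINT x|lborel. f x * (\<phi> (x + y) - \<phi> x))" 0] by simp
  finally show ?thesis using r.cz_op_schwartz_pairing[OF pb fm \<phi>] by (simp add: algebra_simps)
qed

theorem lim_mod_poly_pv_op:
  assumes f: "tame R b f" and b: "0 < b"
    and fs: "\<And>m. fs m \<in> L2" "\<And>m. tame R b (fs m)" and lim: "lim_mod_poly fs f"
  shows "lim_mod_poly (\<lambda>m. pv_op \<rho> K (fs m)) (cz_op K c f)" unfolding lim_mod_poly_def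
proof
  fix \<phi> :: "'v \<Rightarrow> complex" assume \<phi>0: "\<phi> \<in> schwartz0"
  interpret r: cz_kernel \<rho> "\<lambda>y. K (- y)" A R \<delta> c by (rule reflected_cz_kernel)
  have \<phi>: "\<phi> \<in> schwartz" using \<phi>0 by (simp add: schwartz0_def)
  have [measurable]: "\<phi> \<in> borel_measurable borel" using \<phi> by (rule schwartz_measurable)
  have "(LINT x|lborel. pv_op \<rho> K (fs m) x * \<phi> x) = (LINT x|lborel. fs m x * cz_op (\<lambda>y. K (- y)) c \<phi> x)" for m
  proof -
    note lh = tame_local_hoelder[OF fs(2)[of m] b]
    note pv = pv_op_eq_cz_op[OF fs(1)[of m] lh b]
    have [measurable]: "pv_op \<rho> K (fs m) \<in> borel_measurable borel" "cz_op K c (fs m) \<in> borel_measurable borel"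
      using pv(1) cz_op_measurable[OF lh b] by auto
    have "(LINT x|lborel. pv_op \<rho> K (fs m) x * \<phi> x) = (LINT x|lborel. cz_op K c (fs m) x * \<phi> x)"
      using pv(2) by (intro integral_cong_AE) auto
    also have "... = (LINT x|lborel. fs m x * cz_op (\<lambda>y. K (- y)) c \<phi> x)" using fs(2) b \<phi> by (rule cz_op_tame_pairing)
    finally show ?thesis .
  qed
  moreover have "(LINT x|lborel. cz_op K c f x * \<phi> x) = (LINT x|lborel. f x * cz_op (\<lambda>y. K (- y)) c \<phi> x)"
    using f b \<phi> by (rule cz_op_tame_pairing)
  moreover have "cz_op (\<lambda>y. K (- y)) c \<phi> \<in> schwartz0" using \<phi>0 by (rule r.cz_op_schwartz0)
  ultimately show "(\<lambda>m. LINT x|lborel. pv_op \<rho> K (fs m) x * \<phi> x) \<longlonglongrightarrow> (LINT x|lborel. cz_op K c f x * \<phi> x)"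
    using lim unfolding lim_mod_poly_def by simp
qed

end

section \<open>Lipschitz seminorms and approximating sequences\<close>

lemma ennreal_divide_le_iff:
  assumes "0 < q" "0 \<le> L"
  shows "x / ennreal q \<le> ennreal L \<longleftrightarrow> x \<le> ennreal (L * q)"
proof (cases x)
  case (real r)
  then have "x / ennreal q = ennreal (r / q)" using assms by (simp add: divide_ennreal)
  then show ?thesis using real assms by (simp add: divide_le_eq)
next
  case top
  then show ?thesis using assms by (simp add: ennreal_top_divide top_unique)
qed

lemma sup_norm_le_iff: "0 \<le> L \<Longrightarrow> sup_norm f \<le> ennreal L \<longleftrightarrow> (\<forall>x. norm (f x) \<le> L)" by (simp add: sup_norm_def SUP_le_iff)

text \<open>Common form of the two one-parameter seminorms, so that the proof for a general length
  covers both.\<close>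

definition lip_norm :: "('v::euclidean_space \<Rightarrow> real) \<Rightarrow> real \<Rightarrow> ('v \<Rightarrow> complex) \<Rightarrow> ennreal" where
  "lip_norm \<rho> a f = (SUP u\<in>-{0}. sup_norm (diff_op u f) / ennreal (\<rho> u powr a))"

lemma (in length_function) lip_norm_le_iff:
  assumes "0 \<le> L" shows "lip_norm \<rho> a f \<le> ennreal L \<longleftrightarrow> hoelder a L f"
proof -
  have "lip_norm \<rho> a f \<le> ennreal L \<longleftrightarrow> (\<forall>u\<in>-{0}. \<forall>x. norm (f (x - u) - f x) \<le> L * \<rho> u powr a)"
    unfolding lip_norm_def SUP_le_iff
    by (intro ball_cong refl) (simp add: ennreal_divide_le_iff[OF _ assms] sup_norm_le_iff assms eq_0_iff diff_op_def)
  also have "... \<longleftrightarrow> hoelder a L f" unfolding hoelder_def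
  proof (intro iffI allI)
    fix x u assume "\<forall>u\<in>-{0}. \<forall>x. norm (f (x - u) - f x) \<le> L * \<rho> u powr a"
    then show "norm (f (x - u) - f x) \<le> L * \<rho> u powr a" by (cases "u = 0") auto
  qed auto
  finally show ?thesis .
qed

lemma powr_le_one_add: "0 \<le> t \<Longrightarrow> 0 \<le> a \<Longrightarrow> a \<le> 1 \<Longrightarrow> t powr a \<le> 1 + (t::real)"
proof (cases "t \<le> 1")
  case True
  assume "0 \<le> t" "0 \<le> a"
  then have "t powr a \<le> 1" using True by (intro powr_le1) auto
  with \<open>0 \<le> t\<close> show ?thesis by linarith
next
  case False
  assume "a \<le> 1"
  then have "t powr a \<le> t powr 1" using False by (intro powr_mono) auto
  with False show ?thesis by simp
qed

context length_function begin

lemma powr_le: "0 \<le> a \<Longrightarrow> a \<le> 1 \<Longrightarrow> \<rho> u powr a \<le> 2 + norm u" using powr_le_one_add[of "\<rho> u" a] le_norm[of u] by simp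

lemma hoelder_tame:
  assumes f: "hoelder a L f" and a: "0 < a" "a \<le> 1"
  shows "tame R a f" unfolding tame_def
proof (intro conjI)
  have L: "0 \<le> L" using f by (rule hoelder_nonneg)
  show "continuous_on UNIV f" using f a(1) by (rule hoelder_continuous)
  have "norm (f x) \<le> (norm (f 0) + 2 * L) * (1 + norm x) ^ 1" for x
  proof -
    have "norm (f x) \<le> norm (f 0) + norm (f x - f 0)" by (rule norm_triangle_sub)
    also have "norm (f x - f 0) \<le> L * \<rho> (- x) powr a" using hoelderD[OF f, of 0 "- x"] by simp
    also have "... \<le> L * (2 + norm x)" using powr_le[of a "- x"] a L by (intro mult_left_mono) auto
    finally have "norm (f x) \<le> norm (f 0) + L * (2 + norm x)" by simp
    also have "... \<le> (norm (f 0) + 2 * L) * (1 + norm x)" using L by (simp add: algebra_simps)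
    finally show ?thesis by simp
  qed
  then show "poly_bounded f" unfolding poly_bounded_def by blast
  have "norm (f (x - u) - f x) \<le> L * (1 + norm x) ^ 0 * \<rho> u powr a" for x u using hoelderD[OF f, of x u] by simp
  then show "\<exists>C N. \<forall>x u. \<rho> u \<le> R \<longrightarrow> norm (f (x - u) - f x) \<le> C * (1 + norm x) ^ N * \<rho> u powr a" by blast
qed

end

lemma schwartz0_affine:
  fixes \<phi> :: "'v::euclidean_space \<Rightarrow> complex" and w :: "'v \<Rightarrow> complex"
  assumes \<phi>: "\<phi> \<in> schwartz0"
  shows "integrable lborel (\<lambda>x. (a + (\<Sum>b\<in>Basis. of_real (x \<bullet> b) * w b)) * \<phi> x)"
    and "(LINT x|lborel. (a + (\<Sum>b\<in>Basis. of_real (x \<bullet> b) * w b)) * \<phi> x) = 0"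
proof -
  have \<phi>': "\<phi> \<in> schwartz" using \<phi> by (simp add: schwartz0_def)
  have p1: "real_polynomial_function (\<lambda>x::'v. 1)" by (rule real_polynomial_function.intros)
  have pb: "real_polynomial_function (\<lambda>x::'v. x \<bullet> b)" for b by (intro real_polynomial_function.intros(1) bounded_linear_inner_left)
  have i: "integrable lborel (\<lambda>x. p x *\<^sub>R \<phi> x)" if "real_polynomial_function p" "continuous_on UNIV p" for p
  proof -
    have "poly_bounded p" using that(1) by (rule poly_bounded_real_polynomial)
    then have "poly_bounded (\<lambda>x. complex_of_real (p x))" by (simp add: poly_bounded_def)
    moreover have "(\<lambda>x. complex_of_real (p x)) \<in> borel_measurable borel"
      using that(2) by (intro borel_measurable_continuous_onI continuous_intros)
    ultimately have "integrable lborel (\<lambda>x. complex_of_real (p x) * \<phi> x)" using \<phi>' by (rule integrable_poly_schwartz)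
    then show ?thesis by (simp add: scaleR_conv_of_real)
  qed
  have i1: "integrable lborel (\<lambda>x. (1::real) *\<^sub>R \<phi> x)" by (rule i[OF p1]) simp
  have ib: "integrable lborel (\<lambda>x. (x \<bullet> b) *\<^sub>R \<phi> x)" for b by (rule i[OF pb]) (intro continuous_intros)
  have eq: "(\<lambda>x. (a + (\<Sum>b\<in>Basis. of_real (x \<bullet> b) * w b)) * \<phi> x) = (\<lambda>x. a * ((1::real) *\<^sub>R \<phi> x) + (\<Sum>b\<in>Basis. w b * ((x \<bullet> b) *\<^sub>R \<phi> x)))"
    by (rule ext) (simp add: distrib_left sum_distrib_left scaleR_conv_of_real mult_ac)
  show "integrable lborel (\<lambda>x. (a + (\<Sum>b\<in>Basis. of_real (x \<bullet> b) * w b)) * \<phi> x)"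
    unfolding eq using i1 ib by (intro Bochner_Integration.integrable_add integrable_mult_right Bochner_Integration.integrable_sum)
  have "(LINT x|lborel. a * ((1::real) *\<^sub>R \<phi> x) + (\<Sum>b\<in>Basis. w b * ((x \<bullet> b) *\<^sub>R \<phi> x)))
      = a * (LINT x|lborel. (1::real) *\<^sub>R \<phi> x) + (\<Sum>b\<in>Basis. w b * (LINT x|lborel. (x \<bullet> b) *\<^sub>R \<phi> x))"
  proof -
    have s: "integrable lborel (\<lambda>x. \<Sum>b\<in>Basis. w b * ((x \<bullet> b) *\<^sub>R \<phi> x))"
      by (intro Bochner_Integration.integrable_sum integrable_mult_right ib)
    have "(LINT x|lborel. (\<Sum>b\<in>Basis. w b * ((x \<bullet> b) *\<^sub>R \<phi> x))) = (\<Sum>b\<in>Basis. LINT x|lborel. w b * ((x \<bullet> b) *\<^sub>R \<phi> x))"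
      by (intro Bochner_Integration.integral_sum integrable_mult_right ib)
    then show ?thesis by (simp only: Bochner_Integration.integral_add[OF integrable_mult_right[OF i1] s] integral_mult_right_zero)
  qed
  also have "... = 0"
  proof -
    have "(LINT x|lborel. (1::real) *\<^sub>R \<phi> x) = 0" using \<phi> p1 unfolding schwartz0_def by blast
    moreover have "(LINT x|lborel. (x \<bullet> b) *\<^sub>R \<phi> x) = 0" for b using \<phi> pb[of b] unfolding schwartz0_def by blast
    ultimately show ?thesis by simp
  qed
  finally show "(LINT x|lborel. (a + (\<Sum>b\<in>Basis. of_real (x \<bullet> b) * w b)) * \<phi> x) = 0" unfolding eq .
qed

text \<open>Elements of \<open>schwartz0\<close> annihilate affine functions, so \<open>fs m\<close>
  may drift away from \<open>f\<close> by an affine function that varies with \<open>m\<close> in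
  any way; the error left after removing it is allowed a fixed polynomial weight, which Schwartz
  decay absorbs.\<close>

lemma lim_mod_polyI:
  fixes f :: "'v::euclidean_space \<Rightarrow> complex" and w :: "nat \<Rightarrow> 'v \<Rightarrow> complex"
  assumes f: "poly_bounded f" "continuous_on UNIV f" and fs: "\<And>m. continuous_on UNIV (fs m)"
    and le: "\<And>m x. norm (fs m x - f x + (a m + (\<Sum>b\<in>Basis. of_real (x \<bullet> b) * w m b))) \<le> \<eta> m * (1 + norm x) ^ N"
    and \<eta>: "\<eta> \<longlonglongrightarrow> 0"
  shows "lim_mod_poly fs f" unfolding lim_mod_poly_def
proof
  fix \<phi> :: "'v \<Rightarrow> complex" assume \<phi>0: "\<phi> \<in> schwartz0"
  then have \<phi>: "\<phi> \<in> schwartz" by (simp add: schwartz0_def)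
  have [measurable]: "\<phi> \<in> borel_measurable borel" using \<phi> by (rule schwartz_measurable)
  let ?p = "\<lambda>m x. a m + (\<Sum>b\<in>Basis. of_real (x \<bullet> b) * w m b)"
  let ?E = "\<lambda>m x. fs m x - f x + ?p m x"
  have E_cont: "continuous_on UNIV (?E m)" for m by (intro continuous_intros fs f)
  have E_int: "integrable lborel (\<lambda>x. ?E m x * \<phi> x)" for m
  proof (rule integrable_poly_schwartz[OF _ _ \<phi>])
    show "poly_bounded (?E m)" using le unfolding poly_bounded_def by blast
    show "?E m \<in> borel_measurable borel" using E_cont by (rule borel_measurable_continuous_onI)
  qed
  obtain D where D: "0 \<le> D" "\<And>x. 1 * (1 + norm x) ^ N * norm (\<phi> x) \<le> D / (1 + norm x) ^ (DIM('v) + 1)"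
    using schwartz_dominating[OF \<phi>, of 1 N] by auto
  have f_int: "integrable lborel (\<lambda>x. f x * \<phi> x)"
    using f \<phi> by (intro integrable_poly_schwartz) (auto intro: borel_measurable_continuous_onI)
  define J where "J = (LINT x|lborel. D * (1 / (1 + norm (x::'v)) ^ (DIM('v) + 1)))"
  have J_int: "integrable lborel (\<lambda>x::'v. D * (1 / (1 + norm x) ^ (DIM('v) + 1)))" by (intro integrable_mult_right integrable_inverse_power)
  have bound: "norm ((LINT x|lborel. fs m x * \<phi> x) - (LINT x|lborel. f x * \<phi> x)) \<le> \<eta> m * J" for m
  proof -
    have "\<eta> m * 1 \<ge> 0" using order_trans[OF norm_ge_zero le[of m 0]] by simp
    then have \<eta>0: "0 \<le> \<eta> m" by simp
    have "(LINT x|lborel. fs m x * \<phi> x) = (LINT x|lborel. ?E m x * \<phi> x + f x * \<phi> x - ?p m x * \<phi> x)"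
      by (intro Bochner_Integration.integral_cong) (auto simp: algebra_simps)
    also have "... = (LINT x|lborel. ?E m x * \<phi> x) + (LINT x|lborel. f x * \<phi> x) - (LINT x|lborel. ?p m x * \<phi> x)"
      by (simp only: Bochner_Integration.integral_diff[OF Bochner_Integration.integrable_add[OF E_int f_int] schwartz0_affine(1)[OF \<phi>0]]
        Bochner_Integration.integral_add[OF E_int f_int])
    finally have "(LINT x|lborel. fs m x * \<phi> x) - (LINT x|lborel. f x * \<phi> x) = (LINT x|lborel. ?E m x * \<phi> x)"
      by (simp only: schwartz0_affine(2)[OF \<phi>0]) simp
    also have "norm ... \<le> (LINT x|lborel. norm (?E m x * \<phi> x))" by (rule integral_norm_bound)
    also have "... \<le> (LINT x|lborel. \<eta> m * (D * (1 / (1 + norm (x::'v)) ^ (DIM('v) + 1))))"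
    proof (rule Bochner_Integration.integral_mono)
      show "integrable lborel (\<lambda>x. norm (?E m x * \<phi> x))" using E_int by (rule integrable_norm)
      show "integrable lborel (\<lambda>x::'v. \<eta> m * (D * (1 / (1 + norm x) ^ (DIM('v) + 1))))" using J_int by (rule integrable_mult_right)
      fix x
      have "norm (?E m x * \<phi> x) \<le> (\<eta> m * (1 + norm x) ^ N) * norm (\<phi> x)" unfolding norm_mult using le by (intro mult_right_mono) auto
      also have "... = \<eta> m * (1 * (1 + norm x) ^ N * norm (\<phi> x))" by simp
      also have "... \<le> \<eta> m * (D / (1 + norm x) ^ (DIM('v) + 1))" using D(2) \<eta>0 by (rule mult_left_mono)
      finally show "norm (?E m x * \<phi> x) \<le> \<eta> m * (D * (1 / (1 + norm x) ^ (DIM('v) + 1)))" by simp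
    qed
    also have "... = \<eta> m * J" unfolding J_def by (rule integral_mult_right_zero)
    finally show ?thesis .
  qed
  have "(\<lambda>m. \<eta> m * J) \<longlonglongrightarrow> 0" using \<eta> by (rule tendsto_mult_left_zero)
  then have "(\<lambda>m. (LINT x|lborel. fs m x * \<phi> x) - (LINT x|lborel. f x * \<phi> x)) \<longlonglongrightarrow> 0"
    using bound by (intro Lim_null_comparison[of "\<lambda>m. (LINT x|lborel. fs m x * \<phi> x) - (LINT x|lborel. f x * \<phi> x)"]) auto
  then show "(\<lambda>m. LINT x|lborel. fs m x * \<phi> x) \<longlonglongrightarrow> (LINT x|lborel. f x * \<phi> x)" by (simp add: LIM_zero_iff)
qed

section \<open>Approximating sequences in the Hoelder spaces\<close>

context length_function begin

lemma bounded_support_L2: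
  assumes "continuous_on UNIV f" "\<And>x. norm (f x) \<le> Q" "\<And>x. r \<le> \<rho> x \<Longrightarrow> f x = 0"
  shows "f \<in> L2"
proof -
  have "l2_sq f \<le> ennreal (Q\<^sup>2) * emeasure lborel {x. \<rho> x < r}" using assms(2,3) by (rule l2_sq_bounded_support)
  also have "... < \<infinity>" using emeasure_ball_finite by (simp add: ennreal_mult_less_top)
  finally show ?thesis using assms(1) by (simp add: L2_iff borel_measurable_continuous_onI)
qed

text \<open>Subtracting f(0) makes the function of size at most L (2s)^a on the support, which
  balances the Hoelder constant s^(-a) of the cut-off. The constant 3, independent of s, is 1 for
  the increment of \<open>f\<close> plus 2 for that of the cut-off, since \<open>2 powr a\<close> is
  at most 2.\<close>

lemma hoelder_cutoff:
  assumes f: "hoelder a L f" and a: "0 < a" "a < 1" and s: "0 < s"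
  shows "hoelder a (3 * L) (\<lambda>x. of_real (cutoff s x) * (f x - f 0))"
proof -
  let ?f = "\<lambda>x. f x - f 0" and ?c = "\<lambda>x. complex_of_real (cutoff s x)"
  have L: "0 \<le> L" using f by (rule hoelder_nonneg)
  have main: "norm (?c (x - u) * ?f (x - u) - ?c x * ?f x) \<le> 3 * L * \<rho> u powr a" if x: "\<rho> x \<le> 2 * s" for x u
  proof -
    have 1: "norm (?c (x - u) * (f (x - u) - f x)) \<le> 1 * (L * \<rho> u powr a)"
      unfolding norm_mult using hoelderD[OF f] cutoff_bounds[of s "x - u"] by (intro mult_mono) auto
    have "norm (?f x) \<le> L * \<rho> (- x) powr a" using hoelderD[OF f, of 0 "- x"] by simp
    also have "... \<le> L * (2 * s) powr a" using x L a by (intro mult_left_mono powr_mono2) (auto simp: minus)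
    finally have fx: "norm (?f x) \<le> L * (2 * s) powr a" .
    have cd: "\<bar>cutoff s (x - u) - cutoff s x\<bar> \<le> (\<rho> u / s) powr a"
    proof (cases "\<rho> u \<le> s")
      case True
      have "(\<rho> u / s) powr 1 \<le> (\<rho> u / s) powr a" using True s a by (intro powr_mono') auto
      then show ?thesis using cutoff_diff[OF s, of x u] s by simp
    next
      case False
      then have "1 powr a \<le> (\<rho> u / s) powr a" using s a by (intro powr_mono2) auto
      then show ?thesis using cutoff_bounds[of s "x - u"] cutoff_bounds[of s x] by auto
    qed
    have "norm ((?c (x - u) - ?c x) * ?f x) \<le> (\<rho> u / s) powr a * (L * (2 * s) powr a)"
      unfolding norm_mult of_real_diff[symmetric] norm_of_real using cd fx by (intro mult_mono) auto
    also have "... = 2 powr a * (L * \<rho> u powr a)" using s by (simp add: powr_divide powr_mult)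
    also have "... \<le> 2 powr 1 * (L * \<rho> u powr a)" using a L by (intro mult_right_mono powr_mono) auto
    finally have 2: "norm ((?c (x - u) - ?c x) * ?f x) \<le> 2 * (L * \<rho> u powr a)" by simp
    have "?c (x - u) * ?f (x - u) - ?c x * ?f x = ?c (x - u) * (f (x - u) - f x) + (?c (x - u) - ?c x) * ?f x" by (simp add: algebra_simps)
    then show ?thesis using norm_triangle_ineq[of "?c (x - u) * (f (x - u) - f x)" "(?c (x - u) - ?c x) * ?f x"] 1 2 by simp
  qed
  show ?thesis unfolding hoelder_def
  proof (intro allI)
    fix x u
    show "norm (?c (x - u) * ?f (x - u) - ?c x * ?f x) \<le> 3 * L * \<rho> u powr a"
    proof (cases "\<rho> x \<le> 2 * s")
      case True
      then show ?thesis by (rule main)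
    next
      case x: False
      show ?thesis
      proof (cases "\<rho> (x - u) \<le> 2 * s")
        case True
        from main[OF this, of "- u"] show ?thesis by (simp add: minus norm_minus_commute)
      next
        case False
        then show ?thesis using x s L cutoff_eq_0[OF s, of x] cutoff_eq_0[OF s, of "x - u"] by simp
      qed
    qed
  qed
qed

lemma lip_spaceE:
  assumes "f \<in> lip_space (lip_norm \<rho> a)"
  obtains L where "0 \<le> L" "lip_norm \<rho> a f = ennreal L" "hoelder a L f"
proof -
  have "lip_norm \<rho> a f < top" using assms by (simp add: lip_space_def)
  then obtain L where L: "0 \<le> L" "lip_norm \<rho> a f = ennreal L" by (cases "lip_norm \<rho> a f") auto
  then have "hoelder a L f" using lip_norm_le_iff[OF L(1), of a f] by simp
  with L show ?thesis by (rule that)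
qed

lemma lip_spaceI:
  assumes "hoelder a L f" "0 < a" shows "f \<in> lip_space (lip_norm \<rho> a)" "lip_norm \<rho> a f \<le> ennreal L"
proof -
  show le: "lip_norm \<rho> a f \<le> ennreal L" using assms hoelder_nonneg[OF assms(1)] by (simp add: lip_norm_le_iff)
  show "f \<in> lip_space (lip_norm \<rho> a)" using hoelder_continuous[OF assms] le by (auto simp: lip_space_def intro: le_less_trans)
qed

lemma lip_approx_exists:
  assumes f: "f \<in> lip_space (lip_norm \<rho> \<alpha>)" and \<alpha>: "0 < \<alpha>" "\<alpha> < 1"
  shows "\<exists>fs. lip_approx (lip_norm \<rho> \<alpha>) 3 f fs"
proof -
  obtain L where L: "0 \<le> L" "lip_norm \<rho> \<alpha> f = ennreal L" and h: "hoelder \<alpha> L f" using f by (rule lip_spaceE)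
  have cont: "continuous_on UNIV f" using f by (simp add: lip_space_def)
  define fs where "fs = (\<lambda>m x. of_real (cutoff (real (Suc m)) x) * (f x - f 0))"
  have fs_h: "hoelder \<alpha> (3 * L) (fs m)" for m unfolding fs_def using h \<alpha> by (rule hoelder_cutoff) simp
  have fs_cont: "continuous_on UNIV (fs m)" for m using fs_h \<alpha>(1) by (rule hoelder_continuous)
  have sz: "norm (f x - f 0) \<le> L * (2 + norm x)" for x
  proof -
    have "norm (f x - f 0) \<le> L * \<rho> (- x) powr \<alpha>" using hoelderD[OF h, of 0 "- x"] by simp
    also have "... \<le> L * (2 + norm x)" using powr_le[of \<alpha> "- x"] \<alpha> L by (intro mult_left_mono) auto
    finally show ?thesis .
  qed
  have "fs m \<in> L2" for m
  proof -
    obtain Q where Q: "0 \<le> Q" "\<And>y. \<rho> y \<le> 2 * real (Suc m) \<Longrightarrow> norm (fs m y) \<le> Q" using bounded_on_cball[OF fs_cont] by metis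
    have z: "fs m x = 0" if "2 * real (Suc m) \<le> \<rho> x" for x using that cutoff_eq_0[of "real (Suc m)" x] by (simp add: fs_def)
    show ?thesis
    proof (rule bounded_support_L2[OF fs_cont _ z])
      show "norm (fs m x) \<le> Q" for x using Q z[of x] by (cases "\<rho> x \<le> 2 * real (Suc m)") auto
    qed
  qed
  moreover have "fs m \<in> lip_space (lip_norm \<rho> \<alpha>)" "lip_norm \<rho> \<alpha> (fs m) \<le> ennreal 3 * lip_norm \<rho> \<alpha> f" for m
    using lip_spaceI[OF fs_h \<alpha>(1), of m] L by (simp_all add: ennreal_mult')
  moreover have "lim_mod_poly fs f"
  proof (rule lim_mod_polyI[where a = "\<lambda>m. f 0" and w = "\<lambda>_ _. 0" and N = 2])
    show "poly_bounded f" using hoelder_tame[OF h, of 1] \<alpha> by (simp add: tame_def)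
    show "(\<lambda>m. 2 * L * inverse (real (Suc m))) \<longlonglongrightarrow> 0" using LIMSEQ_inverse_real_of_nat by (rule tendsto_mult_right_zero)
    fix m x
    have "fs m x - f x + f 0 = of_real (cutoff (real (Suc m)) x - 1) * (f x - f 0)" by (simp add: fs_def algebra_simps)
    then have "norm (fs m x - f x + f 0) = \<bar>cutoff (real (Suc m)) x - 1\<bar> * norm (f x - f 0)" by (simp only: norm_mult norm_of_real)
    also have "... \<le> (inverse (real (Suc m)) * (1 + norm x)) * (L * (2 * (1 + norm x)))"
    proof (rule mult_mono)
      \<comment> \<open>The deviation is at most 1 and vanishes on the ball of radius m + 1; outside
        it 1 \<le> (1 + |x|) / (m + 1), which buys the rate at the price of one power of the
        weight.\<close>
      show "\<bar>cutoff (real (Suc m)) x - 1\<bar> \<le> inverse (real (Suc m)) * (1 + norm x)"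
      proof (cases "\<rho> x \<le> real (Suc m)")
        case False
        then have "real (Suc m) \<le> 1 + norm x" using le_norm[of x] by linarith
        then have "1 \<le> inverse (real (Suc m)) * (1 + norm x)" by (simp add: field_simps)
        then show ?thesis using cutoff_bounds[of "real (Suc m)" x] by linarith
      qed (simp add: cutoff_eq_1)
      have "L * (2 + norm x) \<le> L * (2 * (1 + norm x))" using L by (intro mult_left_mono) auto
      then show "norm (f x - f 0) \<le> L * (2 * (1 + norm x))" using sz[of x] by linarith
    qed auto
    also have "... = 2 * L * inverse (real (Suc m)) * (1 + norm x)\<^sup>2" by (simp add: power2_eq_square)
    finally show "norm (fs m x - f x + (f 0 + (\<Sum>b\<in>Basis. of_real (x \<bullet> b) * 0))) \<le> 2 * L * inverse (real (Suc m)) * (1 + norm x)\<^sup>2" by simp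
  qed (use cont fs_cont in auto)
  ultimately show ?thesis unfolding lip_approx_def by blast
qed

end

section \<open>Boundedness on the Hoelder spaces\<close>

context cz_kernel begin

text \<open>The extension is represented by \<open>cz_op\<close> itself:
  \<open>lim_mod_poly_pv_op\<close> makes the images of every admissible sequence, whatever its
  constant, converge to it.\<close>

lemma bounded_on_lipI:
  assumes b: "0 < b" and tame: "\<And>f. f \<in> lip_space N \<Longrightarrow> tame R b f"
    and bound: "\<And>f. f \<in> lip_space N \<Longrightarrow> continuous_on UNIV (cz_op K c f) \<and> N (cz_op K c f) \<le> ennreal C * N f"
    and approx: "\<And>f. f \<in> lip_space N \<Longrightarrow> \<exists>fs. lip_approx N B f fs"
  shows "bounded_on_lip N (pv_op \<rho> K)" unfolding bounded_on_lip_def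
proof (intro exI ballI bexI conjI)
  fix f assume f: "f \<in> lip_space N"
  show "lip_extension N (pv_op \<rho> K) B f (cz_op K c f)" unfolding lip_extension_def
  proof (intro conjI allI impI)
    show "\<exists>fs. lip_approx N B f fs" using f by (rule approx)
    fix B' fs assume "lip_approx N B' f fs"
    then show "lim_mod_poly (\<lambda>m. pv_op \<rho> K (fs m)) (cz_op K c f)"
      using tame f by (intro lim_mod_poly_pv_op[OF _ b]) (auto simp: lip_approx_def)
  qed
  show "N (cz_op K c f) \<le> ennreal C * N f" using bound[OF f] by blast
  moreover have "N f < \<infinity>" using f by (simp add: lip_space_def)
  ultimately show "cz_op K c f \<in> lip_space N" using bound[OF f] by (auto simp: lip_space_def ennreal_mult_less_top intro: le_less_trans)
qed

theorem bounded_on_lip_norm: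
  assumes a: "0 < a" "a < 1"
  shows "bounded_on_lip (lip_norm \<rho> a) (pv_op \<rho> K)"
proof -
  obtain C where C: "0 \<le> C" "\<And>L f. hoelder a L f \<Longrightarrow> hoelder a (C * L) (cz_op K c f)" using cz_op_hoelder[OF a] by metis
  show ?thesis
  proof (rule bounded_on_lipI[OF a(1)])
    fix f assume f: "f \<in> lip_space (lip_norm \<rho> a)"
    obtain L where L: "0 \<le> L" "lip_norm \<rho> a f = ennreal L" and h: "hoelder a L f" using f by (rule lip_spaceE)
    show "tame R a f" using h a by (intro hoelder_tame) auto
    show "continuous_on UNIV (cz_op K c f) \<and> lip_norm \<rho> a (cz_op K c f) \<le> ennreal C * lip_norm \<rho> a f"
      using hoelder_continuous[OF C(2)[OF h] a(1)] lip_spaceI(2)[OF C(2)[OF h] a(1)] C(1) L by (simp add: ennreal_mult')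
    show "\<exists>fs. lip_approx (lip_norm \<rho> a) 3 f fs" using f a by (rule lip_approx_exists)
  qed
qed

end

section \<open>The composite Lipschitz spaces\<close>

definition bi_hoelder ::
  "('v::euclidean_space \<Rightarrow> real) \<Rightarrow> real \<Rightarrow> ('v \<Rightarrow> real) \<Rightarrow> real \<Rightarrow> real \<Rightarrow> ('v \<Rightarrow> complex) \<Rightarrow> bool" where
  "bi_hoelder \<sigma> a \<rho> b L f \<longleftrightarrow>
     (\<forall>x u v. norm (diff_op u (diff_op v f) x) \<le> L * (\<sigma> u powr a * \<rho> v powr b))"

lemma bi_hoelderD:
  "bi_hoelder \<sigma> a \<rho> b L f \<Longrightarrow> norm (diff_op u (diff_op v f) x) \<le> L * (\<sigma> u powr a * \<rho> v powr b)" by (simp add: bi_hoelder_def)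

lemma diff_op_commute: "diff_op u (diff_op v f) = diff_op v (diff_op u f)" by (rule ext) (simp add: diff_op_def algebra_simps)

lemma continuous_diff_op: "continuous_on UNIV f \<Longrightarrow> continuous_on UNIV (diff_op u f)"
  unfolding diff_op_def by (intro continuous_intros continuous_on_compose2[of UNIV f UNIV "\<lambda>x. x - u"]) auto

section \<open>Growth and local regularity in the composite spaces\<close>

locale two_lengths = s: length_function \<sigma> + r: length_function \<rho>
  for \<sigma> \<rho> :: "'v::euclidean_space \<Rightarrow> real"
begin

lemma bi_hoelder_nonneg: assumes "bi_hoelder \<sigma> a \<rho> b L f" shows "0 \<le> L"
proof -
  obtain e :: 'v where "e \<in> Basis" using nonempty_Basis by blast
  then have e: "0 < \<sigma> e" "0 < \<rho> e" using nonzero_Basis by (auto simp: s.pos_iff r.pos_iff)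
  have "0 \<le> L * (\<sigma> e powr a * \<rho> e powr b)" using bi_hoelderD[OF assms, of e e 0] norm_ge_zero order_trans by blast
  moreover have "0 < \<sigma> e powr a * \<rho> e powr b" using e by simp
  ultimately show ?thesis using zero_le_mult_iff linorder_not_less by blast
qed

text \<open>The diagonal u = v says that f(-v) - f(0) is nearly doubled when v is. Growth and
  regularity at one point are extracted from this, although the seminorm bounds no first difference
  directly.\<close>

lemma bi_hoelder_double:
  assumes f: "bi_hoelder \<sigma> a \<rho> b L f"
  shows "norm ((f (- (2 *\<^sub>R v)) - f 0) - 2 * (f (- v) - f 0)) \<le> L * (\<sigma> v powr a * \<rho> v powr b)"
proof -
  have "diff_op v (diff_op v f) 0 = (f (- (2 *\<^sub>R v)) - f 0) - 2 * (f (- v) - f 0)" by (simp add: diff_op_def scaleR_2 algebra_simps)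
  then show ?thesis using bi_hoelderD[OF f, of v v 0] by simp
qed

text \<open>Halve v until it enters the unit ball, where continuity bounds \<open>f\<close>. On the
  way back each doubling adds an error of order (2 + |v|)^2, and the factor of at most 2 (1 + |v|)
  accumulated over the doublings raises the exponent to 3.\<close>

lemma bi_hoelder_poly_bounded:
  assumes f: "bi_hoelder \<sigma> a \<rho> b L f" "continuous_on UNIV f" and ab: "0 < a" "a < 1" "0 < b" "b < 1"
  shows "poly_bounded f"
proof -
  define g where "g = (\<lambda>v. f (- v) - f 0)"
  have L: "0 \<le> L" using f(1) by (rule bi_hoelder_nonneg)
  obtain B where B: "0 \<le> B" "\<And>y. norm y \<le> 1 \<Longrightarrow> norm (f y) \<le> B" using norm_length.bounded_on_cball[OF f(2)] by metis
  have g1: "norm (g v) \<le> 2 * B" if "norm v \<le> 1" for v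
    using B(2)[of "- v"] B(2)[of 0] that norm_triangle_ineq4[of "f (- v)" "f 0"] by (simp add: g_def)
  have iter: "norm (g v) \<le> 2 ^ j * (2 * B) + (2 ^ j - 1) * (L * (2 + M)\<^sup>2)"
    if "norm v \<le> 2 ^ j" "norm v \<le> M" for v j M using that
  proof (induction j arbitrary: v)
    case 0
    then show ?case using g1 by simp
  next
    case (Suc j)
    let ?w = "(1 / 2) *\<^sub>R v"
    have w: "norm ?w \<le> 2 ^ j" "norm ?w \<le> M"
    proof -
      have nw: "norm ?w = norm v / 2" by simp
      show "norm ?w \<le> 2 ^ j" using Suc.prems(1) nw by simp
      show "norm ?w \<le> M" using Suc.prems(2) nw norm_ge_zero[of v] by linarith
    qed
    have "norm (g v - 2 * g ?w) \<le> L * (\<sigma> ?w powr a * \<rho> ?w powr b)" using bi_hoelder_double[OF f(1), of ?w] by (simp add: g_def)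
    also have "... \<le> L * ((2 + M) * (2 + M))"
    proof -
      have "\<sigma> ?w powr a \<le> 2 + M" "\<rho> ?w powr b \<le> 2 + M" using s.powr_le[of a ?w] r.powr_le[of b ?w] w(2) ab by linarith+
      moreover have "0 \<le> 2 + M" using Suc.prems(2) norm_ge_zero[of v] by linarith
      ultimately show ?thesis using L by (intro mult_left_mono mult_mono) auto
    qed
    finally have "norm (g v - 2 * g ?w) \<le> L * (2 + M)\<^sup>2" by (simp add: power2_eq_square)
    moreover have "norm (g v) \<le> norm (2 * g ?w) + norm (g v - 2 * g ?w)" by (rule norm_triangle_sub)
    moreover have "norm (2 * g ?w) = 2 * norm (g ?w)" by (simp add: norm_mult)
    ultimately have "norm (g v) \<le> 2 * norm (g ?w) + L * (2 + M)\<^sup>2" by linarith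
    also have "... \<le> 2 * (2 ^ j * (2 * B) + (2 ^ j - 1) * (L * (2 + M)\<^sup>2)) + L * (2 + M)\<^sup>2"
      using Suc.IH[OF w] by (intro add_right_mono mult_left_mono) auto
    also have "... = 2 ^ Suc j * (2 * B) + (2 ^ Suc j - 1) * (L * (2 + M)\<^sup>2)" by (simp add: algebra_simps)
    finally show ?case .
  qed
  have g_le: "norm (g v) \<le> (4 * B + 8 * L) * (1 + norm v) ^ 3" for v
  proof -
    let ?t = "1 + norm v"
    obtain j where j: "2 ^ j * 1 \<le> ?t" "?t < 2 * (2 ^ j * 1)" using dyadic_above[of 1 ?t] by auto
    then have "norm v \<le> 2 ^ Suc j" by simp
    then have "norm (g v) \<le> 2 ^ Suc j * (2 * B) + (2 ^ Suc j - 1) * (L * (2 + norm v)\<^sup>2)" by (rule iter) simp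
    also have "... \<le> (2 * ?t) * (2 * B) + (2 * ?t) * (L * (2 * ?t)\<^sup>2)"
      using j B L by (intro add_mono mult_right_mono mult_mono mult_left_mono power_mono mult_nonneg_nonneg) auto
    also have "... = 4 * B * ?t + 8 * L * ?t ^ 3" by algebra
    also have "... \<le> 4 * B * ?t ^ 3 + 8 * L * ?t ^ 3" using B L self_le_power[of ?t 3] by (intro add_mono mult_left_mono) auto
    finally show ?thesis by (simp add: distrib_right)
  qed
  have "norm (f x) \<le> (norm (f 0) + (4 * B + 8 * L)) * (1 + norm x) ^ 3" for x
  proof -
    have "norm (f x) \<le> norm (f 0) + norm (g (- x))" using norm_triangle_sub[of "f x" "f 0"] by (simp add: g_def)
    also have "norm (f 0) \<le> norm (f 0) * (1 + norm x) ^ 3" by (simp add: mult_le_cancel_left1 one_le_power)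
    finally show ?thesis using g_le[of "- x"] by (simp add: distrib_right)
  qed
  then show ?thesis unfolding poly_bounded_def by blast
qed

text \<open>At the base point 0, double v until its size is comparable to 1: the boundary term is
  then of order |v|, the \<sigma>-factor stays bounded inside the unit ball, and the \<rho>-factors
  sum geometrically because b < 1. Another point x is reached by one mixed difference with u = -x,
  whose \<sigma>-factor accounts for the polynomial growth in x.\<close>

lemma bi_hoelder_tame:
  assumes f: "bi_hoelder \<sigma> a \<rho> b L f" "continuous_on UNIV f" and ab: "0 < a" "a < 1" "0 < b" "b < 1"
    and R: "0 < R"
  shows "r.tame R b f"
proof -
  define g where "g = (\<lambda>v. f (- v) - f 0)"
  have L: "0 \<le> L" using f(1) by (rule bi_hoelder_nonneg)
  obtain B where B: "0 \<le> B" "\<And>y. norm y \<le> (1 + R) * R + 1 \<Longrightarrow> norm (f y) \<le> B" using norm_length.bounded_on_cball[OF f(2)] by metis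
  have R0: "0 \<le> (1 + R) * R" using R by simp
  have gB: "norm (g v) \<le> 2 * B" if "norm v \<le> (1 + R) * R + 1" for v
    using B(2)[of "- v"] B(2)[of 0] that R0 norm_triangle_ineq4[of "f (- v)" "f 0"] by (simp add: g_def)
  define q where "q = 2 powr (b - 1)"
  have q: "0 < q" "q < 1" using ab powr_less_mono[of "b - 1" 0 2] by (auto simp: q_def)
  have iter: "norm (g v) \<le> norm (g ((2 ^ j) *\<^sub>R v)) / 2 ^ j + 3 * L * \<rho> v powr b * (\<Sum>i<j. q ^ i)"
    if "norm ((2 ^ j) *\<^sub>R v) \<le> 1" for v j using that
  proof (induction j)
    case (Suc j)
    let ?w = "(2 ^ j) *\<^sub>R v"
    have w: "norm ?w \<le> 1" using Suc.prems mult_nonneg_nonneg[of "2 ^ j" "norm v"] by simp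
    have eq: "(2 ^ Suc j) *\<^sub>R v = 2 *\<^sub>R ?w" by simp
    have "norm (g (2 *\<^sub>R ?w) - 2 * g ?w) \<le> L * (\<sigma> ?w powr a * \<rho> ?w powr b)" unfolding g_def by (rule bi_hoelder_double[OF f(1)])
    also have "... \<le> L * (3 * (2 ^ j * \<rho> v) powr b)"
      using s.powr_le[of a ?w] w ab L r.scale_pow[of j v] by (intro mult_left_mono mult_mono powr_mono2) auto
    also have "... = 3 * L * \<rho> v powr b * (2 powr b) ^ j" by (simp add: powr_mult power_powr_commute)
    finally have "norm (g (2 *\<^sub>R ?w) - 2 * g ?w) \<le> 3 * L * \<rho> v powr b * (2 powr b) ^ j" .
    moreover have "2 * norm (g ?w) \<le> norm (g (2 *\<^sub>R ?w)) + norm (g (2 *\<^sub>R ?w) - 2 * g ?w)"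
      using norm_triangle_sub[of "2 * g ?w" "g (2 *\<^sub>R ?w)"] by (simp add: norm_mult norm_minus_commute)
    moreover have "0 \<le> 3 * L * \<rho> v powr b * (2 powr b) ^ j" using L by simp
    ultimately have "norm (g ?w) \<le> norm (g (2 *\<^sub>R ?w)) / 2 + 3 * L * \<rho> v powr b * (2 powr b) ^ j" by linarith
    then have "norm (g ?w) / 2 ^ j \<le> (norm (g (2 *\<^sub>R ?w)) / 2 + 3 * L * \<rho> v powr b * (2 powr b) ^ j) / 2 ^ j"
      by (rule divide_right_mono) simp
    also have "... = norm (g ((2 ^ Suc j) *\<^sub>R v)) / 2 ^ Suc j + 3 * L * \<rho> v powr b * q ^ j"
      unfolding eq by (simp add: add_divide_distrib q_def powr_diff power_divide)
    finally show ?case using Suc.IH[OF w] by (simp add: algebra_simps)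
  qed simp
  \<comment> \<open>The three summands belong to the boundary term at unit scale, to the geometric
    sum, and to the case |v| > 1, where plain boundedness is compared with
    \<open>((1 + R) * \<rho> v) powr b\<close>, which is at least 1.\<close>
  define C where "C = 4 * B * (1 + R) * R powr (1 - b) + 3 * L / (1 - q) + 2 * B * (1 + R) powr b"
  have C1: "0 \<le> 4 * B * (1 + R) * R powr (1 - b)" "0 \<le> 3 * L / (1 - q)" "0 \<le> 2 * B * (1 + R) powr b" using B L q R by auto
  have near: "norm (g v) \<le> C * \<rho> v powr b" if v: "\<rho> v \<le> R" for v
  proof -
    have nv: "norm v \<le> (1 + R) * \<rho> v" using v by (rule r.norm_le_mult)
    consider "v = 0" | "v \<noteq> 0" "norm v \<le> 1" | "1 < norm v" by linarith
    then show ?thesis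
    proof cases
      case 1
      then show ?thesis by (simp add: g_def)
    next
      case 2
      then obtain j where j: "2 ^ j * norm v \<le> 1" "1 < 2 * (2 ^ j * norm v)" using dyadic_above[of "norm v" 1] by auto
      have "norm (g ((2 ^ j) *\<^sub>R v)) \<le> 2 * B" using j(1) R0 by (intro gB) simp
      moreover have "1 / 2 ^ j \<le> 2 * norm v" using j(2) by (simp add: divide_le_eq mult_ac)
      ultimately have "norm (g ((2 ^ j) *\<^sub>R v)) * (1 / 2 ^ j) \<le> (2 * B) * (2 * norm v)" using B by (intro mult_mono) auto
      also have "... \<le> (2 * B) * (2 * ((1 + R) * (R powr (1 - b) * \<rho> v powr b)))"
      proof -
        have "\<rho> v = \<rho> v powr (1 - b) * \<rho> v powr b" by (simp flip: powr_add)
        also have "... \<le> R powr (1 - b) * \<rho> v powr b" using v ab by (intro mult_right_mono powr_mono2) auto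
        finally have "(1 + R) * \<rho> v \<le> (1 + R) * (R powr (1 - b) * \<rho> v powr b)" using R by (intro mult_left_mono) auto
        with nv show ?thesis using B by (intro mult_left_mono) auto
      qed
      finally have 1: "norm (g ((2 ^ j) *\<^sub>R v)) / 2 ^ j \<le> 4 * B * (1 + R) * R powr (1 - b) * \<rho> v powr b"
        by (simp only: mult_ac divide_inverse)
      have "(\<Sum>i<j. q ^ i) \<le> (\<Sum>i. q ^ i)" using q by (intro sum_le_suminf summable_geometric) auto
      then have "(\<Sum>i<j. q ^ i) \<le> 1 / (1 - q)" using q by (simp add: suminf_geometric)
      then have "3 * L * \<rho> v powr b * (\<Sum>i<j. q ^ i) \<le> 3 * L * \<rho> v powr b * (1 / (1 - q))" using L by (intro mult_left_mono) auto
      also have "... = 3 * L / (1 - q) * \<rho> v powr b" by simp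
      finally have "norm (g v) \<le> 4 * B * (1 + R) * R powr (1 - b) * \<rho> v powr b + 3 * L / (1 - q) * \<rho> v powr b"
        using iter[of j v] j(1) 1 by simp
      also have "... = (4 * B * (1 + R) * R powr (1 - b) + 3 * L / (1 - q)) * \<rho> v powr b" by (simp only: distrib_right)
      also have "... \<le> C * \<rho> v powr b" using C1(3) by (intro mult_right_mono) (simp_all only: C_def le_add_same_cancel1 powr_ge_zero)
      finally show ?thesis .
    next
      case 3
      have "(1 + R) * \<rho> v \<le> (1 + R) * R" using v R by (intro mult_left_mono) auto
      then have "norm v \<le> (1 + R) * R + 1" using nv by linarith
      then have "norm (g v) \<le> 2 * B * 1" using gB by simp
      also have "1 \<le> ((1 + R) * \<rho> v) powr b" using nv 3 ab by (intro ge_one_powr_ge_zero) auto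
      then have "2 * B * 1 \<le> 2 * B * ((1 + R) * \<rho> v) powr b" using B by (intro mult_left_mono) auto
      also have "... = 2 * B * (1 + R) powr b * \<rho> v powr b" using R by (simp add: powr_mult)
      also have "... \<le> C * \<rho> v powr b" using C1(1,2) by (intro mult_right_mono) (simp_all only: C_def le_add_same_cancel2 powr_ge_zero add_nonneg_nonneg)
      finally show ?thesis .
    qed
  qed
  have C: "0 \<le> C" using C1 unfolding C_def by simp
  have "norm (f (x - v) - f x) \<le> (C + 2 * L) * (1 + norm x) ^ 1 * \<rho> v powr b" if v: "\<rho> v \<le> R" for x v
  proof -
    have "diff_op (- x) (diff_op v f) 0 = (f (x - v) - f x) - g v" by (simp add: diff_op_def g_def)
    then have "norm ((f (x - v) - f x) - g v) \<le> L * (\<sigma> (- x) powr a * \<rho> v powr b)" using bi_hoelderD[OF f(1), of "- x" v 0] by simp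
    also have "... \<le> L * (2 * (1 + norm x) * \<rho> v powr b)"
    proof -
      have "\<sigma> (- x) powr a \<le> 2 + norm (- x)" using ab by (intro s.powr_le) auto
      also have "... \<le> 2 * (1 + norm x)" by simp
      finally have "\<sigma> (- x) powr a \<le> 2 * (1 + norm x)" .
      then show ?thesis using L by (intro mult_left_mono mult_right_mono) auto
    qed
    finally have "norm ((f (x - v) - f x) - g v) \<le> L * (2 * (1 + norm x) * \<rho> v powr b)" .
    moreover have "norm (f (x - v) - f x) \<le> norm (g v) + norm ((f (x - v) - f x) - g v)" by (rule norm_triangle_sub)
    moreover have "C * \<rho> v powr b \<le> C * \<rho> v powr b * (1 + norm x)" using mult_left_mono[of 1 "1 + norm x" "C * \<rho> v powr b"] C by simp
    ultimately have "norm (f (x - v) - f x) \<le> C * \<rho> v powr b * (1 + norm x) + L * (2 * (1 + norm x) * \<rho> v powr b)"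
      using near[OF v] by linarith
    then show ?thesis by (simp add: algebra_simps)
  qed
  then show ?thesis unfolding r.tame_def using f bi_hoelder_poly_bounded[OF f ab] by blast
qed

end

section \<open>The operator on the composite spaces\<close>

context cz_kernel begin

lemma tame_continuous_cz_op:
  assumes f: "tame R b f" and b: "0 < b"
  shows "continuous_on UNIV (cz_op K c f)"
proof -
  have cont: "continuous_on UNIV f" using f by (simp add: tame_def)
  then have [measurable]: "f \<in> borel_measurable borel" by (rule borel_measurable_continuous_onI)
  have f_lim: "(\<lambda>n. f (X n)) \<longlonglongrightarrow> f x" if "X \<longlonglongrightarrow> x" for X x using continuous_on_tendsto_compose[OF cont that] by simp
  obtain C0 N where C0: "\<And>x u. \<rho> u \<le> R \<Longrightarrow> norm (f (x - u) - f x) \<le> C0 * (1 + norm x) ^ N * \<rho> u powr b" using f unfolding tame_def by blast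
  have "isCont (cz_op K c f) x" for x
  proof (rule continuous_at_sequentiallyI)
    fix X assume X: "X \<longlonglongrightarrow> x"
    then obtain M where M: "\<And>n. norm (X n) \<le> M" using convergent_imp_Bseq[of X] by (auto simp: convergent_def Bseq_def)
    have "(\<lambda>n. LINT y|lborel. K y * (f (X n - y) - f (X n))) \<longlonglongrightarrow> (LINT y|lborel. K y * (f (x - y) - f x))"
    proof (rule integral_dominated_convergence)
      show "integrable lborel (\<lambda>y. (\<bar>C0\<bar> * (1 + M) ^ N) * (norm (K y) * \<rho> y powr b))"
        using b by (intro integrable_mult_right integrable_K_power)
      have "(\<lambda>n. K y * (f (X n - y) - f (X n))) \<longlonglongrightarrow> K y * (f (x - y) - f x)" for y by (intro tendsto_intros f_lim X)
      then show "AE y in lborel. (\<lambda>n. K y * (f (X n - y) - f (X n))) \<longlonglongrightarrow> K y * (f (x - y) - f x)" by simp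
      fix n
      have "norm (K y * (f (X n - y) - f (X n))) \<le> (\<bar>C0\<bar> * (1 + M) ^ N) * (norm (K y) * \<rho> y powr b)" for y
      proof (cases "\<rho> y \<le> R")
        case True
        have "C0 * (1 + norm (X n)) ^ N \<le> \<bar>C0\<bar> * (1 + M) ^ N" using M[of n] by (intro mult_mono power_mono) auto
        then have "C0 * (1 + norm (X n)) ^ N * \<rho> y powr b \<le> \<bar>C0\<bar> * (1 + M) ^ N * \<rho> y powr b" by (rule mult_right_mono) simp
        then have "norm (f (X n - y) - f (X n)) \<le> \<bar>C0\<bar> * (1 + M) ^ N * \<rho> y powr b" using C0[OF True, of "X n"] by linarith
        then have "norm (K y) * norm (f (X n - y) - f (X n)) \<le> norm (K y) * (\<bar>C0\<bar> * (1 + M) ^ N * \<rho> y powr b)" by (rule mult_left_mono) simp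
        then show ?thesis by (simp add: norm_mult mult_ac)
      next
        case False
        then show ?thesis by (simp add: support)
      qed
      then show "AE y in lborel. norm (K y * (f (X n - y) - f (X n))) \<le> (\<bar>C0\<bar> * (1 + M) ^ N) * (norm (K y) * \<rho> y powr b)" by simp
    qed measurable
    then show "(\<lambda>n. cz_op K c f (X n)) \<longlonglongrightarrow> cz_op K c f x" unfolding cz_op_def by (intro tendsto_intros f_lim X)
  qed
  then show ?thesis by (simp add: continuous_at_imp_continuous_on)
qed

lemma cz_op_bi_hoelder:
  assumes "length_function \<sigma>" and ab: "0 < a" "a < 1" "0 < b" "b < 1"
  obtains C where "0 \<le> C" "\<And>L f. continuous_on UNIV f \<Longrightarrow> bi_hoelder \<sigma> a \<rho> b L f \<Longrightarrow>
    bi_hoelder \<sigma> a \<rho> b (C * L) (cz_op K c f)"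
proof -
  interpret two_lengths \<sigma> \<rho> using assms(1) length_function_axioms by (simp add: two_lengths_def)
  obtain C where C: "0 \<le> C" "\<And>L f. hoelder b L f \<Longrightarrow> hoelder b (C * L) (cz_op K c f)" using cz_op_hoelder[OF ab(3,4)] by metis
  have "bi_hoelder \<sigma> a \<rho> b (C * L) (cz_op K c f)" if cont: "continuous_on UNIV f" and f: "bi_hoelder \<sigma> a \<rho> b L f" for L f
    unfolding bi_hoelder_def
  proof (intro allI)
    fix x u v
    have t: "tame R b f" using f cont ab R_pos by (rule bi_hoelder_tame)
    have "hoelder b (L * \<sigma> u powr a) (diff_op u f)" unfolding hoelder_def
    proof (intro allI)
      fix x v
      have "diff_op u f (x - v) - diff_op u f x = diff_op u (diff_op v f) x"
        unfolding diff_op_commute[of u v] by (simp add: diff_op_def[of v])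
      then show "norm (diff_op u f (x - v) - diff_op u f x) \<le> L * \<sigma> u powr a * \<rho> v powr b"
        using bi_hoelderD[OF f, of u v x] by (simp add: mult.assoc)
    qed
    from C(2)[OF this] have h: "hoelder b (C * (L * \<sigma> u powr a)) (diff_op u (cz_op K c f))"
      by (simp only: cz_op_diff_op[OF tame_integrable[OF t ab(3)]])
    have "diff_op u (diff_op v (cz_op K c f)) x = diff_op u (cz_op K c f) (x - v) - diff_op u (cz_op K c f) x"
      unfolding diff_op_commute[of u v] by (simp add: diff_op_def[of v])
    then show "norm (diff_op u (diff_op v (cz_op K c f)) x) \<le> C * L * (\<sigma> u powr a * \<rho> v powr b)"
      using hoelderD[OF h, of x v] by (simp add: mult.assoc)
  qed
  with C(1) show ?thesis using that by blast
qed

end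

section \<open>Tent averages and the high-frequency part\<close>

lemma continuous_conv:
  fixes f :: "'v::euclidean_space \<Rightarrow> complex"
  assumes k: "integrable lborel k" "\<And>y. M \<le> norm y \<Longrightarrow> k y = 0" and f: "continuous_on UNIV f"
  shows "continuous_on UNIV (conv k f)"
proof -
  have [measurable]: "f \<in> borel_measurable borel" "k \<in> borel_measurable borel" using f k by (auto intro: borel_measurable_continuous_onI)
  have f_lim: "(\<lambda>n. f (X n)) \<longlonglongrightarrow> f x" if "X \<longlonglongrightarrow> x" for X x using continuous_on_tendsto_compose[OF f that] by simp
  have "isCont (conv k f) x" for x
  proof (rule continuous_at_sequentiallyI)
    fix X assume X: "X \<longlonglongrightarrow> x"
    then obtain S where S: "\<And>n. norm (X n) \<le> S" using convergent_imp_Bseq[of X] by (auto simp: convergent_def Bseq_def)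
    obtain B where B: "0 \<le> B" "\<And>y. norm y \<le> S + M \<Longrightarrow> norm (f y) \<le> B" using norm_length.bounded_on_cball[OF f] by metis
    show "(\<lambda>n. conv k f (X n)) \<longlonglongrightarrow> conv k f x" unfolding conv_def
    proof (rule integral_dominated_convergence)
      show "integrable lborel (\<lambda>y. B * norm (k y))" using k by simp
      show "AE y in lborel. (\<lambda>n. k y * f (X n - y)) \<longlonglongrightarrow> k y * f (x - y)" by (intro AE_I2 tendsto_intros f_lim X)
      fix n
      have "norm (k y * f (X n - y)) \<le> B * norm (k y)" for y
      proof (cases "M \<le> norm y")
        case False
        then have "norm (X n - y) \<le> S + M" using S[of n] norm_triangle_ineq4[of "X n" y] by linarith
        then show ?thesis using mult_right_mono[OF B(2), of "X n - y" "norm (k y)"] by (simp add: norm_mult mult.commute)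
      qed (simp add: k)
      then show "AE y in lborel. norm (k y * f (X n - y)) \<le> B * norm (k y)" by simp
    qed measurable
  qed
  then show ?thesis by (simp add: continuous_at_imp_continuous_on)
qed

text \<open>A Lipschitz averaging profile is enough here: what is used of it is its mass, its
  support and its first differences.\<close>

definition tent_height :: "real \<Rightarrow> 'v::euclidean_space \<Rightarrow> real" where
  "tent_height M y = max 0 (1 - norm y / M)"

definition tent :: "real \<Rightarrow> 'v::euclidean_space \<Rightarrow> complex" where
  "tent M y = of_real (tent_height M y / (LINT z|lborel. tent_height M (z :: 'v)))"

lemma tent_height_bounds: "0 < M \<Longrightarrow> 0 \<le> tent_height M y" "0 < M \<Longrightarrow> tent_height M y \<le> 1" by (auto simp: tent_height_def)

lemma tent_height_eq_0: "0 < M \<Longrightarrow> M \<le> norm y \<Longrightarrow> tent_height M y = 0" by (simp add: tent_height_def max_def)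

lemma tent_height_measurable [measurable]: "tent_height M \<in> borel_measurable borel" unfolding tent_height_def[abs_def] by measurable

lemma tent_measurable [measurable]: "tent M \<in> borel_measurable borel" unfolding tent_def[abs_def] by measurable

lemma tent_height_diff: "0 < M \<Longrightarrow> \<bar>tent_height M (y - u) - tent_height M y\<bar> \<le> norm u / M"
proof -
  assume M: "0 < M"
  have "\<bar>norm (y - u) - norm y\<bar> \<le> norm u" using norm_length.diff_ge[of y u] norm_length.triangle_diff[of y u] by linarith
  then have "\<bar>norm (y - u) / M - norm y / M\<bar> \<le> norm u / M" using M by (simp add: divide_right_mono flip: diff_divide_distrib)
  then show ?thesis unfolding tent_height_def by linarith
qed

lemma integrable_tent_height:
  assumes M: "0 < M" shows "integrable lborel (tent_height M :: 'v::euclidean_space \<Rightarrow> real)"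
proof (rule Bochner_Integration.integrable_bound)
  show "integrable lborel (indicator {x::'v. norm x < M} :: 'v \<Rightarrow> real)"
    using emeasure_norm_less[of M, where 'v = 'v] M by (intro integrable_real_indicator) auto
  show "AE x in lborel. norm (tent_height M x) \<le> norm (indicator {x::'v. norm x < M} x :: real)"
  proof (rule AE_I2)
    fix x :: 'v
    show "norm (tent_height M x) \<le> norm (indicator {x::'v. norm x < M} x :: real)"
      using tent_height_bounds[OF M, of x] tent_height_eq_0[OF M, of x] by (cases "norm x < M") auto
  qed
qed simp

lemma tent_mass_ge:
  assumes M: "0 < M"
  shows "(M / 2) ^ DIM('v) * measure lborel (ball (0::'v) 1) / 2 \<le> (LINT z|lborel. tent_height M (z :: 'v::euclidean_space))"
proof -
  let ?I = "\<lambda>x::'v. 1 / 2 * indicator {x. norm x < M / 2} x :: real"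
  have e: "emeasure lborel {x::'v. norm x < M / 2} = ennreal ((M / 2) ^ DIM('v) * measure lborel (ball (0::'v) 1))"
    using M by (intro emeasure_norm_less) simp
  have i: "integrable lborel ?I" using e by (intro integrable_mult_right integrable_real_indicator) auto
  have "(LINT x|lborel. ?I x) \<le> (LINT z|lborel. tent_height M (z :: 'v))"
  proof (rule Bochner_Integration.integral_mono[OF i integrable_tent_height[OF M]])
    fix x :: 'v show "?I x \<le> tent_height M x" using M by (auto simp: indicator_def tent_height_def field_simps)
  qed
  moreover have "measure lborel {x::'v. norm x < M / 2} = (M / 2) ^ DIM('v) * measure lborel (ball (0::'v) 1)"
    using M by (intro measure_eq_emeasure_eq_ennreal e) simp
  ultimately show ?thesis by simp
qed

lemma unit_ball_pos: "0 < measure lborel (ball (0::'v::euclidean_space) 1)" using content_ball_pos[of 1 "0::'v"] by simp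

lemma tent_mass_pos: "0 < M \<Longrightarrow> 0 < (LINT z|lborel. tent_height M (z :: 'v::euclidean_space))"
proof -
  assume M: "0 < M"
  then have "0 < (M / 2) ^ DIM('v) * measure lborel (ball (0::'v) 1) / 2" using unit_ball_pos[where 'v = 'v] by simp
  then show ?thesis using tent_mass_ge[OF M, where 'v = 'v] by (rule less_le_trans)
qed

lemma norm_tent:
  fixes y :: "'v::euclidean_space"
  shows "0 < M \<Longrightarrow> norm (tent M y) = tent_height M y / (LINT z|lborel. tent_height M (z :: 'v))"
  using tent_mass_pos[of M, where 'v = 'v] tent_height_bounds[of M y] unfolding tent_def norm_of_real by simp

lemma tent_eq_0: "0 < M \<Longrightarrow> M \<le> norm y \<Longrightarrow> tent M y = 0" by (simp add: tent_def tent_height_eq_0)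

lemma integrable_tent: "0 < M \<Longrightarrow> integrable lborel (tent M)"
  unfolding tent_def[abs_def] using integrable_tent_height by (intro integrable_of_real integrable_divide_zero) auto

lemma integral_tent: "0 < M \<Longrightarrow> (LINT y|lborel. tent M (y::'v::euclidean_space)) = 1"
  using tent_mass_pos[of M, where 'v = 'v] unfolding tent_def[abs_def] integral_complex_of_real by simp

lemma nn_integral_tent: "0 < M \<Longrightarrow> (\<integral>\<^sup>+y. ennreal (norm (tent M (y::'v::euclidean_space))) \<partial>lborel) = 1"
proof -
  assume M: "0 < M"
  have "(\<integral>\<^sup>+y. ennreal (norm (tent M (y::'v))) \<partial>lborel) = ennreal (LINT y|lborel. norm (tent M (y::'v)))"
    using integrable_tent[OF M] by (intro nn_integral_eq_integral) auto
  then show ?thesis using tent_mass_pos[OF M, where 'v = 'v] by (simp add: norm_tent[OF M])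
qed

text \<open>Twice the ratio of the volumes of the balls of radius 2M, where a shifted tent still
  lives, and M/2, where the tent is at least 1/2.\<close>

definition tent_const :: "'v::euclidean_space itself \<Rightarrow> real" where
  "tent_const _ = 2 * 4 ^ DIM('v)"

lemma tent_const_ge: "2 \<le> tent_const TYPE('v::euclidean_space)" by (simp add: tent_const_def one_le_power)

text \<open>For |u| \<le> M the difference is at most |u| / M over the mass, on a ball of radius 2M,
  and \<open>tent_mass_ge\<close> bounds the mass from below. For larger u the trivial bound 2 is
  enough since \<open>tent_const\<close> is at least 2.\<close>

lemma nn_integral_tent_diff:
  fixes u :: "'v::euclidean_space"
  assumes M: "0 < M"
  shows "(\<integral>\<^sup>+y. ennreal (norm (tent M (y - u) - tent M y)) \<partial>lborel) \<le> ennreal (tent_const TYPE('v) * min 1 (norm u / M))"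
proof (cases "norm u \<le> M")
  case True
  let ?m = "LINT z|lborel. tent_height M (z :: 'v)" and ?V = "measure lborel (ball (0::'v) 1)"
  have m: "0 < ?m" using M by (rule tent_mass_pos)
  have "(\<integral>\<^sup>+y. ennreal (norm (tent M (y - u) - tent M y)) \<partial>lborel)
      \<le> (\<integral>\<^sup>+y. ennreal (norm u / M / ?m) * indicator {y::'v. norm y < 2 * M} y \<partial>lborel)"
  proof (rule nn_integral_mono)
    fix y :: 'v
    show "ennreal (norm (tent M (y - u) - tent M y)) \<le> ennreal (norm u / M / ?m) * indicator {y. norm y < 2 * M} y"
    proof (cases "norm y < 2 * M")
      case y: True
      have "tent M (y - u) - tent M y = of_real ((tent_height M (y - u) - tent_height M y) / ?m)"
        by (simp add: tent_def diff_divide_distrib)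
      then have "norm (tent M (y - u) - tent M y) = \<bar>tent_height M (y - u) - tent_height M y\<bar> / ?m"
        using m by (simp only: norm_of_real abs_divide abs_of_pos)
      also have "... \<le> norm u / M / ?m" using tent_height_diff[OF M, of y u] m by (intro divide_right_mono) auto
      finally show ?thesis using y by (simp add: ennreal_leI)
    next
      case False
      then have "M \<le> norm (y - u)" "M \<le> norm y" using True norm_triangle_ineq2[of y u] M by linarith+
      then show ?thesis using M by (simp add: tent_eq_0)
    qed
  qed
  also have "... = ennreal (norm u / M / ?m) * emeasure lborel {y::'v. norm y < 2 * M}" by (intro nn_integral_cmult_indicator) simp
  also have "... = ennreal (norm u / M / ?m * ((2 * M) ^ DIM('v) * ?V))"
  proof -
    have "0 \<le> norm u / M / ?m" using M m by simp
    moreover have "emeasure lborel {y::'v. norm y < 2 * M} = ennreal ((2 * M) ^ DIM('v) * ?V)" using M by (intro emeasure_norm_less) simp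
    ultimately show ?thesis by (simp only: ennreal_mult')
  qed
  also have "... \<le> ennreal (tent_const TYPE('v) * min 1 (norm u / M))"
  proof (rule ennreal_leI)
    have "(2 * M) ^ DIM('v) * ?V = tent_const TYPE('v) * ((M / 2) ^ DIM('v) * ?V / 2)"
    proof -
      have "(4::real) ^ DIM('v) = 2 ^ DIM('v) * 2 ^ DIM('v)" by (simp flip: power_mult_distrib)
      then show ?thesis by (simp add: tent_const_def power_divide power_mult_distrib)
    qed
    also have "... \<le> tent_const TYPE('v) * ?m" using tent_mass_ge[OF M, where 'v = 'v] by (intro mult_left_mono) (auto simp: tent_const_def)
    finally have "norm u / M / ?m * ((2 * M) ^ DIM('v) * ?V) \<le> norm u / M / ?m * (tent_const TYPE('v) * ?m)"
      using M m by (intro mult_left_mono) auto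
    also have "... = tent_const TYPE('v) * min 1 (norm u / M)" using M m True by simp
    finally show "norm u / M / ?m * ((2 * M) ^ DIM('v) * ?V) \<le> tent_const TYPE('v) * min 1 (norm u / M)" .
  qed
  finally show ?thesis .
next
  case False
  have "(\<integral>\<^sup>+y. ennreal (norm (tent M (y - u) - tent M y)) \<partial>lborel)
      \<le> (\<integral>\<^sup>+y. ennreal (norm (tent M (y - u))) + ennreal (norm (tent M y)) \<partial>lborel)"
    by (intro nn_integral_mono) (simp add: norm_triangle_ineq4 flip: ennreal_plus)
  also have "... = 1 + 1"
    using nn_integral_lborel_shift[of "\<lambda>y. ennreal (norm (tent M y))" u] by (simp add: nn_integral_add nn_integral_tent[OF M])
  also have "... = ennreal 2" by simp
  also have "... \<le> ennreal (tent_const TYPE('v) * min 1 (norm u / M))"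
    using False M tent_const_ge[where 'v = 'v] by (intro ennreal_leI) (simp add: min_def)
  finally show ?thesis .
qed

lemma tent_conv_integrable:
  fixes f :: "'v::euclidean_space \<Rightarrow> complex"
  assumes "0 < M" "continuous_on UNIV f" shows "integrable lborel (\<lambda>y. tent M y * f (x - y))"
  using norm_length.integrable_conv[OF integrable_tent tent_eq_0] assms by blast

lemma continuous_conv_tent: "0 < M \<Longrightarrow> continuous_on UNIV f \<Longrightarrow> continuous_on UNIV (conv (tent M) f)"
  by (rule continuous_conv[OF integrable_tent tent_eq_0])

lemma norm_weighted_integral_le:
  fixes k f :: "'v::euclidean_space \<Rightarrow> complex"
  assumes [measurable]: "k \<in> borel_measurable borel" and k: "(\<integral>\<^sup>+y. ennreal (norm (k y)) \<partial>lborel) \<le> ennreal B" "0 \<le> B"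
    and f: "\<And>y. k y \<noteq> 0 \<Longrightarrow> norm (f y) \<le> D" and D: "0 \<le> D"
  shows "norm (LINT y|lborel. k y * f y) \<le> B * D"
proof (rule norm_integral_bounded_nn)
  have "(\<integral>\<^sup>+y. ennreal (norm (k y * f y)) \<partial>lborel) \<le> (\<integral>\<^sup>+y. ennreal (norm (k y)) * ennreal D \<partial>lborel)"
  proof (rule nn_integral_mono)
    fix y
    have "norm (k y * f y) \<le> norm (k y) * D" unfolding norm_mult using f[of y] by (cases "k y = 0") (auto intro: mult_left_mono)
    then show "ennreal (norm (k y * f y)) \<le> ennreal (norm (k y)) * ennreal D" using D by (simp add: ennreal_leI flip: ennreal_mult)
  qed
  also have "... = (\<integral>\<^sup>+y. ennreal (norm (k y)) \<partial>lborel) * ennreal D" by (rule nn_integral_multc) simp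
  also have "... \<le> ennreal B * ennreal D" using k by (intro mult_right_mono) auto
  finally show "(\<integral>\<^sup>+y. ennreal (norm (k y * f y)) \<partial>lborel) \<le> ennreal (B * D)" using k by (simp add: ennreal_mult')
qed (use k D in simp)

text \<open>Removing a local average expresses a function by its first differences of length up to
  M. A composite seminorm controls second differences only, so the operation is applied twice to
  such functions.\<close>

definition highpass :: "real \<Rightarrow> ('v::euclidean_space \<Rightarrow> complex) \<Rightarrow> 'v \<Rightarrow> complex" where
  "highpass M f x = f x - conv (tent M) f x"

lemma continuous_highpass: "0 < M \<Longrightarrow> continuous_on UNIV f \<Longrightarrow> continuous_on UNIV (highpass M f)"
  unfolding highpass_def[abs_def] by (intro continuous_intros continuous_conv_tent)

lemma diff_op_conv_tent:
  assumes M: "0 < M" and f: "continuous_on UNIV f"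
  shows "diff_op u (conv (tent M) f) = conv (tent M) (diff_op u f)"
proof
  fix x
  have e: "x - u - y = x - y - u" for y by (simp add: algebra_simps)
  have i: "integrable lborel (\<lambda>y. tent M y * f (x - y - u))" using tent_conv_integrable[OF M f, of "x - u"] by (simp only: e)
  have "conv (tent M) (diff_op u f) x = (LINT y|lborel. tent M y * f (x - y - u) - tent M y * f (x - y))"
    by (simp add: diff_op_def conv_def right_diff_distrib)
  also have "... = (LINT y|lborel. tent M y * f (x - y - u)) - (LINT y|lborel. tent M y * f (x - y))"
    by (rule Bochner_Integration.integral_diff[OF i tent_conv_integrable[OF M f]])
  finally show "diff_op u (conv (tent M) f) x = conv (tent M) (diff_op u f) x" by (simp only: diff_op_def conv_def e)
qed

lemma diff_op_highpass:
  assumes "0 < M" "continuous_on UNIV f"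
  shows "diff_op u (highpass M f) = highpass M (diff_op u f)"
proof
  fix x
  have "diff_op u (highpass M f) x = diff_op u f x - diff_op u (conv (tent M) f) x" by (simp add: highpass_def diff_op_def)
  then show "diff_op u (highpass M f) x = highpass M (diff_op u f) x" by (simp only: diff_op_conv_tent[OF assms] highpass_def)
qed

lemma highpass_le:
  fixes f :: "'v::euclidean_space \<Rightarrow> complex"
  assumes M: "0 < M" and f: "continuous_on UNIV f" and D: "0 \<le> D"
    and le: "\<And>y. norm y \<le> M \<Longrightarrow> norm (diff_op y f x) \<le> D"
  shows "norm (highpass M f x) \<le> D"
proof -
  have "highpass M f x = (LINT y|lborel. tent M (y::'v)) * f x - (LINT y|lborel. tent M y * f (x - y))"
    by (simp add: highpass_def conv_def integral_tent[OF M])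
  also have "... = - (LINT y|lborel. tent M y * diff_op y f x)"
  proof -
    have "integrable lborel (\<lambda>y. tent M y * f x)" using integrable_tent[OF M] by (rule integrable_mult_left)
    from Bochner_Integration.integral_diff[OF tent_conv_integrable[OF M f, of x] this]
    show ?thesis by (simp only: diff_op_def right_diff_distrib integral_mult_left_zero minus_diff_eq)
  qed
  finally have "norm (highpass M f x) = norm (LINT y|lborel. tent M y * diff_op y f x)" by simp
  also have "... \<le> 1 * D"
  proof (rule norm_weighted_integral_le)
    show "norm (diff_op y f x) \<le> D" if "tent M y \<noteq> 0" for y using that tent_eq_0[OF M, of y] by (intro le) force
  qed (use nn_integral_tent[OF M, where 'v = 'v] D in auto)
  finally show ?thesis by simp
qed

lemma highpass_sup_le:
  assumes M: "0 < M" and f: "continuous_on UNIV f" and D: "0 \<le> D" and le: "\<And>x. norm (f x) \<le> D"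
  shows "norm (highpass M f x) \<le> 2 * D"
proof (rule highpass_le[OF M f])
  show "norm (diff_op y f x) \<le> 2 * D" for y
    using le[of "x - y"] le[of x] norm_triangle_ineq4[of "f (x - y)" "f x"] by (simp add: diff_op_def)
qed (use D in simp)

text \<open>The difference is moved to the tent. The differenced tent has integral zero, so f(x) can
  be subtracted and only increments of \<open>f\<close> of length up to M + |u| enter, with the gain
  |u| / M.\<close>

lemma diff_op_conv_tent_le:
  fixes f :: "'v::euclidean_space \<Rightarrow> complex"
  assumes M: "0 < M" and f: "continuous_on UNIV f" and D: "0 \<le> D"
    and le: "\<And>y. norm y \<le> M + norm u \<Longrightarrow> norm (diff_op y f x) \<le> D"
  shows "norm (diff_op u (conv (tent M) f) x) \<le> tent_const TYPE('v) * min 1 (norm u / M) * D"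
proof -
  let ?k = "\<lambda>y. tent M (y - u) - tent M y"
  have i1: "integrable lborel (\<lambda>y. tent M (y - u) * f (x - y))" and
    e1: "(LINT y|lborel. tent M (y - u) * f (x - y)) = conv (tent M) f (x - u)"
  proof -
    have [measurable]: "f \<in> borel_measurable borel" using f by (rule borel_measurable_continuous_onI)
    have eq: "(\<lambda>y. tent M (y - u) * f (x - y)) = (\<lambda>y. (\<lambda>z. tent M z * f (x - u - z)) (y - u))" by (auto simp: algebra_simps)
    show "integrable lborel (\<lambda>y. tent M (y - u) * f (x - y))"
      unfolding eq using tent_conv_integrable[OF M f, of "x - u"] by (rule integrable_lborel_shift)
    show "(LINT y|lborel. tent M (y - u) * f (x - y)) = conv (tent M) f (x - u)"
      unfolding eq conv_def by (rule integral_lborel_shift) measurable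
  qed
  note i2 = tent_conv_integrable[OF M f, of x]
  note i3 = integrable_lborel_shift[OF integrable_tent[OF M], of u]
  have i4: "integrable lborel (\<lambda>y. tent M (y - u) * f x)" "integrable lborel (\<lambda>y. tent M y * f x)"
    using i3 integrable_tent[OF M] by (auto intro: integrable_mult_left)
  have "(LINT y|lborel. ?k y * diff_op y f x)
      = (LINT y|lborel. (tent M (y - u) * f (x - y) - tent M y * f (x - y)) - (tent M (y - u) * f x - tent M y * f x))"
    by (intro Bochner_Integration.integral_cong) (auto simp: diff_op_def algebra_simps)
  also have "... = (conv (tent M) f (x - u) - conv (tent M) f x)
      - ((LINT y|lborel. tent M (y - u)) * f x - (LINT y|lborel. tent M (y::'v)) * f x)"
    by (simp only: Bochner_Integration.integral_diff[OF Bochner_Integration.integrable_diff[OF i1 i2] Bochner_Integration.integrable_diff[OF i4]]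
      Bochner_Integration.integral_diff[OF i1 i2] Bochner_Integration.integral_diff[OF i4] e1 integral_mult_left_zero) (simp only: conv_def)
  also have "... = diff_op u (conv (tent M) f) x" by (simp add: diff_op_def integral_lborel_shift)
  finally have "norm (diff_op u (conv (tent M) f) x) = norm (LINT y|lborel. ?k y * diff_op y f x)" by simp
  also have "... \<le> tent_const TYPE('v) * min 1 (norm u / M) * D"
  proof (rule norm_weighted_integral_le)
    show "norm (diff_op y f x) \<le> D" if "?k y \<noteq> 0" for y
    proof (rule le, rule ccontr)
      assume "\<not> norm y \<le> M + norm u"
      then have "M \<le> norm (y - u)" "M \<le> norm y" using norm_triangle_ineq2[of y u] norm_ge_zero[of u] by linarith+
      then show False using that M by (simp add: tent_eq_0)
    qed
    show "0 \<le> tent_const TYPE('v) * min 1 (norm u / M)" using M tent_const_ge[where 'v = 'v] by simp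
  qed (use nn_integral_tent_diff[OF M] D in auto)
  finally show ?thesis .
qed

text \<open>Near-additive functions are near-linear (Hyers); the error stays polynomial.\<close>

lemma near_additive_real:
  fixes d :: "real \<Rightarrow> complex"
  assumes cont: "continuous_on UNIV d" and e: "0 \<le> e" and d01: "d 0 = 0" "d 1 = 0"
    and add: "\<And>s t. norm (d (s + t) - d s - d t) \<le> e * ((1 + \<bar>s\<bar>)\<^sup>2 * (1 + \<bar>t\<bar>)\<^sup>2)"
  shows "norm (d t) \<le> 57 * e * (1 + \<bar>t\<bar>) ^ 4"
proof -
  have unit: "norm (d t) \<le> 48 * e" if t: "0 \<le> t" "t \<le> 1" for t
  proof -
    have "continuous_on {0..1} (\<lambda>t. norm (d t))" by (intro continuous_intros continuous_on_subset[OF cont]) auto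
    \<comment> \<open>At a point \<open>s\<close> of maximal |d|: if s \<le> 1/2, doubling compares
      |d(s)| with itself. Otherwise d(1) = 0 relates s to r = 1 - s \<le> 1/2, and doubling r gives
      |d(s)| \<le> 24e + |d(s)| / 2, hence 48e.\<close>
    then obtain s where s: "s \<in> {0..1}" "\<And>t. t \<in> {0..1} \<Longrightarrow> norm (d t) \<le> norm (d s)"
      using continuous_attains_sup[of "{0..1::real}" "\<lambda>t. norm (d t)"] by auto
    have err: "norm (d (p + q) - d p - d q) \<le> 16 * e" if "0 \<le> p" "p \<le> 1" "0 \<le> q" "q \<le> 1" for p q
    proof -
      have "(1 + \<bar>p\<bar>)\<^sup>2 * (1 + \<bar>q\<bar>)\<^sup>2 \<le> 2\<^sup>2 * 2\<^sup>2" using that by (intro mult_mono power_mono) auto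
      then have "e * ((1 + \<bar>p\<bar>)\<^sup>2 * (1 + \<bar>q\<bar>)\<^sup>2) \<le> e * 16" using e by (intro mult_left_mono) auto
      with add[of p q] show ?thesis by simp
    qed
    have double: "2 * norm (d p) \<le> norm (d (p + p)) + 16 * e" if "0 \<le> p" "p \<le> 1" for p
    proof -
      have "2 * d p = d (p + p) - (d (p + p) - d p - d p)" by simp
      then have "norm (2 * d p) \<le> norm (d (p + p)) + norm (d (p + p) - d p - d p)" by (metis norm_triangle_ineq4)
      then show ?thesis using err[OF that that] by (simp add: norm_mult)
    qed
    have "norm (d s) \<le> 48 * e"
    proof (cases "s \<le> 1 / 2")
      case True
      then show ?thesis using double[of s] s(1) s(2)[of "s + s"] e by auto
    next
      case False
      define r where "r = 1 - s"
      have r: "0 \<le> r" "r \<le> 1 / 2" "r \<le> 1" using False s(1) by (auto simp: r_def)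
      have "norm (d (s + r) - d s - d r) \<le> 16 * e" using s(1) r by (intro err) auto
      moreover have "d (s + r) = 0" using d01 by (simp add: r_def)
      moreover have "d s = - (0 - d s - d r) - d r" by simp
      ultimately have "norm (d s) \<le> 16 * e + norm (d r)"
        by (metis (no_types, lifting) add_right_mono norm_minus_cancel norm_triangle_ineq4 order_trans)
      moreover have "2 * norm (d r) \<le> norm (d s) + 16 * e" using double[of r] s(2)[of "r + r"] r by auto
      ultimately show ?thesis by linarith
    qed
    with s(2)[of t] t show ?thesis by auto
  qed
  \<comment> \<open>Adding 1 at a time costs 4e (1 + n)^2 per step, since d(1) = 0; the sum over the
    steps is cubic.\<close>
  have nat: "norm (d (real n)) \<le> 4 * e * (1 + real n) ^ 3" for n
  proof (induction n)
    case (Suc n)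
    have "norm (d (real n + 1) - d (real n) - d 1) \<le> e * ((1 + real n)\<^sup>2 * 4)" using add[of "real n" 1] by simp
    moreover have "norm (d (real n + 1)) \<le> norm (d (real n)) + norm (d (real n + 1) - d (real n))" by (rule norm_triangle_sub)
    ultimately have "norm (d (real (Suc n))) \<le> 4 * e * (1 + real n) ^ 3 + e * ((1 + real n)\<^sup>2 * 4)" using Suc d01 by (simp add: add.commute)
    also have "... = 4 * e * ((1 + real n) ^ 3 + (1 + real n)\<^sup>2)" by (simp add: algebra_simps)
    also have "(1 + real n) ^ 3 + (1 + real n)\<^sup>2 \<le> (1 + real (Suc n)) ^ 3" by (simp add: power3_eq_cube power2_eq_square algebra_simps)
    then have "4 * e * ((1 + real n) ^ 3 + (1 + real n)\<^sup>2) \<le> 4 * e * (1 + real (Suc n)) ^ 3" using e by (intro mult_left_mono) auto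
    finally show ?case .
  qed (use d01 e in simp)
  \<comment> \<open>56 = 4 + 4 + 48: additivity between integer and fractional part, the integer
    part, the unit interval. Negative t adds one more e through the defect of d(t) + d(-t).\<close>
  have pos: "norm (d t) \<le> 56 * e * (1 + t) ^ 4" if t: "0 \<le> t" for t
  proof -
    define n where "n = nat \<lfloor>t\<rfloor>"
    define s where "s = t - real n"
    have s: "0 \<le> s" "s \<le> 1" "real n \<le> t" using t unfolding s_def n_def by linarith+
    have "norm (d (real n + s) - d (real n) - d s) \<le> e * ((1 + real n)\<^sup>2 * (1 + s)\<^sup>2)" using add[of "real n" s] s by simp
    also have "... \<le> e * ((1 + t)\<^sup>2 * 2\<^sup>2)" using s e by (intro mult_left_mono mult_mono power_mono) auto
    finally have 1: "norm (d t - d (real n) - d s) \<le> 4 * e * (1 + t)\<^sup>2" by (simp add: s_def)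
    have "norm (d (real n)) \<le> 4 * e * (1 + t) ^ 3" using s e by (intro order_trans[OF nat] mult_left_mono power_mono) auto
    moreover have "norm (d t) \<le> norm (d t - d (real n) - d s) + norm (d (real n)) + norm (d s)"
      using norm_triangle_ineq[of "d t - d (real n) - d s" "d (real n) + d s"] norm_triangle_ineq[of "d (real n)" "d s"] by simp
    ultimately have "norm (d t) \<le> 4 * e * (1 + t)\<^sup>2 + 4 * e * (1 + t) ^ 3 + 48 * e * 1" using 1 unit[OF s(1,2)] by simp
    also have "... \<le> 4 * e * (1 + t) ^ 4 + 4 * e * (1 + t) ^ 4 + 48 * e * (1 + t) ^ 4"
      using e t by (intro add_mono mult_left_mono power_increasing one_le_power) auto
    finally show ?thesis by simp
  qed
  show ?thesis
  proof (cases "0 \<le> t")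
    case True
    have "56 * e * (1 + t) ^ 4 \<le> 57 * e * (1 + t) ^ 4" using e True by (intro mult_right_mono) auto
    then show ?thesis using pos[OF True] True by simp
  next
    case False
    have "norm (d (t + - t) - d t - d (- t)) \<le> e * ((1 + \<bar>t\<bar>)\<^sup>2 * (1 + \<bar>t\<bar>)\<^sup>2)" using add[of t "- t"] by simp
    then have "norm (d t + d (- t)) \<le> e * (1 + \<bar>t\<bar>) ^ 4" using d01 norm_minus_cancel[of "d t + d (- t)"] by (simp flip: power_add)
    then have "norm (d t) \<le> e * (1 + \<bar>t\<bar>) ^ 4 + norm (d (- t))" using norm_triangle_ineq4[of "d t + d (- t)" "d (- t)"] by simp
    then show ?thesis using pos[of "- t"] False by simp
  qed
qed

text \<open>One coordinate is added at a time: each of the \<open>DIM('v)\<close> steps costs the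
  square of 1 + \<open>DIM('v)\<close> for near additivity at the partial sum and 57 for the
  coordinate axis.\<close>

definition hyers_const :: "'v::euclidean_space itself \<Rightarrow> real" where
  "hyers_const _ = real DIM('v) * ((1 + real DIM('v))\<^sup>2 + 57)"

text \<open>On each axis the function g(t b) - t g(b) of t vanishes at 0 and 1 and has the same
  additivity defect as g along that axis, so the one-dimensional case applies; near additivity then
  reassembles the coordinates.\<close>

lemma near_additive:
  fixes g :: "'v::euclidean_space \<Rightarrow> complex"
  assumes cont: "continuous_on UNIV g" and e: "0 \<le> e" and g0: "g 0 = 0"
    and add: "\<And>x y. norm (g (x + y) - g x - g y) \<le> e * ((1 + norm x)\<^sup>2 * (1 + norm y)\<^sup>2)"
  shows "norm (g x - (\<Sum>b\<in>Basis. of_real (x \<bullet> b) * g b)) \<le> hyers_const TYPE('v) * e * (1 + norm x) ^ 4"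
proof -
  let ?d = "real DIM('v)"
  have line: "norm (g (t *\<^sub>R b) - of_real t * g b) \<le> 57 * e * (1 + \<bar>t\<bar>) ^ 4" if b: "b \<in> Basis" for t b
  proof (rule near_additive_real[of "\<lambda>t. g (t *\<^sub>R b) - of_real t * g b"])
    show "continuous_on UNIV (\<lambda>t. g (t *\<^sub>R b) - of_real t * g b)" by (intro continuous_intros continuous_on_compose2[OF cont]) auto
    show "norm (g ((s + t) *\<^sub>R b) - of_real (s + t) * g b - (g (s *\<^sub>R b) - of_real s * g b) - (g (t *\<^sub>R b) - of_real t * g b))
      \<le> e * ((1 + \<bar>s\<bar>)\<^sup>2 * (1 + \<bar>t\<bar>)\<^sup>2)" for s t using add[of "s *\<^sub>R b" "t *\<^sub>R b"] b by (simp add: algebra_simps)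
  qed (use e g0 in simp_all)
  have "norm (g (\<Sum>b\<in>S. (x \<bullet> b) *\<^sub>R b) - (\<Sum>b\<in>S. of_real (x \<bullet> b) * g b))
      \<le> real (card S) * (((1 + ?d)\<^sup>2 + 57) * e * (1 + norm x) ^ 4)" if "finite S" "S \<subseteq> Basis" for S using that
  proof (induction S rule: finite_induct)
    case (insert b S)
    let ?p = "\<Sum>b\<in>S. (x \<bullet> b) *\<^sub>R b" and ?q = "(x \<bullet> b) *\<^sub>R b" and ?l = "\<Sum>b\<in>S. of_real (x \<bullet> b) * g b"
    have b: "b \<in> Basis" and S: "S \<subseteq> Basis" using insert.prems by auto
    have xb: "\<bar>x \<bullet> b\<bar> \<le> norm x" using b by (rule Basis_le_norm)
    have "norm ?p \<le> (\<Sum>b\<in>S. norm x)" using S Basis_le_norm by (intro order_trans[OF norm_sum] sum_mono) (auto simp: norm_Basis subset_eq)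
    also have "... \<le> ?d * norm x" using card_mono[OF finite_Basis S] by (simp add: mult_right_mono)
    also have "1 + ?d * norm x \<le> (1 + ?d) * (1 + norm x)" by (simp add: algebra_simps)
    finally have p: "1 + norm ?p \<le> (1 + ?d) * (1 + norm x)" by simp
    have "norm (g (?q + ?p) - g ?q - g ?p) \<le> e * ((1 + norm ?q)\<^sup>2 * (1 + norm ?p)\<^sup>2)" by (rule add)
    also have "... \<le> e * ((1 + norm x)\<^sup>2 * ((1 + ?d) * (1 + norm x))\<^sup>2)" using p xb b e by (intro mult_left_mono mult_mono power_mono) auto
    also have "... = (1 + ?d)\<^sup>2 * e * (1 + norm x) ^ 4" by (simp add: power_mult_distrib flip: power_add)
    finally have 1: "norm (g (?q + ?p) - g ?q - g ?p) \<le> (1 + ?d)\<^sup>2 * e * (1 + norm x) ^ 4" .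
    have "57 * e * (1 + \<bar>x \<bullet> b\<bar>) ^ 4 \<le> 57 * e * (1 + norm x) ^ 4" using xb e by (intro mult_left_mono power_mono) auto
    then have 2: "norm (g ?q - of_real (x \<bullet> b) * g b) \<le> 57 * e * (1 + norm x) ^ 4" using line[OF b, of "x \<bullet> b"] by linarith
    have "g (\<Sum>b\<in>insert b S. (x \<bullet> b) *\<^sub>R b) - (\<Sum>b\<in>insert b S. of_real (x \<bullet> b) * g b)
        = (g (?q + ?p) - g ?q - g ?p) + (g ?q - of_real (x \<bullet> b) * g b) + (g ?p - ?l)" using insert.hyps by simp
    also have "norm ... \<le> (1 + ?d)\<^sup>2 * e * (1 + norm x) ^ 4 + 57 * e * (1 + norm x) ^ 4
        + real (card S) * (((1 + ?d)\<^sup>2 + 57) * e * (1 + norm x) ^ 4)" using 1 2 insert.IH[OF S] by (intro norm_triangle_le add_mono) auto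
    also have "... = real (card (insert b S)) * (((1 + ?d)\<^sup>2 + 57) * e * (1 + norm x) ^ 4)" using insert.hyps by (simp add: algebra_simps)
    finally show ?case .
  qed (use g0 in simp)
  from this[of Basis] show ?thesis by (simp add: euclidean_representation hyers_const_def mult.assoc)
qed

lemma powr_scale_bound:
  fixes t S a m :: real
  assumes "0 \<le> t" "0 < S" "0 \<le> a" "a \<le> 1" "0 \<le> m" "m \<le> 1" "m \<le> 2 * (t / S)"
  shows "m \<le> 2 * ((1 / S) powr a * t powr a)"
proof -
  have "min 1 (t / S) \<le> (t / S) powr a"
  proof (cases "t \<le> S")
    case True
    then have "(t / S) powr 1 \<le> (t / S) powr a" using assms by (intro powr_mono') auto
    then show ?thesis using assms by simp
  next
    case False
    then have "1 powr a \<le> (t / S) powr a" using assms by (intro powr_mono2) auto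
    then show ?thesis by simp
  qed
  then have "m \<le> 2 * (t / S) powr a" using assms by linarith
  then show ?thesis using assms by (simp add: powr_divide)
qed

text \<open>A Euclidean cut-off at scale S acts for \<rho> as one at scale sqrt S: by
  \<open>norm_le\<close>, \<rho> u \<le> sqrt S implies |u| \<le> 2 \<rho> u sqrt S. In this form
  one and the same bump serves both lengths.\<close>

lemma (in length_function) min_norm_le_powr:
  assumes S: "1 \<le> S" and a: "0 \<le> a" "a \<le> 1"
  shows "min 1 (norm u / S) \<le> 2 * ((1 / sqrt S) powr a * \<rho> u powr a)"
proof (rule powr_scale_bound)
  show "min 1 (norm u / S) \<le> 2 * (\<rho> u / sqrt S)"
  proof (cases "\<rho> u \<le> sqrt S")
    case True
    have S': "S = sqrt S * sqrt S" "1 \<le> sqrt S" using S by auto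
    have "norm u \<le> \<rho> u * 1 + \<rho> u * \<rho> u" using norm_le[of u] by (simp add: power2_eq_square)
    also have "... \<le> \<rho> u * sqrt S + \<rho> u * sqrt S" using True S' by (intro add_mono mult_left_mono) auto
    finally have "norm u / S \<le> (2 * \<rho> u * sqrt S) / S" using S by (intro divide_right_mono) (auto simp: mult_ac)
    also have "... = 2 * (\<rho> u / sqrt S)" using S by (subst (2) S'(1)) (simp add: field_simps)
    finally show ?thesis by linarith
  next
    case False
    then have "1 \<le> \<rho> u / sqrt S" using S by (simp add: le_divide_eq)
    then show ?thesis by linarith
  qed
qed (use S a in auto)

text \<open>The composite seminorm of a product asks for second differences of the cut-off of order
  |u| |v| / S^2, which a merely Lipschitz plateau lacks; after averaging with a tent one difference
  falls on the plateau and the other on the tent. The plateau is 1 up to 2S and 0 beyond 3S, so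
  averaging leaves 1 up to S and 0 beyond 4S.\<close>

definition bump :: "real \<Rightarrow> 'v::euclidean_space \<Rightarrow> complex" where
  "bump S = conv (tent S) (\<lambda>x. of_real (min 1 (max 0 (3 - norm x / S))))"

lemma bump_properties:
  fixes x u v :: "'v::euclidean_space"
  assumes S: "0 < S"
  shows "continuous_on UNIV (bump S :: 'v \<Rightarrow> complex)"
    and "norm (bump S x) \<le> 1"
    and "4 * S \<le> norm x \<Longrightarrow> bump S x = 0"
    and "norm x \<le> S \<Longrightarrow> bump S x = 1"
    and "norm (diff_op u (bump S) x) \<le> min 1 (norm u / S)"
    and "norm (diff_op u (diff_op v (bump S)) x) \<le> tent_const TYPE('v) * min 1 (norm u / S) * (2 * min 1 (norm v / S))"
proof -
  define \<theta> where "\<theta> = (\<lambda>x::'v. complex_of_real (min 1 (max 0 (3 - norm x / S))))"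
  have b: "bump S = conv (tent S) \<theta>" by (simp add: bump_def \<theta>_def)
  have c: "continuous_on UNIV \<theta>" unfolding \<theta>_def using S by (intro continuous_intros) auto
  have \<theta>1: "norm (\<theta> z) \<le> 1" for z by (simp add: \<theta>_def)
  have \<theta>d: "norm (diff_op u \<theta> z) \<le> min 1 (norm u / S)" for u z
  proof -
    have "\<bar>norm (z - u) - norm z\<bar> \<le> norm u" using norm_length.diff_ge[of z u] norm_length.triangle_diff[of z u] by linarith
    then have "\<bar>norm (z - u) / S - norm z / S\<bar> \<le> norm u / S" using S by (simp add: divide_right_mono flip: diff_divide_distrib)
    then have "\<bar>min 1 (max 0 (3 - norm (z - u) / S)) - min 1 (max 0 (3 - norm z / S))\<bar> \<le> min 1 (norm u / S)" by linarith
    moreover have "diff_op u \<theta> z = of_real (min 1 (max 0 (3 - norm (z - u) / S)) - min 1 (max 0 (3 - norm z / S)))"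
      by (simp add: diff_op_def \<theta>_def)
    ultimately show ?thesis by (simp only: norm_of_real)
  qed
  have avg: "norm (conv (tent S) F z) \<le> D" if "\<And>z. norm (F z) \<le> D" "0 \<le> D" for F :: "'v \<Rightarrow> complex" and D z
  proof -
    have "norm (LINT y|lborel. tent S y * F (z - y)) \<le> 1 * D"
      using nn_integral_tent[OF S, where 'v = 'v] that by (intro norm_weighted_integral_le) auto
    then show ?thesis by (simp add: conv_def)
  qed
  show "continuous_on UNIV (bump S :: 'v \<Rightarrow> complex)" unfolding b using S c by (rule continuous_conv_tent)
  show "norm (bump S x) \<le> 1" unfolding b using \<theta>1 by (intro avg) auto
  show "norm (diff_op u (bump S) x) \<le> min 1 (norm u / S)" unfolding b diff_op_conv_tent[OF S c] using \<theta>d S by (intro avg) auto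
  show "bump S x = 0" if x: "4 * S \<le> norm x"
  proof -
    have "tent S y * \<theta> (x - y) = 0" for y
    proof (cases "S \<le> norm y")
      case False
      then have "3 * S \<le> norm (x - y)" using x norm_triangle_ineq2[of x y] by linarith
      then have "3 - norm (x - y) / S \<le> 0" using S by (simp add: field_simps)
      then show ?thesis by (simp add: \<theta>_def max_def)
    qed (use S in \<open>simp add: tent_eq_0\<close>)
    then show ?thesis unfolding b conv_def by (simp only:) simp
  qed
  show "bump S x = 1" if x: "norm x \<le> S"
  proof -
    have "tent S y * \<theta> (x - y) = tent S y" for y
    proof (cases "S \<le> norm y")
      case False
      then have "norm (x - y) \<le> 2 * S" using x norm_triangle_ineq4[of x y] by linarith
      then have "1 \<le> 3 - norm (x - y) / S" using S by (simp add: field_simps)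
      then show ?thesis by (simp add: \<theta>_def min_def max_def)
    qed (use S in \<open>simp add: tent_eq_0\<close>)
    then show ?thesis unfolding b conv_def by (simp only: integral_tent[OF S])
  qed
  have "norm (diff_op u (conv (tent S) (diff_op v \<theta>)) x) \<le> tent_const TYPE('v) * min 1 (norm u / S) * (2 * min 1 (norm v / S))"
  proof (rule diff_op_conv_tent_le[OF S continuous_diff_op[OF c]])
    fix y
    show "norm (diff_op y (diff_op v \<theta>) x) \<le> 2 * min 1 (norm v / S)"
      using \<theta>d[of v "x - y"] \<theta>d[of v x] norm_triangle_ineq4[of "diff_op v \<theta> (x - y)" "diff_op v \<theta> x"]
      unfolding diff_op_def[of y] by linarith
  qed (use S in simp)
  then show "norm (diff_op u (diff_op v (bump S)) x) \<le> tent_const TYPE('v) * min 1 (norm u / S) * (2 * min 1 (norm v / S))"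
    unfolding b diff_op_conv_tent[OF S c] .
qed

lemma diff_op_diff_op_mult:
  "diff_op u (diff_op v (\<lambda>x. h x * k x)) x = diff_op u (diff_op v h) x * k (x - u - v)
    + diff_op v h x * diff_op u k (x - v) + diff_op u h x * diff_op v k (x - u)
    + h x * diff_op u (diff_op v k) x"
proof -
  have "x - v - u = x - u - v" by (simp add: algebra_simps)
  then show ?thesis by (simp add: diff_op_def) (simp add: algebra_simps)
qed

lemma large_scale_exists:
  fixes A B C a b :: real
  assumes "0 < a" "0 < b"
  obtains T where "1 \<le> T" "B \<le> T" "C * (1 / T) powr a \<le> 1 / 2" "A * (1 / T) powr b \<le> 1 / 2"
proof -
  have lim: "((\<lambda>T::real. D * T powr - s) \<longlongrightarrow> 0) at_top" if "0 < s" for D s :: real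
    using that by (intro tendsto_mult_right_zero tendsto_neg_powr filterlim_ident) auto
  have "\<forall>\<^sub>F T in at_top. C * T powr - a < 1 / 2" "\<forall>\<^sub>F T in at_top. A * T powr - b < 1 / 2"
    by (rule order_tendstoD(2)[OF lim]; use assms in simp)+
  moreover have "\<forall>\<^sub>F T in at_top. max 1 B \<le> (T::real)" by (rule eventually_ge_at_top)
  ultimately have "\<forall>\<^sub>F T in at_top. C * T powr - a < 1 / 2 \<and> A * T powr - b < 1 / 2 \<and> max 1 B \<le> T" by eventually_elim auto
  then obtain T where T: "C * T powr - a < 1 / 2" "A * T powr - b < 1 / 2" "max 1 B \<le> T"
    using eventually_happens'[OF trivial_limit_at_top_linorder] by blast
  have "(1 / T) powr s = T powr - s" for s using T(3) by (simp add: powr_divide powr_minus_divide)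
  then show ?thesis using T by (intro that[of T]) auto
qed

section \<open>Approximating sequences in the composite spaces\<close>

context two_lengths begin

text \<open>Each of the two \<open>highpass\<close> either spends one difference over a length of at
  most M, paying 2 + M, or is bounded trivially by the factor 2. With zero, one or two differences
  taken outside, two, one or none are left to be spent; in the middle cases 2 + M is rounded up to
  its square.\<close>

lemma highpass_bi_hoelder:
  assumes f: "continuous_on UNIV f" "bi_hoelder \<sigma> a \<rho> b L f" and ab: "0 < a" "a < 1" "0 < b" "b < 1" and M: "1 \<le> M"
  defines "h \<equiv> highpass M (highpass M f)"
  shows "norm (h x) \<le> L * (2 + M)\<^sup>2"
    and "norm (diff_op v h x) \<le> L * (2 * (2 + M)\<^sup>2) * \<rho> v powr b"
    and "norm (diff_op u h x) \<le> L * (2 * (2 + M)\<^sup>2) * \<sigma> u powr a"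
    and "norm (diff_op u (diff_op v h) x) \<le> 4 * L * (\<sigma> u powr a * \<rho> v powr b)"
proof -
  have M0: "0 < M" using M by simp
  have L: "0 \<le> L" using f(2) by (rule bi_hoelder_nonneg)
  have comm: "diff_op u h = highpass M (highpass M (diff_op u f))" for u
    unfolding h_def using M0 f(1) by (simp add: diff_op_highpass continuous_highpass)
  have dc: "continuous_on UNIV (diff_op u f)" for u using f(1) by (rule continuous_diff_op)
  have sM: "\<sigma> y powr a \<le> 2 + M" "\<rho> y powr b \<le> 2 + M" if "norm y \<le> M" for y using s.powr_le[of a y] r.powr_le[of b y] that ab by linarith+
  have q1: "norm (highpass M (diff_op v f) z) \<le> L * ((2 + M) * \<rho> v powr b)" for v z
  proof (rule highpass_le[OF M0 dc])
    fix y :: 'v assume "norm y \<le> M"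
    then have "L * (\<sigma> y powr a * \<rho> v powr b) \<le> L * ((2 + M) * \<rho> v powr b)" using sM L by (intro mult_left_mono mult_right_mono) auto
    then show "norm (diff_op y (diff_op v f) z) \<le> L * ((2 + M) * \<rho> v powr b)" using bi_hoelderD[OF f(2), of y v z] by linarith
  qed (use L M in simp)
  have q2: "norm (highpass M (diff_op u f) z) \<le> L * ((2 + M) * \<sigma> u powr a)" for u z
  proof (rule highpass_le[OF M0 dc])
    fix y :: 'v assume "norm y \<le> M"
    then have "L * (\<sigma> u powr a * \<rho> y powr b) \<le> L * (\<sigma> u powr a * (2 + M))" using sM L by (intro mult_left_mono) auto
    then show "norm (diff_op y (diff_op u f) z) \<le> L * ((2 + M) * \<sigma> u powr a)"
      using bi_hoelderD[OF f(2), of u y z] by (simp add: diff_op_commute[of y u] mult.commute)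
  qed (use L M in simp)
  have sq: "(2 + M) \<le> (2 + M)\<^sup>2" using M by (simp add: power2_eq_square mult_le_cancel_left1)
  show "norm (h x) \<le> L * (2 + M)\<^sup>2" unfolding h_def
  proof (rule highpass_le[OF M0 continuous_highpass[OF M0 f(1)]])
    fix y :: 'v assume y: "norm y \<le> M"
    have "norm (diff_op y (highpass M f) x) \<le> L * ((2 + M) * \<rho> y powr b)" unfolding diff_op_highpass[OF M0 f(1)] by (rule q1)
    also have "... \<le> L * ((2 + M) * (2 + M))" using sM[OF y] L M by (intro mult_left_mono) auto
    finally show "norm (diff_op y (highpass M f) x) \<le> L * (2 + M)\<^sup>2" by (simp add: power2_eq_square)
  qed (use L in simp)
  have "norm (diff_op v h x) \<le> 2 * (L * ((2 + M) * \<rho> v powr b))"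
    unfolding comm using q1 L M by (intro highpass_sup_le M0 continuous_highpass dc) auto
  also have "... \<le> 2 * (L * ((2 + M)\<^sup>2 * \<rho> v powr b))" using sq L by (intro mult_left_mono mult_right_mono) auto
  finally show "norm (diff_op v h x) \<le> L * (2 * (2 + M)\<^sup>2) * \<rho> v powr b" by (simp add: mult_ac)
  have "norm (diff_op u h x) \<le> 2 * (L * ((2 + M) * \<sigma> u powr a))"
    unfolding comm using q2 L M by (intro highpass_sup_le M0 continuous_highpass dc) auto
  also have "... \<le> 2 * (L * ((2 + M)\<^sup>2 * \<sigma> u powr a))" using sq L by (intro mult_left_mono mult_right_mono) auto
  finally show "norm (diff_op u h x) \<le> L * (2 * (2 + M)\<^sup>2) * \<sigma> u powr a" by (simp add: mult_ac)
  have "diff_op u (diff_op v h) = highpass M (highpass M (diff_op u (diff_op v f)))"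
    unfolding comm using M0 dc by (simp add: diff_op_highpass continuous_highpass)
  moreover have "norm (highpass M (highpass M (diff_op u (diff_op v f))) x) \<le> 2 * (2 * (L * (\<sigma> u powr a * \<rho> v powr b)))"
    using bi_hoelderD[OF f(2)] L by (intro highpass_sup_le M0 continuous_highpass continuous_diff_op f(1)) auto
  ultimately show "norm (diff_op u (diff_op v h) x) \<le> 4 * L * (\<sigma> u powr a * \<rho> v powr b)" by simp
qed

text \<open>\<open>G\<close> is the tent average of f plus that of \<open>highpass M f\<close>. In
  each, one difference falls on the tent with gain |u| / M, against increments over lengths up to M
  + |u| that cost M^a; the net factor M^(a - 1) becomes small for large M because a < 1. The
  constant 12 is 3, from D + 2D, times the 4 inside \<open>D\<close>.\<close>

lemma lowpass_near_additive:
  assumes f: "continuous_on UNIV f" "bi_hoelder \<sigma> a \<rho> b L f" and ab: "0 < a" "a < 1" "0 < b" "b < 1" and M: "1 \<le> M"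
  defines "G \<equiv> \<lambda>x. f x - highpass M (highpass M f) x"
  shows "norm (diff_op u (diff_op v G) x) \<le> 12 * tent_const TYPE('v) * L * M powr (a - 1) * ((1 + norm u)\<^sup>2 * (1 + norm v)\<^sup>2)"
proof -
  have M0: "0 < M" using M by simp
  have L: "0 \<le> L" using f(2) by (rule bi_hoelder_nonneg)
  let ?c = "tent_const TYPE('v)"
  have c: "0 \<le> ?c" using tent_const_ge[where 'v = 'v] by linarith
  have dc: "continuous_on UNIV (diff_op v f)" using f(1) by (rule continuous_diff_op)
  define D where "D = L * (2 * M powr a * (1 + norm u) * (2 * (1 + norm v)))"
  have D0: "0 \<le> D" using L by (simp add: D_def)
  have D: "norm (diff_op y (diff_op v f) z) \<le> D" if y: "norm y \<le> M + norm u" for y z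
  proof -
    have "\<sigma> y \<le> (2 * M) * (1 + norm u)"
    proof -
      have "(2 * M) * (1 + norm u) = M + M + M * norm u + M * norm u" by algebra
      moreover have "norm u \<le> M * norm u" "0 \<le> M * norm u" using M by (simp_all add: mult_le_cancel_right1)
      ultimately show ?thesis using s.le_norm[of y] y M by linarith
    qed
    then have "\<sigma> y powr a \<le> ((2 * M) * (1 + norm u)) powr a" using ab by (intro powr_mono2) auto
    also have "... = 2 powr a * M powr a * (1 + norm u) powr a" using M by (simp add: powr_mult)
    also have "... \<le> 2 powr 1 * M powr a * (1 + norm u) powr 1" using ab M by (intro mult_mono powr_mono) auto
    finally have "\<sigma> y powr a \<le> 2 * M powr a * (1 + norm u)" using one_add_norm_pos[of u] by simp
    moreover have "\<rho> v powr b \<le> 2 * (1 + norm v)" by (rule order_trans[OF r.powr_le]) (use ab in auto)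
    ultimately have "L * (\<sigma> y powr a * \<rho> v powr b) \<le> D" unfolding D_def using L by (intro mult_left_mono mult_mono) auto
    then show ?thesis using bi_hoelderD[OF f(2), of y v z] by linarith
  qed
  have G: "diff_op u (diff_op v G) x = diff_op u (conv (tent M) (diff_op v f)) x + diff_op u (conv (tent M) (highpass M (diff_op v f))) x"
  proof -
    have "G = (\<lambda>x. conv (tent M) f x + conv (tent M) (highpass M f) x)"
      unfolding G_def by (rule ext) (simp add: highpass_def[of M "highpass M f"] highpass_def[of M f])
    then have "diff_op v G = (\<lambda>x. diff_op v (conv (tent M) f) x + diff_op v (conv (tent M) (highpass M f)) x)"
      by (simp add: diff_op_def add_diff_add)
    then have "diff_op v G = (\<lambda>x. conv (tent M) (diff_op v f) x + conv (tent M) (highpass M (diff_op v f)) x)"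
      using M0 f(1) by (simp only: diff_op_conv_tent continuous_highpass diff_op_highpass)
    then show ?thesis by (simp add: diff_op_def[of u])
  qed
  have "norm (diff_op u (conv (tent M) (diff_op v f)) x) \<le> ?c * min 1 (norm u / M) * D"
    using D D0 by (intro diff_op_conv_tent_le[OF M0 dc]) auto
  moreover have "norm (diff_op u (conv (tent M) (highpass M (diff_op v f))) x) \<le> ?c * min 1 (norm u / M) * (2 * D)"
  proof (rule diff_op_conv_tent_le[OF M0 continuous_highpass[OF M0 dc]])
    fix y :: 'v assume y: "norm y \<le> M + norm u"
    show "norm (diff_op y (highpass M (diff_op v f)) x) \<le> 2 * D"
      unfolding diff_op_highpass[OF M0 dc] using D[OF y] D0 by (intro highpass_sup_le M0 continuous_diff_op f(1)) auto
  qed (use D0 in simp)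
  ultimately have "norm (diff_op u (diff_op v G) x) \<le> ?c * min 1 (norm u / M) * D + ?c * min 1 (norm u / M) * (2 * D)"
    unfolding G by (intro norm_triangle_le add_mono)
  also have "... = 3 * (?c * min 1 (norm u / M) * D)" by simp
  also have "... \<le> 3 * (?c * ((1 + norm u) / M) * D)"
  proof -
    have "min 1 (norm u / M) \<le> (1 + norm u) / M" using M0 by (intro min.coboundedI2 divide_right_mono) auto
    then show ?thesis using c D0 by (intro mult_left_mono mult_right_mono) auto
  qed
  also have "... = 12 * ?c * L * (M powr a / M) * ((1 + norm u)\<^sup>2 * (1 + norm v))"
    using M0 by (simp add: D_def power2_eq_square field_simps)
  also have "M powr a / M = M powr (a - 1)" using M0 by (simp add: powr_diff)
  also have "12 * ?c * L * M powr (a - 1) * ((1 + norm u)\<^sup>2 * (1 + norm v))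
      \<le> 12 * ?c * L * M powr (a - 1) * ((1 + norm u)\<^sup>2 * (1 + norm v)\<^sup>2)"
    using c L self_le_power[of "1 + norm v" 2] by (intro mult_left_mono) auto
  finally show ?thesis .
qed

text \<open>In the product rule for the high-frequency part times the bump, the term with both
  differences on the former gives 4L. Every other term carries a negative power of the scale of the
  bump, which is chosen after M and so beats constants of order (2 + M)^2; together these terms add
  at most L, whence 5L.\<close>

lemma bi_hoelder_approx:
  assumes f: "continuous_on UNIV f" "bi_hoelder \<sigma> a \<rho> b L f" and ab: "0 < a" "a < 1" "0 < b" "b < 1" and M: "1 \<le> M"
  obtains k where "continuous_on UNIV k" "k \<in> L2" "bi_hoelder \<sigma> a \<rho> b (5 * L) k"
    "\<And>x. norm (k x - highpass M (highpass M f) x) \<le> 2 * L / M * norm x"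
proof -
  have M0: "0 < M" using M by simp
  have L: "0 \<le> L" using f(2) by (rule bi_hoelder_nonneg)
  define h where "h = highpass M (highpass M f)"
  have hc: "continuous_on UNIV h" unfolding h_def using M0 f(1) by (intro continuous_highpass)
  define A where "A = 2 * (2 + M)\<^sup>2"
  define c where "c = tent_const TYPE('v)"
  have A: "0 \<le> A" by (simp add: A_def)
  have c: "0 \<le> c" using tent_const_ge[where 'v = 'v] by (simp add: c_def)
  note hb = highpass_bi_hoelder[OF f ab M, folded h_def A_def]
  have h1: "norm (h x) \<le> L * A" for x
  proof -
    have "L * (2 + M)\<^sup>2 \<le> L * A" using L by (intro mult_left_mono) (auto simp: A_def)
    with hb(1)[of x] show ?thesis by linarith
  qed
  \<comment> \<open>The spare unit is shared equally by the two exponents. The condition on M A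
    makes the error 2LA, which occurs only for |x| > S, at most (2L / M) |x|.\<close>
  obtain T where T: "1 \<le> T" "M * A \<le> T" "A * (2 + 8 * c) * (1 / T) powr a \<le> 1 / 2" "(2 * A) * (1 / T) powr b \<le> 1 / 2"
    using large_scale_exists[OF ab(1,3)] by metis
  define S where "S = T\<^sup>2"
  have S: "1 \<le> S" "0 < S" "sqrt S = T" using T(1) by (auto simp: S_def one_le_power)
  have ST: "M * A \<le> S" using T self_le_power[of T 2] by (simp add: S_def)
  define \<omega> where "\<omega> = (bump S :: 'v \<Rightarrow> complex)"
  note \<omega> = bump_properties[OF S(2), where 'v = 'v, folded \<omega>_def c_def]
  define ka kb where "ka = (1 / T) powr a" and "kb = (1 / T) powr b"
  have k01: "0 \<le> ka" "0 \<le> kb" "kb \<le> 1" using T(1) ab unfolding ka_def kb_def by (auto intro!: powr_le1)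
  have mu: "min 1 (norm u / S) \<le> 2 * (ka * \<sigma> u powr a)" for u using s.min_norm_le_powr[OF S(1), of a u] ab S(3) by (simp add: ka_def)
  have mv: "min 1 (norm v / S) \<le> 2 * (kb * \<rho> v powr b)" for v using r.min_norm_le_powr[OF S(1), of b v] ab S(3) by (simp add: kb_def)
  define k where "k = (\<lambda>x. h x * \<omega> x)"
  have kc: "continuous_on UNIV k" unfolding k_def using hc \<omega>(1) by (intro continuous_intros)
  have "k \<in> L2"
  proof (rule norm_length.bounded_support_L2[OF kc])
    fix x
    have "norm (k x) \<le> (L * A) * 1" unfolding k_def norm_mult using h1[of x] \<omega>(2)[of x] L A by (intro mult_mono) auto
    then show "norm (k x) \<le> L * A" by simp
    show "4 * S \<le> norm x \<Longrightarrow> k x = 0" using \<omega>(3)[of x] by (simp add: k_def)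
  qed
  moreover have "bi_hoelder \<sigma> a \<rho> b (5 * L) k" unfolding bi_hoelder_def
  proof (intro allI)
    fix x u v
    define P where "P = \<sigma> u powr a" define Q where "Q = \<rho> v powr b"
    have PQ: "0 \<le> P" "0 \<le> Q" by (auto simp: P_def Q_def)
    have 1: "norm (diff_op u (diff_op v h) x * \<omega> (x - u - v)) \<le> (4 * L * (P * Q)) * 1"
      unfolding norm_mult P_def Q_def using hb(4)[of u v x] \<omega>(2) by (intro mult_mono) (use L in auto)
    have 2: "norm (diff_op v h x * diff_op u \<omega> (x - v)) \<le> (L * A * Q) * (2 * (ka * P))"
      unfolding norm_mult P_def Q_def using hb(2)[of v x] order_trans[OF \<omega>(5) mu[of u]] L A by (intro mult_mono) auto
    have 3: "norm (diff_op u h x * diff_op v \<omega> (x - u)) \<le> (L * A * P) * (2 * (kb * Q))"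
      unfolding norm_mult P_def Q_def using hb(3)[of u x] order_trans[OF \<omega>(5) mv[of v]] L A by (intro mult_mono) auto
    have "c * min 1 (norm u / S) * (2 * min 1 (norm v / S)) \<le> c * (2 * (ka * P)) * (2 * (2 * (kb * Q)))"
      using mu[of u] mv[of v] c k01 S PQ unfolding P_def Q_def by (intro mult_mono mult_left_mono mult_nonneg_nonneg) auto
    then have "norm (diff_op u (diff_op v \<omega>) x) \<le> c * (2 * (ka * P)) * (2 * (2 * (kb * Q)))" using \<omega>(6)[of u v x] by linarith
    also have "... = 8 * c * ka * (P * Q) * kb" by simp
    also have "... \<le> 8 * c * ka * (P * Q) * 1" using k01 c PQ by (intro mult_left_mono) auto
    finally have 4: "norm (h x * diff_op u (diff_op v \<omega>) x) \<le> (L * A) * (8 * c * ka * (P * Q))"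
      unfolding norm_mult using h1[of x] L A by (intro mult_mono) auto
    have "norm (diff_op u (diff_op v k) x) \<le> (4 * L * (P * Q)) * 1 + (L * A * Q) * (2 * (ka * P))
        + (L * A * P) * (2 * (kb * Q)) + (L * A) * (8 * c * ka * (P * Q))"
      unfolding k_def diff_op_diff_op_mult by (intro norm_triangle_le add_mono 1 2 3 4)
    also have "... = L * (P * Q) * (4 + A * (2 + 8 * c) * ka + (2 * A) * kb)" by (simp add: algebra_simps)
    also have "... \<le> L * (P * Q) * 5" using T(3,4) L PQ unfolding ka_def[symmetric] kb_def[symmetric] by (intro mult_left_mono) auto
    finally show "norm (diff_op u (diff_op v k) x) \<le> 5 * L * (\<sigma> u powr a * \<rho> v powr b)" by (simp add: P_def Q_def mult_ac)
  qed
  moreover have "norm (k x - highpass M (highpass M f) x) \<le> 2 * L / M * norm x" for x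
  proof (cases "norm x \<le> S")
    case True
    then show ?thesis using \<omega>(4)[of x] L M0 by (simp add: k_def h_def)
  next
    case False
    have "k x - h x = h x * (\<omega> x - 1)" by (simp add: k_def algebra_simps)
    moreover have "norm (\<omega> x - 1) \<le> 2" using \<omega>(2)[of x] norm_triangle_ineq4[of "\<omega> x" 1] by simp
    ultimately have "norm (k x - h x) \<le> (L * A) * 2" using h1[of x] L A by (simp only: norm_mult) (intro mult_mono, auto)
    also have "... = 2 * L / M * (M * A)" using M0 by simp
    also have "... \<le> 2 * L / M * norm x" using False ST L M0 by (intro mult_left_mono) auto
    finally show ?thesis by (simp add: h_def)
  qed
  ultimately show ?thesis using that kc by blast
qed

lemma bi_hoelder_approx_sequence:
  assumes f: "continuous_on UNIV f" "bi_hoelder \<sigma> a \<rho> b L f" and ab: "0 < a" "a < 1" "0 < b" "b < 1"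
  shows "\<exists>fs. (\<forall>m. continuous_on UNIV (fs m) \<and> fs m \<in> L2 \<and> bi_hoelder \<sigma> a \<rho> b (5 * L) (fs m)) \<and> lim_mod_poly fs f"
proof -
  have L: "0 \<le> L" using f(2) by (rule bi_hoelder_nonneg)
  have "\<exists>k. continuous_on UNIV k \<and> k \<in> L2 \<and> bi_hoelder \<sigma> a \<rho> b (5 * L) k \<and>
    (\<forall>x. norm (k x - highpass (real (Suc m)) (highpass (real (Suc m)) f) x) \<le> 2 * L / real (Suc m) * norm x)" for m
    using bi_hoelder_approx[OF f ab, of "real (Suc m)"] by (metis One_nat_def Suc_le_mono le0 of_nat_1 of_nat_mono)
  then obtain fs where fs: "\<And>m. continuous_on UNIV (fs m)" "\<And>m. fs m \<in> L2" "\<And>m. bi_hoelder \<sigma> a \<rho> b (5 * L) (fs m)"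
    "\<And>m x. norm (fs m x - highpass (real (Suc m)) (highpass (real (Suc m)) f) x) \<le> 2 * L / real (Suc m) * norm x" by metis
  define G where "G = (\<lambda>m x. f x - highpass (real (Suc m)) (highpass (real (Suc m)) f) x)"
  define e where "e = (\<lambda>m. 12 * tent_const TYPE('v) * L * real (Suc m) powr (a - 1))"
  have e0: "0 \<le> e m" for m using tent_const_ge[where 'v = 'v] L by (simp add: e_def)
  have G_le: "norm ((G m x - G m 0) - (\<Sum>b\<in>Basis. of_real (x \<bullet> b) * (G m b - G m 0)))
      \<le> hyers_const TYPE('v) * e m * (1 + norm x) ^ 4" for m x
  proof (rule near_additive[OF _ e0])
    show "continuous_on UNIV (\<lambda>x. G m x - G m 0)" unfolding G_def by (intro continuous_intros f(1) continuous_highpass) auto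
    fix x y
    have Gm: "G m = (\<lambda>x. f x - highpass (real (Suc m)) (highpass (real (Suc m)) f) x)" unfolding G_def ..
    \<comment> \<open>The second difference at 0 is exactly the additivity defect of G m - G m 0,
      which links the low-frequency estimate to \<open>near_additive\<close>.\<close>
    have "diff_op (- x) (diff_op (- y) (G m)) 0 = G m (x + y) - G m 0 - (G m x - G m 0) - (G m y - G m 0)" by (simp add: diff_op_def)
    then show "norm (G m (x + y) - G m 0 - (G m x - G m 0) - (G m y - G m 0)) \<le> e m * ((1 + norm x)\<^sup>2 * (1 + norm y)\<^sup>2)"
      using lowpass_near_additive[OF f ab, of "real (Suc m)" "- x" "- y" 0, folded Gm] unfolding e_def norm_minus_cancel by simp
  qed simp
  have "lim_mod_poly fs f"
  proof (rule lim_mod_polyI[where a = "\<lambda>m. G m 0" and w = "\<lambda>m b. G m b - G m 0" and N = 4])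
    show "poly_bounded f" using bi_hoelder_poly_bounded[OF f(2,1) ab] .
    let ?\<eta> = "\<lambda>m. 2 * L * inverse (real (Suc m)) + hyers_const TYPE('v) * (12 * tent_const TYPE('v) * L) * real (Suc m) powr (a - 1)"
    have "(\<lambda>m. real (Suc m) powr (a - 1)) \<longlonglongrightarrow> 0"
      using ab by (intro tendsto_neg_powr filterlim_compose[OF filterlim_real_sequentially] filterlim_Suc) auto
    then show "?\<eta> \<longlonglongrightarrow> 0" using LIMSEQ_inverse_real_of_nat by (intro tendsto_add_zero tendsto_mult_right_zero)
    fix m x
    let ?h = "highpass (real (Suc m)) (highpass (real (Suc m)) f) x"
    have "fs m x - f x + (G m 0 + (\<Sum>b\<in>Basis. of_real (x \<bullet> b) * (G m b - G m 0)))
        = (fs m x - ?h) - ((G m x - G m 0) - (\<Sum>b\<in>Basis. of_real (x \<bullet> b) * (G m b - G m 0)))" by (simp add: G_def)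
    also have "norm ... \<le> 2 * L / real (Suc m) * norm x + hyers_const TYPE('v) * e m * (1 + norm x) ^ 4"
      using norm_triangle_ineq4 add_mono[OF fs(4)[of m x] G_le[of m x]] order_trans by blast
    also have "... \<le> 2 * L / real (Suc m) * (1 + norm x) ^ 4 + hyers_const TYPE('v) * e m * (1 + norm x) ^ 4"
    proof -
      have "norm x \<le> (1 + norm x) ^ 4" using self_le_power[of "1 + norm x" 4] norm_ge_zero[of x] by linarith
      then show ?thesis using L by (intro add_right_mono mult_left_mono) auto
    qed
    also have "... = ?\<eta> m * (1 + norm x) ^ 4" by (simp add: e_def divide_inverse algebra_simps)
    finally show "norm (fs m x - f x + (G m 0 + (\<Sum>b\<in>Basis. of_real (x \<bullet> b) * (G m b - G m 0)))) \<le> ?\<eta> m * (1 + norm x) ^ 4" .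
  qed (use f fs in auto)
  with fs show ?thesis by blast
qed

end

section \<open>The composite seminorm and boundedness on the composite spaces\<close>

definition com_norm ::
  "('v::euclidean_space \<Rightarrow> real) \<Rightarrow> real \<Rightarrow> ('v \<Rightarrow> real) \<Rightarrow> real \<Rightarrow> ('v \<Rightarrow> complex) \<Rightarrow> ennreal" where
  "com_norm \<sigma> a \<rho> b f = (SUP u\<in>-{0}. SUP v\<in>-{0}.
     sup_norm (diff_op u (diff_op v f)) / ennreal (\<sigma> u powr a * \<rho> v powr b))"

text \<open>The boundedness theorem puts the length adapted to the kernel second, as in case (A); in
  case (B) that is the isotropic length, which \<open>lip_norm_com\<close> has first.\<close>

lemma com_norm_commute: "com_norm \<sigma> a \<rho> b = com_norm \<rho> b \<sigma> a"
proof
  fix f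
  have "com_norm \<sigma> a \<rho> b f = (SUP v\<in>-{0}. SUP u\<in>-{0}.
     sup_norm (diff_op u (diff_op v f)) / ennreal (\<sigma> u powr a * \<rho> v powr b))" unfolding com_norm_def by (rule SUP_commute)
  also have "... = com_norm \<rho> b \<sigma> a f" unfolding com_norm_def by (intro SUP_cong refl) (simp add: diff_op_commute mult.commute)
  finally show "com_norm \<sigma> a \<rho> b f = com_norm \<rho> b \<sigma> a f" .
qed

lemma (in two_lengths) com_norm_le_iff:
  assumes L: "0 \<le> L"
  shows "com_norm \<sigma> a \<rho> b f \<le> ennreal L \<longleftrightarrow> bi_hoelder \<sigma> a \<rho> b L f"
proof -
  have "com_norm \<sigma> a \<rho> b f \<le> ennreal L \<longleftrightarrow> (\<forall>u\<in>-{0}. \<forall>v\<in>-{0}. \<forall>x. norm (diff_op u (diff_op v f) x) \<le> L * (\<sigma> u powr a * \<rho> v powr b))"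
    unfolding com_norm_def SUP_le_iff
    by (intro ball_cong refl) (simp add: ennreal_divide_le_iff[OF _ L] sup_norm_le_iff L s.eq_0_iff r.eq_0_iff)
  also have "... \<longleftrightarrow> bi_hoelder \<sigma> a \<rho> b L f" unfolding bi_hoelder_def
  proof (intro iffI allI)
    fix x u v assume *: "\<forall>u\<in>-{0}. \<forall>v\<in>-{0}. \<forall>x. norm (diff_op u (diff_op v f) x) \<le> L * (\<sigma> u powr a * \<rho> v powr b)"
    show "norm (diff_op u (diff_op v f) x) \<le> L * (\<sigma> u powr a * \<rho> v powr b)"
    proof (cases "u = 0 \<or> v = 0")
      case True
      then have "diff_op u (diff_op v f) x = 0" by (auto simp: diff_op_def)
      then show ?thesis using L by simp
    qed (use * in auto)
  qed auto
  finally show ?thesis .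
qed

theorem (in cz_kernel) bounded_on_com_norm:
  assumes \<sigma>: "length_function \<sigma>" and ab: "0 < a" "a < 1" "0 < b" "b < 1"
  shows "bounded_on_lip (com_norm \<sigma> a \<rho> b) (pv_op \<rho> K)"
proof -
  interpret two_lengths \<sigma> \<rho> using \<sigma> length_function_axioms by (simp add: two_lengths_def)
  obtain C where C: "0 \<le> C" "\<And>L f. continuous_on UNIV f \<Longrightarrow> bi_hoelder \<sigma> a \<rho> b L f \<Longrightarrow>
    bi_hoelder \<sigma> a \<rho> b (C * L) (cz_op K c f)" using cz_op_bi_hoelder[OF \<sigma> ab] by metis
  show ?thesis
  proof (rule bounded_on_lipI[OF ab(3)])
    fix f assume f: "f \<in> lip_space (com_norm \<sigma> a \<rho> b)"
    then have cont: "continuous_on UNIV f" by (simp add: lip_space_def)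
    have "com_norm \<sigma> a \<rho> b f < top" using f by (simp add: lip_space_def)
    then obtain L where L: "0 \<le> L" "com_norm \<sigma> a \<rho> b f = ennreal L" by (cases "com_norm \<sigma> a \<rho> b f") auto
    then have h: "bi_hoelder \<sigma> a \<rho> b L f" using com_norm_le_iff[OF L(1), of a b f] by simp
    show t: "tame R b f" using h cont ab R_pos by (rule bi_hoelder_tame)
    have "com_norm \<sigma> a \<rho> b (cz_op K c f) \<le> ennreal (C * L)" using C(2)[OF cont h] C(1) L by (subst com_norm_le_iff) auto
    then show "continuous_on UNIV (cz_op K c f) \<and> com_norm \<sigma> a \<rho> b (cz_op K c f) \<le> ennreal C * com_norm \<sigma> a \<rho> b f"
      using tame_continuous_cz_op[OF t ab(3)] C(1) L by (simp add: ennreal_mult')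
    obtain fs where fs: "\<And>m. continuous_on UNIV (fs m)" "\<And>m. fs m \<in> L2"
        "\<And>m. bi_hoelder \<sigma> a \<rho> b (5 * L) (fs m)" "lim_mod_poly fs f" using bi_hoelder_approx_sequence[OF cont h ab] by blast
    have "com_norm \<sigma> a \<rho> b (fs m) \<le> ennreal (5 * L)" for m using fs(3)[of m] L by (subst com_norm_le_iff) auto
    moreover from this have "com_norm \<sigma> a \<rho> b (fs m) < \<infinity>" for m by (rule le_less_trans) simp
    ultimately have "com_norm \<sigma> a \<rho> b (fs m) \<le> ennreal 5 * com_norm \<sigma> a \<rho> b f" "com_norm \<sigma> a \<rho> b (fs m) < \<infinity>" for m
      using L by (auto simp: ennreal_mult')
    with fs show "\<exists>fs. lip_approx (com_norm \<sigma> a \<rho> b) 5 f fs" unfolding lip_approx_def lip_space_def by blast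
  qed
qed

section \<open>Products of homogeneous functions\<close>

lemma smooth_on_has_derivative:
  assumes "smooth_on S F" "x \<in> S"
  shows "(F has_derivative (\<lambda>v. iter_deriv [v] F x)) (at x)"
proof -
  have "iter_deriv [] F differentiable (at x)" using assms unfolding smooth_on_def by blast
  then show ?thesis by (simp add: iter_deriv.simps(2) frechet_derivative_works[symmetric])
qed

lemma smooth_on_continuous_on:
  assumes "smooth_on S F" "T \<subseteq> S" shows "continuous_on T (iter_deriv vs F)"
  using assms unfolding smooth_on_def by (meson continuous_at_imp_continuous_on differentiable_imp_continuous_within subsetD)

lemma smooth_on_measurable:
  assumes "smooth_on (-{0}) F" shows "F \<in> borel_measurable borel"
proof -
  have "continuous_on (-{0}) F" using smooth_on_continuous_on[OF assms order_refl, of "[]"] by simp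
  then have "(\<lambda>x. indicator (-{0}) x *\<^sub>R F x) \<in> borel_measurable borel" by (intro borel_measurable_continuous_on_indicator) auto
  then have "(\<lambda>x. indicator (-{0}) x *\<^sub>R F x + indicator {0} x *\<^sub>R F 0) \<in> borel_measurable borel" by (rule borel_measurable_add) measurable
  also have "(\<lambda>x. indicator (-{0}) x *\<^sub>R F x + indicator {0} x *\<^sub>R F 0) = F" by (auto simp: indicator_def)
  finally show ?thesis .
qed

lemma smooth_on_bounded_compact:
  assumes "smooth_on (-{0}) F" "compact S" "0 \<notin> S"
  obtains B where "0 \<le> B" "\<And>x. x \<in> S \<Longrightarrow> norm (iter_deriv vs F x) \<le> B"
proof -
  have "compact (iter_deriv vs F ` S)" using assms by (intro compact_continuous_image smooth_on_continuous_on) auto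
  then obtain B where "\<forall>z\<in>iter_deriv vs F ` S. norm z \<le> B" using compact_imp_bounded bounded_iff by metis
  then show ?thesis by (intro that[of "max 0 B"]) force+
qed

lemma smooth_on_lipschitz_compact:
  fixes F :: "'v::euclidean_space \<Rightarrow> complex"
  assumes F: "smooth_on (-{0}) F" and S: "compact S" "0 \<notin> S"
  obtains B where "0 \<le> B" "\<And>x y. closed_segment x y \<subseteq> S \<Longrightarrow> norm (F x - F y) \<le> B * norm (x - y)"
proof -
  have "\<exists>B. 0 \<le> B \<and> (\<forall>x\<in>S. norm (iter_deriv [b] F x) \<le> B)" for b using smooth_on_bounded_compact[OF F S] by metis
  then obtain D where D: "\<And>b. 0 \<le> D b" "\<And>b x. x \<in> S \<Longrightarrow> norm (iter_deriv [b] F x) \<le> D b" by metis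
  have "norm (F x - F y) \<le> (\<Sum>b\<in>Basis. D b) * norm (x - y)" if xy: "closed_segment x y \<subseteq> S" for x y
  proof (rule differentiable_bound[of "closed_segment x y" F "\<lambda>z v. iter_deriv [v] F z"])
    fix z assume "z \<in> closed_segment x y"
    then have z: "z \<in> S" "z \<in> - {0}" using xy S(2) by auto
    note d = smooth_on_has_derivative[OF F z(2)]
    show "(F has_derivative (\<lambda>v. iter_deriv [v] F z)) (at z within closed_segment x y)" using d by (rule has_derivative_at_withinI)
    have "onorm (\<lambda>v. iter_deriv [v] F z) \<le> (\<Sum>b\<in>Basis. norm (iter_deriv [b] F z))"
      using d by (intro onorm_componentwise) (rule has_derivative_bounded_linear)
    also have "... \<le> (\<Sum>b\<in>Basis. D b)" using z by (intro sum_mono D)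
    finally show "onorm (\<lambda>v. iter_deriv [v] F z) \<le> (\<Sum>b\<in>Basis. D b)" .
  qed auto
  moreover have "0 \<le> (\<Sum>b\<in>Basis. D b)" using D(1) by (intro sum_nonneg)
  ultimately show ?thesis using that by blast
qed

section \<open>Size and regularity of homogeneous functions\<close>

context length_function begin

lemma segment_bounds:
  assumes "z \<in> closed_segment (y - u) y"
  shows "\<rho> y - \<rho> u \<le> \<rho> z" "\<rho> z \<le> \<rho> y + \<rho> u"
proof -
  obtain t where t: "0 \<le> t" "t \<le> 1" "z = (1 - t) *\<^sub>R (y - u) + t *\<^sub>R y" using assms unfolding closed_segment_def by blast
  then have z: "z = y - (1 - t) *\<^sub>R u" by (simp add: algebra_simps)
  have "\<rho> ((1 - t) *\<^sub>R u) \<le> \<rho> u" using t by (intro star) auto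
  then show "\<rho> y - \<rho> u \<le> \<rho> z" "\<rho> z \<le> \<rho> y + \<rho> u"
    unfolding z using diff_ge[of y "(1 - t) *\<^sub>R u"] triangle_diff[of y "(1 - t) *\<^sub>R u"] by linarith+
qed

lemma compact_annulus: "compact {y. r \<le> \<rho> y \<and> \<rho> y \<le> s}"
proof -
  have "closed {y. r \<le> \<rho> y}" using continuous by (intro closed_Collect_le) auto
  then have "compact ({y. \<rho> y \<le> s} \<inter> {y. r \<le> \<rho> y})" using compact_cball by (rule compact_Int_closed[rotated])
  also have "{y. \<rho> y \<le> s} \<inter> {y. r \<le> \<rho> y} = {y. r \<le> \<rho> y \<and> \<rho> y \<le> s}" by auto
  finally show ?thesis .
qed

end

locale homogeneous_length = length_function \<rho> for \<rho> :: "'v::euclidean_space \<Rightarrow> real" +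
  fixes dil :: "real \<Rightarrow> 'v \<Rightarrow> 'v"
  assumes dil_scale: "0 < t \<Longrightarrow> \<rho> (dil t x) = t * \<rho> x"
    and dil_diff: "dil t (x - y) = dil t x - dil t y"
begin

definition kernel_class :: "real \<Rightarrow> ('v \<Rightarrow> complex) \<Rightarrow> bool" where
  "kernel_class p F \<longleftrightarrow> smooth_on (-{0}) F \<and> (\<forall>t>0. \<forall>x. x \<noteq> 0 \<longrightarrow> (t powr p) *\<^sub>R F (dil t x) = F x)"

text \<open>Rescaling to \<rho> x = 1, a compact set avoiding the origin, where smoothness gives a
  bound.\<close>

lemma kernel_class_bound:
  assumes F: "kernel_class p F"
  obtains C where "0 \<le> C" "\<And>x. x \<noteq> 0 \<Longrightarrow> norm (F x) \<le> C * \<rho> x powr (- p)"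
proof -
  obtain C where C: "0 \<le> C" "\<And>x. x \<in> {y. 1 \<le> \<rho> y \<and> \<rho> y \<le> 1} \<Longrightarrow> norm (iter_deriv [] F x) \<le> C"
    using smooth_on_bounded_compact[of F "{y. 1 \<le> \<rho> y \<and> \<rho> y \<le> 1}" "[]"] F compact_annulus by (auto simp: kernel_class_def)
  have "norm (F x) \<le> C * \<rho> x powr (- p)" if x: "x \<noteq> 0" for x
  proof -
    have r: "0 < \<rho> x" using x by (simp add: pos_iff)
    have "F x = ((1 / \<rho> x) powr p) *\<^sub>R F (dil (1 / \<rho> x) x)" using F x r by (simp add: kernel_class_def)
    then have "norm (F x) = \<rho> x powr (- p) * norm (F (dil (1 / \<rho> x) x))" using r by (simp add: powr_divide powr_minus_divide)
    also have "... \<le> \<rho> x powr (- p) * C" using C(2)[of "dil (1 / \<rho> x) x"] r by (intro mult_left_mono) (simp_all add: dil_scale)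
    finally show ?thesis by (simp add: mult.commute)
  qed
  with C(1) show ?thesis using that by blast
qed

text \<open>After rescaling to \<rho> x = 1 one has \<rho> u \<le> 1/2, the segment from x - u to x
  stays in the compact annulus between the radii 1/2 and 2, and |u| \<le> 2 \<rho> u; a Lipschitz
  bound on that annulus scales back.\<close>

lemma kernel_class_diff:
  assumes F: "kernel_class p F"
  obtains C where "0 \<le> C" "\<And>x u. x \<noteq> 0 \<Longrightarrow> 2 * \<rho> u \<le> \<rho> x \<Longrightarrow> norm (F (x - u) - F x) \<le> C * (\<rho> u / \<rho> x) * \<rho> x powr (- p)"
proof -
  obtain B where B: "0 \<le> B" "\<And>x y. closed_segment x y \<subseteq> {y. 1 / 2 \<le> \<rho> y \<and> \<rho> y \<le> 2} \<Longrightarrow> norm (F x - F y) \<le> B * norm (x - y)"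
  proof -
    have "smooth_on (-{0}) F" "0 \<notin> {y. 1 / 2 \<le> \<rho> y \<and> \<rho> y \<le> 2}" using F by (auto simp: kernel_class_def)
    from smooth_on_lipschitz_compact[OF this(1) compact_annulus this(2)] show ?thesis using that by blast
  qed
  have "norm (F (x - u) - F x) \<le> 2 * B * (\<rho> u / \<rho> x) * \<rho> x powr (- p)" if x: "x \<noteq> 0" and u: "2 * \<rho> u \<le> \<rho> x" for x u
  proof -
    have r: "0 < \<rho> x" using x by (simp add: pos_iff)
    define t where "t = 1 / \<rho> x"
    have t: "0 < t" using r by (simp add: t_def)
    let ?x = "dil t x" and ?u = "dil t u"
    have sx: "\<rho> ?x = 1" "\<rho> ?u = \<rho> u / \<rho> x" "\<rho> ?u \<le> 1 / 2" using r t u by (simp_all add: dil_scale t_def field_simps)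
    have "x - u \<noteq> 0" using u r by auto
    then have "F (x - u) - F x = (t powr p) *\<^sub>R (F (?x - ?u) - F ?x)"
      using F x t by (simp add: kernel_class_def scaleR_diff_right flip: dil_diff)
    then have eq: "norm (F (x - u) - F x) = \<rho> x powr (- p) * norm (F (?x - ?u) - F ?x)"
      using r by (simp add: t_def powr_divide powr_minus_divide)
    have "closed_segment (?x - ?u) ?x \<subseteq> {y. 1 / 2 \<le> \<rho> y \<and> \<rho> y \<le> 2}"
    proof
      fix z assume "z \<in> closed_segment (?x - ?u) ?x"
      from segment_bounds[OF this] have "1 / 2 \<le> \<rho> z" "\<rho> z \<le> 2" using sx(1,3) by linarith+
      then show "z \<in> {y. 1 / 2 \<le> \<rho> y \<and> \<rho> y \<le> 2}" by simp
    qed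
    then have "norm (F (?x - ?u) - F ?x) \<le> B * norm ?u" using B(2)[of "?x - ?u" ?x] by simp
    also have "... \<le> B * ((1 + 1) * \<rho> ?u)" using norm_le_mult[of ?u 1] sx B(1) by (intro mult_left_mono) auto
    finally have "norm (F (?x - ?u) - F ?x) \<le> 2 * B * (\<rho> u / \<rho> x)" unfolding sx(2) by (simp only: mult_ac one_add_one)
    then have "\<rho> x powr (- p) * norm (F (?x - ?u) - F ?x) \<le> \<rho> x powr (- p) * (2 * B * (\<rho> u / \<rho> x))" by (rule mult_left_mono) simp
    then show ?thesis unfolding eq by (simp add: mult_ac)
  qed
  with B(1) show ?thesis using that[of "2 * B"] by simp
qed

lemma kernel_class_hoelder:
  assumes F: "kernel_class p F" and \<delta>: "0 < \<delta>" "\<delta> \<le> 1"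
  obtains C where "0 \<le> C" "\<And>x u. x \<noteq> 0 \<Longrightarrow> x - u \<noteq> 0 \<Longrightarrow>
    norm (F (x - u) - F x) \<le> C * \<rho> u powr \<delta> * (\<rho> x powr (- (p + \<delta>)) + \<rho> (x - u) powr (- (p + \<delta>)))"
proof -
  obtain C where C: "0 \<le> C" "\<And>x. x \<noteq> 0 \<Longrightarrow> norm (F x) \<le> C * \<rho> x powr (- p)" using kernel_class_bound[OF F] by metis
  obtain C' where C': "0 \<le> C'" "\<And>x u. x \<noteq> 0 \<Longrightarrow> 2 * \<rho> u \<le> \<rho> x \<Longrightarrow> norm (F (x - u) - F x) \<le> C' * (\<rho> u / \<rho> x) * \<rho> x powr (- p)"
    using kernel_class_diff[OF F] by metis
  have large: "norm (F x) \<le> 3 * C * \<rho> u powr \<delta> * \<rho> x powr (- (p + \<delta>))" if x: "x \<noteq> 0" "\<rho> x \<le> 3 * \<rho> u" for x u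
  proof -
    have "\<rho> x powr \<delta> \<le> (3 * \<rho> u) powr \<delta>" using x \<delta> by (intro powr_mono2) auto
    also have "... = 3 powr \<delta> * \<rho> u powr \<delta>" by (simp add: powr_mult)
    also have "... \<le> 3 powr 1 * \<rho> u powr \<delta>" using \<delta> by (intro mult_right_mono powr_mono) auto
    finally have 1: "\<rho> x powr \<delta> \<le> 3 * \<rho> u powr \<delta>" by simp
    have "\<rho> x powr (- p) = \<rho> x powr \<delta> * \<rho> x powr (- (p + \<delta>))" by (simp flip: powr_add)
    also have "... \<le> 3 * \<rho> u powr \<delta> * \<rho> x powr (- (p + \<delta>))" using 1 by (rule mult_right_mono) simp
    finally have "C * \<rho> x powr (- p) \<le> C * (3 * \<rho> u powr \<delta> * \<rho> x powr (- (p + \<delta>)))" using C(1) by (rule mult_left_mono)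
    with C(2)[OF x(1)] show ?thesis by (simp add: mult_ac)
  qed
  have "norm (F (x - u) - F x) \<le> (C' + 3 * C) * \<rho> u powr \<delta> * (\<rho> x powr (- (p + \<delta>)) + \<rho> (x - u) powr (- (p + \<delta>)))"
    if x: "x \<noteq> 0" "x - u \<noteq> 0" for x u
  proof (cases "2 * \<rho> u \<le> \<rho> x")
    case True
    have r: "0 < \<rho> x" using x by (simp add: pos_iff)
    have "(\<rho> u / \<rho> x) powr 1 \<le> (\<rho> u / \<rho> x) powr \<delta>" using True r \<delta> nonneg[of u] by (intro powr_mono') (auto simp: divide_le_eq)
    then have "\<rho> u / \<rho> x \<le> \<rho> u powr \<delta> / \<rho> x powr \<delta>" using r by (simp add: powr_divide)
    then have "C' * (\<rho> u / \<rho> x) * \<rho> x powr (- p) \<le> C' * (\<rho> u powr \<delta> / \<rho> x powr \<delta>) * \<rho> x powr (- p)"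
      using C'(1) by (intro mult_right_mono mult_left_mono) auto
    also have "... = C' * \<rho> u powr \<delta> * \<rho> x powr (- (p + \<delta>))"
    proof -
      have "\<rho> x powr (- (p + \<delta>)) = \<rho> x powr (- p) / \<rho> x powr \<delta>" using powr_diff[of "\<rho> x" "- p" \<delta>] by simp
      then show ?thesis by simp
    qed
    also have "... \<le> (C' + 3 * C) * \<rho> u powr \<delta> * (\<rho> x powr (- (p + \<delta>)) + \<rho> (x - u) powr (- (p + \<delta>)))"
      using C C' by (intro mult_mono mult_right_mono) auto
    finally show ?thesis using C'(2)[OF x(1) True] by linarith
  next
    case False
    then have "\<rho> x \<le> 3 * \<rho> u" "\<rho> (x - u) \<le> 3 * \<rho> u" using triangle_diff[of x u] nonneg[of u] by linarith+
    from large[OF x(1) this(1)] large[OF x(2) this(2)]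
    have "norm (F (x - u) - F x) \<le> 3 * C * \<rho> u powr \<delta> * \<rho> (x - u) powr (- (p + \<delta>)) + 3 * C * \<rho> u powr \<delta> * \<rho> x powr (- (p + \<delta>))"
      by (intro norm_triangle_le_diff add_mono)
    also have "... = 3 * C * \<rho> u powr \<delta> * (\<rho> x powr (- (p + \<delta>)) + \<rho> (x - u) powr (- (p + \<delta>)))" by (simp add: algebra_simps)
    also have "... \<le> (C' + 3 * C) * \<rho> u powr \<delta> * (\<rho> x powr (- (p + \<delta>)) + \<rho> (x - u) powr (- (p + \<delta>)))"
      using C C' by (intro mult_right_mono) auto
    finally show ?thesis .
  qed
  then show ?thesis using that[of "C' + 3 * C"] C(1) C'(1) by simp
qed

end

text \<open>Only the factor that is homogeneous for the other dilations is sensitive: near the origin it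
  is replaced by its values on the range of a projection \<open>\<pi>\<close>. In case (A) \<open>\<rho> = |\<cdot>|\<^sub>h\<close>, \<open>\<sigma> = |\<cdot>|\<^sub>e\<close>,
  \<open>\<pi>(x', x\<^sub>n) = (x', 0)\<close>, \<open>\<theta> = 1\<close>; in case (B) \<open>\<rho> = |\<cdot>|\<^sub>e\<close>, \<open>\<sigma> = |\<cdot>|\<^sub>h\<close>, \<open>\<pi>(x', x\<^sub>n) = (0, x\<^sub>n)\<close>, \<open>\<theta> = 1/2\<close>.\<close>

locale product_kernel = two_lengths \<sigma> \<rho> + h: homogeneous_length \<rho> dil + g: homogeneous_length \<sigma> dil'
  for \<sigma> \<rho> :: "'v::euclidean_space \<Rightarrow> real" and dil dil' +
  fixes \<pi> :: "'v \<Rightarrow> 'v" and \<theta> D s0 p q r0 R :: real and F G K :: "'v \<Rightarrow> complex"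
  assumes \<theta>: "0 < \<theta>" "\<theta> \<le> 1"
    and compare: "\<rho> u \<le> 1 \<Longrightarrow> \<sigma> u \<le> 2 * \<rho> u powr \<theta>"
    and \<pi>_measurable [measurable]: "\<pi> \<in> borel_measurable borel"
    and \<pi>_nonzero: "AE x in lborel. \<pi> x \<noteq> 0"
    and \<pi>_close: "\<sigma> (x - \<pi> x) \<le> \<rho> x powr (2 * \<theta>)"
    and \<pi>_le: "\<sigma> (\<pi> x) \<le> \<sigma> x"
    and power_integrals: "0 \<le> s \<Longrightarrow> s < s0 \<Longrightarrow>
      \<exists>C. \<forall>r>0. (\<integral>\<^sup>+x\<in>{x. \<rho> x < r}. ennreal (\<sigma> (\<pi> x) powr (- s)) \<partial>lborel) \<le> ennreal (C * r powr (D - \<theta> * s))"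
    and exponents: "0 < s0" "q < s0" "p + \<theta> * q = D"
    and F: "h.kernel_class p F" and G: "g.kernel_class q G"
    and K_smooth: "smooth_on (-{0}) K" and K_support: "R \<le> \<rho> x \<Longrightarrow> K x = 0"
    and r0: "0 < r0" and K_eq: "0 < \<rho> x \<Longrightarrow> \<rho> x < r0 \<Longrightarrow> K x = F x * G x"
    and mean_zero: "0 < a \<Longrightarrow> a < b \<Longrightarrow>
      (LINT x|lborel. indicator {x. a \<le> \<rho> x \<and> \<rho> x < b} x *\<^sub>R (F x * G (\<pi> x))) = 0"
begin

text \<open>For s \<ge> 0 the weight at x is dominated almost everywhere by the one at \<pi> x. A
  negative s occurs as well, since the degree q may be negative; then the power is bounded through
  \<open>compare\<close>, and the volume of the ball, which is the case s = 0 of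
  \<open>power_integrals\<close>, finishes. The restriction r \<le> 1 comes from
  \<open>compare\<close>.\<close>

lemma \<sigma>_integrals:
  assumes s: "s < s0"
  obtains C where "0 \<le> C"
    "\<And>r. 0 < r \<Longrightarrow> r \<le> 1 \<Longrightarrow> (\<integral>\<^sup>+x\<in>{x. \<rho> x < r}. ennreal (\<sigma> x powr (- s)) \<partial>lborel) \<le> ennreal (C * r powr (D - \<theta> * s))"
    "\<And>r. 0 < r \<Longrightarrow> r \<le> 1 \<Longrightarrow> (\<integral>\<^sup>+x\<in>{x. \<rho> x < r}. ennreal (\<sigma> (\<pi> x) powr (- s)) \<partial>lborel) \<le> ennreal (C * r powr (D - \<theta> * s))"
proof (cases "0 \<le> s")
  case True
  obtain C where C: "\<And>r. 0 < r \<Longrightarrow> (\<integral>\<^sup>+x\<in>{x. \<rho> x < r}. ennreal (\<sigma> (\<pi> x) powr (- s)) \<partial>lborel) \<le> ennreal (C * r powr (D - \<theta> * s))"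
    using power_integrals[OF True s] by blast
  have C': "(\<integral>\<^sup>+x\<in>{x. \<rho> x < r}. ennreal (\<sigma> (\<pi> x) powr (- s)) \<partial>lborel) \<le> ennreal (max 0 C * r powr (D - \<theta> * s))" if "0 < r" for r
    by (rule order_trans[OF C[OF that]]) (intro ennreal_leI mult_right_mono, auto)
  have "(\<integral>\<^sup>+x\<in>{x. \<rho> x < r}. ennreal (\<sigma> x powr (- s)) \<partial>lborel) \<le> ennreal (max 0 C * r powr (D - \<theta> * s))" if "0 < r" for r
  proof (rule order_trans[OF _ C'[OF that]], rule nn_integral_mono_AE)
    show "AE x in lborel. ennreal (\<sigma> x powr (- s)) * indicator {x. \<rho> x < r} x \<le> ennreal (\<sigma> (\<pi> x) powr (- s)) * indicator {x. \<rho> x < r} x"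
      using \<pi>_nonzero
    proof eventually_elim
      case (elim x)
      then have "\<sigma> x powr (- s) \<le> \<sigma> (\<pi> x) powr (- s)" using True \<pi>_le[of x] by (intro powr_mono2') (auto simp: s.pos_iff)
      then show ?case by (intro mult_right_mono ennreal_leI) auto
    qed
  qed
  with C' show ?thesis by (intro that[of "max 0 C"]) auto
next
  case False
  obtain C where C: "\<And>r. 0 < r \<Longrightarrow> (\<integral>\<^sup>+x\<in>{x. \<rho> x < r}. ennreal (\<sigma> (\<pi> x) powr (- 0)) \<partial>lborel) \<le> ennreal (C * r powr (D - \<theta> * 0))"
    using power_integrals[of 0] exponents by auto
  have vol: "emeasure lborel {x. \<rho> x < r} \<le> ennreal (max 0 C * r powr D)" if "0 < r" for r
  proof -
    have "emeasure lborel {x. \<rho> x < r} = (\<integral>\<^sup>+x. indicator {x. \<rho> x < r} x \<partial>lborel)" by simp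
    also have "... = (\<integral>\<^sup>+x\<in>{x. \<rho> x < r}. ennreal (\<sigma> (\<pi> x) powr (- 0)) \<partial>lborel)"
      using \<pi>_nonzero by (intro nn_integral_cong_AE) (auto simp: indicator_def s.eq_0_iff)
    also have "... \<le> ennreal (C * r powr D)" using C[OF that] by simp
    also have "... \<le> ennreal (max 0 C * r powr D)" by (intro ennreal_leI mult_right_mono) auto
    finally show ?thesis .
  qed
  have main: "(\<integral>\<^sup>+x\<in>{x. \<rho> x < r}. ennreal (f x powr (- s)) \<partial>lborel) \<le> ennreal (2 powr (- s) * max 0 C * r powr (D - \<theta> * s))"
    if r: "0 < r" "r \<le> 1" and f: "\<And>x. 0 \<le> f x" "\<And>x. f x \<le> \<sigma> x" for r and f :: "'v \<Rightarrow> real"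
  proof -
    have "(\<integral>\<^sup>+x\<in>{x. \<rho> x < r}. ennreal (f x powr (- s)) \<partial>lborel)
        \<le> (\<integral>\<^sup>+x. ennreal ((2 * r powr \<theta>) powr (- s)) * indicator {x. \<rho> x < r} x \<partial>lborel)"
    proof (rule nn_integral_mono)
      fix x
      have "f x powr (- s) \<le> (2 * r powr \<theta>) powr (- s)" if "\<rho> x < r"
      proof -
        have "\<rho> x powr \<theta> \<le> r powr \<theta>" using that \<theta> by (intro powr_mono2) auto
        then have "f x \<le> 2 * r powr \<theta>" using compare[of x] f(2)[of x] that r(2) by linarith
        then show ?thesis using False f(1) by (intro powr_mono2) auto
      qed
      then show "ennreal (f x powr (- s)) * indicator {x. \<rho> x < r} x \<le> ennreal ((2 * r powr \<theta>) powr (- s)) * indicator {x. \<rho> x < r} x"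
        by (auto simp: indicator_def intro!: ennreal_leI)
    qed
    also have "... = ennreal ((2 * r powr \<theta>) powr (- s)) * emeasure lborel {x. \<rho> x < r}" by (intro nn_integral_cmult_indicator) simp
    also have "... \<le> ennreal ((2 * r powr \<theta>) powr (- s)) * ennreal (max 0 C * r powr D)" using vol[OF r(1)] by (rule mult_left_mono) simp
    also have "... = ennreal (2 powr (- s) * max 0 C * r powr (D - \<theta> * s))"
    proof -
      have "(2 * r powr \<theta>) powr (- s) * (max 0 C * r powr D) = 2 powr (- s) * max 0 C * r powr (D - \<theta> * s)"
        using r by (simp add: powr_mult powr_powr flip: powr_add)
      then show ?thesis by (simp flip: ennreal_mult')
    qed
    finally show ?thesis .
  qed
  show ?thesis by (rule that[of "2 powr (- s) * max 0 C"]) (use main[of _ \<sigma>] main[of _ "\<lambda>x. \<sigma> (\<pi> x)"] \<pi>_le in auto)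
qed

end

lemma set_nn_integral_sum_le:
  fixes f :: "'a \<Rightarrow> complex" and w1 w2 :: "'a \<Rightarrow> real"
  assumes [measurable]: "w1 \<in> borel_measurable M" "w2 \<in> borel_measurable M" "S \<in> sets M"
    and le: "AE y in M. y \<in> S \<longrightarrow> norm (f y) \<le> c * (w1 y + w2 y)"
    and pos: "0 \<le> c" "\<And>y. 0 \<le> w1 y" "\<And>y. 0 \<le> w2 y" "0 \<le> B1" "0 \<le> B2"
    and B: "(\<integral>\<^sup>+y\<in>S. ennreal (w1 y) \<partial>M) \<le> ennreal B1" "(\<integral>\<^sup>+y\<in>S. ennreal (w2 y) \<partial>M) \<le> ennreal B2"
  shows "(\<integral>\<^sup>+y\<in>S. ennreal (norm (f y)) \<partial>M) \<le> ennreal (c * (B1 + B2))"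
proof -
  have "(\<integral>\<^sup>+y\<in>S. ennreal (norm (f y)) \<partial>M) \<le> (\<integral>\<^sup>+y. ennreal c * (ennreal (w1 y) * indicator S y + ennreal (w2 y) * indicator S y) \<partial>M)"
  proof (rule nn_integral_mono_AE)
    show "AE y in M. ennreal (norm (f y)) * indicator S y \<le> ennreal c * (ennreal (w1 y) * indicator S y + ennreal (w2 y) * indicator S y)"
      using le
    proof eventually_elim
      case (elim y)
      then show ?case using pos by (auto simp: indicator_def ennreal_mult'[symmetric] simp flip: ennreal_plus intro!: ennreal_leI)
    qed
  qed
  also have "... = ennreal c * ((\<integral>\<^sup>+y\<in>S. ennreal (w1 y) \<partial>M) + (\<integral>\<^sup>+y\<in>S. ennreal (w2 y) \<partial>M))" by (simp add: nn_integral_cmult nn_integral_add)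
  also have "... \<le> ennreal c * (ennreal B1 + ennreal B2)" using B by (intro mult_left_mono add_mono) auto
  also have "... = ennreal (c * (B1 + B2))" using pos by (simp add: ennreal_mult')
  finally show ?thesis .
qed

lemma annulus_powr:
  assumes "0 < r" "r \<le> t" "t < 2 * r" shows "t powr s \<le> 2 powr \<bar>s\<bar> * r powr (s::real)"
proof (cases "0 \<le> s")
  case True
  then have "t powr s \<le> (2 * r) powr s" using assms by (intro powr_mono2) auto
  with True assms show ?thesis by (simp add: powr_mult)
next
  case False
  then have "t powr s \<le> r powr s" using assms by (intro powr_mono2') auto
  also have "... \<le> 2 powr \<bar>s\<bar> * r powr s" using mult_right_mono[of 1 "2 powr \<bar>s\<bar>" "r powr s"] by (simp add: ge_one_powr_ge_zero)
  finally show ?thesis .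
qed

section \<open>Kernel conditions near the origin\<close>

context product_kernel begin

abbreviation annulus :: "real \<Rightarrow> 'v set" where
  "annulus r \<equiv> {y. r \<le> \<rho> y \<and> \<rho> y < 2 * r}"

text \<open>If 2 \<rho> u \<le> r, the annulus shifted by u lies in the ball of radius 3r; this is
  the origin of the conditions 3r \<le> 1 and, later, 3r \<le> r0.\<close>

lemma annulus_integrals:
  assumes s: "s < s0"
  obtains J where "0 \<le> J"
    "\<And>r u. 0 < r \<Longrightarrow> 3 * r \<le> 1 \<Longrightarrow> 2 * \<rho> u \<le> r \<Longrightarrow>
      (\<integral>\<^sup>+y\<in>annulus r. ennreal (\<sigma> (y - u) powr (- s)) \<partial>lborel) \<le> ennreal (J * r powr (D - \<theta> * s))"
    "\<And>r. 0 < r \<Longrightarrow> 3 * r \<le> 1 \<Longrightarrow>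
      (\<integral>\<^sup>+y\<in>annulus r. ennreal (\<sigma> (\<pi> y) powr (- s)) \<partial>lborel) \<le> ennreal (J * r powr (D - \<theta> * s))"
proof -
  obtain C where C: "0 \<le> C"
    "\<And>r. 0 < r \<Longrightarrow> r \<le> 1 \<Longrightarrow> (\<integral>\<^sup>+x\<in>{x. \<rho> x < r}. ennreal (\<sigma> x powr (- s)) \<partial>lborel) \<le> ennreal (C * r powr (D - \<theta> * s))"
    "\<And>r. 0 < r \<Longrightarrow> r \<le> 1 \<Longrightarrow> (\<integral>\<^sup>+x\<in>{x. \<rho> x < r}. ennreal (\<sigma> (\<pi> x) powr (- s)) \<partial>lborel) \<le> ennreal (C * r powr (D - \<theta> * s))"
    by (rule \<sigma>_integrals[OF s that])
  define J where "J = C * 3 powr (D - \<theta> * s)"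
  have J: "ennreal (C * (3 * r) powr (D - \<theta> * s)) = ennreal (J * r powr (D - \<theta> * s))" if "0 < r" for r
    using that by (simp add: J_def powr_mult mult.assoc)
  show ?thesis
  proof (rule that)
    show "0 \<le> J" using C by (simp add: J_def)
    fix r :: real assume r: "0 < r" "3 * r \<le> 1"
    have "(\<integral>\<^sup>+y\<in>annulus r. ennreal (\<sigma> (\<pi> y) powr (- s)) \<partial>lborel) \<le> (\<integral>\<^sup>+y\<in>{x. \<rho> x < 3 * r}. ennreal (\<sigma> (\<pi> y) powr (- s)) \<partial>lborel)"
      using r by (intro nn_integral_mono) (auto simp: indicator_def)
    also have "... \<le> ennreal (J * r powr (D - \<theta> * s))" using C(3)[of "3 * r"] r J[OF r(1)] by simp
    finally show "(\<integral>\<^sup>+y\<in>annulus r. ennreal (\<sigma> (\<pi> y) powr (- s)) \<partial>lborel) \<le> ennreal (J * r powr (D - \<theta> * s))" .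
    fix u assume u: "2 * \<rho> u \<le> r"
    have "(\<integral>\<^sup>+y\<in>annulus r. ennreal (\<sigma> (y - u) powr (- s)) \<partial>lborel)
        \<le> (\<integral>\<^sup>+y. ennreal (\<sigma> (y - u) powr (- s)) * indicator {x. \<rho> x < 3 * r} (y - u) \<partial>lborel)"
    proof (rule nn_integral_mono)
      fix y
      show "ennreal (\<sigma> (y - u) powr (- s)) * indicator (annulus r) y \<le> ennreal (\<sigma> (y - u) powr (- s)) * indicator {x. \<rho> x < 3 * r} (y - u)"
        using r.triangle_diff[of y u] u r by (auto simp: indicator_def)
    qed
    also have "... = (\<integral>\<^sup>+y. ennreal (\<sigma> y powr (- s)) * indicator {x. \<rho> x < 3 * r} y \<partial>lborel)"
      by (rule nn_integral_lborel_shift[of "\<lambda>y. ennreal (\<sigma> y powr (- s)) * indicator {x. \<rho> x < 3 * r} y"]) measurable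
    also have "... \<le> ennreal (J * r powr (D - \<theta> * s))" using C(2)[of "3 * r"] r J[OF r(1)] by simp
    finally show "(\<integral>\<^sup>+y\<in>annulus r. ennreal (\<sigma> (y - u) powr (- s)) \<partial>lborel) \<le> ennreal (J * r powr (D - \<theta> * s))" .
  qed
qed

lemma FG_measurable [measurable]: "F \<in> borel_measurable borel" "G \<in> borel_measurable borel" "K \<in> borel_measurable borel"
  using F G K_smooth by (auto simp: h.kernel_class_def g.kernel_class_def intro: smooth_on_measurable)

lemma F_annulus:
  obtains C where "0 \<le> C" "\<And>r y. 0 < r \<Longrightarrow> y \<in> annulus r \<Longrightarrow> norm (F y) \<le> C * r powr (- p)"
    "\<And>r y u. 0 < r \<Longrightarrow> y \<in> annulus r \<Longrightarrow> 2 * \<rho> u \<le> r \<Longrightarrow> norm (F (y - u) - F y) \<le> C * (\<rho> u / r) * r powr (- p)"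
proof -
  obtain C1 where C1: "0 \<le> C1" "\<And>x. x \<noteq> 0 \<Longrightarrow> norm (F x) \<le> C1 * \<rho> x powr (- p)" using h.kernel_class_bound[OF F] by metis
  obtain C2 where C2: "0 \<le> C2" "\<And>x u. x \<noteq> 0 \<Longrightarrow> 2 * \<rho> u \<le> \<rho> x \<Longrightarrow> norm (F (x - u) - F x) \<le> C2 * (\<rho> u / \<rho> x) * \<rho> x powr (- p)"
    using h.kernel_class_diff[OF F] by metis
  let ?P = "2 powr \<bar>- p\<bar>"
  show ?thesis
  proof (rule that[of "(C1 + C2) * ?P"])
    show "0 \<le> (C1 + C2) * ?P" using C1 C2 by simp
    fix r y assume r: "0 < r" and y: "y \<in> annulus r"
    have y0: "y \<noteq> 0" "0 < \<rho> y" using r y by auto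
    have P: "\<rho> y powr (- p) \<le> ?P * r powr (- p)" using r y by (intro annulus_powr) auto
    have "C1 * \<rho> y powr (- p) \<le> (C1 + C2) * (?P * r powr (- p))" using P C1 C2 by (intro mult_mono) auto
    then show "norm (F y) \<le> (C1 + C2) * ?P * r powr (- p)" using C1(2)[OF y0(1)] by (simp add: mult.assoc)
    fix u assume u: "2 * \<rho> u \<le> r"
    have "C2 * (\<rho> u / \<rho> y) * \<rho> y powr (- p) \<le> (C1 + C2) * (\<rho> u / r) * (?P * r powr (- p))"
      using P C1 C2 y r y0 by (intro mult_mono divide_left_mono) auto
    moreover have "norm (F (y - u) - F y) \<le> C2 * (\<rho> u / \<rho> y) * \<rho> y powr (- p)" using C2(2)[OF y0(1), of u] u y by simp
    ultimately show "norm (F (y - u) - F y) \<le> (C1 + C2) * ?P * (\<rho> u / r) * r powr (- p)" by (simp add: mult_ac)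
  qed
qed

text \<open>On the annulus \<open>F\<close> has its homogeneous size r^(-p), \<open>G\<close> has
  integral of order r^(D - \<theta> q) because q < s0, and p + \<theta> q = D makes the powers
  cancel.\<close>

lemma size_small:
  obtains A where "0 \<le> A"
    "\<And>r. 0 < r \<Longrightarrow> 3 * r \<le> 1 \<Longrightarrow> 3 * r \<le> r0 \<Longrightarrow> l1_on (annulus r) K \<le> ennreal A"
proof -
  obtain CF where CF: "0 \<le> CF" "\<And>r y. 0 < r \<Longrightarrow> y \<in> annulus r \<Longrightarrow> norm (F y) \<le> CF * r powr (- p)" using F_annulus by metis
  obtain CG where CG: "0 \<le> CG" "\<And>x. x \<noteq> 0 \<Longrightarrow> norm (G x) \<le> CG * \<sigma> x powr (- q)" using g.kernel_class_bound[OF G] by metis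
  obtain J where J: "0 \<le> J" "\<And>r u. 0 < r \<Longrightarrow> 3 * r \<le> 1 \<Longrightarrow> 2 * \<rho> u \<le> r \<Longrightarrow>
      (\<integral>\<^sup>+y\<in>annulus r. ennreal (\<sigma> (y - u) powr (- q)) \<partial>lborel) \<le> ennreal (J * r powr (D - \<theta> * q))"
    "\<And>r. 0 < r \<Longrightarrow> 3 * r \<le> 1 \<Longrightarrow>
      (\<integral>\<^sup>+y\<in>annulus r. ennreal (\<sigma> (\<pi> y) powr (- q)) \<partial>lborel) \<le> ennreal (J * r powr (D - \<theta> * q))"
    by (rule annulus_integrals[OF exponents(2) that])
  have "l1_on (annulus r) K \<le> ennreal (CF * CG * J)"
    if r: "0 < r" "3 * r \<le> 1" "3 * r \<le> r0" for r
  proof -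
    have "l1_on (annulus r) K \<le> ennreal (CF * r powr (- p) * CG * (J * r powr (D - \<theta> * q) + 0))"
    proof (rule set_nn_integral_sum_le[where ?w1.0 = "\<lambda>y. \<sigma> y powr (- q)" and ?w2.0 = "\<lambda>_. 0"])
      show "AE y in lborel. y \<in> annulus r \<longrightarrow> norm (K y) \<le> CF * r powr (- p) * CG * (\<sigma> y powr (- q) + 0)"
      proof (intro AE_I2 impI)
        fix y assume y: "y \<in> annulus r"
        then have "K y = F y * G y" "y \<noteq> 0" using r by (auto intro!: K_eq)
        then have "norm (K y) \<le> (CF * r powr (- p)) * (CG * \<sigma> y powr (- q))"
          using CF(2)[OF r(1) y] CG CF(1) by (simp add: norm_mult mult_mono)
        then show "norm (K y) \<le> CF * r powr (- p) * CG * (\<sigma> y powr (- q) + 0)" by (simp add: mult.assoc)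
      qed
    qed (use J(2)[of r 0] r CF(1) CG(1) J(1) in auto)
    also have "CF * r powr (- p) * CG * (J * r powr (D - \<theta> * q) + 0) = CF * CG * J * (r powr (- p) * r powr (D - \<theta> * q))" by simp
    also have "r powr (- p) * r powr (D - \<theta> * q) = 1" using r exponents(3) by (simp flip: powr_add)
    finally show ?thesis by simp
  qed
  moreover have "0 \<le> CF * CG * J" using CF CG J by simp
  ultimately show ?thesis using that by blast
qed

text \<open>Product rule. The increment of \<open>F\<close> gains \<rho> u / r. That of
  \<open>G\<close> gains only \<open>\<sigma> u powr \<delta>\<close>, at most twice
  \<open>\<rho> u powr (\<theta> * \<delta>)\<close>, and raises the singularity to q + \<delta>,
  still integrable as q + \<delta> < s0; by scaling the gain becomes \<rho> u / r to the power
  \<theta> \<delta>.\<close>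

lemma regular_small:
  assumes \<delta>: "0 < \<delta>" "\<delta> \<le> 1" "q + \<delta> < s0"
  obtains A where "0 \<le> A"
    "\<And>r u. 0 < r \<Longrightarrow> 3 * r \<le> 1 \<Longrightarrow> 3 * r \<le> r0 \<Longrightarrow> 2 * \<rho> u \<le> r \<Longrightarrow>
      l1_on (annulus r) (\<lambda>y. K (y - u) - K y) \<le> ennreal (A * (\<rho> u / r) powr (\<theta> * \<delta>))"
proof -
  obtain CF where CF: "0 \<le> CF" "\<And>r y. 0 < r \<Longrightarrow> y \<in> annulus r \<Longrightarrow> norm (F y) \<le> CF * r powr (- p)"
    "\<And>r y u. 0 < r \<Longrightarrow> y \<in> annulus r \<Longrightarrow> 2 * \<rho> u \<le> r \<Longrightarrow> norm (F (y - u) - F y) \<le> CF * (\<rho> u / r) * r powr (- p)" by (rule F_annulus[OF that])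
  obtain CG where CG: "0 \<le> CG" "\<And>x. x \<noteq> 0 \<Longrightarrow> norm (G x) \<le> CG * \<sigma> x powr (- q)" using g.kernel_class_bound[OF G] by metis
  obtain CH where CH: "0 \<le> CH" "\<And>x u. x \<noteq> 0 \<Longrightarrow> x - u \<noteq> 0 \<Longrightarrow>
    norm (G (x - u) - G x) \<le> CH * \<sigma> u powr \<delta> * (\<sigma> x powr (- (q + \<delta>)) + \<sigma> (x - u) powr (- (q + \<delta>)))"
    using g.kernel_class_hoelder[OF G \<delta>(1,2)] by metis
  obtain J1 where J1: "0 \<le> J1" "\<And>r u. 0 < r \<Longrightarrow> 3 * r \<le> 1 \<Longrightarrow> 2 * \<rho> u \<le> r \<Longrightarrow>
      (\<integral>\<^sup>+y\<in>annulus r. ennreal (\<sigma> (y - u) powr (- q)) \<partial>lborel) \<le> ennreal (J1 * r powr (D - \<theta> * q))"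
    "\<And>r. 0 < r \<Longrightarrow> 3 * r \<le> 1 \<Longrightarrow>
      (\<integral>\<^sup>+y\<in>annulus r. ennreal (\<sigma> (\<pi> y) powr (- q)) \<partial>lborel) \<le> ennreal (J1 * r powr (D - \<theta> * q))"
    by (rule annulus_integrals[OF exponents(2) that])
  obtain J2 where J2: "0 \<le> J2" "\<And>r u. 0 < r \<Longrightarrow> 3 * r \<le> 1 \<Longrightarrow> 2 * \<rho> u \<le> r \<Longrightarrow>
      (\<integral>\<^sup>+y\<in>annulus r. ennreal (\<sigma> (y - u) powr (- (q + \<delta>))) \<partial>lborel) \<le> ennreal (J2 * r powr (D - \<theta> * (q + \<delta>)))"
    "\<And>r. 0 < r \<Longrightarrow> 3 * r \<le> 1 \<Longrightarrow>
      (\<integral>\<^sup>+y\<in>annulus r. ennreal (\<sigma> (\<pi> y) powr (- (q + \<delta>))) \<partial>lborel) \<le> ennreal (J2 * r powr (D - \<theta> * (q + \<delta>)))"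
    by (rule annulus_integrals[OF \<delta>(3) that])
  define A where "A = CF * CG * J1 + CF * CH * 2 * (J2 + J2)"
  have "l1_on (annulus r) (\<lambda>y. K (y - u) - K y) \<le> ennreal (A * (\<rho> u / r) powr (\<theta> * \<delta>))"
    if r: "0 < r" "3 * r \<le> 1" "3 * r \<le> r0" and u: "2 * \<rho> u \<le> r" for r u
  proof -
    let ?T1 = "\<lambda>y. (F (y - u) - F y) * G (y - u)" and ?T2 = "\<lambda>y. F y * (G (y - u) - G y)"
    let ?t = "\<rho> u / r"
    have t: "0 \<le> ?t" "?t \<le> 1" using r u by (auto simp: divide_le_eq)
    have nz: "y \<noteq> 0 \<and> y - u \<noteq> 0 \<and> \<rho> (y - u) < 3 * r \<and> \<rho> y < 3 * r" if "y \<in> annulus r" for y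
      using that r u r.diff_ge[of y u] r.triangle_diff[of y u] r.pos_iff[of y] r.pos_iff[of "y - u"] by auto
    have 1: "l1_on (annulus r) (\<lambda>y. ?T1 y) \<le> ennreal (CF * ?t * r powr (- p) * CG * (J1 * r powr (D - \<theta> * q) + 0))"
    proof (rule set_nn_integral_sum_le[where ?w1.0 = "\<lambda>y. \<sigma> (y - u) powr (- q)" and ?w2.0 = "\<lambda>_. 0"])
      show "AE y in lborel. y \<in> annulus r \<longrightarrow> norm (?T1 y) \<le> CF * ?t * r powr (- p) * CG * (\<sigma> (y - u) powr (- q) + 0)"
      proof (intro AE_I2 impI)
        fix y assume y: "y \<in> annulus r"
        have "norm (?T1 y) \<le> (CF * ?t * r powr (- p)) * (CG * \<sigma> (y - u) powr (- q))"
          unfolding norm_mult using CF(1) CF(3)[OF r(1) y u] CG(2) nz[OF y] mult_nonneg_nonneg[OF mult_nonneg_nonneg[OF CF(1) t(1)], of "r powr (- p)"] by (intro mult_mono) auto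
        then show "norm (?T1 y) \<le> CF * ?t * r powr (- p) * CG * (\<sigma> (y - u) powr (- q) + 0)" by (simp add: mult.assoc)
      qed
    qed (use J1(2)[of r u] u r CF(1) CG(1) J1(1) in auto)
    have 2: "l1_on (annulus r) (\<lambda>y. ?T2 y)
        \<le> ennreal (CF * r powr (- p) * (CH * \<sigma> u powr \<delta>) * (J2 * r powr (D - \<theta> * (q + \<delta>)) + J2 * r powr (D - \<theta> * (q + \<delta>))))"
    proof (rule set_nn_integral_sum_le[where ?w1.0 = "\<lambda>y. \<sigma> y powr (- (q + \<delta>))" and ?w2.0 = "\<lambda>y. \<sigma> (y - u) powr (- (q + \<delta>))"])
      show "AE y in lborel. y \<in> annulus r \<longrightarrow> norm (?T2 y)
          \<le> CF * r powr (- p) * (CH * \<sigma> u powr \<delta>) * (\<sigma> y powr (- (q + \<delta>)) + \<sigma> (y - u) powr (- (q + \<delta>)))"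
      proof (intro AE_I2 impI)
        fix y assume y: "y \<in> annulus r"
        have "norm (?T2 y) \<le> (CF * r powr (- p)) * (CH * \<sigma> u powr \<delta> * (\<sigma> y powr (- (q + \<delta>)) + \<sigma> (y - u) powr (- (q + \<delta>))))"
          unfolding norm_mult using CF(1) CF(2)[OF r(1) y] CH(2) nz[OF y] by (intro mult_mono) auto
        then show "norm (?T2 y) \<le> CF * r powr (- p) * (CH * \<sigma> u powr \<delta>) * (\<sigma> y powr (- (q + \<delta>)) + \<sigma> (y - u) powr (- (q + \<delta>)))"
          by (simp add: mult.assoc)
      qed
    qed (use J2(2)[of r u] J2(2)[of r 0] u r CF(1) CH(1) J2(1) in auto)
    have "l1_on (annulus r) (\<lambda>y. K (y - u) - K y)
        \<le> (\<integral>\<^sup>+y. ennreal (norm (?T1 y)) * indicator (annulus r) y + ennreal (norm (?T2 y)) * indicator (annulus r) y \<partial>lborel)"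
    proof (rule nn_integral_mono)
      fix y
      show "ennreal (norm (K (y - u) - K y)) * indicator (annulus r) y
        \<le> ennreal (norm (?T1 y)) * indicator (annulus r) y + ennreal (norm (?T2 y)) * indicator (annulus r) y"
      proof (cases "y \<in> annulus r")
        case True
        have "K (y - u) = F (y - u) * G (y - u)" "K y = F y * G y" using nz[OF True] r by (auto intro!: K_eq simp: r.pos_iff)
        then have "K (y - u) - K y = ?T1 y + ?T2 y" by (simp add: algebra_simps)
        then show ?thesis using True norm_triangle_ineq[of "?T1 y" "?T2 y"] by (simp flip: ennreal_plus)
      qed simp
    qed
    also have "... = l1_on (annulus r) (\<lambda>y. ?T1 y) + l1_on (annulus r) (\<lambda>y. ?T2 y)" by (rule nn_integral_add) measurable
    also have "... \<le> ennreal (CF * ?t * r powr (- p) * CG * (J1 * r powr (D - \<theta> * q) + 0))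
      + ennreal (CF * r powr (- p) * (CH * \<sigma> u powr \<delta>) * (J2 * r powr (D - \<theta> * (q + \<delta>)) + J2 * r powr (D - \<theta> * (q + \<delta>))))"
      by (intro add_mono 1 2)
    also have "... = ennreal (CF * ?t * r powr (- p) * CG * (J1 * r powr (D - \<theta> * q) + 0)
      + CF * r powr (- p) * (CH * \<sigma> u powr \<delta>) * (J2 * r powr (D - \<theta> * (q + \<delta>)) + J2 * r powr (D - \<theta> * (q + \<delta>))))"
      using CF(1) CG(1) CH(1) J1(1) J2(1) t(1) by (intro ennreal_plus[symmetric] mult_nonneg_nonneg add_nonneg_nonneg) auto
    also have "... \<le> ennreal (A * ?t powr (\<theta> * \<delta>))"
    proof (rule ennreal_leI)
      have \<gamma>: "0 < \<theta> * \<delta>" "\<theta> * \<delta> \<le> 1" using \<theta> \<delta> by (auto intro: mult_le_one)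
      have e1: "r powr (- p) * r powr (D - \<theta> * q) = 1" using r exponents(3) by (simp flip: powr_add)
      have e2: "r powr (- p) * r powr (D - \<theta> * (q + \<delta>)) = r powr (- (\<theta> * \<delta>))"
        unfolding exponents(3)[symmetric] by (simp add: algebra_simps flip: powr_add)
      have "?t powr 1 \<le> ?t powr (\<theta> * \<delta>)" using t \<gamma> by (intro powr_mono') auto
      then have tt: "?t \<le> ?t powr (\<theta> * \<delta>)" unfolding powr_one[OF t(1)] .
      have "CF * ?t * r powr (- p) * CG * (J1 * r powr (D - \<theta> * q) + 0) = CF * CG * J1 * ?t * (r powr (- p) * r powr (D - \<theta> * q))" by simp
      also have "... \<le> CF * CG * J1 * ?t powr (\<theta> * \<delta>)" unfolding e1 mult_1_right using tt CF(1) CG(1) J1(1) by (intro mult_left_mono mult_nonneg_nonneg)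
      finally have a: "CF * ?t * r powr (- p) * CG * (J1 * r powr (D - \<theta> * q) + 0) \<le> CF * CG * J1 * ?t powr (\<theta> * \<delta>)" .
      have "\<sigma> u powr \<delta> \<le> (2 * \<rho> u powr \<theta>) powr \<delta>" using compare[of u] u r \<delta> by (intro powr_mono2) auto
      also have "... = 2 powr \<delta> * \<rho> u powr (\<theta> * \<delta>)" by (simp add: powr_mult powr_powr)
      also have "... \<le> 2 powr 1 * \<rho> u powr (\<theta> * \<delta>)" using \<delta> by (intro mult_right_mono powr_mono) auto
      finally have su: "\<sigma> u powr \<delta> \<le> 2 * \<rho> u powr (\<theta> * \<delta>)" by simp
      have "CF * r powr (- p) * (CH * \<sigma> u powr \<delta>) * (J2 * r powr (D - \<theta> * (q + \<delta>)) + J2 * r powr (D - \<theta> * (q + \<delta>)))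
          = CF * CH * (J2 + J2) * \<sigma> u powr \<delta> * (r powr (- p) * r powr (D - \<theta> * (q + \<delta>)))" by (simp add: algebra_simps)
      also have "... \<le> CF * CH * (J2 + J2) * (2 * \<rho> u powr (\<theta> * \<delta>)) * r powr (- (\<theta> * \<delta>))"
        unfolding e2 using su CF CH J2 by (intro mult_right_mono mult_left_mono) auto
      also have "... = CF * CH * 2 * (J2 + J2) * ?t powr (\<theta> * \<delta>)" using r by (simp add: powr_divide powr_minus_divide)
      finally show "CF * ?t * r powr (- p) * CG * (J1 * r powr (D - \<theta> * q) + 0)
        + CF * r powr (- p) * (CH * \<sigma> u powr \<delta>) * (J2 * r powr (D - \<theta> * (q + \<delta>)) + J2 * r powr (D - \<theta> * (q + \<delta>)))
        \<le> A * ?t powr (\<theta> * \<delta>)" using a unfolding A_def distrib_right[of _ _ "?t powr (\<theta> * \<delta>)"] by (rule add_mono[rotated])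
    qed
    finally show ?thesis .
  qed
  moreover have "0 \<le> A" using CF CG CH J1 J2 by (simp add: A_def)
  ultimately show ?thesis using that by blast
qed

text \<open>\<open>\<pi>_close\<close> gains a factor r^(2 \<theta> \<delta>) up to a constant,
  while the stronger singularity q + \<delta> loses r^(-\<theta> \<delta>); the surplus r^(\<theta>
  \<delta>) sums over dyadic annuli down to the origin. So near the origin \<open>K\<close> and its
  frozen version differ by an integrable function.\<close>

lemma projection_error:
  assumes \<delta>: "0 < \<delta>" "\<delta> \<le> 1" "q + \<delta> < s0"
  obtains A where "0 \<le> A"
    "\<And>b. 0 < b \<Longrightarrow> 3 * b \<le> 1 \<Longrightarrow> 3 * b \<le> r0 \<Longrightarrow>
      l1_on {y. 0 < \<rho> y \<and> \<rho> y < b} (\<lambda>y. K y - F y * G (\<pi> y)) \<le> ennreal (A * b powr (\<theta> * \<delta>))"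
proof -
  obtain CF where CF: "0 \<le> CF" "\<And>r y. 0 < r \<Longrightarrow> y \<in> annulus r \<Longrightarrow> norm (F y) \<le> CF * r powr (- p)" using F_annulus by metis
  obtain CH where CH: "0 \<le> CH" "\<And>x u. x \<noteq> 0 \<Longrightarrow> x - u \<noteq> 0 \<Longrightarrow>
    norm (G (x - u) - G x) \<le> CH * \<sigma> u powr \<delta> * (\<sigma> x powr (- (q + \<delta>)) + \<sigma> (x - u) powr (- (q + \<delta>)))"
    using g.kernel_class_hoelder[OF G \<delta>(1,2)] by metis
  obtain J where J: "0 \<le> J" "\<And>r u. 0 < r \<Longrightarrow> 3 * r \<le> 1 \<Longrightarrow> 2 * \<rho> u \<le> r \<Longrightarrow>
      (\<integral>\<^sup>+y\<in>annulus r. ennreal (\<sigma> (y - u) powr (- (q + \<delta>))) \<partial>lborel) \<le> ennreal (J * r powr (D - \<theta> * (q + \<delta>)))"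
    "\<And>r. 0 < r \<Longrightarrow> 3 * r \<le> 1 \<Longrightarrow>
      (\<integral>\<^sup>+y\<in>annulus r. ennreal (\<sigma> (\<pi> y) powr (- (q + \<delta>))) \<partial>lborel) \<le> ennreal (J * r powr (D - \<theta> * (q + \<delta>)))"
    by (rule annulus_integrals[OF \<delta>(3) that])
  let ?\<gamma> = "\<theta> * \<delta>"
  have \<gamma>: "0 < ?\<gamma>" "?\<gamma> \<le> 1" using \<theta> \<delta> by (auto intro: mult_le_one)
  let ?E = "\<lambda>y. K y - F y * G (\<pi> y)"
  define A where "A = CF * CH * 4 * (J + J)"
  have A: "0 \<le> A" using CF CH J by (simp add: A_def)
  have ann: "l1_on (annulus r) ?E \<le> ennreal (A * r powr ?\<gamma>)"
    if r: "0 < r" "3 * r \<le> 1" "3 * r \<le> r0" for r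
  proof -
    have "l1_on (annulus r) ?E
        \<le> ennreal (CF * r powr (- p) * (CH * (4 * r powr (2 * ?\<gamma>))) * (J * r powr (D - \<theta> * (q + \<delta>)) + J * r powr (D - \<theta> * (q + \<delta>))))"
    proof (rule set_nn_integral_sum_le[where ?w1.0 = "\<lambda>y. \<sigma> y powr (- (q + \<delta>))" and ?w2.0 = "\<lambda>y. \<sigma> (\<pi> y) powr (- (q + \<delta>))"])
      show "AE y in lborel. y \<in> annulus r \<longrightarrow> norm (?E y)
          \<le> CF * r powr (- p) * (CH * (4 * r powr (2 * ?\<gamma>))) * (\<sigma> y powr (- (q + \<delta>)) + \<sigma> (\<pi> y) powr (- (q + \<delta>)))" using \<pi>_nonzero
      proof (eventually_elim, intro impI)
        fix y assume \<pi>y: "\<pi> y \<noteq> 0" and y: "y \<in> annulus r"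
        have "K y = F y * G y" "y \<noteq> 0" using y r by (auto intro!: K_eq)
        then have "norm (?E y) = norm (F y) * norm (G (y - (y - \<pi> y)) - G y)"
          by (simp add: norm_minus_commute flip: right_diff_distrib norm_mult)
        also have "... \<le> (CF * r powr (- p)) * (CH * \<sigma> (y - \<pi> y) powr \<delta> * (\<sigma> y powr (- (q + \<delta>)) + \<sigma> (y - (y - \<pi> y)) powr (- (q + \<delta>))))"
          using CF CH(2)[of y "y - \<pi> y"] y r \<pi>y \<open>y \<noteq> 0\<close> by (intro mult_mono) auto
        also have "... \<le> (CF * r powr (- p)) * (CH * (4 * r powr (2 * ?\<gamma>)) * (\<sigma> y powr (- (q + \<delta>)) + \<sigma> (\<pi> y) powr (- (q + \<delta>))))"
        proof -
          have "\<sigma> (y - \<pi> y) \<le> (2 * r) powr (2 * \<theta>)" using \<theta> y by (intro order_trans[OF \<pi>_close] powr_mono2) auto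
          then have "\<sigma> (y - \<pi> y) powr \<delta> \<le> ((2 * r) powr (2 * \<theta>)) powr \<delta>" using \<delta> by (intro powr_mono2) auto
          also have "... = 2 powr (2 * ?\<gamma>) * r powr (2 * ?\<gamma>)" using r by (simp add: powr_powr powr_mult mult.assoc)
          also have "... \<le> 2 powr 2 * r powr (2 * ?\<gamma>)" using \<gamma> by (intro mult_right_mono powr_mono) auto
          finally have "\<sigma> (y - \<pi> y) powr \<delta> \<le> 4 * r powr (2 * ?\<gamma>)" by simp
          from mult_right_mono[OF mult_left_mono[OF this CH(1)], of "\<sigma> y powr (- (q + \<delta>)) + \<sigma> (\<pi> y) powr (- (q + \<delta>))"] CF(1)
          show ?thesis by (intro mult_left_mono) auto
        qed
        finally show "norm (?E y) \<le> CF * r powr (- p) * (CH * (4 * r powr (2 * ?\<gamma>))) * (\<sigma> y powr (- (q + \<delta>)) + \<sigma> (\<pi> y) powr (- (q + \<delta>)))"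
          by (simp add: mult.assoc)
      qed
    qed (use J(2)[of r 0] J(3)[of r] r CF(1) CH(1) J(1) in auto)
    also have "CF * r powr (- p) * (CH * (4 * r powr (2 * ?\<gamma>))) * (J * r powr (D - \<theta> * (q + \<delta>)) + J * r powr (D - \<theta> * (q + \<delta>)))
        = A * (r powr (- p) * r powr (2 * ?\<gamma>) * r powr (D - \<theta> * (q + \<delta>)))" by (simp add: A_def algebra_simps)
    also have "r powr (- p) * r powr (2 * ?\<gamma>) * r powr (D - \<theta> * (q + \<delta>)) = r powr ?\<gamma>"
      unfolding exponents(3)[symmetric] by (simp add: algebra_simps flip: powr_add)
    finally show ?thesis .
  qed
  have "l1_on {y. 0 < \<rho> y \<and> \<rho> y < b} ?E \<le> ennreal (A / (1 - 1 / 2 powr ?\<gamma>) * b powr ?\<gamma>)"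
    if b: "0 < b" "3 * b \<le> 1" "3 * b \<le> r0" for b
  proof -
    have "l1_on {y. 0 < \<rho> y \<and> \<rho> y < b} ?E \<le> ennreal (A * b powr ?\<gamma> / (1 - 1 / 2 powr ?\<gamma>))"
    proof (rule r.nn_integral_dyadic_below)
      fix r assume r: "0 < r" "2 * r \<le> b"
      have "r powr ?\<gamma> \<le> (2 * r) powr ?\<gamma>" using r \<gamma> by (intro powr_mono2) auto
      then have "ennreal (A * r powr ?\<gamma>) \<le> ennreal (A * (2 * r) powr ?\<gamma>)" using A by (intro ennreal_leI mult_left_mono)
      moreover have "3 * r \<le> 1" "3 * r \<le> r0" using r b by linarith+
      ultimately show "l1_on (annulus r) ?E \<le> ennreal (A * (2 * r) powr ?\<gamma>)" using ann[of r] r by (meson order_trans)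
    qed (use A \<gamma> b in auto)
    then show ?thesis by simp
  qed
  moreover have "0 \<le> A / (1 - 1 / 2 powr ?\<gamma>)" using A one_div_2_powr_less[OF \<gamma>(1)] by simp
  ultimately show ?thesis using that by blast
qed

end

section \<open>Kernel conditions away from the origin, and their assembly\<close>

context length_function begin

lemma smooth_integral_far:
  assumes K: "smooth_on (-{0}) K" "\<And>x. R \<le> \<rho> x \<Longrightarrow> K x = 0" and a: "0 < a"
  obtains A where "0 \<le> A" "l1_on {y. a \<le> \<rho> y} K \<le> ennreal A"
proof -
  have "0 \<notin> {y. a \<le> \<rho> y \<and> \<rho> y \<le> R}" using a by simp
  from smooth_on_bounded_compact[OF K(1) compact_annulus this, of "[]"]
  obtain B where B: "0 \<le> B" "\<And>x. x \<in> {y. a \<le> \<rho> y \<and> \<rho> y \<le> R} \<Longrightarrow> norm (iter_deriv [] K x) \<le> B" by blast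
  have "l1_on {y. a \<le> \<rho> y} K \<le> (\<integral>\<^sup>+y. ennreal B * indicator {y. \<rho> y < R} y \<partial>lborel)"
  proof (rule nn_integral_mono)
    fix y
    show "ennreal (norm (K y)) * indicator {y. a \<le> \<rho> y} y \<le> ennreal B * indicator {y. \<rho> y < R} y"
      using B(2)[of y] K(2)[of y] by (cases "\<rho> y < R") (auto simp: indicator_def intro!: ennreal_leI)
  qed
  also have "... = ennreal B * emeasure lborel {y. \<rho> y < R}" by (intro nn_integral_cmult_indicator) simp
  also have "... = ennreal (B * enn2real (emeasure lborel {y. \<rho> y < R}))" using emeasure_ball_finite[of R] B(1) by (simp add: ennreal_mult')
  finally show ?thesis by (rule that[rotated]) (use B(1) in simp)
qed

text \<open>For r \<ge> 2R both values of \<open>K\<close> vanish. Otherwise \<rho> u < R and \<rho>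
  y < 4R, so the segment stays in the compact annulus between a/2 and 5R, where \<open>K\<close> is
  Lipschitz.\<close>

lemma smooth_regular_far:
  assumes K: "smooth_on (-{0}) K" "\<And>x. R \<le> \<rho> x \<Longrightarrow> K x = 0" and a: "0 < a" and R: "0 < R" and \<gamma>: "0 < \<gamma>" "\<gamma> \<le> 1"
  obtains A where "0 \<le> A" "\<And>r u. a \<le> r \<Longrightarrow> 2 * \<rho> u \<le> r \<Longrightarrow>
    l1_on {y. r \<le> \<rho> y \<and> \<rho> y < 2 * r} (\<lambda>y. K (y - u) - K y) \<le> ennreal (A * (\<rho> u / r) powr \<gamma>)"
proof -
  have "0 \<notin> {y. a / 2 \<le> \<rho> y \<and> \<rho> y \<le> 5 * R}" using a by simp
  from smooth_on_lipschitz_compact[OF K(1) compact_annulus this]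
  obtain B where B: "0 \<le> B" "\<And>x y. closed_segment x y \<subseteq> {y. a / 2 \<le> \<rho> y \<and> \<rho> y \<le> 5 * R} \<Longrightarrow> norm (K x - K y) \<le> B * norm (x - y)" by blast
  define V where "V = enn2real (emeasure lborel {y. \<rho> y < 4 * R})"
  have V: "emeasure lborel {y. \<rho> y < 4 * R} = ennreal V" "0 \<le> V" using emeasure_ball_finite[of "4 * R"] by (simp_all add: V_def)
  define A where "A = B * (1 + R) * (2 * R) * V"
  have "l1_on {y. r \<le> \<rho> y \<and> \<rho> y < 2 * r} (\<lambda>y. K (y - u) - K y) \<le> ennreal (A * (\<rho> u / r) powr \<gamma>)"
    if r: "a \<le> r" and u: "2 * \<rho> u \<le> r" for r u
  proof (cases "2 * R \<le> r")
    case True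
    have "K (y - u) = 0 \<and> K y = 0" if "r \<le> \<rho> y" for y using that True u R diff_ge[of y u] by (intro conjI K(2)) linarith+
    then have "l1_on {y. r \<le> \<rho> y \<and> \<rho> y < 2 * r} (\<lambda>y. K (y - u) - K y) = (\<integral>\<^sup>+y. 0 \<partial>(lborel :: 'v measure))"
      by (intro nn_integral_cong) (auto simp: indicator_def)
    then show ?thesis by simp
  next
    case False
    let ?M = "B * (1 + R) * (2 * R) * (\<rho> u / r) powr \<gamma>"
    have M: "0 \<le> ?M" using B R by simp
    have t: "0 \<le> \<rho> u / r" "\<rho> u / r \<le> 1" using r a u nonneg[of u] by (auto simp: divide_le_eq)
    have le: "norm (K (y - u) - K y) \<le> ?M" if y: "r \<le> \<rho> y" "\<rho> y < 2 * r" for y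
    proof -
      have "closed_segment (y - u) y \<subseteq> {y. a / 2 \<le> \<rho> y \<and> \<rho> y \<le> 5 * R}"
      proof
        fix z assume "z \<in> closed_segment (y - u) y"
        from segment_bounds[OF this] have "a / 2 \<le> \<rho> z" "\<rho> z \<le> 5 * R" using y u r False by linarith+
        then show "z \<in> {y. a / 2 \<le> \<rho> y \<and> \<rho> y \<le> 5 * R}" by simp
      qed
      then have "norm (K (y - u) - K y) \<le> B * norm u" using B(2)[of "y - u" y] by simp
      also have "norm u \<le> (1 + R) * \<rho> u" using u False by (intro norm_le_mult) linarith
      also have "\<rho> u = r * (\<rho> u / r)" using r a by simp
      also have "\<rho> u / r \<le> (\<rho> u / r) powr \<gamma>" using powr_mono'[of \<gamma> 1 "\<rho> u / r"] t \<gamma> unfolding powr_one[OF t(1)] by blast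
      also have "r * (\<rho> u / r) powr \<gamma> \<le> 2 * R * (\<rho> u / r) powr \<gamma>" using False by (intro mult_right_mono) auto
      finally show ?thesis using B(1) R r a by (simp add: mult_left_mono mult.assoc)
    qed
    have "l1_on {y. r \<le> \<rho> y \<and> \<rho> y < 2 * r} (\<lambda>y. K (y - u) - K y) \<le> (\<integral>\<^sup>+y. ennreal ?M * indicator {y. \<rho> y < 4 * R} y \<partial>lborel)"
    proof (rule nn_integral_mono)
      fix y
      show "ennreal (norm (K (y - u) - K y)) * indicator {y. r \<le> \<rho> y \<and> \<rho> y < 2 * r} y \<le> ennreal ?M * indicator {y. \<rho> y < 4 * R} y"
        using le[of y] False by (auto simp: indicator_def intro!: ennreal_leI)
    qed
    also have "... = ennreal ?M * emeasure lborel {y. \<rho> y < 4 * R}" by (intro nn_integral_cmult_indicator) simp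
    also have "... = ennreal (?M * V)" unfolding V(1) using M by (rule ennreal_mult'[symmetric])
    also have "?M * V = A * (\<rho> u / r) powr \<gamma>" by (simp add: A_def)
    finally show ?thesis .
  qed
  moreover have "0 \<le> A" using B(1) V(2) R by (simp add: A_def)
  ultimately show ?thesis using that by blast
qed

end

context product_kernel begin

theorem is_cz_kernel:
  assumes R: "0 < R"
  obtains A \<gamma> c where "cz_kernel \<rho> K A R \<gamma> c"
proof -
  \<comment> \<open>Half of the room s0 - q left below the critical exponent, capped by 1.\<close>
  define \<delta> where "\<delta> = min 1 ((s0 - q) / 2)"
  have "q + (s0 - q) / 2 < s0" using exponents(2) by (simp add: field_simps)
  then have \<delta>: "0 < \<delta>" "\<delta> \<le> 1" "q + \<delta> < s0" using exponents(2) unfolding \<delta>_def by (auto simp: min_def)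
  define \<gamma> where "\<gamma> = \<theta> * \<delta>"
  have \<gamma>: "0 < \<gamma>" "\<gamma> \<le> 1" using \<theta> \<delta> by (auto simp: \<gamma>_def intro: mult_le_one)
  define a where "a = min (1 / 3) (r0 / 3)"
  have a: "0 < a" using r0 by (simp add: a_def)
  have near: "3 * r \<le> 1 \<and> 3 * r \<le> r0" if "r \<le> a" for r using that by (simp add: a_def)
  let ?P = "\<lambda>y. F y * G (\<pi> y)"
  let ?I = "\<lambda>r. LINT y|lborel. truncated \<rho> K r y"
  obtain A1 where A1: "0 \<le> A1"
    "\<And>r. 0 < r \<Longrightarrow> 3 * r \<le> 1 \<Longrightarrow> 3 * r \<le> r0 \<Longrightarrow> l1_on (annulus r) K \<le> ennreal A1" by (rule size_small[OF that])
  obtain A2 where A2: "0 \<le> A2" "\<And>r u. 0 < r \<Longrightarrow> 3 * r \<le> 1 \<Longrightarrow> 3 * r \<le> r0 \<Longrightarrow> 2 * \<rho> u \<le> r \<Longrightarrow>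
      l1_on (annulus r) (\<lambda>y. K (y - u) - K y) \<le> ennreal (A2 * (\<rho> u / r) powr (\<theta> * \<delta>))" by (rule regular_small[OF \<delta> that])
  obtain A3 where A3: "0 \<le> A3" "\<And>b. 0 < b \<Longrightarrow> 3 * b \<le> 1 \<Longrightarrow> 3 * b \<le> r0 \<Longrightarrow>
      l1_on {y. 0 < \<rho> y \<and> \<rho> y < b} (\<lambda>y. K y - ?P y) \<le> ennreal (A3 * b powr (\<theta> * \<delta>))" by (rule projection_error[OF \<delta> that])
  obtain A4 where A4: "0 \<le> A4" "l1_on {y. a \<le> \<rho> y} K \<le> ennreal A4" using r.smooth_integral_far[OF K_smooth K_support a] by blast
  obtain A5 where A5: "0 \<le> A5" "\<And>r u. a \<le> r \<Longrightarrow> 2 * \<rho> u \<le> r \<Longrightarrow>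
    l1_on (annulus r) (\<lambda>y. K (y - u) - K y) \<le> ennreal (A5 * (\<rho> u / r) powr \<gamma>)"
    using r.smooth_regular_far[OF K_smooth K_support a R \<gamma>] by blast
  have tm [measurable]: "truncated \<rho> K r \<in> borel_measurable borel" for r unfolding truncated_def by measurable
  have t_nn: "(\<integral>\<^sup>+y. ennreal (norm (truncated \<rho> K r y)) \<partial>lborel) = l1_on {y. r \<le> \<rho> y} K" for r
    by (intro nn_integral_cong) (auto simp: truncated_def)
  have t_int: "integrable lborel (truncated \<rho> K r)" if r: "0 < r" for r
  proof -
    obtain A where "l1_on {y. r \<le> \<rho> y} K \<le> ennreal A" using r.smooth_integral_far[OF K_smooth K_support r] by blast
    then show ?thesis using t_nn[of r] by (intro integrable_bounded_nn) auto
  qed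
  let ?E = "\<lambda>y. indicator {y. 0 < \<rho> y \<and> \<rho> y < a} y *\<^sub>R (K y - ?P y)"
  let ?Er = "\<lambda>r y. indicator {y. r \<le> \<rho> y \<and> \<rho> y < a} y *\<^sub>R (K y - ?P y)"
  have set_eq: "(\<integral>\<^sup>+y. ennreal (norm (indicator S y *\<^sub>R f y)) \<partial>lborel) = l1_on S f"
    for S and f :: "'v \<Rightarrow> complex" by (intro nn_integral_cong) (auto simp: indicator_def)
  have E_nn: "(\<integral>\<^sup>+y. ennreal (norm (indicator {y. 0 < \<rho> y \<and> \<rho> y < b} y *\<^sub>R (K y - ?P y))) \<partial>lborel) \<le> ennreal (A3 * b powr \<gamma>)"
    if "0 < b" "b \<le> a" for b unfolding set_eq \<gamma>_def using that near[OF that(2)] by (intro A3(2)) auto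
  have E_int: "integrable lborel ?E" using E_nn[OF a] by (intro integrable_bounded_nn) auto
  have Er_nn: "(\<integral>\<^sup>+y. ennreal (norm (?Er r y)) \<partial>lborel) \<le> ennreal (A3 * a powr \<gamma>)" if "0 < r" for r
  proof (rule order_trans[OF nn_integral_mono E_nn[OF a order_refl]])
    show "ennreal (norm (?Er r y)) \<le> ennreal (norm (?E y))" for y using that by (intro ennreal_leI) (auto simp: indicator_def)
  qed
  have Er_int: "integrable lborel (?Er r)" if "0 < r" for r using Er_nn[OF that] by (intro integrable_bounded_nn) auto
  have I_eq: "?I r = ?I a + (LINT y|lborel. ?Er r y)" if r: "0 < r" "r < a" for r
  proof -
    have "truncated \<rho> K r y - truncated \<rho> K a y - ?Er r y = indicator {y. r \<le> \<rho> y \<and> \<rho> y < a} y *\<^sub>R ?P y" for y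
      using r by (auto simp: truncated_def indicator_def)
    then have "(LINT y|lborel. truncated \<rho> K r y - truncated \<rho> K a y - ?Er r y) = 0" using mean_zero[OF r] by simp
    moreover have "(LINT y|lborel. truncated \<rho> K r y - truncated \<rho> K a y - ?Er r y) = ?I r - ?I a - (LINT y|lborel. ?Er r y)"
      using r a by (simp add: t_int Er_int)
    ultimately show ?thesis by (simp add: algebra_simps)
  qed
  have far: "norm (?I r) \<le> A4" if "a \<le> r" for r
  proof (rule norm_integral_bounded_nn[OF order_trans[OF _ A4(2)] A4(1)])
    show "(\<integral>\<^sup>+y. ennreal (norm (truncated \<rho> K r y)) \<partial>lborel) \<le> l1_on {y. a \<le> \<rho> y} K"
      unfolding t_nn using that by (intro nn_integral_mono) (auto simp: indicator_def)
  qed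
  define c where "c = ?I a + (LINT y|lborel. ?E y)"
  have rate: "norm (?I r - c) \<le> A3 * r powr \<gamma>" if r: "0 < r" "r < a" for r
  proof -
    have "?E y - ?Er r y = indicator {y. 0 < \<rho> y \<and> \<rho> y < r} y *\<^sub>R (K y - ?P y)" for y using r by (auto simp: indicator_def)
    then have "(LINT y|lborel. ?E y) - (LINT y|lborel. ?Er r y) = (LINT y|lborel. indicator {y. 0 < \<rho> y \<and> \<rho> y < r} y *\<^sub>R (K y - ?P y))"
      using Bochner_Integration.integral_diff[OF E_int Er_int[OF r(1)]] by simp
    moreover have "norm (LINT y|lborel. indicator {y. 0 < \<rho> y \<and> \<rho> y < r} y *\<^sub>R (K y - ?P y)) \<le> A3 * r powr \<gamma>"
      using r A3(1) by (intro norm_integral_bounded_nn E_nn) auto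
    moreover have "norm (?I r - c) = norm ((LINT y|lborel. ?E y) - (LINT y|lborel. ?Er r y))"
      unfolding c_def I_eq[OF r] by (simp add: norm_minus_commute)
    ultimately show ?thesis by simp
  qed
  define A where "A = A1 + A2 + A3 * a powr \<gamma> + A4 + A5"
  have A3': "0 \<le> A3 * a powr \<gamma>" using A3 by simp
  have "cz_kernel \<rho> K A R \<gamma> c"
  proof
    show "0 \<le> A" "0 < R" "0 < \<gamma>" "\<gamma> \<le> 1" using A1(1) A2(1) A3' A4(1) A5(1) R \<gamma> by (auto simp: A_def)
    show "K y = 0" if "R \<le> \<rho> y" for y using that by (rule K_support)
    show "l1_on (annulus r) K \<le> ennreal A" if r: "0 < r" for r
    proof (cases "r \<le> a")
      case True
      have "ennreal A1 \<le> ennreal A" using A2(1) A3' A4(1) A5(1) by (intro ennreal_leI) (simp add: A_def)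
      with A1(2)[of r] r near[OF True] show ?thesis by (meson order_trans)
    next
      case False
      then have "l1_on (annulus r) K \<le> l1_on {y. a \<le> \<rho> y} K" by (intro nn_integral_mono) (auto simp: indicator_def)
      also have "... \<le> ennreal A4" by (rule A4)
      also have "... \<le> ennreal A" using A1(1) A2(1) A3' A5(1) by (intro ennreal_leI) (simp add: A_def)
      finally show ?thesis .
    qed
    show "norm (?I r) \<le> A" if r: "0 < r" for r
    proof (cases "r < a")
      case True
      have "norm (LINT y|lborel. ?Er r y) \<le> A3 * a powr \<gamma>" by (rule norm_integral_bounded_nn[OF Er_nn[OF r] A3'])
      then have "norm (?I r) \<le> A4 + A3 * a powr \<gamma>" unfolding I_eq[OF r True] using far[of a] by (intro norm_triangle_le add_mono) auto
      then show ?thesis using A1(1) A2(1) A5(1) by (simp add: A_def)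
    next
      case False
      then show ?thesis using far[of r] A1(1) A2(1) A3' A5(1) by (simp add: A_def)
    qed
    have "((\<lambda>r. A3 * r powr \<gamma>) \<longlongrightarrow> 0) (at_right 0)"
      using \<gamma> by (intro tendsto_mult_right_zero tendsto_zero_powrI[where b = \<gamma>] tendsto_intros)
        (auto simp: eventually_at_right_field intro: exI[of _ 1])
    moreover have "\<forall>\<^sub>F r in at_right 0. norm (?I r - c) \<le> A3 * r powr \<gamma>" using rate a by (auto simp: eventually_at_right_field)
    ultimately have "((\<lambda>r. ?I r - c) \<longlongrightarrow> 0) (at_right 0)" by (rule Lim_null_comparison[rotated])
    then show "(?I \<longlongrightarrow> c) (at_right 0)" by (simp add: LIM_zero_iff)
    show "l1_on (annulus r) (\<lambda>y. K (y - u) - K y) \<le> ennreal (A * (\<rho> u / r) powr \<gamma>)"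
      if r: "0 < r" and u: "2 * \<rho> u \<le> r" for r u
    proof (cases "r \<le> a")
      case True
      have "ennreal (A2 * (\<rho> u / r) powr \<gamma>) \<le> ennreal (A * (\<rho> u / r) powr \<gamma>)"
        using A1(1) A3' A4(1) A5(1) by (intro ennreal_leI mult_right_mono) (simp_all add: A_def)
      with A2(2)[of r u] r u near[OF True] show ?thesis unfolding \<gamma>_def by (meson order_trans)
    next
      case False
      have "ennreal (A5 * (\<rho> u / r) powr \<gamma>) \<le> ennreal (A * (\<rho> u / r) powr \<gamma>)"
        using A1(1) A2(1) A3' A4(1) by (intro ennreal_leI mult_right_mono) (simp_all add: A_def)
      with A5(2)[of r u] u False show ?thesis by (meson order_trans nle_le)
    qed
  qed measurable
  then show ?thesis by (rule that)
qed

end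

section \<open>Polar coordinates and mean value zero on annuli\<close>

lemma nn_integral_lborel_prod_mult:
  assumes [measurable]: "f \<in> borel_measurable borel" "g \<in> borel_measurable borel"
  shows "(\<integral>\<^sup>+x. f (fst x) * g (snd x) \<partial>(lborel :: ('a::euclidean_space \<times> 'b::euclidean_space) measure))
    = (\<integral>\<^sup>+x. f x \<partial>lborel) * (\<integral>\<^sup>+y. g y \<partial>lborel)"
proof -
  have "(\<integral>\<^sup>+x. f (fst x) * g (snd x) \<partial>(lborel :: ('a \<times> 'b) measure)) = (\<integral>\<^sup>+x. \<integral>\<^sup>+y. f x * g y \<partial>lborel \<partial>lborel)"
    unfolding lborel_prod[symmetric] by (subst lborel.nn_integral_fst[symmetric]) auto
  also have "... = (\<integral>\<^sup>+x. f x \<partial>lborel) * (\<integral>\<^sup>+y. g y \<partial>lborel)" by (simp add: nn_integral_cmult nn_integral_multc)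
  finally show ?thesis .
qed

lemma norm_powr_integral:
  fixes s :: real
  assumes s: "0 \<le> s" "s < DIM('v::euclidean_space)"
  obtains C where "0 \<le> C"
    "\<And>r. 0 < r \<Longrightarrow> (\<integral>\<^sup>+x\<in>{x::'v. norm x < r}. ennreal (norm x powr (- s)) \<partial>lborel) \<le> ennreal (C * r powr (DIM('v) - s))"
proof -
  define V where "V = measure lborel (ball (0::'v) 1)"
  define \<gamma> where "\<gamma> = DIM('v) - s"
  have \<gamma>: "0 < \<gamma>" using s by (simp add: \<gamma>_def)
  have V: "0 \<le> V" by (simp add: V_def)
  define C where "C = 2 ^ DIM('v) * V"
  have C: "0 \<le> C" using V by (simp add: C_def)
  have ann: "(\<integral>\<^sup>+x\<in>{x::'v. r \<le> norm x \<and> norm x < 2 * r}. ennreal (norm x powr (- s)) \<partial>lborel) \<le> ennreal (C * r powr \<gamma>)"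
    if r: "0 < r" for r
  proof -
    have "(\<integral>\<^sup>+x\<in>{x::'v. r \<le> norm x \<and> norm x < 2 * r}. ennreal (norm x powr (- s)) \<partial>lborel)
        \<le> ennreal (r powr (- s)) * emeasure lborel {x::'v. r \<le> norm x \<and> norm x < 2 * r}"
      using r s by (intro set_nn_integral_le_const ennreal_leI powr_mono2') auto
    also have "... \<le> ennreal (r powr (- s)) * emeasure lborel {x::'v. norm x < 2 * r}" by (intro mult_left_mono emeasure_mono) auto
    also have "... = ennreal (r powr (- s) * ((2 * r) ^ DIM('v) * V))"
      unfolding V_def using r by (subst emeasure_norm_less) (simp_all add: ennreal_mult')
    also have "r powr (- s) * ((2 * r) ^ DIM('v) * V) = C * (r powr DIM('v) * r powr (- s))"
      using r by (simp add: C_def power_mult_distrib powr_realpow)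
    also have "r powr DIM('v) * r powr (- s) = r powr \<gamma>" by (simp add: \<gamma>_def flip: powr_add)
    finally show ?thesis .
  qed
  have "(\<integral>\<^sup>+x\<in>{x::'v. norm x < r}. ennreal (norm x powr (- s)) \<partial>lborel) \<le> ennreal (C / (1 - 1 / 2 powr \<gamma>) * r powr \<gamma>)"
    if r: "0 < r" for r
  proof -
    have "(\<integral>\<^sup>+x\<in>{x::'v. norm x < r}. ennreal (norm x powr (- s)) \<partial>lborel)
        = (\<integral>\<^sup>+x\<in>{x::'v. 0 < norm x \<and> norm x < r}. ennreal (norm x powr (- s)) \<partial>lborel)"
      by (intro nn_integral_cong) (auto simp: indicator_def)
    also have "... \<le> ennreal (C * r powr \<gamma> / (1 - 1 / 2 powr \<gamma>))"
    proof (rule norm_length.nn_integral_dyadic_below[OF _ r \<gamma> C])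
      fix t :: real assume t: "0 < t"
      have "C * t powr \<gamma> \<le> C * (2 * t) powr \<gamma>" using t \<gamma> C by (intro mult_left_mono powr_mono2) auto
      then show "(\<integral>\<^sup>+x\<in>{x::'v. t \<le> norm x \<and> norm x < 2 * t}. ennreal (norm x powr (- s)) \<partial>lborel) \<le> ennreal (C * (2 * t) powr \<gamma>)"
        using ann[OF t] by (meson ennreal_leI order_trans)
    qed measurable
    finally show ?thesis by simp
  qed
  moreover have "0 \<le> C / (1 - 1 / 2 powr \<gamma>)" using C one_div_2_powr_less[OF \<gamma>] by simp
  ultimately show ?thesis using that unfolding \<gamma>_def by blast
qed

lemma scale_measure_eq_density: "scale_measure c M = density M (\<lambda>_. c)"
  by (rule measure_eqI) (auto simp: emeasure_density nn_integral_cmult_indicator)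

text \<open>The weight \<open>\<rho>\<^sup>-\<^sup>D\<close> is a superposition of indicators of \<open>{\<rho> < t}\<close>.\<close>

lemma integral_powr_weight_zero:
  fixes W :: "'v::euclidean_space \<Rightarrow> complex"
  assumes [measurable]: "\<rho> \<in> borel_measurable borel" "W \<in> borel_measurable borel"
    and ab: "0 < a" "a < b"
    and int: "integrable lborel (\<lambda>x. indicator {x. a \<le> \<rho> x \<and> \<rho> x < b} x *\<^sub>R W x)"
    and zero: "\<And>t. a < t \<Longrightarrow> t \<le> b \<Longrightarrow> (LINT x|lborel. indicator {x. a \<le> \<rho> x \<and> \<rho> x < t} x *\<^sub>R W x) = 0"
  shows "(LINT x|lborel. indicator {x. a \<le> \<rho> x \<and> \<rho> x < b} x *\<^sub>R (\<rho> x powr (- D) *\<^sub>R W x)) = 0"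
proof -
  let ?S = "{x. a \<le> \<rho> x \<and> \<rho> x < b}"
  let ?w = "\<lambda>t::real. D * t powr (- D - 1)"
  have w: "has_bochner_integral lborel (\<lambda>t. ?w t * indicator {s..b} t) (s powr (- D) - b powr (- D))" if s: "a \<le> s" "s \<le> b" for s
  proof -
    have "has_bochner_integral lborel (\<lambda>t. ?w t * indicator {s..b} t) (- (b powr (- D)) - - (s powr (- D)))"
    proof (rule has_bochner_integral_FTC_Icc_real)
      fix t assume t: "s \<le> t" "t \<le> b"
      show "((\<lambda>t. - (t powr (- D))) has_real_derivative ?w t) (at t)" using t s ab by (auto intro!: derivative_eq_intros)
      show "isCont ?w t" using t s ab by (intro continuous_intros) auto
    qed (use s in auto)
    then show ?thesis by simp
  qed
  have w_int: "integrable lborel (\<lambda>t. ?w t * indicator {a..b} t)" using w[of a] ab by (auto simp: has_bochner_integral_iff)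
  \<comment> \<open>On \<open>?S\<close>, integrating in t from \<rho> x to b recovers
    \<open>\<rho> x powr (- D)\<close> up to the constant \<open>b powr (- D)\<close>, while
    integrating in x first meets only the vanishing integrals of \<open>zero\<close>.\<close>
  let ?\<Phi> = "\<lambda>x t. (indicator {p. \<rho> (fst p) < snd p} (x, t) * (?w t * indicator {a..b} t)) *\<^sub>R (indicator ?S x *\<^sub>R W x)"
  have "{p \<in> space (borel \<Otimes>\<^sub>M borel). \<rho> (fst p) < snd p} \<in> sets (borel \<Otimes>\<^sub>M borel)" by measurable
  then have [measurable]: "{p. \<rho> (fst p) < snd p} \<in> sets (borel \<Otimes>\<^sub>M borel)" by (simp add: space_pair_measure)
  have \<Phi>_int: "integrable (lborel \<Otimes>\<^sub>M lborel) (case_prod ?\<Phi>)"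
  proof (rule integrableI_bounded)
    show "case_prod ?\<Phi> \<in> borel_measurable (lborel \<Otimes>\<^sub>M lborel)" by measurable
    have "(\<integral>\<^sup>+p. ennreal (norm (case_prod ?\<Phi> p)) \<partial>(lborel \<Otimes>\<^sub>M lborel))
        \<le> (\<integral>\<^sup>+p. ennreal (norm (indicator ?S (fst p) *\<^sub>R W (fst p))) * ennreal (norm (?w (snd p) * indicator {a..b} (snd p))) \<partial>(lborel \<Otimes>\<^sub>M lborel))"
      by (intro nn_integral_mono) (auto simp: indicator_def mult_ac abs_mult simp flip: ennreal_mult')
    also have "... = (\<integral>\<^sup>+x. ennreal (norm (indicator ?S x *\<^sub>R W x)) \<partial>lborel) * (\<integral>\<^sup>+t. ennreal (norm (?w t * indicator {a..b} t)) \<partial>lborel)"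
      unfolding lborel_prod by (rule nn_integral_lborel_prod_mult) measurable
    also have "... < \<infinity>" using int w_int unfolding integrable_iff_bounded by (simp add: ennreal_mult_less_top)
    finally show "(\<integral>\<^sup>+p. ennreal (norm (case_prod ?\<Phi> p)) \<partial>(lborel \<Otimes>\<^sub>M lborel)) < \<infinity>" .
  qed
  have inner0: "(LINT x|lborel. ?\<Phi> x t) = 0" for t
  proof (cases "t \<in> {a<..b}")
    case True
    have "?\<Phi> x t = ?w t *\<^sub>R (indicator {x. a \<le> \<rho> x \<and> \<rho> x < t} x *\<^sub>R W x)" for x using True by (auto simp: indicator_def)
    then have "(LINT x|lborel. ?\<Phi> x t) = (LINT x|lborel. ?w t *\<^sub>R (indicator {x. a \<le> \<rho> x \<and> \<rho> x < t} x *\<^sub>R W x))"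
      by (rule Bochner_Integration.integral_cong[OF refl])
    also have "... = 0" using zero[of t] True by (subst integral_scaleR_right) simp
    finally show ?thesis .
  next
    case False
    then have "?\<Phi> x t = 0" for x by (auto simp: indicator_def)
    then have "(LINT x|lborel. ?\<Phi> x t) = (LINT x::'v|lborel. 0)" by (rule Bochner_Integration.integral_cong[OF refl])
    then show ?thesis by simp
  qed
  have inner: "(LINT t|lborel. ?\<Phi> x t) = (\<rho> x powr (- D) - b powr (- D)) *\<^sub>R (indicator ?S x *\<^sub>R W x)" for x
  proof (cases "x \<in> ?S")
    case True
    have "(LINT t|lborel. ?\<Phi> x t) = (LINT t|lborel. (?w t * indicator {\<rho> x..b} t) *\<^sub>R (indicator ?S x *\<^sub>R W x))"
    proof (rule integral_cong_AE)
      show "AE t in lborel. ?\<Phi> x t = (?w t * indicator {\<rho> x..b} t) *\<^sub>R (indicator ?S x *\<^sub>R W x)"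
        using AE_lborel_singleton[of "\<rho> x"] by eventually_elim (use True in \<open>auto simp: indicator_def\<close>)
    qed measurable
    also have "... = (\<rho> x powr (- D) - b powr (- D)) *\<^sub>R (indicator ?S x *\<^sub>R W x)"
      using w[of "\<rho> x"] True by (subst integral_scaleR_left) (auto simp: has_bochner_integral_iff)
    finally show ?thesis .
  qed simp
  have "0 = (LINT t|lborel. LINT x|lborel. ?\<Phi> x t)" unfolding inner0 by simp
  also have "... = (LINT x|lborel. LINT t|lborel. ?\<Phi> x t)" by (rule lborel_pair.Fubini_integral[OF \<Phi>_int])
  also have "... = (LINT x|lborel. (\<rho> x powr (- D) - b powr (- D)) *\<^sub>R (indicator ?S x *\<^sub>R W x))" unfolding inner ..
  finally have diff0: "(LINT x|lborel. (\<rho> x powr (- D) - b powr (- D)) *\<^sub>R (indicator ?S x *\<^sub>R W x)) = 0" by simp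
  have "integrable lborel (\<lambda>x. LINT t|lborel. ?\<Phi> x t)" using lborel_pair.integrable_fst'[OF \<Phi>_int] by (simp only: case_prod_conv)
  then have i1: "integrable lborel (\<lambda>x. (\<rho> x powr (- D) - b powr (- D)) *\<^sub>R (indicator ?S x *\<^sub>R W x))" unfolding inner .
  have i2: "integrable lborel (\<lambda>x. b powr (- D) *\<^sub>R (indicator ?S x *\<^sub>R W x))" using int by (rule integrable_scaleR_right)
  have "(LINT x|lborel. indicator ?S x *\<^sub>R (\<rho> x powr (- D) *\<^sub>R W x))
      = (LINT x|lborel. (\<rho> x powr (- D) - b powr (- D)) *\<^sub>R (indicator ?S x *\<^sub>R W x) + b powr (- D) *\<^sub>R (indicator ?S x *\<^sub>R W x))"
    by (intro Bochner_Integration.integral_cong refl) (simp add: algebra_simps)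
  also have "... = 0 + b powr (- D) *\<^sub>R (LINT x|lborel. indicator ?S x *\<^sub>R W x)"
    unfolding Bochner_Integration.integral_add[OF i1 i2] diff0 integral_scaleR_right ..
  also have "... = 0" using zero[of b] ab by simp
  finally show ?thesis .
qed

text \<open>By the form of the polar measure, mean value zero says that f at the projection of x to
  the unit sphere, almost everywhere \<open>\<rho> x powr D *\<^sub>R f x\<close>, integrates to 0
  over the unit ball; this function is homogeneous of degree 0 and can be integrated down to the
  origin. Scaling carries this to every ball, subtraction to annuli, and
  \<open>integral_powr_weight_zero\<close> removes the weight. Homogeneity is stated almost
  everywhere because a frozen factor is uncontrolled on the subspace where its argument is the
  origin.\<close>

lemma (in homogeneous_length) annulus_mean_zero:
  fixes f :: "'v \<Rightarrow> complex"
  assumes dil_meas [measurable]: "\<And>t. dil t \<in> borel_measurable borel" "(\<lambda>x. dil (1 / \<rho> x) x) \<in> borel_measurable borel"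
    and scale: "\<And>t. 0 < t \<Longrightarrow> lborel = density (distr lborel borel (dil t)) (\<lambda>_. ennreal (t powr D))"
    and D: "0 < D" and f [measurable]: "f \<in> borel_measurable borel"
    and hom: "AE x in lborel. \<forall>t>0. f (dil t x) = t powr (- D) *\<^sub>R f x"
    and mean: "has_bochner_integral (scale_measure (ennreal D)
      (distr (restrict_space lborel {x. 0 < \<rho> x \<and> \<rho> x < 1}) borel (\<lambda>x. dil (1 / \<rho> x) x))) f 0"
    and ab: "0 < a" "a < b"
  shows "(LINT x|lborel. indicator {x. a \<le> \<rho> x \<and> \<rho> x < b} x *\<^sub>R f x) = 0"
proof -
  let ?B = "\<lambda>t. {x. 0 < \<rho> x \<and> \<rho> x < t}"
  let ?W = "\<lambda>x. \<rho> x powr D *\<^sub>R f x"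
  let ?U = "\<lambda>t x. indicator (?B t) x *\<^sub>R ?W x"
  let ?h = "\<lambda>x. indicator (?B 1) x *\<^sub>R f (dil (1 / \<rho> x) x)"
  have [measurable]: "(\<lambda>x. dil (1 / \<rho> x) x) \<in> restrict_space lborel (?B 1) \<rightarrow>\<^sub>M borel" by (rule measurable_restrict_space1) measurable
  have "integrable lborel (\<lambda>x. D *\<^sub>R ?h x) \<and> (LINT x|lborel. ?h x) = 0"
    using mean D unfolding scale_measure_eq_density has_bochner_integral_iff
    by (simp add: integrable_density integral_density integrable_distr_eq integral_distr integrable_restrict_space integral_restrict_space mult.commute)
  then have "integrable lborel ?h \<and> (LINT x|lborel. ?h x) = 0" using D integrable_scaleR_right[of "1 / D" lborel "\<lambda>x. D *\<^sub>R ?h x"] by (simp add: mult.assoc)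
  then have h: "integrable lborel ?h" "(LINT x|lborel. ?h x) = 0" by auto
  have ae: "AE x in lborel. ?h x = ?U 1 x" using hom
  proof eventually_elim
    case (elim x)
    then show ?case by (auto simp: indicator_def powr_divide powr_minus)
  qed
  have U1: "integrable lborel (?U 1)" by (rule integrable_cong_AE_imp[OF h(1) _ ae]) measurable
  have U1_0: "(LINT x|lborel. ?U 1 x) = 0" using h(2) by (subst integral_cong_AE[OF _ _ AE_symmetric[OF ae]]) measurable
  have U: "integrable lborel (?U t) \<and> (LINT x|lborel. ?U t x) = 0" if t: "0 < t" for t
  proof -
    have ae: "AE x in lborel. t powr D *\<^sub>R ?U t (dil t x) = t powr D *\<^sub>R ?U 1 x" using hom
    proof eventually_elim
      case (elim x)
      then have "f (dil t x) = t powr (- D) *\<^sub>R f x" using t by simp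
      then show ?case using t by (auto simp: indicator_def dil_scale powr_mult powr_minus zero_less_mult_iff)
    qed
    have "integrable (density (distr lborel borel (dil t)) (\<lambda>_. ennreal (t powr D))) (?U t) \<longleftrightarrow> integrable lborel (\<lambda>x. t powr D *\<^sub>R ?U t (dil t x))"
      by (simp add: integrable_density integrable_distr_eq del: scaleR_scaleR)
    also have "... \<longleftrightarrow> integrable lborel (\<lambda>x. t powr D *\<^sub>R ?U 1 x)" by (rule integrable_cong_AE[OF _ _ ae]) measurable
    finally have 1: "integrable lborel (?U t)" using U1 by (subst scale[OF t]) (simp del: scaleR_scaleR)
    have "(LINT x|density (distr lborel borel (dil t)) (\<lambda>_. ennreal (t powr D)). ?U t x) = (LINT x|lborel. t powr D *\<^sub>R ?U t (dil t x))"
      by (simp add: integral_density integral_distr del: scaleR_scaleR)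
    also have "... = (LINT x|lborel. t powr D *\<^sub>R ?U 1 x)" by (rule integral_cong_AE[OF _ _ ae]) measurable
    also have "... = 0" using U1_0 by (simp del: scaleR_scaleR)
    finally have 2: "(LINT x|lborel. ?U t x) = 0" using scale[OF t] by simp
    from 1 2 show ?thesis ..
  qed
  have annulus: "indicator {x. a \<le> \<rho> x \<and> \<rho> x < t} x *\<^sub>R ?W x = ?U t x - ?U a x" if "a < t" for t x
    using that ab(1) by (auto simp: indicator_def)
  have "(LINT x|lborel. indicator {x. a \<le> \<rho> x \<and> \<rho> x < b} x *\<^sub>R (\<rho> x powr (- D) *\<^sub>R ?W x)) = 0"
  proof (rule integral_powr_weight_zero[OF _ _ ab])
    show "integrable lborel (\<lambda>x. indicator {x. a \<le> \<rho> x \<and> \<rho> x < b} x *\<^sub>R ?W x)"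
      unfolding annulus[OF ab(2)] using U ab by (intro Bochner_Integration.integrable_diff) auto
    show "(LINT x|lborel. indicator {x. a \<le> \<rho> x \<and> \<rho> x < t} x *\<^sub>R ?W x) = 0" if "a < t" for t
      unfolding annulus[OF that] using U[of t] U[of a] that ab by (subst Bochner_Integration.integral_diff) auto
  qed measurable
  also have "(\<lambda>x. indicator {x. a \<le> \<rho> x \<and> \<rho> x < b} x *\<^sub>R (\<rho> x powr (- D) *\<^sub>R ?W x)) = (\<lambda>x. indicator {x. a \<le> \<rho> x \<and> \<rho> x < b} x *\<^sub>R f x)"
    using ab(1) by (auto simp: indicator_def fun_eq_iff powr_minus)
  finally show ?thesis .
qed

lemma measurable_fst_snd_borel [measurable]:
  "fst \<in> borel_measurable (borel :: ('a::euclidean_space \<times> 'b::euclidean_space) measure)"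
  "snd \<in> borel_measurable (borel :: ('a \<times> 'b) measure)" by (intro borel_measurable_continuous_onI continuous_intros)+

lemma lborel_scale_prod:
  assumes "s \<noteq> 0" "t \<noteq> 0"
  shows "lborel = density (distr lborel borel (\<lambda>x::'a::euclidean_space \<times> 'b::euclidean_space. (s *\<^sub>R fst x, t *\<^sub>R snd x)))
    (\<lambda>_. ennreal (\<bar>s\<bar> ^ DIM('a) * \<bar>t\<bar> ^ DIM('b)))"
proof -
  let ?c = "\<lambda>j::'a \<times> 'b. if fst j = 0 then t else s"
  have T: "0 + (\<Sum>j\<in>Basis. (?c j * (x \<bullet> j)) *\<^sub>R j) = (s *\<^sub>R fst x, t *\<^sub>R snd x)" for x
  proof -
    have "(\<Sum>j\<in>Basis. (?c j * (x \<bullet> j)) *\<^sub>R j) = (\<Sum>i\<in>Basis. (s * (fst x \<bullet> i)) *\<^sub>R (i, 0)) + (\<Sum>i\<in>Basis. (t * (snd x \<bullet> i)) *\<^sub>R (0, i))"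
      unfolding sum_Basis_prod_eq by (intro arg_cong2[where f = plus] sum.cong) (auto simp: inner_prod_def)
    also have "... = (s *\<^sub>R fst x, t *\<^sub>R snd x)"
      by (rule prod_eqI) (simp_all add: fst_sum snd_sum euclidean_representation flip: scaleR_scaleR scaleR_sum_right)
    finally show ?thesis by simp
  qed
  have P: "(\<Prod>j\<in>Basis. \<bar>?c j\<bar>) = \<bar>s\<bar> ^ DIM('a) * \<bar>t\<bar> ^ DIM('b)"
  proof -
    have "(\<Prod>j\<in>Basis. \<bar>?c j\<bar>) = (\<Prod>j\<in>(\<lambda>u. (u, 0)) ` (Basis::'a set). \<bar>?c j\<bar>) * (\<Prod>j\<in>(\<lambda>u. (0, u)) ` (Basis::'b set). \<bar>?c j\<bar>)"
      unfolding Basis_prod_def by (rule prod.union_disjoint) auto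
    also have "(\<Prod>j\<in>(\<lambda>u. (u, 0::'b)) ` (Basis::'a set). \<bar>?c j\<bar>) = (\<Prod>j\<in>(Basis::'a set). \<bar>s\<bar>)"
    proof (subst prod.reindex)
      show "prod ((\<lambda>j. \<bar>?c j\<bar>) \<circ> (\<lambda>u. (u, 0::'b))) (Basis::'a set) = (\<Prod>j\<in>(Basis::'a set). \<bar>s\<bar>)" by (rule prod.cong) auto
    qed (simp add: inj_on_def)
    also have "(\<Prod>j\<in>(\<lambda>u. (0::'a, u)) ` (Basis::'b set). \<bar>?c j\<bar>) = (\<Prod>j\<in>(Basis::'b set). \<bar>t\<bar>)" by (subst prod.reindex) (auto simp: inj_on_def)
    finally show ?thesis by simp
  qed
  show ?thesis using lborel_affine_euclidean[of ?c 0] assms unfolding T P by simp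
qed

lemma AE_fst_nonzero: "AE x in (lborel :: ('a::euclidean_space \<times> 'b::euclidean_space) measure). fst x \<noteq> 0"
proof (rule AE_I')
  have "emeasure (lborel :: ('a \<times> 'b) measure) ({0} \<times> UNIV) = 0"
    unfolding lborel_prod[symmetric] by (subst lborel.emeasure_pair_measure_Times) auto
  then show "{0} \<times> UNIV \<in> null_sets (lborel :: ('a \<times> 'b) measure)" by (auto simp: null_sets_def intro!: borel_closed closed_Times)
qed auto

lemma AE_snd_nonzero: "AE x in (lborel :: ('a::euclidean_space \<times> 'b::euclidean_space) measure). snd x \<noteq> 0"
proof (rule AE_I')
  have "emeasure (lborel :: ('a \<times> 'b) measure) (UNIV \<times> {0}) = 0"
    unfolding lborel_prod[symmetric] by (subst lborel.emeasure_pair_measure_Times) auto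
  then show "UNIV \<times> {0} \<in> null_sets (lborel :: ('a \<times> 'b) measure)" by (auto simp: null_sets_def intro!: borel_closed closed_Times)
qed auto

section \<open>The two concrete lengths and their dilations\<close>

lemma norm_h_sq: "(norm_h x)\<^sup>2 = (norm (fst x))\<^sup>2 + \<bar>snd x\<bar>" by (simp add: norm_h_def)

lemma norm_h_nonneg: "0 \<le> norm_h x" by (simp add: norm_h_def)

lemma norm_fst_le_norm_h: "norm (fst x) \<le> norm_h x" by (simp add: norm_h_def real_le_rsqrt)

interpretation norm_h_length: length_function "norm_h :: 'm::finite pt \<Rightarrow> real"
proof
  show "continuous_on UNIV (norm_h :: 'm pt \<Rightarrow> real)" unfolding norm_h_def by (intro continuous_intros)
  fix x y :: "'m pt"
  show "norm_h x = 0 \<longleftrightarrow> x = 0" by (auto simp: norm_h_def add_nonneg_eq_0_iff prod_eq_iff)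
  show "norm_h (- x) = norm_h x" by (simp add: norm_h_def)
  \<comment> \<open>\<open>norm_h\<close> is the Euclidean length of the plane vector with entries
    |x'| and sqrt |x_n|; subadditivity of the square root reduces the triangle inequality to the
    plane.\<close>
  have "0 \<le> 2 * sqrt \<bar>snd x\<bar> * sqrt \<bar>snd y\<bar>" by simp
  then have "\<bar>snd x + snd y\<bar> \<le> \<bar>snd x\<bar> + \<bar>snd y\<bar> + 2 * sqrt \<bar>snd x\<bar> * sqrt \<bar>snd y\<bar>" using abs_triangle_ineq[of "snd x" "snd y"] by linarith
  then have "\<bar>snd x + snd y\<bar> \<le> (sqrt \<bar>snd x\<bar> + sqrt \<bar>snd y\<bar>)\<^sup>2" by (simp add: power2_sum)
  then have "norm_h (x + y) \<le> sqrt ((norm (fst x) + norm (fst y))\<^sup>2 + (sqrt \<bar>snd x\<bar> + sqrt \<bar>snd y\<bar>)\<^sup>2)"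
    unfolding norm_h_def by (intro real_sqrt_le_mono add_mono power_mono) (auto simp: norm_triangle_ineq)
  also have "... \<le> norm_h x + norm_h y"
    using real_sqrt_sum_squares_triangle_ineq[of "norm (fst x)" "norm (fst y)" "sqrt \<bar>snd x\<bar>" "sqrt \<bar>snd y\<bar>"] by (simp add: norm_h_def)
  finally show "norm_h (x + y) \<le> norm_h x + norm_h y" .
  have "norm x \<le> norm (fst x) + \<bar>snd x\<bar>" using sqrt_sum_squares_le_sum_abs[of "norm (fst x)" "\<bar>snd x\<bar>"] by (simp add: norm_prod_def)
  also have "... \<le> norm_h x + (norm_h x)\<^sup>2" using norm_fst_le_norm_h[of x] norm_h_sq[of x] zero_le_power2[of "norm (fst x)"] by linarith
  finally show "norm x \<le> norm_h x + (norm_h x)\<^sup>2" .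
  have "(norm (fst x))\<^sup>2 \<le> (norm x)\<^sup>2" "\<bar>snd x\<bar> \<le> norm x"
    using norm_fst_le[of "fst x" "snd x"] norm_snd_le[of "snd x" "fst x"] by (simp_all add: power_mono)
  then have "(norm (fst x))\<^sup>2 + \<bar>snd x\<bar> \<le> (1 + norm x)\<^sup>2" unfolding power2_sum power_one mult_1_right using norm_ge_zero[of x] by linarith
  then show "norm_h x \<le> 1 + norm x" unfolding norm_h_def by (intro real_le_lsqrt) auto
  show "norm_h (t *\<^sub>R x) \<le> norm_h x" if "0 \<le> t" "t \<le> 1" for t
    unfolding norm_h_def using that by (intro real_sqrt_le_mono add_mono power_mono) (auto simp: abs_mult mult_left_le_one_le)
qed

interpretation dil_e_length: homogeneous_length "norm :: 'm::finite pt \<Rightarrow> real" dil_e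
proof
  fix t :: real and x y :: "'m pt" assume "0 < t"
  have "dil_e t x = t *\<^sub>R x" by (simp add: dil_e_def prod_eq_iff)
  with \<open>0 < t\<close> show "norm (dil_e t x) = t * norm x" by simp
qed (simp add: dil_e_def scaleR_diff_right right_diff_distrib)

interpretation dil_h_length: homogeneous_length "norm_h :: 'm::finite pt \<Rightarrow> real" dil_h
proof
  fix t :: real and x y :: "'m pt" assume "0 < t"
  have "norm_h (dil_h t x) = sqrt (t\<^sup>2 * ((norm (fst x))\<^sup>2 + \<bar>snd x\<bar>))"
    by (simp add: norm_h_def dil_h_def power_mult_distrib abs_mult algebra_simps)
  with \<open>0 < t\<close> show "norm_h (dil_h t x) = t * norm_h x" by (simp add: norm_h_def real_sqrt_mult)
qed (simp add: dil_h_def scaleR_diff_right right_diff_distrib)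

lemma kernel_class_e: "dil_e_length.kernel_class k E \<longleftrightarrow> smooth_on (-{0}) E \<and> homogeneous dil_e k E"
  by (simp add: dil_e_length.kernel_class_def homogeneous_def)

lemma kernel_class_h: "dil_h_length.kernel_class l H \<longleftrightarrow> smooth_on (-{0}) H \<and> homogeneous dil_h l H"
  by (simp add: dil_h_length.kernel_class_def homogeneous_def)

lemma dil_measurable [measurable]:
  "(dil_e t :: 'm::finite pt \<Rightarrow> _) \<in> borel_measurable borel" "(dil_h t :: 'm::finite pt \<Rightarrow> _) \<in> borel_measurable borel"
  "(\<lambda>x :: 'm::finite pt. dil_e (1 / norm x) x) \<in> borel_measurable borel"
  "(\<lambda>x :: 'm::finite pt. dil_h (1 / norm_h x) x) \<in> borel_measurable borel" unfolding dil_e_def[abs_def] dil_h_def[abs_def] by measurable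

lemma homogeneous_eq:
  assumes "homogeneous dil k E" "0 < t" "x \<noteq> 0"
  shows "E (dil t x) = t powr (- k) *\<^sub>R E x"
proof -
  have "E x = t powr k *\<^sub>R E (dil t x)" using assms(1)[unfolded homogeneous_def, rule_format, OF assms(2,3)] ..
  then show ?thesis using assms(2) by (simp flip: powr_add)
qed

lemma annulus_mean_zero_h:
  fixes E H :: "'m::finite pt \<Rightarrow> complex"
  assumes E: "smooth_on (-{0}) E" "homogeneous dil_e k E" and H: "smooth_on (-{0}) H" "homogeneous dil_h l H"
    and kl: "k + l = real CARD('m) + 2"
    and mean: "mean_zero sphere_measure_h (\<lambda>(x', xn). E (x', 0) * H (x', xn))"
    and ab: "0 < a" "a < b"
  shows "(LINT x|lborel. indicator {x. a \<le> norm_h x \<and> norm_h x < b} x *\<^sub>R (H x * E (fst x, 0))) = 0"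
proof (rule dil_h_length.annulus_mean_zero[OF _ _ _ _ _ _ _ ab])
  note [measurable] = smooth_on_measurable[OF E(1)] smooth_on_measurable[OF H(1)]
  show "(\<lambda>x. H x * E (fst x, 0)) \<in> borel_measurable borel" by measurable
  show "lborel = density (distr lborel borel (dil_h t :: 'm pt \<Rightarrow> _)) (\<lambda>_. ennreal (t powr (real CARD('m) + 2)))" if "0 < t" for t
    using lborel_scale_prod[of t "t\<^sup>2", where 'a = "real ^ 'm" and 'b = real] that by (simp add: dil_h_def[abs_def] powr_add powr_realpow)
  show "AE x in lborel. \<forall>t>0. H (dil_h t x) * E (fst (dil_h t x), 0) = t powr (- (real CARD('m) + 2)) *\<^sub>R (H x * E (fst x, 0))"
    using AE_fst_nonzero
  proof (eventually_elim, intro allI impI)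
    fix x :: "'m pt" and t :: real assume x: "fst x \<noteq> 0" and t: "0 < t"
    have "E (fst (dil_h t x), 0) = E (dil_e t (fst x, 0))" by (simp add: dil_h_def dil_e_def)
    also have "... = t powr (- k) *\<^sub>R E (fst x, 0)" using x t by (intro homogeneous_eq[OF E(2)]) (auto simp: prod_eq_iff)
    finally have "E (fst (dil_h t x), 0) = t powr (- k) *\<^sub>R E (fst x, 0)" .
    moreover have "H (dil_h t x) = t powr (- l) *\<^sub>R H x" using x t by (intro homogeneous_eq[OF H(2)]) (auto simp: prod_eq_iff)
    moreover have "t powr (- k) * t powr (- l) = t powr (- (real CARD('m) + 2))" unfolding kl[symmetric] by (simp flip: powr_add)
    ultimately show "H (dil_h t x) * E (fst (dil_h t x), 0) = t powr (- (real CARD('m) + 2)) *\<^sub>R (H x * E (fst x, 0))" by simp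
  qed
  have "(\<lambda>(x', xn). E (x', 0) * H (x', xn)) = (\<lambda>x. H x * E (fst x, 0))" by (auto simp: fun_eq_iff)
  with mean show "has_bochner_integral (scale_measure (ennreal (real CARD('m) + 2))
      (distr (restrict_space lborel {x. 0 < norm_h x \<and> norm_h x < 1}) borel (\<lambda>x. dil_h (1 / norm_h x) x)))
      (\<lambda>x. H x * E (fst x, 0)) 0" by (simp add: mean_zero_def sphere_measure_h_def polar_measure_def)
qed auto

lemma annulus_mean_zero_e:
  fixes E H :: "'m::finite pt \<Rightarrow> complex"
  assumes E: "smooth_on (-{0}) E" "homogeneous dil_e k E" and H: "smooth_on (-{0}) H" "homogeneous dil_h l H"
    and kl: "k + l / 2 = real CARD('m) + 1"
    and mean: "mean_zero sphere_measure_e (\<lambda>(x', xn). E (x', xn) * H (0, xn))"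
    and ab: "0 < a" "a < b"
  shows "(LINT x|lborel. indicator {x. a \<le> norm x \<and> norm x < b} x *\<^sub>R (E x * H (0, snd x))) = 0"
proof (rule dil_e_length.annulus_mean_zero[OF _ _ _ _ _ _ _ ab])
  note [measurable] = smooth_on_measurable[OF E(1)] smooth_on_measurable[OF H(1)]
  show "(\<lambda>x. E x * H (0, snd x)) \<in> borel_measurable borel" by measurable
  show "lborel = density (distr lborel borel (dil_e t :: 'm pt \<Rightarrow> _)) (\<lambda>_. ennreal (t powr (real CARD('m) + 1)))" if "0 < t" for t
    using lborel_scale_prod[of t t, where 'a = "real ^ 'm" and 'b = real] that by (simp add: dil_e_def[abs_def] powr_add powr_realpow)
  show "AE x in lborel. \<forall>t>0. E (dil_e t x) * H (0, snd (dil_e t x)) = t powr (- (real CARD('m) + 1)) *\<^sub>R (E x * H (0, snd x))"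
    using AE_snd_nonzero
  proof (eventually_elim, intro allI impI)
    fix x :: "'m pt" and t :: real assume x: "snd x \<noteq> 0" and t: "0 < t"
    have "H (0, snd (dil_e t x)) = H (dil_h (sqrt t) (0, snd x))" using t by (simp add: dil_h_def dil_e_def)
    also have "... = sqrt t powr (- l) *\<^sub>R H (0, snd x)" using x t by (intro homogeneous_eq[OF H(2)]) (auto simp: prod_eq_iff)
    also have "sqrt t powr (- l) = t powr (- (l / 2))" using t by (simp add: powr_half_sqrt[symmetric] powr_powr)
    finally have "H (0, snd (dil_e t x)) = t powr (- (l / 2)) *\<^sub>R H (0, snd x)" .
    moreover have "E (dil_e t x) = t powr (- k) *\<^sub>R E x" using x t by (intro homogeneous_eq[OF E(2)]) (auto simp: prod_eq_iff)
    moreover have "t powr (- k) * t powr (- (l / 2)) = t powr (- (real CARD('m) + 1))" unfolding kl[symmetric] by (simp flip: powr_add)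
    ultimately show "E (dil_e t x) * H (0, snd (dil_e t x)) = t powr (- (real CARD('m) + 1)) *\<^sub>R (E x * H (0, snd x))"
      by (simp add: mult.commute)
  qed
  have "(\<lambda>(x', xn). E (x', xn) * H (0, xn)) = (\<lambda>x. E x * H (0, snd x))" by (auto simp: fun_eq_iff)
  with mean show "has_bochner_integral (scale_measure (ennreal (real CARD('m) + 1))
      (distr (restrict_space lborel {x. 0 < norm x \<and> norm x < 1}) borel (\<lambda>x. dil_e (1 / norm x) x)))
      (\<lambda>x. E x * H (0, snd x)) 0" by (simp add: mean_zero_def sphere_measure_e_def polar_measure_def)
qed auto

text \<open>The non-isotropic ball lies in the cylinder |x'| < r, |x_n| < r^2; the weight depends on
  x' alone and is integrable near 0 in dimension n - 1 for s < n - 1.\<close>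

lemma power_integrals_h:
  assumes s: "0 \<le> s" "s < real CARD('m::finite)"
  shows "\<exists>C. \<forall>r>0. (\<integral>\<^sup>+x\<in>{x. norm_h x < r}. ennreal (norm (fst x, 0::real) powr (- s)) \<partial>(lborel :: 'm pt measure))
    \<le> ennreal (C * r powr (real CARD('m) + 2 - s))"
proof -
  obtain C where C: "0 \<le> C" "\<And>r. 0 < r \<Longrightarrow>
    (\<integral>\<^sup>+x\<in>{x :: real ^ 'm. norm x < r}. ennreal (norm x powr (- s)) \<partial>lborel) \<le> ennreal (C * r powr (DIM(real ^ 'm) - s))"
    using norm_powr_integral[where 'v = "real ^ 'm", of s] s by auto
  define V where "V = measure lborel (ball (0::real) 1)"
  have V: "0 \<le> V" by (simp add: V_def)
  show ?thesis
  proof (intro exI allI impI)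
    fix r :: real assume r: "0 < r"
    have "(\<integral>\<^sup>+x\<in>{x. norm_h x < r}. ennreal (norm (fst x, 0::real) powr (- s)) \<partial>(lborel :: 'm pt measure))
      \<le> (\<integral>\<^sup>+x. (ennreal (norm (fst x) powr (- s)) * indicator {x. norm x < r} (fst x)) * indicator {y. norm y < r\<^sup>2} (snd x) \<partial>(lborel :: 'm pt measure))"
    proof (rule nn_integral_mono)
      fix x :: "'m pt"
      have "norm (fst x) < r" "\<bar>snd x\<bar> < r\<^sup>2" if "norm_h x < r"
      proof -
        have "(norm_h x)\<^sup>2 < r\<^sup>2" using that norm_h_nonneg[of x] by (intro power_strict_mono) auto
        then show "\<bar>snd x\<bar> < r\<^sup>2" using norm_h_sq[of x] zero_le_power2[of "norm (fst x)"] by linarith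
      qed (use that norm_fst_le_norm_h[of x] in linarith)
      then show "ennreal (norm (fst x, 0::real) powr (- s)) * indicator {x. norm_h x < r} x
          \<le> (ennreal (norm (fst x) powr (- s)) * indicator {x. norm x < r} (fst x)) * indicator {y. norm y < r\<^sup>2} (snd x)"
        by (auto simp: indicator_def norm_Pair)
    qed
    also have "... = (\<integral>\<^sup>+x\<in>{x :: real ^ 'm. norm x < r}. ennreal (norm x powr (- s)) \<partial>lborel) * (\<integral>\<^sup>+y. indicator {y::real. norm y < r\<^sup>2} y \<partial>lborel)"
      by (rule nn_integral_lborel_prod_mult) measurable
    also have "... \<le> ennreal (C * r powr (DIM(real ^ 'm) - s)) * ennreal (r\<^sup>2 * V)"
      using emeasure_norm_less[of "r\<^sup>2", where 'v = real] C(2)[OF r] by (simp add: V_def mult_right_mono)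
    also have "... = ennreal (C * V * (r powr (DIM(real ^ 'm) - s) * r powr 2))"
      using C(1) r V by (simp add: powr_realpow mult_ac flip: ennreal_mult)
    also have "r powr (DIM(real ^ 'm) - s) * r powr 2 = r powr (real CARD('m) + 2 - s)" by (simp add: algebra_simps flip: powr_add)
    finally show "(\<integral>\<^sup>+x\<in>{x. norm_h x < r}. ennreal (norm (fst x, 0::real) powr (- s)) \<partial>(lborel :: 'm pt measure))
      \<le> ennreal (C * V * r powr (real CARD('m) + 2 - s))" .
  qed
qed

text \<open>On the last axis the non-isotropic length is |x_n|^(1/2), so the weight is |x_n|^(-s/2),
  integrable near 0 on the line for s < 2.\<close>

lemma power_integrals_e:
  assumes s: "0 \<le> s" "s < 2"
  shows "\<exists>C. \<forall>r>0. (\<integral>\<^sup>+x\<in>{x. norm x < r}. ennreal (norm_h (0 :: real ^ 'm, snd x) powr (- s)) \<partial>(lborel :: 'm::finite pt measure))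
    \<le> ennreal (C * r powr (real CARD('m) + 1 - s / 2))"
proof -
  obtain C where C: "0 \<le> C" "\<And>r. 0 < r \<Longrightarrow>
    (\<integral>\<^sup>+x\<in>{x :: real. norm x < r}. ennreal (norm x powr (- (s / 2))) \<partial>lborel) \<le> ennreal (C * r powr (DIM(real) - s / 2))"
    using norm_powr_integral[where 'v = real, of "s / 2"] s by auto
  define V where "V = measure lborel (ball (0::real ^ 'm) 1)"
  have V: "0 \<le> V" by (simp add: V_def)
  show ?thesis
  proof (intro exI allI impI)
    fix r :: real assume r: "0 < r"
    have h: "norm_h (0 :: real ^ 'm, y) powr (- s) = norm y powr (- (s / 2))" for y
      by (simp add: norm_h_def powr_half_sqrt[symmetric] powr_powr)
    have "(\<integral>\<^sup>+x\<in>{x. norm x < r}. ennreal (norm_h (0 :: real ^ 'm, snd x) powr (- s)) \<partial>(lborel :: 'm pt measure))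
      \<le> (\<integral>\<^sup>+x. indicator {x. norm x < r} (fst x) * (ennreal (norm (snd x) powr (- (s / 2))) * indicator {y. norm y < r} (snd x)) \<partial>(lborel :: 'm pt measure))"
    proof (rule nn_integral_mono)
      fix x :: "'m pt"
      show "ennreal (norm_h (0 :: real ^ 'm, snd x) powr (- s)) * indicator {x. norm x < r} x
          \<le> indicator {x. norm x < r} (fst x) * (ennreal (norm (snd x) powr (- (s / 2))) * indicator {y. norm y < r} (snd x))"
        unfolding h using norm_fst_le[of "fst x" "snd x"] norm_snd_le[of "snd x" "fst x"] by (auto simp: indicator_def)
    qed
    also have "... = (\<integral>\<^sup>+x. indicator {x :: real ^ 'm. norm x < r} x \<partial>lborel) * (\<integral>\<^sup>+y\<in>{y :: real. norm y < r}. ennreal (norm y powr (- (s / 2))) \<partial>lborel)"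
      by (rule nn_integral_lborel_prod_mult) measurable
    also have "... \<le> ennreal (r ^ CARD('m) * V) * ennreal (C * r powr (DIM(real) - s / 2))"
      using emeasure_norm_less[of r, where 'v = "real ^ 'm"] C(2)[OF r] r by (simp add: V_def mult_left_mono)
    also have "... = ennreal (C * V * (r powr CARD('m) * r powr (DIM(real) - s / 2)))"
      using C(1) r V by (simp add: powr_realpow mult_ac flip: ennreal_mult)
    also have "r powr CARD('m) * r powr (DIM(real) - s / 2) = r powr (real CARD('m) + 1 - s / 2)"
      by (simp add: algebra_simps flip: powr_add)
    finally show "(\<integral>\<^sup>+x\<in>{x. norm x < r}. ennreal (norm_h (0 :: real ^ 'm, snd x) powr (- s)) \<partial>(lborel :: 'm pt measure))
      \<le> ennreal (C * V * r powr (real CARD('m) + 1 - s / 2))" .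
  qed
qed

theorem theorem1p9:
  fixes n :: nat and k l :: real
    and K E H :: "(real ^ 'm::finite) \<times> real \<Rightarrow> complex"
  assumes "n = CARD('m) + 1"
    and "compact (closure {x. K x \<noteq> 0})"
    and "smooth_on (-{0}) K"
    and "smooth_on (-{0}) E" and "homogeneous dil_e k E"
    and "smooth_on (-{0}) H" and "homogeneous dil_h l H"
    and "\<exists>r0>0. \<forall>x. 0 < norm x \<and> norm x < r0 \<longrightarrow> K x = E x * H x"
  shows "(k + l = real n + 1 \<and> l > 2 \<and>
            mean_zero sphere_measure_h (\<lambda>(x', xn). E (x', 0) * H (x', xn)) \<longrightarrow>
            (\<forall>\<alpha>. 0 < \<alpha> \<and> \<alpha> < 1 \<longrightarrow> bounded_on_lip (lip_norm_h \<alpha>) (pv_op norm_h K)) \<and>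
            (\<forall>\<alpha>1 \<alpha>2. 0 < \<alpha>1 \<and> \<alpha>1 < 1 \<and> 0 < \<alpha>2 \<and> \<alpha>2 < 1 \<longrightarrow>
               bounded_on_lip (lip_norm_com \<alpha>1 \<alpha>2) (pv_op norm_h K)))
       \<and> (k + l / 2 = real n \<and> l < 2 \<and>
            mean_zero sphere_measure_e (\<lambda>(x', xn). E (x', xn) * H (0, xn)) \<longrightarrow>
            (\<forall>\<alpha>. 0 < \<alpha> \<and> \<alpha> < 1 \<longrightarrow> bounded_on_lip (lip_norm_e \<alpha>) (pv_op norm K)) \<and>
            (\<forall>\<alpha>1 \<alpha>2. 0 < \<alpha>1 \<and> \<alpha>1 < 1 \<and> 0 < \<alpha>2 \<and> \<alpha>2 < 1 \<longrightarrow>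
               bounded_on_lip (lip_norm_com \<alpha>1 \<alpha>2) (pv_op norm K)))"
proof -
  let ?m = "real CARD('m)"
  obtain B where B: "0 < B" "\<And>x. K x \<noteq> 0 \<Longrightarrow> norm x \<le> B"
  proof -
    have "bounded (closure {x. K x \<noteq> 0})" using assms(2) by (rule compact_imp_bounded)
    then have "bounded {x. K x \<noteq> 0}" by (rule bounded_subset[OF _ closure_subset])
    then show ?thesis using that unfolding bounded_pos by blast
  qed
  obtain r0 where r0: "0 < r0" "\<And>x. 0 < norm x \<Longrightarrow> norm x < r0 \<Longrightarrow> K x = E x * H x" using assms(8) by blast
  have n: "real n = ?m + 1" using assms(1) by simp
  have caseA: "\<exists>A R \<gamma> c. cz_kernel norm_h K A R \<gamma> c"
    if kl: "k + l = real n + 1" "l > 2" and mean: "mean_zero sphere_measure_h (\<lambda>(x', xn). E (x', 0) * H (x', xn))"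
  proof -
    \<comment> \<open>With \<open>norm_h x\<close> below r1 \<le> 1 one has |x| \<le> 2
      \<open>norm_h x\<close> < r0, so the factorization of \<open>K\<close> holds there.\<close>
    define r1 where "r1 = min 1 (r0 / 2)"
    have kl': "k + l = ?m + 2" using kl(1) n by simp
    \<comment> \<open>Here p = l, q = k, D = n + 1 and s0 = n - 1, so that the hypothesis l > 2 is
      the condition q < s0. The support radius B + 2 accounts for \<open>norm_h x\<close> being at
      most 1 + |x|.\<close>
    interpret product_kernel norm norm_h dil_h dil_e "\<lambda>x. (fst x, 0)" 1 "?m + 2" ?m l k r1 "B + 2" H E K
    proof
      show "norm u \<le> 2 * norm_h u powr 1" if "norm_h u \<le> 1" for u :: "'m pt"
      proof -
        have "(norm_h u)\<^sup>2 \<le> norm_h u" using that norm_h_nonneg[of u] by (simp add: power2_eq_square mult_left_le)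
        with norm_h_length.norm_le[of u] show ?thesis by simp
      qed
      show "(\<lambda>x :: 'm pt. (fst x, 0 :: real)) \<in> borel_measurable borel" by measurable
      show "AE x in (lborel :: 'm pt measure). (fst x, 0) \<noteq> 0" using AE_fst_nonzero by eventually_elim (simp add: prod_eq_iff)
      show "norm (x - (fst x, 0)) \<le> norm_h x powr (2 * 1)" for x :: "'m pt"
      proof -
        have "norm (x - (fst x, 0)) = \<bar>snd x\<bar>" by (simp add: norm_prod_def)
        also have "\<dots> \<le> (norm_h x)\<^sup>2" unfolding norm_h_sq by simp
        also have "\<dots> = norm_h x powr (2 * 1)" using norm_h_nonneg[of x] by simp
        finally show ?thesis .
      qed
      show "norm (fst x, 0 :: real) \<le> norm x" for x :: "'m pt" using norm_fst_le[of "fst x" "snd x"] by (simp add: norm_Pair)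
      show "\<exists>C. \<forall>r>0. (\<integral>\<^sup>+x\<in>{x. norm_h x < r}. ennreal (norm (fst x, 0::real) powr (- s)) \<partial>(lborel :: 'm pt measure))
        \<le> ennreal (C * r powr (?m + 2 - 1 * s))" if "0 \<le> s" "s < ?m" for s using power_integrals_h[OF that] by simp
      show "k < ?m" "l + 1 * k = ?m + 2" using kl kl' by auto
      show "dil_h_length.kernel_class l H" "dil_e_length.kernel_class k E" using assms by (auto simp: kernel_class_e kernel_class_h)
      show "K x = 0" if "B + 2 \<le> norm_h x" for x using that B(2)[of x] norm_h_length.le_norm[of x] by force
      show "0 < r1" using r0 by (simp add: r1_def)
      show "K x = H x * E x" if "0 < norm_h x" "norm_h x < r1" for x
      proof -
        have "(norm_h x)\<^sup>2 \<le> norm_h x" using that by (simp add: r1_def power2_eq_square mult_left_le)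
        then have "norm x < r0" using norm_h_length.norm_le[of x] that by (simp add: r1_def)
        moreover have "0 < norm x" using that by (simp add: norm_h_length.pos_iff)
        ultimately show ?thesis using r0(2)[of x] by simp
      qed
      show "(LINT x|lborel. indicator {x. a \<le> norm_h x \<and> norm_h x < b} x *\<^sub>R (H x * E (fst x, 0))) = 0"
        if "0 < a" "a < b" for a b using assms(4-7) kl' mean that by (rule annulus_mean_zero_h)
    qed (use assms(3) in auto)
    have "0 < B + 2" using B by simp
    then obtain A \<gamma> c where "cz_kernel norm_h K A (B + 2) \<gamma> c" by (rule is_cz_kernel)
    then show ?thesis by blast
  qed
  have caseB: "\<exists>A R \<gamma> c. cz_kernel norm K A R \<gamma> c"
    if kl: "k + l / 2 = real n" "l < 2" and mean: "mean_zero sphere_measure_e (\<lambda>(x', xn). E (x', xn) * H (0, xn))"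
  proof -
    have kl': "k + l / 2 = ?m + 1" using kl(1) n by simp
    \<comment> \<open>Roles exchanged: p = k, q = l, D = n, and q < s0 = 2 is the hypothesis l < 2.
      The exponent \<theta> = 1/2 reflects that \<open>norm_h\<close> is near the origin at most of
      the order of the square root of the Euclidean length.\<close>
    interpret product_kernel norm_h norm dil_e dil_h "\<lambda>x. (0, snd x)" "1 / 2" "?m + 1" 2 k l r0 "B + 1" E H K
    proof
      show "norm_h u \<le> 2 * norm u powr (1 / 2)" if "norm u \<le> 1" for u :: "'m pt"
      proof -
        have "(norm (fst u))\<^sup>2 \<le> (norm u)\<^sup>2" using norm_fst_le[of "fst u" "snd u"] by (simp add: power_mono)
        also have "\<dots> \<le> norm u" using that by (simp add: power2_eq_square mult_left_le)
        finally have "(norm (fst u))\<^sup>2 + \<bar>snd u\<bar> \<le> 4 * norm u" using norm_snd_le[of "snd u" "fst u"] norm_ge_zero[of u] by simp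
        then have "norm_h u \<le> sqrt (4 * norm u)" unfolding norm_h_def by (rule real_sqrt_le_mono)
        then show ?thesis by (simp add: real_sqrt_mult powr_half_sqrt)
      qed
      show "(\<lambda>x :: 'm pt. (0 :: real ^ 'm, snd x)) \<in> borel_measurable borel" by measurable
      show "AE x in (lborel :: 'm pt measure). (0, snd x) \<noteq> 0" using AE_snd_nonzero by eventually_elim (simp add: prod_eq_iff)
      show "norm_h (x - (0, snd x)) \<le> norm x powr (2 * (1 / 2))" for x :: "'m pt"
        using norm_fst_le[of "fst x" "snd x"] by (simp add: norm_h_def)
      show "norm_h (0 :: real ^ 'm, snd x) \<le> norm_h x" for x :: "'m pt" by (simp add: norm_h_def)
      show "\<exists>C. \<forall>r>0. (\<integral>\<^sup>+x\<in>{x. norm x < r}. ennreal (norm_h (0 :: real ^ 'm, snd x) powr (- s)) \<partial>(lborel :: 'm pt measure))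
        \<le> ennreal (C * r powr (?m + 1 - 1 / 2 * s))" if "0 \<le> s" "s < 2" for s using power_integrals_e[OF that, where 'm = 'm] by simp
      show "l < 2" "k + 1 / 2 * l = ?m + 1" using kl kl' by auto
      show "dil_e_length.kernel_class k E" "dil_h_length.kernel_class l H" using assms by (auto simp: kernel_class_e kernel_class_h)
      show "K x = 0" if "B + 1 \<le> norm x" for x using that B(2)[of x] by force
      show "(LINT x|lborel. indicator {x. a \<le> norm x \<and> norm x < b} x *\<^sub>R (E x * H (0, snd x))) = 0"
        if "0 < a" "a < b" for a b using assms(4-7) kl' mean that by (rule annulus_mean_zero_e)
    qed (use assms(3) r0 in auto)
    have "0 < B + 1" using B by simp
    then obtain A \<gamma> c where "cz_kernel norm K A (B + 1) \<gamma> c" by (rule is_cz_kernel)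
    then show ?thesis by blast
  qed
  have lip: "lip_norm_e \<alpha> = lip_norm norm \<alpha>" "lip_norm_h \<alpha> = lip_norm norm_h \<alpha>" "lip_norm_com \<alpha> \<beta> = com_norm norm \<alpha> norm_h \<beta>" for \<alpha> \<beta>
    by (auto simp: fun_eq_iff lip_norm_e_def lip_norm_h_def lip_norm_com_def lip_norm_def com_norm_def)
  show ?thesis
  proof (intro conjI impI; elim conjE)
    assume "k + l = real n + 1" "l > 2" "mean_zero sphere_measure_h (\<lambda>(x', xn). E (x', 0) * H (x', xn))"
    then obtain A R \<gamma> c where "cz_kernel norm_h K A R \<gamma> c" using caseA by blast
    then interpret cz_kernel norm_h K A R \<gamma> c .
    show "\<forall>\<alpha>. 0 < \<alpha> \<and> \<alpha> < 1 \<longrightarrow> bounded_on_lip (lip_norm_h \<alpha>) (pv_op norm_h K)" unfolding lip using bounded_on_lip_norm by blast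
    show "\<forall>\<alpha>1 \<alpha>2. 0 < \<alpha>1 \<and> \<alpha>1 < 1 \<and> 0 < \<alpha>2 \<and> \<alpha>2 < 1 \<longrightarrow> bounded_on_lip (lip_norm_com \<alpha>1 \<alpha>2) (pv_op norm_h K)"
      unfolding lip using bounded_on_com_norm[OF norm_length.length_function_axioms] by blast
  next
    assume "k + l / 2 = real n" "l < 2" "mean_zero sphere_measure_e (\<lambda>(x', xn). E (x', xn) * H (0, xn))"
    then obtain A R \<gamma> c where "cz_kernel norm K A R \<gamma> c" using caseB by blast
    then interpret cz_kernel norm K A R \<gamma> c .
    show "\<forall>\<alpha>. 0 < \<alpha> \<and> \<alpha> < 1 \<longrightarrow> bounded_on_lip (lip_norm_e \<alpha>) (pv_op norm K)" unfolding lip using bounded_on_lip_norm by blast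
    show "\<forall>\<alpha>1 \<alpha>2. 0 < \<alpha>1 \<and> \<alpha>1 < 1 \<and> 0 < \<alpha>2 \<and> \<alpha>2 < 1 \<longrightarrow> bounded_on_lip (lip_norm_com \<alpha>1 \<alpha>2) (pv_op norm K)"
      unfolding lip using bounded_on_com_norm[OF norm_h_length.length_function_axioms] by (subst com_norm_commute) blast
  qed
qed

end
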